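(* Let $L_1,L_2,L_3\in\mathbb{Z}[x_1,x_2]$ be linear forms which are linearly independent (i.e. pairwise non-proportional, so that each pairwise resultant is non-zero). For $X\ge 1$ put $$T(X)=\sum_{\substack{x_1,x_2\in\mathbb{N}\\ x_1,x_2\le X}}\tau\big(L_1(x_1,x_2)L_2(x_1,x_2)L_3(x_1,x_2)\big).$$ Then for any $\varepsilon>0$ there exist constants $c_0,c_1,c_2,c_3\in\mathbb{R}$, with $c_0>0$, such that $$T(X)=\sum_{i=0}^3 c_iX^2(\log X)^{3-i}+O_{\varepsilon,L_1,L_2,L_3}\big(X^{2-\frac14+\varepsilon}\big),$$ where the implied constant depends only on $\varepsilon$ and $L_1,L_2,L_3$.
   Context: $\tau(n)=\sum_{d\mid n}1$ is the divisor function, extended to non-zero negative integers by $\tau(-n)=\tau(n)$; we use the convention $\tau(0)=0$. $\mathbb{N}=\{1,2,3,\dots\}$. *)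

theory Defs
  imports Complex_Main
begin

definition tau :: "int \<Rightarrow> nat" where
  "tau n = (if n = 0 then 0 else card {d :: nat. d > 0 \<and> int d dvd n})"

definition linform :: "int \<times> int \<Rightarrow> int \<Rightarrow> int \<Rightarrow> int" where
  "linform L x1 x2 = fst L * x1 + snd L * x2"

(* Resultant of two binary linear forms; nonzero iff the forms are non-proportional. *)
definition lin_res :: "int \<times> int \<Rightarrow> int \<times> int \<Rightarrow> int" where
  "lin_res L M = fst L * snd M - snd L * fst M"

definition Tsum :: "int \<times> int \<Rightarrow> int \<times> int \<Rightarrow> int \<times> int \<Rightarrow> real \<Rightarrow> real" where
  "Tsum L1 L2 L3 X =
     (\<Sum>x1\<in>{1..nat \<lfloor>X\<rfloor>}. \<Sum>x2\<in>{1..nat \<lfloor>X\<rfloor>}.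
        real (tau (linform L1 (int x1) (int x2) * linform L2 (int x1) (int x2)
                   * linform L3 (int x1) (int x2))))"

end

theory Submission
  imports Defs "HOL-Analysis.Analysis" "HOL-Number_Theory.Number_Theory" "HOL-Real_Asymp.Real_Asymp"
    "HOL-Computational_Algebra.Squarefree"
begin

text \<open>Comparing prime powers gives an identity
  \<open>\<tau>(n\<^sub>0 n\<^sub>1 n\<^sub>2) = \<Sum>\<kappa>. \<lambda>(\<kappa>) \<Prod>i. \<tau>(n\<^sub>i / k\<^sub>i(\<kappa>))\<close> with \<open>\<bar>\<lambda>\<bar> \<le> 1\<close>. Each factor \<open>\<tau>(n\<^sub>i / k\<^sub>i)\<close> is written by the
  hyperbola method as twice a sum over \<open>d\<^sub>i\<close> with \<open>k\<^sub>i d\<^sub>i\<^sup>2 \<le> n\<^sub>i\<close>, so that the problem becomes one of counting the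
  points of the plane lattices \<open>{x. k\<^sub>i d\<^sub>i dvd L\<^sub>i(x)}\<close> in convex subsets of the box. With a reduced basis the
  count has an error \<open>O(N / \<bar>v\<bar> + 1)\<close>, \<open>v\<close> a shortest lattice vector. Summed over \<open>\<kappa>\<close> and \<open>d\<close> this is
  \<open>O(N powr (7/4 + \<epsilon>))\<close>: there are few \<open>(\<kappa>, d)\<close> in total, and those with a short \<open>v\<close> are bounded by the number of
  divisors of the values \<open>L\<^sub>i(v)\<close>.

  The density of such a lattice is a sum over rational points \<open>\<theta>\<close> of a finite-dimensional torus (orthogonality of
  characters); this separates the three variables, and the sums over \<open>d\<^sub>i\<close> become smoothed harmonic sums, equal to
  a logarithm plus a constant up to a power saving. What remains are mean values over the box of products
  of \<open>ln \<bar>L\<^sub>i(x)\<bar>\<close>, treated by homogeneity: their normalised values at \<open>N\<close> and \<open>M\<close> are both close to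
  that at \<open>N M\<close>.

  The asymptotic formula holds for arbitrary bounded weights \<open>\<lambda>\<close>. The choice \<open>\<lambda>(\<kappa>) = [\<kappa> = 1]\<close> gives the sum of
  \<open>\<tau>(n\<^sub>0) \<tau>(n\<^sub>1) \<tau>(n\<^sub>2)\<close>, whose leading coefficient is visibly positive. As \<open>\<tau>(n\<^sub>0) \<tau>(n\<^sub>1) \<tau>(n\<^sub>2)\<close> exceeds
  \<open>\<tau>(n\<^sub>0 n\<^sub>1 n\<^sub>2)\<close> at most by a factor bounded in terms of \<open>gcd(x\<^sub>1, x\<^sub>2)\<close>, which is small on average,
  positivity of \<open>c\<^sub>0\<close> follows.\<close>

section \<open>The divisor function\<close>

text \<open>The exponent 7/4 is a balance. There are about N^(3/2) pairs (\<kappa>, d), and an error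
  N/|v| with |v| >= N^(3/4) costs at most N^(1/4) for each. Over shorter vectors the sum of 1/|v| is
  about N^(3/4), each serves about N^\<epsilon> pairs, and N * N^(3/4) is again N^(7/4). Vectors on
  a line L_i = 0 put no divisor condition on d_i; they are tolerable because a line holds boundedly
  many vectors of each norm. The main term meets the same limit. The harmonic sums have natural
  error (s/z)^(1/2), but s can be as large as the square of the denominator l of its term, which
  would leave no decay in l. Half of the saving is given away: (s/z)^(1/4) leaves l^(-1/2), the
  series over \<kappa> and \<theta> converges because every component of \<kappa> divides at least
  two of the numbers, and z^(-1/4) averages to N^(-1/4). Lattice points are compared with the
  integer points of the same region, not with its area, so that the main term stays a sum over
  x.\<close>

definition ndiv :: "nat \<Rightarrow> nat" where "ndiv n = card {d. d dvd n}"

text \<open>The weights of the hyperbola method: \<open>\<tau>(n)\<close> is twice the sum of \<open>hw (d\<^sup>2) n\<close> over the divisors \<open>d\<close>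
  of \<open>n\<close>, the weight \<open>1/2\<close> accounting for \<open>d\<^sup>2 = n\<close>.\<close>

definition hw :: "nat \<Rightarrow> nat \<Rightarrow> real" where
  "hw t n = (if t < n then 1 else if t = n then 1/2 else 0)"

lemma hw_nonneg: "0 \<le> hw t n" and hw_le_1: "hw t n \<le> 1" and hw_eq_0: "n < t \<Longrightarrow> hw t n = 0"
  by (auto simp: hw_def)

lemma ndiv_0 [simp]: "ndiv 0 = 0" and ndiv_1 [simp]: "ndiv (Suc 0) = 1"
  by (auto simp: ndiv_def)

lemma finite_divs: "n > 0 \<Longrightarrow> finite {d::nat. d dvd n}"
  by (simp add: finite_divisors_nat)

lemma ndiv_pos: "n > 0 \<Longrightarrow> ndiv n > 0"
  unfolding ndiv_def using finite_divs[of n] by (auto simp: card_gt_0_iff)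

text \<open>The involution d -> n/d of the divisors pairs the weights:
  \<open>hw (d\<^sup>2) n + hw ((n div d)\<^sup>2) n = 1\<close>.\<close>

lemma ndiv_eq_sum_hw:
  assumes "n > 0"
  shows "real (ndiv n) = 2 * (\<Sum>d | d dvd n. hw (d\<^sup>2) n)"
proof -
  let ?A = "{d. d dvd n}"
  have "(\<Sum>d\<in>?A. hw (d\<^sup>2) n) = (\<Sum>d\<in>?A. hw ((n div d)\<^sup>2) n)"
    by (rule sum.reindex_bij_witness[of _ "\<lambda>d. n div d" "\<lambda>d. n div d"])
       (use assms in \<open>auto simp: dvd_div_eq_mult\<close>)
  then have "2 * (\<Sum>d\<in>?A. hw (d\<^sup>2) n) = (\<Sum>d\<in>?A. hw (d\<^sup>2) n + hw ((n div d)\<^sup>2) n)"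
    by (simp add: sum.distrib)
  also have "\<dots> = (\<Sum>d\<in>?A. 1)"
  proof (intro sum.cong refl)
    fix d assume "d \<in> ?A"
    then obtain e where e: "n = d * e" by auto
    with assms have pos: "d > 0" "e > 0" by auto
    have "n div d = e" using e pos by simp
    moreover have "d\<^sup>2 < n \<longleftrightarrow> d < e" "d\<^sup>2 = n \<longleftrightarrow> d = e" "e\<^sup>2 < n \<longleftrightarrow> e < d" "e\<^sup>2 = n \<longleftrightarrow> d = e"
      using pos by (auto simp: e power2_eq_square)
    ultimately show "hw (d\<^sup>2) n + hw ((n div d)\<^sup>2) n = 1"
      by (auto simp: hw_def)
  qed
  also have "\<dots> = ndiv n" by (simp add: ndiv_def)
  finally show ?thesis by simp
qed

lemma ndiv_mult_le: "ndiv (m * n) \<le> ndiv m * ndiv n"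
proof (cases "m = 0 \<or> n = 0")
  case False
  then have fin: "finite {d. d dvd m}" "finite {d. d dvd n}" by (auto intro: finite_divs)
  have "{d. d dvd m * n} \<subseteq> (\<lambda>(x, y). x * y) ` ({d. d dvd m} \<times> {d. d dvd n})"
  proof
    fix d assume "d \<in> {d. d dvd m * n}"
    then have "d dvd m * n" by simp
    then obtain x y where "d = x * y" "x dvd m" "y dvd n" using division_decomp by blast
    then show "d \<in> (\<lambda>(x, y). x * y) ` ({d. d dvd m} \<times> {d. d dvd n})" by force
  qed
  then have "ndiv (m * n) \<le> card ({d. d dvd m} \<times> {d. d dvd n})"
    unfolding ndiv_def using fin by (intro surj_card_le) auto
  then show ?thesis by (simp add: ndiv_def card_cartesian_product)
qed auto

lemma ndiv_coprime_mult:
  assumes "coprime m n"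
  shows "ndiv (m * n) = ndiv m * ndiv n"
proof (cases "m = 0 \<or> n = 0")
  case False
  have inj: "inj_on (\<lambda>(x, y). x * y) ({d. d dvd m} \<times> {d. d dvd n})"
  proof (rule inj_onI, clarify)
    fix x y x' y' assume a: "x dvd m" "y dvd n" "x' dvd m" "y' dvd n" "x * y = x' * y'"
    have "x dvd x' * y'" "coprime x y'" "x' dvd x * y" "coprime x' y"
      using a(5) coprime_divisors[OF a(1,4) assms] coprime_divisors[OF a(3,2) assms] 
        dvd_triv_left[of x y] dvd_triv_left[of x' y'] by auto
    then have "x = x'" by (simp add: coprime_dvd_mult_left_iff dvd_antisym)
    moreover have "x > 0" using a(1) False by (auto intro!: Nat.gr0I)
    ultimately show "x = x' \<and> y = y'" using a(5) by auto
  qed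
  have "{d. d dvd m * n} = (\<lambda>(x, y). x * y) ` ({d. d dvd m} \<times> {d. d dvd n})"
  proof (intro equalityI subsetI)
    fix d assume "d \<in> {d. d dvd m * n}"
    then have "d dvd m * n" by simp
    then obtain x y where "d = x * y" "x dvd m" "y dvd n" using division_decomp by blast
    then show "d \<in> (\<lambda>(x, y). x * y) ` ({d. d dvd m} \<times> {d. d dvd n})" by force
  qed (auto intro: mult_dvd_mono)
  then show ?thesis using card_image[OF inj] by (simp add: ndiv_def card_cartesian_product)
qed auto

lemma ndiv_prime_power:
  assumes "prime p"
  shows "ndiv (p ^ a) = Suc a"
proof -
  have "{d. d dvd p ^ a} = (\<lambda>i. p ^ i) ` {..a}"
    using divides_primepow_nat[OF assms, of _ a] by auto
  moreover have "inj_on (\<lambda>i. p ^ i) {..a}"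
    using prime_gt_1_nat[OF assms] by (auto intro!: inj_onI)
  ultimately show ?thesis by (simp add: ndiv_def card_image)
qed

lemma ndiv_prime_power_mult:
  assumes "prime p" "\<not> p dvd m"
  shows "ndiv (p ^ a * m) = Suc a * ndiv m"
proof -
  have "coprime (p ^ a) m" using assms by (simp add: prime_imp_coprime)
  then show ?thesis using ndiv_coprime_mult ndiv_prime_power[OF assms(1)] by simp
qed

text \<open>Reverses \<open>ndiv_mult_le\<close> up to the gcd; positivity rests on it. For D = x y
  the factor \<open>e = D div gcd D n\<close> is the part of D that n cannot supply. It divides x,
  and the quotient q satisfies q y = gcd D n, so q divides both m and n. From (q, D) one recovers x
  = q e and then y.\<close>

lemma ndiv_mult_ndiv_le: "ndiv m * ndiv n \<le> ndiv (gcd m n) * ndiv (m * n)"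
proof (cases "m = 0 \<or> n = 0")
  case False
  define \<phi> where "\<phi> = (\<lambda>(x, y). (x div (x * y div gcd (x * y) n), x * y))"
  have main: "(x * y) div gcd (x * y) n dvd x" "x > 0" "y > 0"
    if "x dvd m" "y dvd n" for x y
  proof -
    show pos: "x > 0" "y > 0" using that False by (auto intro!: Nat.gr0I)
    let ?D = "x * y" let ?g = "gcd ?D n"
    have g0: "?g > 0" using False by auto
    have "?D dvd x * n" using that by (auto intro: mult_dvd_mono)
    moreover have "?D = ?D div ?g * ?g" "n = n div ?g * ?g" by auto
    ultimately have "?D div ?g * ?g dvd x * (n div ?g) * ?g" by (metis mult.assoc)
    then have "?D div ?g dvd x * (n div ?g)" using g0 by (metis dvd_times_right_cancel_iff not_gr_zero)
    moreover have "coprime (?D div ?g) (n div ?g)"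
      using False div_gcd_coprime by blast
    ultimately show "?D div ?g dvd x" by (simp add: coprime_dvd_mult_left_iff)
  qed
  have "inj_on \<phi> ({d. d dvd m} \<times> {d. d dvd n})"
  proof (rule inj_onI, clarify)
    fix x y x' y' assume a: "x dvd m" "y dvd n" "x' dvd m" "y' dvd n" "\<phi> (x, y) = \<phi> (x', y')"
    have D: "x * y = x' * y'" using a(5) by (auto simp: \<phi>_def)
    define e where "e = (x * y) div gcd (x * y) n"
    have "x div e = x' div e" using a(5) by (auto simp: \<phi>_def e_def D)
    moreover have "e dvd x" "e dvd x'" using main(1)[OF a(1,2)] main(1)[OF a(3,4)] by (auto simp: e_def D)
    ultimately have "x = x'" by (metis dvd_mult_div_cancel)
    then show "x = x' \<and> y = y'" using D main(2)[OF a(1,2)] by auto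
  qed
  moreover have "\<phi> ` ({d. d dvd m} \<times> {d. d dvd n}) \<subseteq> {d. d dvd gcd m n} \<times> {d. d dvd m * n}"
  proof
    fix z assume "z \<in> \<phi> ` ({d. d dvd m} \<times> {d. d dvd n})"
    then obtain x y where xy: "x dvd m" "y dvd n" "z = \<phi> (x, y)" by auto
    obtain q D where z: "z = (q, D)" by force
    have a: "x dvd m" "y dvd n" "(q, D) = \<phi> (x, y)" using xy z by auto
    have D: "D = x * y" using a(3) by (auto simp: \<phi>_def)
    define e where "e = D div gcd D n"
    have q: "q = x div e" using a(3) by (auto simp: \<phi>_def e_def D)
    have ex: "e dvd x" using main(1)[OF a(1,2)] by (simp add: e_def D)
    then have qe: "q * e = x" using q by simp
    have De: "D = e * gcd D n" by (simp add: e_def)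
    have "q dvd m" using qe a(1) by (metis dvd_mult_left)
    moreover have "e * (q * y) = e * gcd D n" using De D qe by (metis mult.assoc mult.commute)
    moreover have "e > 0" using ex main(2)[OF a(1,2)] by (auto intro!: Nat.gr0I)
    ultimately have "q dvd gcd m n"
      by (metis dvd_triv_left gcd_greatest gcd_nat.boundedE mult_left_cancel not_gr_zero)
    moreover have "D dvd m * n" using D a by (auto intro: mult_dvd_mono)
    ultimately show "z \<in> {d. d dvd gcd m n} \<times> {d. d dvd m * n}" by (simp add: z)
  qed
  moreover have "finite ({d. d dvd gcd m n} \<times> {d. d dvd m * n})"
    using False by (intro finite_cartesian_product finite_divs) auto
  ultimately have "card ({d. d dvd m} \<times> {d. d dvd n}) \<le> card ({d. d dvd gcd m n} \<times> {d. d dvd m * n})"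
    by (rule card_inj_on_le)
  then show ?thesis by (simp add: ndiv_def card_cartesian_product)
qed auto

text \<open>At a prime power the comparison is between a + 1 and p to the power a \<epsilon>. From
  \<open>B = 2 powr (1 / \<epsilon>)\<close> on, \<open>p powr \<epsilon>\<close> is at least 2 and
  2^a suffices; each of the finitely many smaller primes costs a factor \<open>K\<close>.\<close>

lemma ndiv_le_powr:
  fixes \<epsilon> :: real
  assumes "\<epsilon> > 0"
  shows "\<exists>C\<ge>1. \<forall>n>0. real (ndiv n) \<le> C * real n powr \<epsilon>"
proof -
  define B where "B = 2 powr (1 / \<epsilon>)"
  define K where "K = max 1 (1 / (\<epsilon> * ln 2))"
  have K1: "K \<ge> 1" by (simp add: K_def)
  have local: "real a + 1 \<le> (if real p < B then K else 1) * real (p ^ a) powr \<epsilon>" if "prime p" for p a :: nat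
  proof -
    have p2: "real p \<ge> 2" using prime_ge_2_nat[OF that] by simp
    have eq: "real (p ^ a) powr \<epsilon> = exp (real a * (\<epsilon> * ln (real p)))"
      using p2 by (simp add: powr_def ln_realpow mult_ac)
    show ?thesis
    proof (cases "real p < B")
      case True
      have e: "exp (real a * (\<epsilon> * ln (real p))) \<ge> 1 + real a * (\<epsilon> * ln 2)"
      proof -
        have "exp (real a * (\<epsilon> * ln (real p))) \<ge> 1 + real a * (\<epsilon> * ln (real p))" by simp
        moreover have "real a * (\<epsilon> * ln 2) \<le> real a * (\<epsilon> * ln (real p))"
          using p2 assms by (intro mult_left_mono) auto
        ultimately show ?thesis by linarith
      qed
      have K2: "K * (\<epsilon> * ln 2) \<ge> 1"
      proof -
        have "1 / (\<epsilon> * ln 2) \<le> K" by (simp add: K_def)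
        then show ?thesis using assms by (simp add: field_simps)
      qed
      have "real a + 1 \<le> K + real a * (K * (\<epsilon> * ln 2))"
        using K1 mult_left_mono[OF K2, of "real a"] by simp
      also have "\<dots> = K * (1 + real a * (\<epsilon> * ln 2))" by (simp add: algebra_simps)
      also have "\<dots> \<le> K * exp (real a * (\<epsilon> * ln (real p)))" using e K1 by (intro mult_left_mono) auto
      finally show ?thesis using True eq by simp
    next
      case False
      then have "ln B \<le> ln (real p)" unfolding B_def using p2 by (intro ln_mono) auto
      then have "ln 2 / \<epsilon> \<le> ln (real p)" by (simp add: B_def ln_powr)
      then have "ln 2 \<le> \<epsilon> * ln (real p)" using assms by (simp add: field_simps)
      then have "real a * ln 2 \<le> real a * (\<epsilon> * ln (real p))" by (intro mult_left_mono) auto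
      then have "exp (real a * ln 2) \<le> exp (real a * (\<epsilon> * ln (real p)))" by simp
      moreover have "exp (real a * ln 2) = 2 ^ a" by (simp add: exp_of_nat_mult)
      moreover have "real a + 1 \<le> 2 ^ a" 
        using of_nat_less_two_power[of a] 
        by (metis Suc_leI less_exp of_nat_Suc of_nat_le_iff of_nat_numeral of_nat_power add.commute)
      ultimately show ?thesis using False eq by simp
    qed
  qed
  define w where "w = (\<lambda>n. card {p \<in> prime_factors n. real p < B})"
  have *: "n > 0 \<Longrightarrow> real (ndiv n) \<le> K ^ w n * real n powr \<epsilon>" for n
  proof (induction n rule: less_induct)
    case (less n)
    show ?case
    proof (cases "n = 1")
      case True then show ?thesis by (simp add: w_def)
    next
      case False
      then obtain p where p: "prime p" "p dvd n" using prime_factor_nat by blast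
      obtain m where m: "n = p ^ multiplicity p n * m" "\<not> p dvd m"
        using multiplicity_decompose'[of n p] less.prems p by (metis not_prime_unit not_gr_zero)
      define a where "a = multiplicity p n"
      have n: "n = p ^ a * m" using m a_def by simp
      have a0: "a > 0" using p less.prems by (simp add: a_def prime_multiplicity_gt_zero_iff)
      have m0: "m > 0" using n less.prems by (auto intro!: Nat.gr0I)
      have "p ^ a > 1" using prime_gt_1_nat[OF p(1)] a0 by (rule one_less_power)
      then have mn: "m < n" using n m0 by simp
      have pf: "prime_factors n = insert p (prime_factors m)"
        using n p a0 m0 prime_gt_0_nat[OF p(1)] by (simp add: prime_factors_product prime_factorization_prime_power)
      have "p \<notin> prime_factors m" using m(2) by auto
      have wn: "w n = w m + (if real p < B then 1 else 0)"
      proof -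
        have "{q \<in> prime_factors n. real q < B} = (if real p < B then insert p {q \<in> prime_factors m. real q < B} else {q \<in> prime_factors m. real q < B})"
          using pf by auto
        then show ?thesis using \<open>p \<notin> prime_factors m\<close> by (simp add: w_def)
      qed
      have "real (ndiv n) = (real a + 1) * real (ndiv m)"
        using ndiv_prime_power_mult[OF p(1) m(2), of a] by (simp add: n algebra_simps)
      also have "\<dots> \<le> ((if real p < B then K else 1) * real (p ^ a) powr \<epsilon>) * (K ^ w m * real m powr \<epsilon>)"
        using local[OF p(1), of a] less.IH[OF mn m0] K1 by (intro mult_mono) auto
      also have "\<dots> = K ^ w n * real n powr \<epsilon>"
        unfolding wn by (simp add: n powr_mult)
      finally show ?thesis .
    qed
  qed
  define C where "C = K ^ card {p. real p < B}"
  have finB: "finite {p::nat. real p < B}" 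
    by (rule finite_subset[of _ "{..nat \<lceil>B\<rceil>}"]) (auto, linarith)
  have "real (ndiv n) \<le> C * real n powr \<epsilon>" if "n > 0" for n
  proof -
    have "w n \<le> card {p::nat. real p < B}" unfolding w_def by (intro card_mono finB) auto
    then have "K ^ w n \<le> C" unfolding C_def using K1 by (intro power_increasing) auto
    then show ?thesis using *[OF that] by (smt (verit) mult_right_mono powr_ge_zero)
  qed
  moreover have "C \<ge> 1" using K1 by (simp add: C_def)
  ultimately show ?thesis by auto
qed

section \<open>The divisor function of a product of three numbers\<close>

text \<open>The components \<open>\<kappa> 0, \<kappa> 1, \<kappa> 2\<close> divide two of the three numbers, \<open>\<kappa> 3\<close> and \<open>\<kappa> 4\<close> all of them. At a prime
  with exponents \<open>a, b, c\<close> the identity reads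
  \<open>1 + a + b + c = (1+a)(1+b)(1+c) - a b (1+c) - a (1+b) c - (1+a) b c + 2 a b c\<close>.\<close>

definition slots :: "nat \<Rightarrow> nat set" where
  "slots i = (if i = 0 then {0,1,3,4} else if i = 1 then {0,2,3,4} else {1,2,3,4})"

definition kk :: "nat \<Rightarrow> (nat \<Rightarrow> nat) \<Rightarrow> nat" where
  "kk i \<kappa> = (\<Prod>j\<in>slots i. \<kappa> j)"

text \<open>Squarefreeness of the whole product puts each prime into at most one slot, that is, into
  one summand of the local identity. Its coefficient 2 is spread over the slots 3 and 4, which keeps
  all weights in {-1, 0, 1} at the price of a second component dividing all three numbers.\<close>

definition lamT :: "(nat \<Rightarrow> nat) \<Rightarrow> real" where
  "lamT \<kappa> = (if squarefree (\<Prod>j<5. \<kappa> j) then (-1) ^ card (prime_factors (\<kappa> 0 * \<kappa> 1 * \<kappa> 2)) else 0)"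

text \<open>The value 0 makes the local factor \<open>a\<close> for a modulus divisible by p correct
  at \<open>a = 0\<close> as well, so that no divisibility conditions have to be carried
  along.\<close>

definition qdiv :: "nat \<Rightarrow> nat \<Rightarrow> nat" where
  "qdiv n j = (if j dvd n then ndiv (n div j) else 0)"

lemma abs_lamT_le_1: "\<bar>lamT \<kappa>\<bar> \<le> 1"
  by (simp add: lamT_def)

lemma slots_subset: "i < 3 \<Longrightarrow> slots i \<subseteq> {..<5}" and finite_slots [simp]: "finite (slots i)"
  by (auto simp: slots_def)

lemma prod_lessThan_3: "(\<Prod>i<(3::nat). f i) = f 0 * f 1 * (f 2 :: 'a::comm_monoid_mult)"
  by (simp add: numeral_3_eq_3 numeral_2_eq_2 mult_ac)

lemma prod_lessThan_5: "(\<Prod>i<(5::nat). f i) = f 0 * f 1 * f 2 * f 3 * (f 4 :: 'a::comm_monoid_mult)"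
proof -
  have "{..<5::nat} = {0,1,2,3,4}" by auto
  then show ?thesis by (simp add: mult_ac)
qed

lemma kk_explicit:
  "kk 0 \<kappa> = \<kappa> 0 * \<kappa> 1 * \<kappa> 3 * \<kappa> 4" "kk (Suc 0) \<kappa> = \<kappa> 0 * \<kappa> 2 * \<kappa> 3 * \<kappa> 4" "kk 2 \<kappa> = \<kappa> 1 * \<kappa> 2 * \<kappa> 3 * \<kappa> 4"
  by (auto simp: kk_def slots_def mult_ac)

lemma qdiv_prime_power:
  assumes p: "prime p" and m: "\<not> p dvd m" and j: "\<not> p dvd j"
  shows "qdiv (p ^ a * m) j = Suc a * qdiv m j" "qdiv (p ^ a * m) (p * j) = a * qdiv m j"
proof -
  have cop: "coprime j (p ^ b)" for b using p j by (metis coprime_commute coprime_power_right_iff prime_imp_coprime)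
  have dv: "j dvd p ^ b * m \<longleftrightarrow> j dvd m" for b
    using cop coprime_dvd_mult_right_iff by blast
  have eq: "ndiv (p ^ b * m div j) = Suc b * ndiv (m div j)" if "j dvd m" for b
  proof -
    have "p ^ b * m div j = p ^ b * (m div j)" using that by (simp add: div_mult_swap)
    moreover have "\<not> p dvd m div j" using m that by (metis dvd_mult_div_cancel dvd_triv_right dvd_trans)
    ultimately show ?thesis using ndiv_prime_power_mult[OF p] by simp
  qed
  show "qdiv (p ^ a * m) j = Suc a * qdiv m j"
    using eq[of a] dv by (simp add: qdiv_def)
  show "qdiv (p ^ a * m) (p * j) = a * qdiv m j"
  proof (cases a)
    case 0
    then have "\<not> p * j dvd p ^ a * m" using m by (auto dest: dvd_mult_left)
    then show ?thesis using 0 by (simp add: qdiv_def)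
  next
    case (Suc b)
    have p0: "p \<noteq> 0" using p by auto
    have "p * j dvd p ^ a * m \<longleftrightarrow> j dvd m" using dv[of b] p0 by (simp add: Suc mult.assoc)
    moreover have "p ^ a * m div (p * j) = p ^ b * m div j" using p0 by (simp add: Suc mult.assoc)
    ultimately show ?thesis using eq[of b] by (simp add: qdiv_def Suc)
  qed
qed

lemma squarefree_prime_mult_iff:
  assumes "prime p" "\<not> p dvd (n::nat)"
  shows "squarefree (p * n) \<longleftrightarrow> squarefree n"
proof
  show "squarefree (p * n) \<Longrightarrow> squarefree n" by (meson dvd_triv_right squarefree_mono)
  assume "squarefree n"
  moreover have "squarefree p" using assms(1) by (simp add: squarefree_prime)
  moreover have "coprime p n" using assms by (simp add: prime_imp_coprime)
  ultimately show "squarefree (p * n)" by (simp add: squarefree_mult_coprime)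
qed

text \<open>A tuple with squarefree product has at most one slot divisible by \<^term>\<open>p\<close>; the value
  \<open>o' = 5\<close> stands for no such slot.\<close>

definition pupd :: "nat \<Rightarrow> nat \<Rightarrow> (nat \<Rightarrow> nat) \<Rightarrow> nat \<Rightarrow> nat" where
  "pupd p o' \<kappa> = (if o' < 5 then \<kappa>(o' := p * \<kappa> o') else \<kappa>)"

definition sqf :: "nat \<Rightarrow> (nat \<Rightarrow> nat) set" where
  "sqf M = {\<kappa> \<in> PiE {..<5} (\<lambda>_. {d. d dvd M}). squarefree (\<Prod>j<5. \<kappa> j)}"

context
  fixes p :: nat and N :: nat
  assumes p: "prime p" and pN: "\<not> p dvd N"
begin

lemma prod_pupd: "finite S \<Longrightarrow> S \<subseteq> {..<5} \<Longrightarrow> (\<Prod>j\<in>S. pupd p o' \<kappa> j) = (if o' \<in> S then p else 1) * (\<Prod>j\<in>S. \<kappa> j)"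
proof -
  assume S: "finite S" "S \<subseteq> {..<5}"
  have "(\<Prod>j\<in>S. pupd p o' \<kappa> j) = (\<Prod>j\<in>S. (if j = o' then p else 1) * \<kappa> j)"
    using S by (intro prod.cong) (auto simp: pupd_def)
  also have "\<dots> = (\<Prod>j\<in>S. if j = o' then p else 1) * (\<Prod>j\<in>S. \<kappa> j)" by (rule prod.distrib)
  also have "(\<Prod>j\<in>S. if j = o' then p else 1) = (if o' \<in> S then p else 1)" using S by simp
  finally show ?thesis .
qed

lemma sqf_not_dvd:
  assumes "\<kappa> \<in> sqf N" "j < 5" shows "\<not> p dvd \<kappa> j"
  using assms pN by (auto simp: sqf_def PiE_def Pi_def intro: dvd_trans)

lemma sqf_not_dvd_prod:
  assumes "\<kappa> \<in> sqf N" "S \<subseteq> {..<5}" shows "\<not> p dvd (\<Prod>j\<in>S. \<kappa> j)"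
  using sqf_not_dvd[OF assms(1)] assms(2) p finite_subset[OF assms(2)]
  by (subst prime_dvd_prod_iff) auto

text \<open>Restoring the prime p to a tuple of divisors of N amounts to choosing its slot, or none.
  The exponent A does not influence the count because squarefreeness admits p at most once.\<close>

lemma bij_pupd:
  assumes A: "A > 0"
  shows "bij_betw (\<lambda>(o', \<kappa>). pupd p o' \<kappa>) ({..5} \<times> sqf N) (sqf (p ^ A * N))"
  unfolding bij_betw_def
proof
  have p0: "p > 0" using p by (simp add: prime_gt_0_nat)
  have key: "p dvd pupd p o' \<kappa> j \<longleftrightarrow> j = o'" if "o' \<le> 5" "\<kappa> \<in> sqf N" "j < 5" for o' \<kappa> j
    using sqf_not_dvd[OF that(2,3)] that by (auto simp: pupd_def)
  show "inj_on (\<lambda>(o', \<kappa>). pupd p o' \<kappa>) ({..5} \<times> sqf N)"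
  proof (rule inj_onI, clarify)
    fix o1 \<kappa>1 o2 \<kappa>2
    assume a: "o1 \<le> 5" "\<kappa>1 \<in> sqf N" "o2 \<le> 5" "\<kappa>2 \<in> sqf N" "pupd p o1 \<kappa>1 = pupd p o2 \<kappa>2"
    have "j = o1 \<longleftrightarrow> j = o2" if "j < 5" for j
      using key[OF a(1,2) that] key[OF a(3,4) that] a(5) by simp
    then have o: "o1 = o2" using a(1,3) by (metis le_neq_implies_less)
    moreover have "\<kappa>1 j = \<kappa>2 j" for j
      using fun_cong[OF a(5), of j] o p0 by (auto simp: pupd_def split: if_splits)
    ultimately show "o1 = o2 \<and> \<kappa>1 = \<kappa>2" by auto
  qed
  show "(\<lambda>(o', \<kappa>). pupd p o' \<kappa>) ` ({..5} \<times> sqf N) = sqf (p ^ A * N)"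
  proof (intro equalityI subsetI)
    fix x assume "x \<in> (\<lambda>(o', \<kappa>). pupd p o' \<kappa>) ` ({..5} \<times> sqf N)"
    then obtain o' \<kappa> where x: "x = pupd p o' \<kappa>" "o' \<le> 5" "\<kappa> \<in> sqf N" by auto
    have "squarefree (\<Prod>j<5. pupd p o' \<kappa> j)"
      using x sqf_not_dvd_prod[OF x(3), of "{..<5}"] squarefree_prime_mult_iff[OF p]
      by (subst prod_pupd) (auto simp: sqf_def)
    moreover have "pupd p o' \<kappa> \<in> PiE {..<5} (\<lambda>_. {d. d dvd p ^ A * N})"
    proof -
      have "p dvd p ^ A" using A by (simp add: dvd_power)
      then show ?thesis
        using x(3) by (auto simp: sqf_def pupd_def PiE_def Pi_def extensional_def mult_dvd_mono)
    qed
    ultimately show "x \<in> sqf (p ^ A * N)" using x by (auto simp: sqf_def)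
  next
    fix x assume x: "x \<in> sqf (p ^ A * N)"
    have nd: "y dvd N" if "y dvd p ^ A * N" "\<not> p dvd y" for y
    proof -
      have "coprime y (p ^ A)" using p that by (metis coprime_commute coprime_power_right_iff prime_imp_coprime)
      then show ?thesis using that by (simp add: coprime_dvd_mult_right_iff)
    qed
    have xd: "x j dvd p ^ A * N" if "j < 5" for j using x that by (auto simp: sqf_def PiE_def Pi_def)
    have xe: "x j = undefined" if "\<not> j < 5" for j using x that by (auto simp: sqf_def PiE_def extensional_def)
    show "x \<in> (\<lambda>(o', \<kappa>). pupd p o' \<kappa>) ` ({..5} \<times> sqf N)"
    proof (cases "\<exists>j<5. p dvd x j")
      case False
      then have "x \<in> sqf N" using x xd xe nd by (auto simp: sqf_def PiE_def Pi_def extensional_def)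
      then show ?thesis by (intro image_eqI[of _ _ "(5, x)"]) (auto simp: pupd_def)
    next
      case True
      then obtain j where "j < 5" "p dvd x j" by blast
      then obtain c where j: "j < 5" "x j = p * c" by (auto elim: dvdE)
      define \<kappa> where "\<kappa> = x(j := c)"
      have up: "x = pupd p j \<kappa>" using j by (auto simp: pupd_def \<kappa>_def)
      have "squarefree (p * (\<Prod>j<5. \<kappa> j))"
        using x j prod_pupd[of "{..<5}" j \<kappa>] unfolding sqf_def up by simp
      then have sq: "\<not> p dvd (\<Prod>j<5. \<kappa> j)" "squarefree (\<Prod>j<5. \<kappa> j)"
      proof -
        assume a: "squarefree (p * (\<Prod>j<5. \<kappa> j))"
        show "squarefree (\<Prod>j<5. \<kappa> j)" using a by (meson dvd_triv_right squarefree_mono)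
        show "\<not> p dvd (\<Prod>j<5. \<kappa> j)"
        proof
          assume "p dvd (\<Prod>j<5. \<kappa> j)"
          then have "p ^ 2 dvd p * (\<Prod>j<5. \<kappa> j)" by (simp add: power2_eq_square mult_dvd_mono)
          then have "p dvd 1" using a squarefreeD by blast
          then show False using p by auto
        qed
      qed
      have "\<not> p dvd \<kappa> i" if "i < 5" for i using sq(1) that by (meson dvd_prodI dvd_trans finite_lessThan lessThan_iff)
      moreover have "\<kappa> i dvd p ^ A * N" if "i < 5" for i
        using xd[OF that] j by (auto simp: \<kappa>_def split: if_splits dest: dvd_mult_right)
      moreover have "\<kappa> i = undefined" if "\<not> i < 5" for i using xe[OF that] j that by (auto simp: \<kappa>_def)
      ultimately have "\<kappa> \<in> sqf N" using nd sq(2) by (auto simp: sqf_def PiE_def Pi_def extensional_def)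
      then show ?thesis using up j by (intro image_eqI[of _ _ "(j, \<kappa>)"]) auto
    qed
  qed
qed

lemma lamT_pupd:
  assumes "\<kappa> \<in> sqf N" "o' \<le> 5" shows "lamT (pupd p o' \<kappa>) = (if o' < 3 then -1 else 1) * lamT \<kappa>"
proof -
  have sf: "squarefree (\<Prod>j<5. pupd p o' \<kappa> j)" "squarefree (\<Prod>j<5. \<kappa> j)"
    using assms sqf_not_dvd_prod[OF assms(1), of "{..<5}"] squarefree_prime_mult_iff[OF p]
    by (auto simp: prod_pupd) (auto simp: sqf_def)
  let ?P = "\<lambda>\<kappa>. \<kappa> 0 * \<kappa> 1 * \<kappa> 2 :: nat"
  have P: "?P x = (\<Prod>j<(3::nat). x j)" for x by (simp add: prod_lessThan_3)
  have eq: "?P (pupd p o' \<kappa>) = (if o' < 3 then p else 1) * ?P \<kappa>"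
    unfolding P by (subst prod_pupd) auto
  have np: "\<not> p dvd ?P \<kappa>" unfolding P by (rule sqf_not_dvd_prod[OF assms(1)]) auto
  then have n0: "?P \<kappa> \<noteq> 0" by (metis dvd_0_right)
  have "prime_factors (p * ?P \<kappa>) = insert p (prime_factors (?P \<kappa>))"
    using n0 p by (subst prime_factors_product) (auto simp: prime_prime_factors)
  moreover have "p \<notin> prime_factors (?P \<kappa>)" using np by auto
  ultimately have "card (prime_factors (p * ?P \<kappa>)) = Suc (card (prime_factors (?P \<kappa>)))" by simp
  moreover have "lamT (pupd p o' \<kappa>) = (-1) ^ card (prime_factors (?P (pupd p o' \<kappa>)))"
    "lamT \<kappa> = (-1) ^ card (prime_factors (?P \<kappa>))" using sf by (auto simp: lamT_def)
  ultimately show ?thesis unfolding eq by simp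
qed

text \<open>A slot for p turns the factor a_i + 1 into a_i exactly for those i whose slots contain
  it; with the signs of \<open>lamT_pupd\<close> the six products add up to the local
  identity.\<close>

lemma sum_pupd:
  fixes m a :: "nat \<Rightarrow> nat"
  assumes \<kappa>: "\<kappa> \<in> sqf N" and m: "\<And>i. i < 3 \<Longrightarrow> \<not> p dvd m i"
  shows "(\<Sum>o'\<le>5. lamT (pupd p o' \<kappa>) * (\<Prod>i<3. real (qdiv (p ^ a i * m i) (kk i (pupd p o' \<kappa>)))))
    = (1 + real (a 0) + a 1 + a 2) * (lamT \<kappa> * (\<Prod>i<3. real (qdiv (m i) (kk i \<kappa>))))"
proof -
  have q: "real (qdiv (p ^ a i * m i) (kk i (pupd p o' \<kappa>)))
      = (if o' \<in> slots i then real (a i) else real (a i) + 1) * real (qdiv (m i) (kk i \<kappa>))" if "i < 3" for i o'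
  proof -
    have "kk i (pupd p o' \<kappa>) = (if o' \<in> slots i then p else 1) * kk i \<kappa>"
      unfolding kk_def using slots_subset[OF that] by (intro prod_pupd) auto
    moreover have "\<not> p dvd kk i \<kappa>"
      unfolding kk_def by (rule sqf_not_dvd_prod[OF \<kappa> slots_subset[OF that]])
    ultimately show ?thesis using qdiv_prime_power[OF p m[OF that], of "kk i \<kappa>" "a i"] by (auto simp: algebra_simps)
  qed
  have s6: "(\<Sum>i\<le>(5::nat). f i) = f 0 + f 1 + f 2 + f 3 + f 4 + (f 5 :: real)" for f
  proof -
    have "{..5::nat} = {0,1,2,3,4,5}" by auto
    then show ?thesis by simp
  qed
  have "(\<Sum>o'\<le>5. lamT (pupd p o' \<kappa>) * (\<Prod>i<3. real (qdiv (p ^ a i * m i) (kk i (pupd p o' \<kappa>)))))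
    = (\<Sum>o'\<le>5. (if o' < 3 then -1 else 1) * (\<Prod>i<3. if o' \<in> slots i then real (a i) else real (a i) + 1)
         * (lamT \<kappa> * (\<Prod>i<3. real (qdiv (m i) (kk i \<kappa>)))))"
    using \<kappa> by (intro sum.cong refl) (simp add: lamT_pupd q prod_lessThan_3)
  also have "\<dots> = (\<Sum>o'\<le>5. (if o' < 3 then -1 else 1) * (\<Prod>i<3. if o' \<in> slots i then real (a i) else real (a i) + 1))
         * (lamT \<kappa> * (\<Prod>i<3. real (qdiv (m i) (kk i \<kappa>))))"
    by (simp only: sum_distrib_right)
  also have "(\<Sum>o'\<le>5. (if o' < 3 then -1 else 1) * (\<Prod>i<3. if o' \<in> slots i then real (a i) else real (a i) + 1))
     = 1 + real (a 0) + a 1 + a 2"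
    unfolding s6 prod_lessThan_3 by (simp add: slots_def algebra_simps)
  finally show ?thesis .
qed

end

text \<open>Induction on the product, removing one prime from all three numbers at once:
  \<open>bij_pupd\<close> splits the index set and \<open>sum_pupd\<close> collects 1 + a_0 + a_1 +
  a_2, the factor by which \<open>ndiv\<close> grows.\<close>

lemma ndiv_prod_eq_sum_sqf:
  fixes n :: "nat \<Rightarrow> nat"
  assumes "\<And>i. i < 3 \<Longrightarrow> n i > 0"
  shows "real (ndiv (\<Prod>i<3. n i)) = (\<Sum>\<kappa>\<in>sqf (\<Prod>i<3. n i). lamT \<kappa> * (\<Prod>i<3. real (qdiv (n i) (kk i \<kappa>))))"
  using assms
proof (induction "\<Prod>i<3. n i" arbitrary: n rule: less_induct)
  case less
  define N where "N = (\<Prod>i<3. n i)"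
  have N0: "N > 0" using less.prems by (auto simp: N_def)
  show ?case
  proof (cases "N = 1")
    case True
    then have n1: "n i = 1" if "i < 3" for i
      using that by (metis N_def dvd_prodI finite_lessThan lessThan_iff nat_dvd_1_iff_1)
    have "sqf 1 = {\<lambda>j\<in>{..<5}. 1}"
      by (auto simp: sqf_def PiE_def Pi_def extensional_def)
    moreover have "kk i (\<lambda>j\<in>{..<5}. 1) = 1" if "i < 3" for i
      unfolding kk_def using slots_subset[OF that] by (intro prod.neutral) auto
    ultimately show ?thesis using True n1 by (simp add: N_def lamT_def qdiv_def)
  next
    case False
    then obtain p where p: "prime p" "p dvd N" using prime_factor_nat by blast
    have "\<exists>a m. n i = p ^ a * m \<and> \<not> p dvd m" if "i < 3" for i
      using multiplicity_decompose'[of "n i" p] less.prems[OF that] p by (metis not_prime_unit not_gr_zero)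
    then obtain a m where am: "\<And>i. i < 3 \<Longrightarrow> n i = p ^ a i * m i" "\<And>i. i < 3 \<Longrightarrow> \<not> p dvd m i" by metis
    define A where "A = (\<Sum>i<3. a i)"
    define M where "M = (\<Prod>i<3. m i)"
    have m0: "m i > 0" if "i < 3" for i using am(2)[OF that] by (auto intro!: Nat.gr0I)
    have NM: "N = p ^ A * M" unfolding N_def A_def M_def power_sum using am(1) by (simp add: prod.distrib)
    have pM: "\<not> p dvd M" unfolding M_def using am(2) p by (subst prime_dvd_prod_iff) auto
    have A0: "A > 0" using p pM NM by (auto intro!: Nat.gr0I)
    have "p ^ A > 1" using prime_gt_1_nat[OF p(1)] A0 by (rule one_less_power)
    then have MN: "M < N" using NM N0 by simp
    have "(\<Sum>\<kappa>\<in>sqf N. lamT \<kappa> * (\<Prod>i<3. real (qdiv (n i) (kk i \<kappa>))))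
       = (\<Sum>(o', \<kappa>)\<in>{..5} \<times> sqf M. lamT (pupd p o' \<kappa>) * (\<Prod>i<3. real (qdiv (n i) (kk i (pupd p o' \<kappa>)))))"
      unfolding NM by (subst sum.reindex_bij_betw[OF bij_pupd[OF p(1) pM A0], symmetric]) (simp add: case_prod_unfold)
    also have "\<dots> = (\<Sum>\<kappa>\<in>sqf M. \<Sum>o'\<le>5. lamT (pupd p o' \<kappa>) * (\<Prod>i<3. real (qdiv (p ^ a i * m i) (kk i (pupd p o' \<kappa>)))))"
      using am(1) by (subst sum.cartesian_product[symmetric], subst sum.swap) simp
    also have "\<dots> = (\<Sum>\<kappa>\<in>sqf M. (1 + real (a 0) + a 1 + a 2) * (lamT \<kappa> * (\<Prod>i<3. real (qdiv (m i) (kk i \<kappa>)))))"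
      by (intro sum.cong refl sum_pupd[OF p(1) pM] am(2))
    also have "\<dots> = (1 + real (a 0) + a 1 + a 2) * real (ndiv M)"
      using less.hyps[of m] MN m0 by (simp add: M_def N_def sum_distrib_left)
    also have "\<dots> = real (ndiv N)"
      unfolding NM ndiv_prime_power_mult[OF p(1) pM] by (simp add: A_def eval_nat_numeral algebra_simps)
    finally show ?thesis by (simp add: N_def)
  qed
qed

lemma kk_dvd_slot: "j \<in> slots i \<Longrightarrow> \<kappa> j dvd kk i \<kappa>"
  by (simp add: kk_def dvd_prodI)

lemma slot_ex: assumes "j < 5" shows "\<exists>i<3. j \<in> slots i"
proof -
  consider "j = 0" | "j = 1" | "j = 2" | "j = 3" | "j = 4" using assms by linarith
  then show ?thesis by cases (auto simp: slots_def intro: exI[of _ 0] exI[of _ 1])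
qed

text \<open>The index set of \<open>ndiv_prod_eq_sum_sqf\<close> depends on the numbers. A nonzero
  term forces every component of \<kappa> to divide one of them, so a fixed box can replace it; this
  permits summing over x before \<kappa>.\<close>

lemma ndiv_prod_eq_sum:
  fixes n :: "nat \<Rightarrow> nat"
  assumes n: "\<And>i. i < 3 \<Longrightarrow> n i > 0" "\<And>i. i < 3 \<Longrightarrow> n i \<le> B"
  shows "real (ndiv (\<Prod>i<3. n i)) = (\<Sum>\<kappa>\<in>PiE {..<5} (\<lambda>_. {1..B}). lamT \<kappa> * (\<Prod>i<3. real (qdiv (n i) (kk i \<kappa>))))"
proof -
  let ?N = "\<Prod>i<3. n i" let ?t = "\<lambda>\<kappa>. lamT \<kappa> * (\<Prod>i<3. real (qdiv (n i) (kk i \<kappa>)))"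
  have N0: "?N > 0" using n by auto
  let ?A = "sqf ?N" let ?B = "PiE {..<5::nat} (\<lambda>_. {1..B})"
  have nz: "\<kappa> \<in> PiE {..<5} (\<lambda>_. {d. d dvd ?N}) \<inter> ?B \<and> squarefree (\<Prod>j<5. \<kappa> j)" if \<kappa>: "?t \<kappa> \<noteq> 0" "\<kappa> \<in> ?A \<union> ?B" for \<kappa>
  proof -
    have sf: "squarefree (\<Prod>j<5. \<kappa> j)" using \<kappa>(1) by (auto simp: lamT_def split: if_splits)
    have kd: "kk i \<kappa> dvd n i" if "i < 3" for i
      using \<kappa>(1) that by (auto simp: qdiv_def split: if_splits)
    have "\<kappa> j dvd ?N \<and> \<kappa> j \<in> {1..B}" if j: "j < 5" for j
    proof -
      obtain i where i: "i < 3" "j \<in> slots i" using slot_ex[OF j] by blast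
      have d: "\<kappa> j dvd n i" using kk_dvd_slot[OF i(2)] kd[OF i(1)] by (rule dvd_trans)
      moreover have "n i dvd ?N" using i by (intro dvd_prodI) auto
      moreover have "\<kappa> j \<le> B" using dvd_imp_le[OF d n(1)[OF i(1)]] n(2)[OF i(1)] by linarith
      moreover have "\<kappa> j > 0" using d n(1)[OF i(1)] by (auto intro!: Nat.gr0I)
      ultimately show ?thesis by (auto intro: dvd_trans)
    qed
    moreover have "\<kappa> \<in> extensional {..<5}" using \<kappa>(2) by (auto simp: sqf_def PiE_def)
    ultimately show ?thesis using sf by (auto simp: PiE_def Pi_def)
  qed
  have fB: "finite ?B" by (intro finite_PiE) auto
  have fA: "finite ?A"
    by (rule finite_subset[of _ "PiE {..<5::nat} (\<lambda>_. {d. d dvd ?N})"])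
       (use N0 in \<open>auto simp: sqf_def intro!: finite_PiE finite_divs\<close>)
  note fin = fA fB
  have nz2: "\<kappa> \<in> ?A \<inter> ?B" if "?t \<kappa> \<noteq> 0" "\<kappa> \<in> ?A \<union> ?B" for \<kappa>
    using nz[OF that] unfolding sqf_def by blast
  have "sum ?t ?A = sum ?t (?A \<inter> ?B)" using fin nz2 by (intro sum.mono_neutral_right) blast+
  also have "\<dots> = sum ?t ?B" using fin nz2 by (intro sum.mono_neutral_left) blast+
  finally show ?thesis using ndiv_prod_eq_sum_sqf[OF n(1)] by simp
qed

section \<open>Counting points of plane lattices in convex regions\<close>

definition rp :: "int \<times> int \<Rightarrow> real \<times> real" where
  "rp x = (real_of_int (fst x), real_of_int (snd x))"

definition sn :: "int \<times> int \<Rightarrow> int" where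
  "sn v = max \<bar>fst v\<bar> \<bar>snd v\<bar>"

lemma sn_pos: "v \<noteq> 0 \<Longrightarrow> sn v > 0"
  by (cases v) (auto simp: sn_def zero_prod_def)

text \<open>Real coordinates, because translates of the lattice are counted as well.\<close>

definition pt :: "int \<times> int \<Rightarrow> int \<times> int \<Rightarrow> real \<Rightarrow> real \<Rightarrow> real \<times> real" where
  "pt v w x y = (x * fst v + y * fst w, x * snd v + y * snd w)"

text \<open>The squared Euclidean length, integral so that a shortest pair exists by well-ordering.
  The final bounds use the supremum norm \<open>sn\<close>, whose spheres are easy to count.\<close>

definition qn :: "int \<times> int \<Rightarrow> int" where
  "qn v = (fst v)\<^sup>2 + (snd v)\<^sup>2"

section \<open>Translates of a lattice inside a convex region\<close>

lemma card_int_near: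
  assumes "B \<ge> 0"
  shows "finite {b::int. \<bar>of_int b + t\<bar> \<le> (B::real)}" "real (card {b::int. \<bar>of_int b + t\<bar> \<le> B}) \<le> 2 * B + 1"
proof -
  have eq: "{b::int. \<bar>of_int b + t\<bar> \<le> B} = {\<lceil>-B - t\<rceil>..\<lfloor>B - t\<rfloor>}"
    by (auto simp: ceiling_le_iff le_floor_iff abs_le_iff)
  show "finite {b::int. \<bar>of_int b + t\<bar> \<le> B}" unfolding eq by simp
  have "real (nat (\<lfloor>B - t\<rfloor> - \<lceil>-B - t\<rceil> + 1)) \<le> 2 * B + 1"
  proof (cases "\<lfloor>B - t\<rfloor> - \<lceil>-B - t\<rceil> + 1 \<ge> 0")
    case True
    then have "real (nat (\<lfloor>B - t\<rfloor> - \<lceil>-B - t\<rceil> + 1)) = of_int \<lfloor>B - t\<rfloor> - of_int \<lceil>-B - t\<rceil> + 1" by simp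
    also have "\<dots> \<le> (B - t) - (-B - t) + 1"
      using of_int_floor_le[of "B - t"] le_of_int_ceiling[of "-B - t"] by linarith
    finally show ?thesis by simp
  qed (use assms in auto)
  then show "real (card {b::int. \<bar>of_int b + t\<bar> \<le> B}) \<le> 2 * B + 1" unfolding eq by simp
qed

text \<open>Every integer point of I except the largest stays in I when moved right by \<alpha>;
  conversely every point a + \<alpha> of I except the largest has a + 1 in I.\<close>

lemma card_shift_interval:
  fixes I :: "real set"
  assumes conv: "\<And>x y z. x \<in> I \<Longrightarrow> y \<in> I \<Longrightarrow> x \<le> z \<Longrightarrow> z \<le> y \<Longrightarrow> z \<in> I"
    and \<alpha>: "0 \<le> \<alpha>" "\<alpha> \<le> 1"
    and fin: "finite {a::int. of_int a \<in> I}" "finite {a::int. of_int a + \<alpha> \<in> I}"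
  shows "\<bar>real (card {a::int. of_int a + \<alpha> \<in> I}) - real (card {a::int. of_int a \<in> I})\<bar> \<le> 1"
proof -
  let ?A = "{a::int. of_int a \<in> I}" and ?B = "{a::int. of_int a + \<alpha> \<in> I}"
  have "?A - {Max ?A} \<subseteq> ?B"
  proof
    fix a assume a: "a \<in> ?A - {Max ?A}"
    then have "a \<le> Max ?A" "Max ?A \<in> ?A" using fin(1) Max_ge Max_in[of ?A] by auto
    then have "a + 1 \<le> Max ?A" using a by auto
    then have "real_of_int a + \<alpha> \<le> of_int (Max ?A)" using \<alpha> by linarith
    then show "a \<in> ?B" using conv[of "of_int a" "of_int (Max ?A)" "of_int a + \<alpha>"] a \<open>Max ?A \<in> ?A\<close> \<alpha> by auto
  qed
  then have 1: "card (?A - {Max ?A}) \<le> card ?B" using fin(2) by (rule card_mono[rotated])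
  have "(\<lambda>a. a + 1) ` (?B - {Max ?B}) \<subseteq> ?A"
  proof clarify
    fix a assume a: "of_int a + \<alpha> \<in> I" "a \<noteq> Max ?B"
    then have "a \<le> Max ?B" "Max ?B \<in> ?B" using fin(2) Max_ge[of ?B a] Max_in[of ?B] by auto
    then have "a + 1 \<le> Max ?B" using a by auto
    then have "real_of_int a + 1 \<le> of_int (Max ?B) + \<alpha>" using \<alpha> by linarith
    then show "real_of_int (a + 1) \<in> I" using conv[of "of_int a + \<alpha>" "of_int (Max ?B) + \<alpha>" "of_int a + 1"] a \<open>Max ?B \<in> ?B\<close> \<alpha> by auto
  qed
  then have "card ((\<lambda>a. a + 1) ` (?B - {Max ?B})) \<le> card ?A" using fin(1) by (rule card_mono[rotated])
  then have 2: "card (?B - {Max ?B}) \<le> card ?A" by (subst (asm) card_image) (auto simp: inj_on_def)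
  show ?thesis using 1 2 by (auto simp: card_Diff_singleton_if abs_le_iff split: if_splits)
qed

lemma card_eq_sum_sections:
  assumes "finite B" "\<And>a b. (a, b) \<in> S \<Longrightarrow> b \<in> B" "\<And>b. finite {a. (a, b) \<in> S}"
  shows "card S = (\<Sum>b\<in>B. card {a. (a, b) \<in> S})"
proof -
  have S: "S = (\<lambda>(b, a). (a, b)) ` (SIGMA b:B. {a. (a, b) \<in> S})" using assms(2) by force
  have "card S = card (SIGMA b:B. {a. (a, b) \<in> S})"
    by (subst S, rule card_image) (auto simp: inj_on_def)
  then show ?thesis using assms by (subst (asm) card_SigmaI) auto
qed

lemma convex_sectionD:
  assumes "convex R" "pt v w x y \<in> R" "pt v w x' y' \<in> R" "0 \<le> u" "u \<le> 1"
  shows "pt v w ((1 - u) * x + u * x') ((1 - u) * y + u * y') \<in> R"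
proof -
  have "(1 - u) *\<^sub>R pt v w x y + u *\<^sub>R pt v w x' y' \<in> R"
    using assms by (intro convexD) auto
  also have "(1 - u) *\<^sub>R pt v w x y + u *\<^sub>R pt v w x' y' = pt v w ((1 - u) * x + u * x') ((1 - u) * y + u * y')"
    by (simp add: pt_def algebra_simps)
  finally show ?thesis .
qed

lemma convex_row:
  assumes R: "convex R" and "pt v w x y \<in> R" "pt v w x' y \<in> R" "x \<le> z" "z \<le> x'"
  shows "pt v w z y \<in> R"
proof (cases "x = x'")
  case False
  then have lt: "x < x'" using assms by auto
  define u where "u = (z - x) / (x' - x)"
  have u: "0 \<le> u" "u \<le> 1" using assms lt by (auto simp: u_def)
  have "u * (x' - x) = z - x" using lt by (simp add: u_def)
  then have "(1 - u) * x + u * x' = z" by (simp add: algebra_simps)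
  moreover have "(1 - u) * y + u * y = y" by (simp add: algebra_simps)
  ultimately show ?thesis using convex_sectionD[OF R assms(2,3) u] by simp
qed (use assms in auto)

lemma pt_swap: "pt w v y x = pt v w x y"
  by (simp add: pt_def)

lemma card_swap_pairs: "card {(a, b). P a b} = card {(b, a). P a b}"
proof -
  have "{(a, b). P a b} = prod.swap ` {(b, a). P a b}" by force
  then show ?thesis by (simp add: card_image)
qed

text \<open>Rows of a convex set are intervals, so a shift along v changes each row by at most one
  point, and at most 2 B + 1 rows meet R.\<close>

lemma card_row_shift:
  assumes R: "convex R" and bd: "\<And>x y. pt v w x y \<in> R \<Longrightarrow> \<bar>x\<bar> \<le> A \<and> \<bar>y\<bar> \<le> B"
    and AB: "A \<ge> 0" "B \<ge> 0" and s: "0 \<le> s" "s \<le> 1"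
  shows "\<bar>real (card {(a::int, b::int). pt v w (of_int a + s) (of_int b + t) \<in> R})
     - real (card {(a::int, b::int). pt v w (of_int a) (of_int b + t) \<in> R})\<bar> \<le> 2 * B + 1"
proof -
  let ?Y = "{b::int. \<bar>of_int b + t\<bar> \<le> B}"
  have fin: "finite {a::int. pt v w (of_int a + s') (of_int b + t) \<in> R}" for s' and b :: int
    by (rule finite_subset[OF _ card_int_near(1)[OF AB(1), of s']]) (use bd in blast)
  have fin0: "finite {a::int. pt v w (of_int a) (of_int b + t) \<in> R}" for b :: int
    using fin[of 0 b] by simp
  have sec: "card {(a::int, b::int). pt v w (of_int a + s') (of_int b + t) \<in> R}
      = (\<Sum>b\<in>?Y. card {a::int. pt v w (of_int a + s') (of_int b + t) \<in> R})" for s'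
  proof (subst card_eq_sum_sections[of ?Y])
    show "finite ?Y" by (rule card_int_near(1)[OF AB(2)])
    show "b \<in> ?Y" if "(a, b) \<in> {(a, b). pt v w (of_int a + s') (of_int b + t) \<in> R}" for a b :: int
      using that bd by blast
  qed (use fin in simp_all)
  have sec0: "card {(a::int, b::int). pt v w (of_int a) (of_int b + t) \<in> R}
      = (\<Sum>b\<in>?Y. card {a::int. pt v w (of_int a) (of_int b + t) \<in> R})"
    using sec[of 0] by simp
  have "real (card {(a::int, b::int). pt v w (of_int a + s) (of_int b + t) \<in> R})
     - real (card {(a::int, b::int). pt v w (of_int a) (of_int b + t) \<in> R})
    = (\<Sum>b\<in>?Y. real (card {a::int. pt v w (of_int a + s) (of_int b + t) \<in> R}) - real (card {a::int. pt v w (of_int a) (of_int b + t) \<in> R}))"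
    unfolding sec[of s] sec0 by (simp add: sum_subtractf)
  also have "\<bar>\<dots>\<bar> \<le> (\<Sum>b\<in>?Y. 1)"
  proof (rule order.trans[OF sum_abs], rule sum_mono)
    fix b :: int
    show "\<bar>real (card {a::int. pt v w (of_int a + s) (of_int b + t) \<in> R}) - real (card {a::int. pt v w (of_int a) (of_int b + t) \<in> R})\<bar> \<le> 1"
      using card_shift_interval[OF _ s, of "{x. pt v w x (of_int b + t) \<in> R}"] convex_row[OF R] fin[of s b] fin0[of b]
      unfolding mem_Collect_eq by blast
  qed
  also have "\<dots> \<le> 2 * B + 1" using card_int_near(2)[OF AB(2)] by simp
  finally show ?thesis .
qed

lemma card_shift_frac:
  assumes R: "convex R" and bd: "\<And>x y. pt v w x y \<in> R \<Longrightarrow> \<bar>x\<bar> \<le> A \<and> \<bar>y\<bar> \<le> B"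
    and AB: "A \<ge> 0" "B \<ge> 0" and s: "0 \<le> s" "s \<le> 1" and t: "0 \<le> t" "t \<le> 1"
  shows "\<bar>real (card {(a::int, b::int). pt v w (of_int a + s) (of_int b + t) \<in> R})
     - real (card {(a::int, b::int). pt v w (of_int a) (of_int b) \<in> R})\<bar> \<le> 2 * A + 2 * B + 2"
proof -
  have "\<bar>real (card {(b::int, a::int). pt w v (of_int b + t) (of_int a + 0) \<in> R})
     - real (card {(b::int, a::int). pt w v (of_int b) (of_int a + 0) \<in> R})\<bar> \<le> 2 * A + 1"
    by (rule card_row_shift[OF R _ AB(2,1) t]) (use bd in \<open>auto simp: pt_swap\<close>)
  then have "\<bar>real (card {(a::int, b::int). pt v w (of_int a) (of_int b + t) \<in> R})
     - real (card {(a::int, b::int). pt v w (of_int a) (of_int b) \<in> R})\<bar> \<le> 2 * A + 1"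
    by (subst (1 2) card_swap_pairs) (simp add: pt_swap[of w v])
  then show ?thesis using card_row_shift[where v = v and w = w and t = t, OF R bd AB s] by linarith
qed

text \<open>The integer parts of the shifts only relabel the points, which reduces to fractional
  shifts.\<close>

lemma card_shift:
  assumes R: "convex R" and bd: "\<And>x y. pt v w x y \<in> R \<Longrightarrow> \<bar>x\<bar> \<le> A \<and> \<bar>y\<bar> \<le> B"
    and AB: "A \<ge> 0" "B \<ge> 0"
  shows "\<bar>real (card {(a::int, b::int). pt v w (of_int a + s) (of_int b + t) \<in> R})
     - real (card {(a::int, b::int). pt v w (of_int a) (of_int b) \<in> R})\<bar> \<le> 2 * A + 2 * B + 2"
proof -
  let ?f = "\<lambda>(a::int, b::int). (a + \<lfloor>s\<rfloor>, b + \<lfloor>t\<rfloor>)"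
  have "bij_betw ?f {(a::int, b::int). pt v w (of_int a + s) (of_int b + t) \<in> R}
     {(a::int, b::int). pt v w (of_int a + frac s) (of_int b + frac t) \<in> R}"
    by (rule bij_betw_byWitness[of _ "\<lambda>(a, b). (a - \<lfloor>s\<rfloor>, b - \<lfloor>t\<rfloor>)"])
       (auto simp: frac_def algebra_simps)
  from bij_betw_same_card[OF this] show ?thesis
    using card_shift_frac[where v = v and w = w and s = "frac s" and t = "frac t", OF R bd AB] by (simp add: frac_lt_1 less_imp_le)
qed

text \<open>Full rank is expressed by a period M in both directions, so that the density can be read
  off as a count in one period square.\<close>

locale plane_lattice =
  fixes \<Lambda> :: "(int \<times> int) set" and M :: int
  assumes diff: "x \<in> \<Lambda> \<Longrightarrow> y \<in> \<Lambda> \<Longrightarrow> x - y \<in> \<Lambda>"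
    and M: "M > 0" "(M, 0) \<in> \<Lambda>" "(0, M) \<in> \<Lambda>"
begin

lemma zero: "0 \<in> \<Lambda>" using diff[OF M(2) M(2)] by simp

lemma add: "x \<in> \<Lambda> \<Longrightarrow> y \<in> \<Lambda> \<Longrightarrow> x + y \<in> \<Lambda>"
  using diff[of x "0 - y"] diff[OF zero, of y] by simp

definition smul :: "int \<Rightarrow> int \<times> int \<Rightarrow> int \<times> int" where "smul a v = (a * fst v, a * snd v)"

lemma smul: assumes "v \<in> \<Lambda>" shows "smul a v \<in> \<Lambda>"
proof (induction a rule: int_induct[of _ 0])
  case base show ?case using zero by (simp add: smul_def zero_prod_def)
next
  case (step1 i)
  have "smul (i + 1) v = smul i v + v" by (simp add: smul_def prod_eq_iff algebra_simps)
  then show ?case using add[OF step1(2) assms] by simp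
next
  case (step2 i)
  have "smul (i - 1) v = smul i v - v" by (simp add: smul_def prod_eq_iff algebra_simps)
  then show ?case using diff[OF step2(2) assms] by simp
qed

text \<open>A linearly independent pair of lattice vectors minimising the sum of the squared lengths is a
  basis, and it is almost orthogonal.\<close>

lemma reduced_basis:
  obtains v w where "v \<in> \<Lambda>" "w \<in> \<Lambda>" "lin_res v w \<noteq> 0" "qn v \<le> qn w" "3 * (qn v * qn w) \<le> 4 * (lin_res v w)\<^sup>2"
    "\<And>x. x \<in> \<Lambda> \<Longrightarrow> \<exists>a b. x = smul a v + smul b w"
proof -
  let ?P = "\<lambda>(v, w). v \<in> \<Lambda> \<and> w \<in> \<Lambda> \<and> lin_res v w \<noteq> 0"
  let ?m = "\<lambda>(v, w). nat (qn v + qn w)"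
  have "?P ((M, 0), (0, M))" using M by (simp add: lin_res_def)
  then obtain vw where vw: "?P vw" "\<And>x. ?P x \<Longrightarrow> ?m vw \<le> ?m x"
    using ex_has_least_nat[of ?P _ ?m] by blast
  obtain v0 w0 where vw0: "vw = (v0, w0)" by (cases vw)
  have qnn: "qn x \<ge> 0" for x by (simp add: qn_def)
  define v where "v = (if qn v0 \<le> qn w0 then v0 else w0)"
  define w where "w = (if qn v0 \<le> qn w0 then w0 else v0)"
  have v: "v \<in> \<Lambda>" and w: "w \<in> \<Lambda>" and det: "lin_res v w \<noteq> 0" and le: "qn v \<le> qn w"
    using vw(1) by (auto simp: v_def w_def vw0 lin_res_def mult.commute)
  have minq: "qn v + qn w \<le> qn x + qn y" if "x \<in> \<Lambda>" "y \<in> \<Lambda>" "lin_res x y \<noteq> 0" for x y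
    using vw(2)[of "(x, y)"] that qnn[of x] qnn[of y] by (auto simp: v_def w_def vw0)
  define ip where "ip = fst v * fst w + snd v * snd w"
  \<comment> \<open>Replacing w by w + v or w - v keeps the pair independent, so minimality bounds
    twice the inner product by \<open>qn v\<close>.\<close>
  have "qn (w + v) \<ge> qn w" "qn (w - v) \<ge> qn w"
    using minq[OF v add[OF w v]] minq[OF v diff[OF w v]] det by (auto simp: lin_res_def algebra_simps)
  then have ip: "2 * \<bar>ip\<bar> \<le> qn v"
    by (auto simp: qn_def ip_def power2_eq_square algebra_simps abs_if)
  \<comment> \<open>Lagrange's identity; since four times the square of the inner product is at most
    \<open>qn v * qn w\<close>, the determinant is bounded below.\<close>
  have lag: "(lin_res v w)\<^sup>2 + ip\<^sup>2 = qn v * qn w"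
    by (simp add: lin_res_def ip_def qn_def power2_eq_square algebra_simps)
  have "4 * ip\<^sup>2 = (2 * \<bar>ip\<bar>)\<^sup>2" by (simp add: power2_eq_square)
  also have "\<dots> \<le> (qn v)\<^sup>2" using ip by (intro power_mono) auto
  also have "\<dots> \<le> qn v * qn w" using le qnn by (simp add: power2_eq_square mult_left_mono)
  finally have det_ge: "3 * (qn v * qn w) \<le> 4 * (lin_res v w)\<^sup>2" using lag by linarith
  have "qn w > 0"
  proof -
    have "qn w \<noteq> 0" using det by (auto simp: qn_def lin_res_def)
    then show ?thesis using qnn[of w] by linarith
  qed
  have basis: "\<exists>a b. x = smul a v + smul b w" if x: "x \<in> \<Lambda>" for x
  proof -
    define D where "D = real_of_int (lin_res v w)"
    have D: "D \<noteq> 0" using det by (simp add: D_def)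
    define \<alpha> \<beta> where "\<alpha> = real_of_int (lin_res x w) / D" and "\<beta> = real_of_int (lin_res v x) / D"
    \<comment> \<open>The nearest lattice combination is subtracted. The remainder y has coordinates
      of size at most 1/2; if one of them were nonzero, y could replace w or v in the minimal pair
      and make it smaller.\<close>
    define a b where "a = round \<alpha>" and "b = round \<beta>"
    define y where "y = x - smul a v - smul b w"
    have y: "y \<in> \<Lambda>" unfolding y_def by (intro diff smul x v w)
    define \<alpha>' \<beta>' where "\<alpha>' = \<alpha> - a" and "\<beta>' = \<beta> - b"
    have ab: "\<bar>\<alpha>'\<bar> \<le> 1/2" "\<bar>\<beta>'\<bar> \<le> 1/2"
      unfolding \<alpha>'_def \<beta>'_def a_def b_def using of_int_round_abs_le[of \<alpha>] of_int_round_abs_le[of \<beta>]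
      by (auto simp: abs_minus_commute)
    have d1: "real_of_int (lin_res v y) = \<beta>' * D"
    proof -
      have "\<beta> * D = lin_res v x" using D by (simp add: \<beta>_def)
      moreover have "real_of_int (lin_res v y) = lin_res v x - b * lin_res v w"
        unfolding of_int_diff[symmetric] of_int_mult[symmetric] of_int_eq_iff by (simp add: y_def lin_res_def smul_def algebra_simps)
      ultimately show ?thesis by (simp add: \<beta>'_def D_def algebra_simps)
    qed
    have d2: "real_of_int (lin_res y w) = \<alpha>' * D"
    proof -
      have "\<alpha> * D = lin_res x w" using D by (simp add: \<alpha>_def)
      moreover have "real_of_int (lin_res y w) = lin_res x w - a * lin_res v w"
        unfolding of_int_diff[symmetric] of_int_mult[symmetric] of_int_eq_iff by (simp add: y_def lin_res_def smul_def algebra_simps)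
      ultimately show ?thesis by (simp add: \<alpha>'_def D_def algebra_simps)
    qed
    have yid: "lin_res v w * fst y = lin_res y w * fst v + lin_res v y * fst w"
      "lin_res v w * snd y = lin_res y w * snd v + lin_res v y * snd w"
      by (auto simp: lin_res_def algebra_simps)
    have fy: "real_of_int (fst y) = \<alpha>' * fst v + \<beta>' * fst w"
    proof -
      have "D * fst y = D * (\<alpha>' * fst v + \<beta>' * fst w)"
        using arg_cong[OF yid(1), of real_of_int] d1 d2 by (simp add: D_def algebra_simps)
      then show ?thesis using D by simp
    qed
    have sy: "real_of_int (snd y) = \<alpha>' * snd v + \<beta>' * snd w"
    proof -
      have "D * snd y = D * (\<alpha>' * snd v + \<beta>' * snd w)"
        using arg_cong[OF yid(2), of real_of_int] d1 d2 by (simp add: D_def algebra_simps)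
      then show ?thesis using D by simp
    qed
    have qy: "real_of_int (qn y) = \<alpha>'\<^sup>2 * qn v + \<beta>'\<^sup>2 * qn w + 2 * (\<alpha>' * \<beta>') * ip"
      unfolding qn_def ip_def by (simp add: fy sy power2_eq_square algebra_simps)
    have sq: "\<alpha>'\<^sup>2 \<le> 1/4" "\<beta>'\<^sup>2 \<le> 1/4"
      using ab power_mono[OF ab(1), of 2] power_mono[OF ab(2), of 2] by (auto simp: power2_eq_square)
    have b0: "\<beta>' = 0"
    proof (rule ccontr)
      assume "\<beta>' \<noteq> 0"
      then have "lin_res v y \<noteq> 0" using d1 D by auto
      then have ge: "qn w \<le> qn y" using minq[OF v y] by simp
      have "\<bar>\<alpha>' * \<beta>'\<bar> \<le> 1/2 * (1/2)" unfolding abs_mult using ab by (intro mult_mono) auto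
      then have "\<bar>\<alpha>' * \<beta>'\<bar> * real_of_int (2 * \<bar>ip\<bar>) \<le> 1/2 * (1/2) * real_of_int (2 * \<bar>ip\<bar>)"
        by (rule mult_right_mono) simp
      then have "\<bar>2 * (\<alpha>' * \<beta>') * ip\<bar> \<le> 1/4 * real_of_int (2 * \<bar>ip\<bar>)" by (simp add: abs_mult mult_ac)
      also have "\<dots> \<le> 1/4 * qn v" using ip by (intro mult_left_mono) (auto simp del: of_int_mult)
      finally have "real_of_int (qn y) \<le> 1/4 * qn v + 1/4 * qn w + 1/4 * qn v"
        using mult_right_mono[OF sq(1), of "real_of_int (qn v)"] mult_right_mono[OF sq(2), of "real_of_int (qn w)"] qnn
        unfolding qy by (simp add: abs_le_iff)
      also have "\<dots> < qn w" using le \<open>qn w > 0\<close> by simp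
      finally show False using ge by simp
    qed
    have "\<alpha>' = 0"
    proof (rule ccontr)
      assume a: "\<alpha>' \<noteq> 0"
      then have "lin_res y w \<noteq> 0" using d2 D by auto
      then have ge: "qn v \<le> qn y" using minq[OF y w] by simp
      have "qn v \<noteq> 0" using det by (auto simp: qn_def lin_res_def)
      then have "qn v > 0" using qnn[of v] by linarith
      then have "real_of_int (qn y) < qn v"
        using mult_right_mono[OF sq(1), of "real_of_int (qn v)"] unfolding qy b0 by simp
      then show False using ge by simp
    qed
    then have "y = 0" using fy sy b0 by (simp add: prod_eq_iff)
    then have "x = smul a v + smul b w" by (simp add: y_def algebra_simps)
    then show ?thesis by blast
  qed
  show ?thesis using that[OF v w det le det_ge basis] .
qed

lemma mod_mem_iff: "(fst x mod M, snd x mod M) \<in> \<Lambda> \<longleftrightarrow> x \<in> \<Lambda>"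
proof -
  define z where "z = smul (fst x div M) (M, 0) + smul (snd x div M) (0, M)"
  have z: "z \<in> \<Lambda>" unfolding z_def by (intro add smul M)
  have "x = (fst x mod M, snd x mod M) + z" by (simp add: z_def smul_def prod_eq_iff)
  then show ?thesis using add[OF _ z] diff[OF _ z] by (metis add_diff_cancel)
qed

text \<open>For the averaging in \<open>lattice_count\<close> each integer point has to lie in
  equally many translates r + \<Lambda>; the map r -> (x - r) mod M shows this.\<close>

lemma card_residues: "card {r \<in> {0..<M} \<times> {0..<M}. x - r \<in> \<Lambda>} = card (\<Lambda> \<inter> {0..<M} \<times> {0..<M})"
proof (rule bij_betw_same_card)
  let ?f = "\<lambda>r. ((fst x - fst r) mod M, (snd x - snd r) mod M)"
  have inv: "(a - (a - b) mod M) mod M = b" if "0 \<le> b" "b < M" for a b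
  proof -
    have "(a - (a - b) mod M) mod M = (a - (a - b)) mod M" by (rule mod_diff_right_eq)
    then show ?thesis using that by simp
  qed
  have mem: "?f r \<in> \<Lambda> \<longleftrightarrow> x - r \<in> \<Lambda>" for r using mod_mem_iff[of "x - r"] by simp
  have mem2: "x - ?f y \<in> \<Lambda> \<longleftrightarrow> y \<in> \<Lambda>" if "y \<in> {0..<M} \<times> {0..<M}" for y
    using mem[of "?f y"] that by (cases y) (simp add: inv)
  show "bij_betw ?f {r \<in> {0..<M} \<times> {0..<M}. x - r \<in> \<Lambda>} (\<Lambda> \<inter> {0..<M} \<times> {0..<M})"
  proof (rule bij_betw_byWitness[of _ ?f])
    show "?f ` {r \<in> {0..<M} \<times> {0..<M}. x - r \<in> \<Lambda>} \<subseteq> \<Lambda> \<inter> {0..<M} \<times> {0..<M}"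
      using mem M(1) by auto
    show "?f ` (\<Lambda> \<inter> {0..<M} \<times> {0..<M}) \<subseteq> {r \<in> {0..<M} \<times> {0..<M}. x - r \<in> \<Lambda>}"
      using mem2 M(1) by auto
  qed (use inv in auto)
qed

text \<open>Averaging takes the place of volume. The translates of \<Lambda> by the residues modulo
  M cover each integer point equally often, so their counts in R add up to the number of integer
  points of R times the number of points of \<Lambda> in a period square. Each translate differs
  from \<Lambda> by at most 2 A + 2 B + 2 points, where A = B = 3 N / sn v bounds the coordinates in
  the reduced basis. The vector v is fixed before R and N.\<close>

lemma lattice_count:
  obtains v where "v \<in> \<Lambda>" "v \<noteq> 0"
    "\<And>R N. convex R \<Longrightarrow> R \<subseteq> {0..N} \<times> {0..N} \<Longrightarrow> N \<ge> 0 \<Longrightarrow>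
       \<bar>real (card {x \<in> \<Lambda>. rp x \<in> R}) - real (card (\<Lambda> \<inter> {0..<M} \<times> {0..<M})) / (real_of_int M)\<^sup>2 * real (card {x. rp x \<in> R})\<bar>
         \<le> 12 * N / sn v + 2"
proof -
  obtain v w where v: "v \<in> \<Lambda>" and w: "w \<in> \<Lambda>" and det: "lin_res v w \<noteq> 0" and le: "qn v \<le> qn w"
    and red: "3 * (qn v * qn w) \<le> 4 * (lin_res v w)\<^sup>2"
    and basis: "\<And>x. x \<in> \<Lambda> \<Longrightarrow> \<exists>a b. x = smul a v + smul b w"
    using reduced_basis by metis
  have v0: "v \<noteq> 0" using det by (auto simp: lin_res_def)
  have snv: "sn v > 0" using sn_pos[OF v0] .
  define D where "D = real_of_int (lin_res v w)"
  have D: "D \<noteq> 0" using det by (simp add: D_def)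
  have sn_qn: "(sn x)\<^sup>2 \<le> qn x" "qn x \<le> 2 * (sn x)\<^sup>2" for x
  proof -
    have "(sn x)\<^sup>2 = max ((fst x)\<^sup>2) ((snd x)\<^sup>2)"
    proof (cases "\<bar>fst x\<bar> \<le> \<bar>snd x\<bar>")
      case True then show ?thesis by (simp add: sn_def max_def abs_le_square_iff)
    next
      case False then show ?thesis using abs_le_square_iff[of "fst x" "snd x"] by (simp add: sn_def max_def)
    qed
    then show "(sn x)\<^sup>2 \<le> qn x" "qn x \<le> 2 * (sn x)\<^sup>2" by (auto simp: qn_def max_def)
  qed
  \<comment> \<open>The square of the left side is at most 2 qn w qn v by Cauchy-Schwarz, and
    reducedness bounds this by a multiple of the squared determinant.\<close>
  have key: "real_of_int (\<bar>fst y\<bar> + \<bar>snd y\<bar>) * sn v \<le> 3 * \<bar>D\<bar>"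
    if y: "y = v \<or> y = w" for y
  proof -
    have "(\<bar>fst y\<bar> + \<bar>snd y\<bar>)\<^sup>2 \<le> 2 * qn y"
      using zero_le_power2[of "\<bar>fst y\<bar> - \<bar>snd y\<bar>"] by (simp add: qn_def power2_eq_square algebra_simps)
    moreover have "qn y \<le> qn w" using y le by auto
    moreover have "(sn v)\<^sup>2 \<le> qn v" by (rule sn_qn)
    ultimately have "(\<bar>fst y\<bar> + \<bar>snd y\<bar>)\<^sup>2 * (sn v)\<^sup>2 \<le> (2 * qn w) * qn v"
      by (intro mult_mono) (auto simp: qn_def)
    moreover have "2 * (qn v * qn w) \<le> 9 * (lin_res v w)\<^sup>2"
      using red zero_le_power2[of "lin_res v w"] by linarith
    ultimately have "(\<bar>fst y\<bar> + \<bar>snd y\<bar>)\<^sup>2 * (sn v)\<^sup>2 \<le> 9 * (lin_res v w)\<^sup>2" by (simp add: mult_ac)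
    then have "((\<bar>fst y\<bar> + \<bar>snd y\<bar>) * sn v)\<^sup>2 \<le> (3 * \<bar>lin_res v w\<bar>)\<^sup>2" by (simp add: power_mult_distrib)
    then have "(\<bar>fst y\<bar> + \<bar>snd y\<bar>) * sn v \<le> 3 * \<bar>lin_res v w\<bar>" by (rule power2_le_imp_le) simp
    then have "real_of_int ((\<bar>fst y\<bar> + \<bar>snd y\<bar>) * sn v) \<le> of_int (3 * \<bar>lin_res v w\<bar>)" by (subst of_int_le_iff)
    then show ?thesis by (simp add: D_def)
  qed
  \<comment> \<open>Cramer's rule: the coordinates of a point of the box are determinants with w or
    v divided by D, and \<open>key\<close> estimates them.\<close>
  have coord: "\<bar>x\<bar> \<le> 3 * N / sn v \<and> \<bar>y\<bar> \<le> 3 * N / sn v" if xy: "pt v w x y \<in> {0..N} \<times> {0..N}" for x y N :: real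
  proof -
    define p where "p = pt v w x y"
    have p: "0 \<le> fst p" "fst p \<le> N" "0 \<le> snd p" "snd p \<le> N" using xy by (auto simp: p_def mem_Times_iff)
    have N0: "N \<ge> 0" using p by linarith
    have ex: "fst p * snd w - snd p * fst w = x * D" "snd p * fst v - fst p * snd v = y * D"
      by (auto simp: p_def pt_def D_def lin_res_def algebra_simps)
    have bnd: "\<bar>fst p * b - snd p * a\<bar> \<le> N * (\<bar>a\<bar> + \<bar>b\<bar>)" for a b :: real
    proof -
      have "\<bar>fst p * b - snd p * a\<bar> \<le> \<bar>fst p * b\<bar> + \<bar>snd p * a\<bar>" by linarith
      also have "\<dots> \<le> N * \<bar>b\<bar> + N * \<bar>a\<bar>" unfolding abs_mult using p by (intro add_mono mult_right_mono) auto
      finally show ?thesis by (simp add: algebra_simps)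
    qed
    have "\<bar>z\<bar> \<le> 3 * N / sn v" if z: "\<bar>z * D\<bar> \<le> N * real_of_int (\<bar>fst y\<bar> + \<bar>snd y\<bar>)" "y = v \<or> y = w" for z y
    proof -
      have "\<bar>z\<bar> * sn v * \<bar>D\<bar> = \<bar>z * D\<bar> * sn v" by (simp add: abs_mult)
      also have "\<dots> \<le> N * real_of_int (\<bar>fst y\<bar> + \<bar>snd y\<bar>) * sn v" using z(1) snv by (intro mult_right_mono) auto
      also have "\<dots> \<le> N * (3 * \<bar>D\<bar>)" unfolding mult.assoc using key[OF z(2)] N0 by (intro mult_left_mono) auto
      finally have "\<bar>z\<bar> * sn v \<le> 3 * N" using D by (simp add: mult.commute mult.left_commute)
      then show ?thesis using snv by (simp add: field_simps)
    qed
    note * = this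
    have "\<bar>x * D\<bar> \<le> N * real_of_int (\<bar>fst w\<bar> + \<bar>snd w\<bar>)"
      using bnd[of "of_int (snd w)" "of_int (fst w)"] unfolding ex(1) by simp
    moreover have "\<bar>y * D\<bar> \<le> N * real_of_int (\<bar>fst v\<bar> + \<bar>snd v\<bar>)"
      using bnd[of "of_int (snd v)" "of_int (fst v)"] unfolding ex(2)[symmetric] by (subst abs_minus_commute) simp
    ultimately show ?thesis using *[of x w] *[of y v] by blast
  qed
  have main: "\<bar>real (card {x \<in> \<Lambda>. rp x \<in> R}) - real (card (\<Lambda> \<inter> {0..<M} \<times> {0..<M})) / (real_of_int M)\<^sup>2 * real (card {x. rp x \<in> R})\<bar>
         \<le> 12 * N / sn v + 2"
    if R: "convex R" "R \<subseteq> {0..N} \<times> {0..N}" and N: "N \<ge> 0" for R N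
  proof -
    let ?E = "12 * N / sn v + 2"
    let ?P = "{0..<M} \<times> {0..<M}"
    have bd: "\<bar>x\<bar> \<le> 3 * N / sn v \<and> \<bar>y\<bar> \<le> 3 * N / sn v" if "pt v w x y \<in> R" for x y
      using coord[of x y N] that R(2) by blast
    have A: "0 \<le> 3 * N / sn v" using N snv by simp
    define c where "c = (\<lambda>r. card {x. x - r \<in> \<Lambda> \<and> rp x \<in> R})"
    \<comment> \<open>In the basis (v, w) the translate by r is the coordinate lattice shifted by
      the real coordinates of r.\<close>
    have cc: "c r = card {(a::int, b::int). pt v w (of_int a + of_int (lin_res r w) / D) (of_int b + of_int (lin_res v r) / D) \<in> R}" for r
      unfolding c_def
    proof (rule bij_betw_same_card[symmetric])
      let ?g = "\<lambda>(a, b). r + smul a v + smul b w"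
      have inj: "inj ?g"
      proof (rule injI, clarify)
        fix a b a' b' assume "r + smul a v + smul b w = r + smul a' v + smul b' w"
        then have e: "(a - a') * fst v + (b - b') * fst w = 0" "(a - a') * snd v + (b - b') * snd w = 0"
          by (auto simp: smul_def prod_eq_iff algebra_simps)
        have z: "(a - a') * lin_res v w = ((a - a') * fst v + (b - b') * fst w) * snd w - ((a - a') * snd v + (b - b') * snd w) * fst w"
          "(b - b') * lin_res v w = ((a - a') * snd v + (b - b') * snd w) * fst v - ((a - a') * fst v + (b - b') * fst w) * snd v"
          by (auto simp: lin_res_def algebra_simps)
        have "(a - a') * lin_res v w = 0" "(b - b') * lin_res v w = 0" unfolding z e by simp_all
        then show "a = a' \<and> b = b'" using det by simp
      qed
      have rpe: "rp (?g (a, b)) = pt v w (of_int a + of_int (lin_res r w) / D) (of_int b + of_int (lin_res v r) / D)" for a b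
      proof -
        have "D * fst r = lin_res r w * fst v + lin_res v r * fst w" "D * snd r = lin_res r w * snd v + lin_res v r * snd w"
          by (auto simp: D_def lin_res_def algebra_simps)
        then have "fst r = lin_res r w / D * fst v + lin_res v r / D * fst w" "snd r = lin_res r w / D * snd v + lin_res v r / D * snd w"
          using D by (simp_all add: field_simps)
        then show ?thesis by (simp add: rp_def pt_def smul_def prod_eq_iff algebra_simps)
      qed
      have "{x. x - r \<in> \<Lambda> \<and> rp x \<in> R} = ?g ` {(a::int, b::int). pt v w (of_int a + of_int (lin_res r w) / D) (of_int b + of_int (lin_res v r) / D) \<in> R}"
      proof (intro equalityI subsetI)
        fix x assume x: "x \<in> {x. x - r \<in> \<Lambda> \<and> rp x \<in> R}"
        then obtain a b where "x - r = smul a v + smul b w" using basis by blast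
        then have xe: "x = ?g (a, b)" by (simp add: algebra_simps)
        then show "x \<in> ?g ` {(a::int, b::int). pt v w (of_int a + of_int (lin_res r w) / D) (of_int b + of_int (lin_res v r) / D) \<in> R}"
        proof (rule image_eqI[where x = "(a, b)"])
          have "rp (?g (a, b)) \<in> R" using x xe by simp
          then show "(a, b) \<in> {(a::int, b::int). pt v w (of_int a + of_int (lin_res r w) / D) (of_int b + of_int (lin_res v r) / D) \<in> R}"
            unfolding rpe by simp
        qed
      next
        fix x assume "x \<in> ?g ` {(a::int, b::int). pt v w (of_int a + of_int (lin_res r w) / D) (of_int b + of_int (lin_res v r) / D) \<in> R}"
        then obtain a b where ab: "x = ?g (a, b)" "rp x \<in> R" using rpe by auto
        have "x - r = smul a v + smul b w" using ab(1) by simp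
        also have "\<dots> \<in> \<Lambda>" by (intro add smul v w)
        finally show "x \<in> {x. x - r \<in> \<Lambda> \<and> rp x \<in> R}" using ab(2) by simp
      qed
      then show "bij_betw ?g {(a::int, b::int). pt v w (of_int a + of_int (lin_res r w) / D) (of_int b + of_int (lin_res v r) / D) \<in> R} {x. x - r \<in> \<Lambda> \<and> rp x \<in> R}"
        using inj by (auto simp: bij_betw_def intro: inj_on_subset)
    qed
    have c0: "c 0 = card {(a::int, b::int). pt v w (of_int a) (of_int b) \<in> R}"
      unfolding cc by (simp add: lin_res_def)
    have near: "\<bar>real (c r) - real (c 0)\<bar> \<le> ?E" for r
      using card_shift[where v = v and w = w and s = "of_int (lin_res r w) / D" and t = "of_int (lin_res v r) / D", OF R(1) bd A A]
      unfolding c0 unfolding cc by simp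
    have finR: "finite {x. rp x \<in> R}"
    proof (rule finite_subset)
      show "{x. rp x \<in> R} \<subseteq> {0..\<lfloor>N\<rfloor>} \<times> {0..\<lfloor>N\<rfloor>}"
      proof
        fix x assume "x \<in> {x. rp x \<in> R}"
        then have "rp x \<in> {0..N} \<times> {0..N}" using R(2) by blast
        then show "x \<in> {0..\<lfloor>N\<rfloor>} \<times> {0..\<lfloor>N\<rfloor>}" by (cases x) (simp add: rp_def le_floor_iff)
      qed
    qed auto
    have "(\<Sum>r\<in>?P. c r) = (\<Sum>r\<in>?P. \<Sum>x | rp x \<in> R. if x - r \<in> \<Lambda> then 1 else 0)"
      unfolding c_def using finR by (intro sum.cong refl) (simp add: sum.If_cases Int_def conj_commute)
    also have "\<dots> = (\<Sum>x | rp x \<in> R. \<Sum>r\<in>?P. if x - r \<in> \<Lambda> then 1 else 0)" by (rule sum.swap)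
    also have "\<dots> = (\<Sum>x | rp x \<in> R. card {r \<in> ?P. x - r \<in> \<Lambda>})"
      by (intro sum.cong refl) (simp add: sum.If_cases Int_def)
    also have "\<dots> = card {x. rp x \<in> R} * card (\<Lambda> \<inter> ?P)" by (simp add: card_residues)
    finally have tot: "(\<Sum>r\<in>?P. real (c r)) = real (card {x. rp x \<in> R}) * card (\<Lambda> \<inter> ?P)"
      by (metis of_nat_mult of_nat_sum)
    have cardP: "real (card ?P) = (real_of_int M)\<^sup>2" using M(1) by (simp add: power2_eq_square card_cartesian_product)
    have "\<bar>(\<Sum>r\<in>?P. real (c 0) - real (c r))\<bar> \<le> (\<Sum>r\<in>?P. ?E)"
      by (rule order.trans[OF sum_abs], rule sum_mono) (use near in \<open>simp add: abs_minus_commute\<close>)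
    then have "\<bar>(real_of_int M)\<^sup>2 * c 0 - real (card {x. rp x \<in> R}) * card (\<Lambda> \<inter> ?P)\<bar> \<le> (real_of_int M)\<^sup>2 * ?E"
      by (simp only: sum_subtractf tot sum_constant cardP)
    moreover have "(real_of_int M)\<^sup>2 * c 0 - real (card {x. rp x \<in> R}) * card (\<Lambda> \<inter> ?P)
        = (real_of_int M)\<^sup>2 * (c 0 - real (card (\<Lambda> \<inter> ?P)) / (real_of_int M)\<^sup>2 * card {x. rp x \<in> R})"
      using M(1) by (simp add: field_simps)
    ultimately have "(real_of_int M)\<^sup>2 * \<bar>c 0 - real (card (\<Lambda> \<inter> ?P)) / (real_of_int M)\<^sup>2 * card {x. rp x \<in> R}\<bar> \<le> (real_of_int M)\<^sup>2 * ?E"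
      by (simp add: abs_mult)
    moreover have "(real_of_int M)\<^sup>2 > 0" using M(1) by simp
    ultimately have "\<bar>c 0 - real (card (\<Lambda> \<inter> ?P)) / (real_of_int M)\<^sup>2 * card {x. rp x \<in> R}\<bar> \<le> ?E"
      by (subst (asm) mult_le_cancel_left_pos)
    then show ?thesis by (simp add: c_def)
  qed
  show ?thesis using that[OF v v0 main] .
qed

end

section \<open>The lattices defined by three forms\<close>

lemma cis_eq_1_iff_Ints: "cis (2 * pi * x) = 1 \<longleftrightarrow> x \<in> \<int>"
proof
  assume "cis (2 * pi * x) = 1"
  then have "cos (2 * pi * x) = 1" by (simp add: complex_eq_iff)
  then obtain n :: int where "2 * pi * x = of_int n * 2 * pi" unfolding cos_one_2pi_int by blast
  then have "x = of_int n" by simp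
  then show "x \<in> \<int>" by simp
next
  assume "x \<in> \<int>"
  then obtain n :: int where "x = of_int n" by (auto elim: Ints_cases)
  then have "cos (2 * pi * x) = 1" unfolding cos_one_2pi_int by (intro exI[of _ n]) simp
  moreover have "sin (2 * pi * x) = 0" using \<open>x = of_int n\<close> by (simp add: sin_int_2pin)
  ultimately show "cis (2 * pi * x) = 1" by (simp add: complex_eq_iff)
qed

lemma sum_cis_orthogonal:
  assumes "M > 0" "real M * \<alpha> \<in> \<int>"
  shows "(\<Sum>j<M. cis (2 * pi * (real j * \<alpha>))) = (if \<alpha> \<in> \<int> then of_nat M else 0)"
proof -
  define z where "z = cis (2 * pi * \<alpha>)"
  have zj: "cis (2 * pi * (real j * \<alpha>)) = z ^ j" for j
    by (simp add: z_def Complex.DeMoivre mult_ac)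
  have "z ^ M = 1" using assms zj[of M] by (simp add: cis_eq_1_iff_Ints)
  moreover have "z = 1 \<longleftrightarrow> \<alpha> \<in> \<int>" by (simp add: z_def cis_eq_1_iff_Ints)
  ultimately show ?thesis unfolding zj using geometric_sum[of z M] by (cases "\<alpha> \<in> \<int>") simp_all
qed

lemma sum_cis_orthogonal_int:
  assumes "M > 0" "real M * \<alpha> \<in> \<int>"
  shows "(\<Sum>x\<in>{0..<int M}. cis (2 * pi * (of_int x * \<alpha>))) = (if \<alpha> \<in> \<int> then of_nat M else 0)"
proof -
  have "(\<Sum>x\<in>{0..<int M}. cis (2 * pi * (of_int x * \<alpha>))) = (\<Sum>j<M. cis (2 * pi * (real j * \<alpha>)))"
    by (rule sum.reindex_bij_witness[of _ int nat]) auto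
  also note sum_cis_orthogonal[OF assms]
  finally show ?thesis .
qed

lemma sum_cis_dvd:
  assumes "D > 0"
  shows "(\<Sum>j<D. cis (2 * pi * (real j * of_int m / D))) = (if int D dvd m then of_nat D else 0)"
proof -
  have "real_of_int m / real_of_int (int D) \<in> \<int> \<longleftrightarrow> int D dvd m"
    using assms by (subst of_int_div_of_int_in_Ints_iff) auto
  moreover have "real D * (of_int m / real D) \<in> \<int>" using assms by simp
  ultimately show ?thesis
    using sum_cis_orthogonal[OF assms, of "of_int m / D"] unfolding of_int_of_nat_eq times_divide_eq_right by (simp only:)
qed

text \<open>The order of x in the circle group, for rational x.\<close>

definition den :: "real \<Rightarrow> nat" where
  "den x = (LEAST n. n > 0 \<and> real n * x \<in> \<int>)"

lemma den:
  assumes "x \<in> \<rat>"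
  shows den_pos: "den x > 0" and den_dvd_iff: "real D * x \<in> \<int> \<longleftrightarrow> den x dvd D"
proof -
  obtain a b :: int where ab: "b > 0" "x = of_int a / of_int b"
    by (rule Rats_cases'[OF assms]) blast
  have "real (nat \<bar>b\<bar>) * x = of_int (sgn b * a)" using ab by (simp add: sgn_if)
  then have "\<exists>n>0. real n * x \<in> \<int>" using ab by (intro exI[of _ "nat \<bar>b\<bar>"]) (auto simp del: of_nat_nat)
  then have *: "den x > 0 \<and> real (den x) * x \<in> \<int>" unfolding den_def by (rule LeastI_ex)
  then show "den x > 0" by simp
  show "real D * x \<in> \<int> \<longleftrightarrow> den x dvd D"
  proof
    assume D: "real D * x \<in> \<int>"
    define r where "r = D mod den x"
    have "real D = real (D div den x) * real (den x) + real r"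
      unfolding r_def of_nat_mult[symmetric] of_nat_add[symmetric] by simp
    then have "real r * x = real D * x - of_nat (D div den x) * (real (den x) * x)" by (simp add: algebra_simps)
    also have "\<dots> \<in> \<int>" by (rule Ints_diff[OF D Ints_mult[OF Ints_of_nat conjunct2[OF *]]])
    finally have "r = 0 \<or> den x \<le> r" unfolding den_def by (metis (mono_tags, lifting) Least_le not_gr_zero)
    moreover have "r < den x" using * by (simp add: r_def)
    ultimately show "den x dvd D" by (auto simp: r_def)
  next
    assume "den x dvd D"
    then obtain c where "D = den x * c" by auto
    then have "real D * x = of_nat c * (real (den x) * x)" by simp
    also have "\<dots> \<in> \<int>" by (rule Ints_mult[OF Ints_of_nat conjunct2[OF *]])
    finally show "real D * x \<in> \<int>" .
  qed
qed

locale three_forms =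
  fixes L :: "nat \<Rightarrow> int \<times> int"
  assumes res: "i < 3 \<Longrightarrow> j < 3 \<Longrightarrow> i \<noteq> j \<Longrightarrow> lin_res (L i) (L j) \<noteq> 0"
begin

definition lf :: "nat \<Rightarrow> int \<times> int \<Rightarrow> int" where
  "lf i x = linform (L i) (fst x) (snd x)"

definition Lam :: "(nat \<Rightarrow> nat) \<Rightarrow> (int \<times> int) set" where
  "Lam D = {x. \<forall>i<3. int (D i) dvd lf i x}"

text \<open>The kernel of the map \<open>\<theta> \<mapsto> \<Sum>i. \<theta> i * L i\<close> from the rational points of the three-dimensional
  torus to the two-dimensional one.\<close>

definition K :: "(nat \<Rightarrow> real) set" where
  "K = {\<theta> \<in> PiE {..<3} (\<lambda>_. {0..<1}). (\<forall>i<3. \<theta> i \<in> \<rat>) \<and>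
     (\<Sum>i<3. \<theta> i * fst (L i)) \<in> \<int> \<and> (\<Sum>i<3. \<theta> i * snd (L i)) \<in> \<int>}"

text \<open>These points are the characters of the product of the cyclic groups of orders D_i that
  are trivial on the image of the integer plane. Their number is therefore the product of the D_i
  divided by the index of \<open>Lam D\<close>.\<close>

definition KD :: "(nat \<Rightarrow> nat) \<Rightarrow> (nat \<Rightarrow> real) set" where
  "KD D = {\<theta> \<in> K. \<forall>i<3. den (\<theta> i) dvd D i}"

lemma lf_diff: "lf i (x - y) = lf i x - lf i y"
  by (simp add: lf_def linform_def algebra_simps)

lemma plane_lattice_Lam:
  assumes "\<And>i. i < 3 \<Longrightarrow> D i > 0"
  shows "plane_lattice (Lam D) (int (\<Prod>i<3. D i))"
proof
  have d: "int (D i) dvd int (\<Prod>i<3. D i)" if "i < 3" for i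
    using that by (subst int_dvd_int_iff) (intro dvd_prodI, auto)
  show "x - y \<in> Lam D" if "x \<in> Lam D" "y \<in> Lam D" for x y
    using that by (auto simp: Lam_def lf_diff)
  show "(int (\<Prod>i<3. D i), 0) \<in> Lam D" "(0, int (\<Prod>i<3. D i)) \<in> Lam D"
    using d by (auto simp: Lam_def lf_def linform_def simp del: of_nat_prod)
  have "(\<Prod>i<3. D i) > 0" using assms by (intro prod_pos) auto
  then show "0 < int (\<Prod>i<3. D i)" by (simp only: of_nat_0_less_iff)
qed

text \<open>Each divisibility is detected by a sum of additive characters. Summing over the period
  square leaves the frequencies whose combination with the forms is integral in both coordinates,
  and these are the points of \<open>KD D\<close>.\<close>

lemma card_Lam_box:
  assumes D: "\<And>i. i < 3 \<Longrightarrow> D i > 0"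
  defines "M \<equiv> \<Prod>i<3. D i"
  shows "finite (KD D)" "real (card (Lam D \<inter> {0..<int M} \<times> {0..<int M})) * real M = real M ^ 2 * real (card (KD D))"
proof -
  let ?P = "{0..<int M} \<times> {0..<int M}"
  let ?J = "PiE {..<3::nat} (\<lambda>i. {..<D i})"
  have M: "M > 0" unfolding M_def using D by (intro prod_pos) auto
  have DM: "D i dvd M" if "i < 3" for i unfolding M_def using that by (intro dvd_prodI) auto
  \<comment> \<open>With \<theta> i = j i / D i these are the two coordinates of the sum of \<theta>
    i * L i, so that their integrality means membership in \<open>K\<close>.\<close>
  define \<alpha> \<beta> where "\<alpha> = (\<lambda>j. \<Sum>i<3. real (j i) / D i * fst (L i))" and "\<beta> = (\<lambda>j. \<Sum>i<3. real (j i) / D i * snd (L i))"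
  have int1: "real M * (real a / D i * of_int b) \<in> \<int>" if i: "i < 3" for a b i
  proof -
    obtain c where "M = D i * c" using DM[OF i] by auto
    then have "real M * (real a / D i * of_int b) = of_int (int c * int a * b)" using D[OF i] by simp
    then show ?thesis by (simp del: of_int_mult)
  qed
  have \<alpha>M: "real M * \<alpha> j \<in> \<int>" and \<beta>M: "real M * \<beta> j \<in> \<int>" for j
    unfolding \<alpha>_def \<beta>_def sum_distrib_left by (rule Ints_sum, rule int1, simp)+
  define G where "G = {j \<in> ?J. \<alpha> j \<in> \<int> \<and> \<beta> j \<in> \<int>}"
  have finJ: "finite ?J" by (intro finite_PiE) auto
  have cis3: "(\<Prod>i<3. cis (f i)) = cis (\<Sum>i<3. f i)" for f :: "nat \<Rightarrow> real"
    by (simp add: eval_nat_numeral cis_mult)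
  have S1: "(\<Prod>i<3. \<Sum>j<D i. cis (2 * pi * (real j * of_int (lf i x) / D i))) = (if x \<in> Lam D then of_nat M else 0)" for x
  proof (cases "x \<in> Lam D")
    case True
    have "(\<Prod>i<3. \<Sum>j<D i. cis (2 * pi * (real j * of_int (lf i x) / D i))) = (\<Prod>i<3. of_nat (D i))"
    proof (rule prod.cong[OF refl])
      fix i :: nat assume i: "i \<in> {..<3}"
      then have "int (D i) dvd lf i x" using True by (simp add: Lam_def)
      then show "(\<Sum>j<D i. cis (2 * pi * (real j * of_int (lf i x) / D i))) = of_nat (D i)"
        using sum_cis_dvd[OF D, of i "lf i x"] i by simp
    qed
    then show ?thesis using True by (simp add: M_def)
  next
    case False
    then obtain i where "i < 3" "\<not> int (D i) dvd lf i x" by (auto simp: Lam_def)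
    then have "\<exists>i\<in>{..<3}. (\<Sum>j<D i. cis (2 * pi * (real j * of_int (lf i x) / D i))) = 0"
      using sum_cis_dvd[OF D, of i "lf i x"] by (intro bexI[of _ i]) simp_all
    then show ?thesis using False by (simp add: prod_zero)
  qed
  have S2: "(\<Prod>i<3. \<Sum>j<D i. cis (2 * pi * (real j * of_int (lf i x) / D i)))
     = (\<Sum>j\<in>?J. cis (2 * pi * (of_int (fst x) * \<alpha> j)) * cis (2 * pi * (of_int (snd x) * \<beta> j)))" for x
  proof -
    have "(\<Prod>i<3. \<Sum>j<D i. cis (2 * pi * (real j * of_int (lf i x) / D i)))
       = (\<Sum>j\<in>?J. \<Prod>i<3. cis (2 * pi * (real (j i) * of_int (lf i x) / D i)))"
      by (rule prod_sum_PiE) auto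
    also have "\<dots> = (\<Sum>j\<in>?J. cis (2 * pi * (of_int (fst x) * \<alpha> j)) * cis (2 * pi * (of_int (snd x) * \<beta> j)))"
    proof (rule sum.cong[OF refl])
      fix j
      have "(\<Sum>i<3. 2 * pi * (real (j i) * of_int (lf i x) / D i)) = 2 * pi * (of_int (fst x) * \<alpha> j) + 2 * pi * (of_int (snd x) * \<beta> j)"
        by (simp add: \<alpha>_def \<beta>_def lf_def linform_def sum_distrib_left sum.distrib[symmetric] algebra_simps add_divide_distrib)
      then show "(\<Prod>i<3. cis (2 * pi * (real (j i) * of_int (lf i x) / D i))) = cis (2 * pi * (of_int (fst x) * \<alpha> j)) * cis (2 * pi * (of_int (snd x) * \<beta> j))"
        by (simp add: cis3 cis_mult)
    qed
    finally show ?thesis .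
  qed
  have "of_nat (card (Lam D \<inter> ?P) * M) = (\<Sum>x\<in>?P. if x \<in> Lam D then of_nat M else (0::complex))"
    by (simp add: sum.If_cases Int_commute)
  also have "\<dots> = (\<Sum>x\<in>?P. \<Sum>j\<in>?J. cis (2 * pi * (of_int (fst x) * \<alpha> j)) * cis (2 * pi * (of_int (snd x) * \<beta> j)))"
    by (intro sum.cong refl) (simp only: S1[symmetric] S2)
  also have "\<dots> = (\<Sum>j\<in>?J. \<Sum>x\<in>?P. cis (2 * pi * (of_int (fst x) * \<alpha> j)) * cis (2 * pi * (of_int (snd x) * \<beta> j)))"
    by (rule sum.swap)
  also have "\<dots> = (\<Sum>j\<in>?J. (\<Sum>x\<in>{0..<int M}. cis (2 * pi * (of_int x * \<alpha> j))) * (\<Sum>x\<in>{0..<int M}. cis (2 * pi * (of_int x * \<beta> j))))"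
    by (simp add: sum_product sum.cartesian_product case_prod_unfold)
  also have "\<dots> = (\<Sum>j\<in>?J. if j \<in> G then of_nat M ^ 2 else 0)"
    by (intro sum.cong refl) (auto simp: sum_cis_orthogonal_int M \<alpha>M \<beta>M G_def power2_eq_square)
  also have "\<dots> = of_nat (card G * M ^ 2)"
    using finJ by (simp add: sum.If_cases G_def Int_def)
  finally have count: "card (Lam D \<inter> ?P) * M = card G * M ^ 2" by (subst (asm) of_nat_eq_iff)
  have bij: "bij_betw (\<lambda>j. \<lambda>i\<in>{..<3}. real (j i) / D i) G (KD D)"
    unfolding bij_betw_def
  proof
    show "inj_on (\<lambda>j. \<lambda>i\<in>{..<3}. real (j i) / D i) G"
    proof (rule inj_onI)
      fix j j' assume a: "j \<in> G" "j' \<in> G" "(\<lambda>i\<in>{..<3}. real (j i) / D i) = (\<lambda>i\<in>{..<3}. real (j' i) / D i)"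
      show "j = j'"
      proof (rule PiE_ext)
        show "j \<in> ?J" "j' \<in> ?J" using a by (auto simp: G_def)
        fix i :: nat assume "i \<in> {..<3}"
        then show "j i = j' i" using fun_cong[OF a(3), of i] D[of i] by simp
      qed
    qed
    show "(\<lambda>j. \<lambda>i\<in>{..<3}. real (j i) / D i) ` G = KD D"
    proof (intro equalityI subsetI)
      fix \<theta> assume "\<theta> \<in> (\<lambda>j. \<lambda>i\<in>{..<3}. real (j i) / D i) ` G"
      then obtain j where j: "j \<in> G" "\<theta> = (\<lambda>i\<in>{..<3}. real (j i) / D i)" by auto
      have ji: "j i < D i" if "i < 3" for i using j(1) that by (auto simp: G_def PiE_def Pi_def)
      have lt: "real (j i) / D i < 1" if "i < 3" for i using ji[OF that] D[OF that] by simp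
      have K: "\<theta> \<in> K"
        using j lt by (auto simp: K_def G_def \<alpha>_def \<beta>_def)
      moreover have "den (\<theta> i) dvd D i" if i: "i < 3" for i
      proof -
        have "\<theta> i \<in> \<rat>" using K i by (auto simp: K_def)
        moreover have "real (D i) * \<theta> i \<in> \<int>" using j(2) i D[OF i] by simp
        ultimately show ?thesis by (simp add: den_dvd_iff)
      qed
      ultimately show "\<theta> \<in> KD D" by (simp add: KD_def)
    next
      fix \<theta> assume \<theta>: "\<theta> \<in> KD D"
      define j where "j = (\<lambda>i\<in>{..<3::nat}. nat \<lfloor>real (D i) * \<theta> i\<rfloor>)"
      have th: "\<theta> i \<in> \<rat>" "0 \<le> \<theta> i" "\<theta> i < 1" "den (\<theta> i) dvd D i" if "i < 3" for i
        using \<theta> that by (auto simp: KD_def K_def PiE_def Pi_def)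
      have ji: "real (j i) = real (D i) * \<theta> i" if i: "i < 3" for i
      proof -
        have "real (D i) * \<theta> i \<in> \<int>" using th[OF i] by (simp add: den_dvd_iff)
        moreover have "real (D i) * \<theta> i \<ge> 0" using th[OF i] by simp
        ultimately show ?thesis using i by (simp add: j_def)
      qed
      have eq: "real (j i) / D i = \<theta> i" if "i < 3" for i using ji[OF that] D[OF that] by simp
      have "j \<in> ?J"
      proof (rule PiE_I)
        fix i :: nat assume i: "i \<in> {..<3}"
        then have "real (j i) < real (D i)" using ji[of i] th[of i] D[of i] by simp
        then show "j i \<in> {..<D i}" by simp
      qed (simp add: j_def)
      moreover have "\<alpha> j \<in> \<int>" "\<beta> j \<in> \<int>"
        unfolding \<alpha>_def \<beta>_def using \<theta> by (simp_all add: eq KD_def K_def)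
      ultimately have "j \<in> G" by (simp add: G_def)
      moreover have "\<theta> = (\<lambda>i\<in>{..<3}. real (j i) / D i)"
        using \<theta> by (auto simp: eq KD_def K_def PiE_def extensional_def fun_eq_iff)
      ultimately show "\<theta> \<in> (\<lambda>j. \<lambda>i\<in>{..<3}. real (j i) / D i) ` G" by blast
    qed
  qed
  have finG: "finite G" using finJ by (simp add: G_def)
  show "finite (KD D)" using bij_betw_finite[OF bij] finG by simp
  have "card G = card (KD D)" by (rule bij_betw_same_card[OF bij])
  then have "real (card (Lam D \<inter> ?P) * M) = real (card (KD D) * M ^ 2)" using count by simp
  then show "real (card (Lam D \<inter> ?P)) * real M = real M ^ 2 * real (card (KD D))" by (simp add: mult.commute)
qed

text \<open>Combining the two integrality conditions with the coefficients of L k removes \<theta>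
  k.\<close>

lemma K_elim:
  assumes \<theta>: "\<theta> \<in> K" and ijk: "i < 3" "j < 3" "k < 3" "i \<noteq> j" "i \<noteq> k" "j \<noteq> k"
  shows "of_int (lin_res (L i) (L k)) * \<theta> i + of_int (lin_res (L j) (L k)) * \<theta> j \<in> \<int>"
proof -
  have set: "{..<3::nat} = {i, j, k}" using ijk by auto
  have s3: "(\<Sum>i<3. f i) = f i + f j + f k" for f :: "nat \<Rightarrow> real"
    unfolding set using ijk by simp
  have "(\<Sum>i<3. \<theta> i * fst (L i)) * of_int (snd (L k)) - (\<Sum>i<3. \<theta> i * snd (L i)) * of_int (fst (L k)) \<in> \<int>"
    using \<theta> by (intro Ints_diff Ints_mult) (auto simp: K_def)
  also have "(\<Sum>i<3. \<theta> i * fst (L i)) * of_int (snd (L k)) - (\<Sum>i<3. \<theta> i * snd (L i)) * of_int (fst (L k))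
    = of_int (lin_res (L i) (L k)) * \<theta> i + of_int (lin_res (L j) (L k)) * \<theta> j"
    unfolding s3 by (simp add: lin_res_def algebra_simps)
  finally show ?thesis .
qed

lemma K_rat: "\<theta> \<in> K \<Longrightarrow> i < 3 \<Longrightarrow> \<theta> i \<in> \<rat>" and K_range: "\<theta> \<in> K \<Longrightarrow> i < 3 \<Longrightarrow> 0 \<le> \<theta> i \<and> \<theta> i < 1"
  by (auto simp: K_def PiE_def Pi_def)

text \<open>By \<open>K_elim\<close> a fixed multiple of \<theta> i is determined modulo 1 by
  \<theta> j. The three orders thus agree up to bounded factors, and \<open>den (\<theta> 0)\<close>
  measures all of \<theta>.\<close>

lemma den_dvd_den:
  assumes \<theta>: "\<theta> \<in> K" and ijk: "i < 3" "j < 3" "k < 3" "i \<noteq> j" "i \<noteq> k" "j \<noteq> k"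
  shows "den (\<theta> i) dvd nat \<bar>lin_res (L i) (L k)\<bar> * den (\<theta> j)"
proof -
  let ?r = "lin_res (L i) (L k)"
  have "real (den (\<theta> j)) * \<theta> j \<in> \<int>" using den_dvd_iff[OF K_rat[OF \<theta> ijk(2)]] by simp
  then have "of_nat (den (\<theta> j)) * (of_int ?r * \<theta> i + of_int (lin_res (L j) (L k)) * \<theta> j) - of_int (lin_res (L j) (L k)) * (real (den (\<theta> j)) * \<theta> j) \<in> \<int>"
    by (intro Ints_diff Ints_mult[OF Ints_of_nat K_elim[OF \<theta> ijk]] Ints_mult[OF Ints_of_int])
  then have "of_int ?r * real (den (\<theta> j)) * \<theta> i \<in> \<int>" by (simp add: algebra_simps)
  moreover have "real (nat \<bar>?r\<bar> * den (\<theta> j)) * \<theta> i = of_int (sgn ?r) * (of_int ?r * real (den (\<theta> j)) * \<theta> i)"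
    by (simp add: sgn_if)
  ultimately have "real (nat \<bar>?r\<bar> * den (\<theta> j)) * \<theta> i \<in> \<int>" by (metis Ints_mult Ints_of_int)
  then show ?thesis using den_dvd_iff[OF K_rat[OF \<theta> ijk(1)]] by blast
qed

text \<open>One constant for two purposes: the first two resultants compare
  \<open>den (\<theta> 0)\<close> with the other orders, the square of the third bounds the number
  of \<theta> with given \<theta> 0.\<close>

definition RR :: nat where
  "RR = nat \<bar>lin_res (L 0) (L 1)\<bar> * nat \<bar>lin_res (L 0) (L 2)\<bar> * nat \<bar>lin_res (L 1) (L 2)\<bar> ^ 2"

lemma RR_pos: "RR > 0"
  using res[of 0 1] res[of 0 2] res[of 1 2] by (simp add: RR_def)

lemma den_0_dvd:
  assumes \<theta>: "\<theta> \<in> K" and i: "i < 3"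
  shows "den (\<theta> 0) dvd RR * den (\<theta> i)"
proof -
  consider "i = 0" | "i = 1" | "i = 2" using i by linarith
  then show ?thesis
  proof cases
    case 2
    have "den (\<theta> 0) dvd nat \<bar>lin_res (L 0) (L 2)\<bar> * den (\<theta> 1)" by (rule den_dvd_den[OF \<theta>]) auto
    also have "\<dots> dvd RR * den (\<theta> 1)" by (intro mult_dvd_mono dvd_refl) (auto simp: RR_def intro: dvd_mult2)
    finally show ?thesis using 2 by simp
  next
    case 3
    have "den (\<theta> 0) dvd nat \<bar>lin_res (L 0) (L 1)\<bar> * den (\<theta> 2)" by (rule den_dvd_den[OF \<theta>]) auto
    also have "\<dots> dvd RR * den (\<theta> 2)" by (intro mult_dvd_mono dvd_refl) (auto simp: RR_def mult.assoc)
    finally show ?thesis using 3 by simp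
  qed auto
qed

lemma eq_of_floor_eq:
  assumes "of_int r * x - of_int r * y \<in> \<int>" "\<lfloor>\<bar>of_int r\<bar> * x\<rfloor> = \<lfloor>\<bar>of_int r\<bar> * (y::real)\<rfloor>" "r \<noteq> 0"
  shows "x = y"
proof -
  obtain n :: int where n: "of_int r * x - of_int r * y = of_int n" using assms(1) by (auto elim: Ints_cases)
  have "\<bar>\<bar>of_int r\<bar> * x - \<bar>of_int r\<bar> * y\<bar> < 1" using assms(2) by linarith
  then have "\<bar>of_int r * x - of_int r * y\<bar> < 1" by (simp add: abs_mult flip: right_diff_distrib)
  then have "n = 0" using n by simp
  then have "of_int r * (x - y) = 0" using n by (simp add: algebra_simps)
  then show ?thesis using assms(3) by simp
qed

text \<open>At most t values \<theta> 0 have order t, and \<theta> 0 determines \<theta> 1 and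
  \<theta> 2 up to division of an integer by the resultant of L 1 and L 2. The floors in
  \<open>?f\<close> record which solution is taken.\<close>

lemma card_K_den:
  shows "finite {\<theta> \<in> K. den (\<theta> 0) = t}" "card {\<theta> \<in> K. den (\<theta> 0) = t} \<le> t * RR"
proof -
  let ?r = "lin_res (L 1) (L 2)"
  let ?f = "\<lambda>\<theta>. (\<lfloor>real t * \<theta> 0\<rfloor>, \<lfloor>\<bar>of_int ?r\<bar> * \<theta> 1\<rfloor>, \<lfloor>\<bar>of_int ?r\<bar> * \<theta> 2\<rfloor>)"
  let ?A = "{\<theta> \<in> K. den (\<theta> 0) = t}" and ?B = "{0..<int t} \<times> {0..<\<bar>?r\<bar>} \<times> {0..<\<bar>?r\<bar>}"
  have r: "?r \<noteq> 0" using res by simp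
  have inj: "inj_on ?f ?A"
  proof (rule inj_onI)
    fix \<theta> \<theta>' assume "\<theta> \<in> ?A" "\<theta>' \<in> ?A" "?f \<theta> = ?f \<theta>'"
    then have a: "\<theta> \<in> K" "\<theta>' \<in> K" "t = den (\<theta>' 0)" "den (\<theta> 0) = den (\<theta>' 0)"
      "\<lfloor>real (den (\<theta>' 0)) * \<theta> 0\<rfloor> = \<lfloor>real (den (\<theta>' 0)) * \<theta>' 0\<rfloor>"
      "\<lfloor>\<bar>real_of_int ?r\<bar> * \<theta> 1\<rfloor> = \<lfloor>\<bar>real_of_int ?r\<bar> * \<theta>' 1\<rfloor>"
      "\<lfloor>\<bar>real_of_int ?r\<bar> * \<theta> 2\<rfloor> = \<lfloor>\<bar>real_of_int ?r\<bar> * \<theta>' 2\<rfloor>"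
      by auto
    have 0: "\<theta> 0 = \<theta>' 0"
    proof (rule eq_of_floor_eq[of "int (den (\<theta>' 0))"])
      show "of_int (int (den (\<theta>' 0))) * \<theta> 0 - of_int (int (den (\<theta>' 0))) * \<theta>' 0 \<in> \<int>"
        using den_dvd_iff[OF K_rat[OF a(1)], of 0 "den (\<theta>' 0)"] den_dvd_iff[OF K_rat[OF a(2)], of 0 "den (\<theta>' 0)"] a(4)
        by (intro Ints_diff) auto
      show "int (den (\<theta>' 0)) \<noteq> 0" using den_pos[OF K_rat[OF a(2)], of 0] by simp
    qed (use a in simp)
    have 1: "\<theta> 1 = \<theta>' 1"
    proof (rule eq_of_floor_eq[OF _ a(6) r])
      show "of_int ?r * \<theta> 1 - of_int ?r * \<theta>' 1 \<in> \<int>"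
        using Ints_diff[OF K_elim[OF a(1), of 0 1 2] K_elim[OF a(2), of 0 1 2]] 0 by simp
    qed
    have 2: "\<theta> 2 = \<theta>' 2"
    proof (rule eq_of_floor_eq[OF _ a(7) r])
      have "of_int (lin_res (L 2) (L 1)) * \<theta> 2 - of_int (lin_res (L 2) (L 1)) * \<theta>' 2 \<in> \<int>"
        using Ints_diff[OF K_elim[OF a(1), of 0 2 1] K_elim[OF a(2), of 0 2 1]] 0 by simp
      moreover have "lin_res (L 2) (L 1) = - ?r" by (simp add: lin_res_def)
      ultimately show "of_int ?r * \<theta> 2 - of_int ?r * \<theta>' 2 \<in> \<int>"
        using Ints_minus by fastforce
    qed
    show "\<theta> = \<theta>'"
    proof (rule PiE_ext)
      show "\<theta> \<in> PiE {..<3} (\<lambda>_. {0..<1})" "\<theta>' \<in> PiE {..<3} (\<lambda>_. {0..<1})" using a by (auto simp: K_def)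
      fix i :: nat assume "i \<in> {..<3}"
      then have "i = 0 \<or> i = 1 \<or> i = 2" by auto
      then show "\<theta> i = \<theta>' i" using 0 1 2 by auto
    qed
  qed
  have img: "?f ` ?A \<subseteq> ?B"
  proof (rule image_subsetI)
    fix \<theta> assume "\<theta> \<in> ?A"
    then have a: "\<theta> \<in> K" "t = den (\<theta> 0)" by auto
    have fl: "\<lfloor>c * \<theta> i\<rfloor> \<in> {0..<m}" if "i < 3" "c = real_of_int m" "m > 0" for i c m
    proof -
      have "0 \<le> c * \<theta> i" "c * \<theta> i < of_int m" using K_range[OF a(1) that(1)] that by auto
      then show ?thesis by (auto simp: floor_less_iff)
    qed
    have "den (\<theta> 0) > 0" using den_pos[OF K_rat[OF a(1)], of 0] by simp
    then show "?f \<theta> \<in> ?B"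
      using fl[of 0 _ "int (den (\<theta> 0))"] fl[of 1 _ "\<bar>?r\<bar>"] fl[of 2 _ "\<bar>?r\<bar>"] r a(2) by auto
  qed
  show "finite ?A" by (rule inj_on_finite[OF inj img]) auto
  have "card ?A \<le> card ?B" by (rule card_inj_on_le[OF inj img]) auto
  also have "\<dots> = t * (nat \<bar>?r\<bar>)^2" by (simp add: card_cartesian_product power2_eq_square)
  also have "\<dots> \<le> t * RR"
  proof -
    have "nat \<bar>lin_res (L 0) (L 1)\<bar> * nat \<bar>lin_res (L 0) (L 2)\<bar> \<ge> 1"
      using res[of 0 1] res[of 0 2] by (simp add: Suc_le_eq)
    then show ?thesis unfolding RR_def using mult_right_mono by fastforce
  qed
  finally show "card ?A \<le> t * RR" .
qed

end

section \<open>Smoothed harmonic sums\<close>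

text \<open>A harmonic sum up to sqrt (z / s), its last term halved if it lies on the boundary; for
  s > 0 the range up to z reaches far enough.\<close>

definition Hom :: "nat \<Rightarrow> nat \<Rightarrow> real" where
  "Hom s z = (\<Sum>j\<in>{1..z}. hw (j\<^sup>2 * s) z / real j)"

lemma harm_le_ln: "n > 0 \<Longrightarrow> harm n \<le> 1 + ln (real n)"
  using euler_mascheroni_sequence_decreasing[of 1 n] by (simp add: harm_def)

lemma Hom_nonneg: "0 \<le> Hom s z"
  by (auto simp: Hom_def intro!: sum_nonneg divide_nonneg_nonneg hw_nonneg)

lemma Hom_le: assumes "z > 0" shows "Hom s z \<le> 1 + ln (real z)"
proof -
  have "Hom s z \<le> (\<Sum>j\<in>{1..z}. inverse (real j))" unfolding Hom_def
    by (intro sum_mono) (use hw_le_1 in \<open>auto simp: divide_inverse intro: mult_left_le_one_le hw_nonneg\<close>)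
  also have "\<dots> = harm z" by (simp add: harm_def)
  finally show ?thesis using harm_le_ln[OF assms] by linarith
qed

lemma Hom_eq_0: assumes "z < s" shows "Hom s z = 0"
proof -
  have "hw (j\<^sup>2 * s) z = 0" if "j \<in> {1..z}" for j
  proof (rule hw_eq_0)
    have "1 * s \<le> j\<^sup>2 * s" using that by (intro mult_right_mono) auto
    then show "z < j\<^sup>2 * s" using assms unfolding mult_1 by linarith
  qed
  then show ?thesis by (simp add: Hom_def)
qed

lemma harm_approx:
  assumes "m > 0"
  shows "\<bar>harm m - ln (real m) - euler_mascheroni\<bar> \<le> 1 / m"
proof -
  obtain n where n: "m = Suc n" using assms by (cases m) auto
  have lim: "(\<lambda>k. harm (k + m) - ln (real (k + m))) \<longlonglongrightarrow> (euler_mascheroni::real)"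
    using LIMSEQ_ignore_initial_segment[OF euler_mascheroni_LIMSEQ, of m] by simp
  have le: "harm (k + m) - ln (real (k + m)) \<le> harm m - ln (real m)" for k
    by (rule euler_mascheroni_sequence_decreasing[OF assms]) simp
  have up: "(euler_mascheroni::real) \<le> harm m - ln (real m)"
    by (rule tendsto_upperbound[OF lim _ sequentially_bot], rule always_eventually, rule allI, rule le)
  have "harm m - ln (real m + 1) \<le> (euler_mascheroni::real)"
  proof -
    have e: "real (n + 2) = real m + 1" by (simp add: n)
    have "0 \<le> 1 / real (2 * (n + 2))" by simp
    then show ?thesis using euler_mascheroni_lower[of n, unfolded e, folded n] by linarith
  qed
  moreover have "ln (real m + 1) - ln (real m) \<le> 1 / m"
  proof -
    have "1 + 1 / real m = (real m + 1) / real m" using assms by (simp add: field_simps)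
    then have "ln (real m + 1) - ln (real m) = ln (1 + 1 / real m)"
      using assms by (simp add: ln_div)
    also have "\<dots> \<le> 1 / m" by (rule ln_add_one_self_le_self) simp
    finally show ?thesis .
  qed
  ultimately show ?thesis using up by (simp add: abs_le_iff)
qed

text \<open>The harmonic sum up to Y = sqrt (z / s) is ln Y plus Euler's constant with an error of
  order 1/Y. Only Y powr (-1/2) is claimed, which costs s^(1/4) instead of s^(1/2) in the series to
  come. For Y < 1 the sum is empty and the error absorbs the logarithm.\<close>

lemma Hom_approx:
  assumes s: "s > 0" and z: "z > 0"
  shows "\<bar>Hom s z - (ln (real z) / 2 + (euler_mascheroni - ln (real s) / 2))\<bar> \<le> 5 * (real s / real z) powr (1/4)"
proof -
  define Y where "Y = sqrt (real z / real s)"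
  have Y0: "Y > 0" using s z by (simp add: Y_def)
  have Y2: "Y\<^sup>2 = real z / real s" using s z by (simp add: Y_def)
  have lnY: "ln Y = ln (real z) / 2 - ln (real s) / 2"
    using s z by (simp add: Y_def ln_sqrt ln_div diff_divide_distrib)
  have Yp: "Y powr (-1/2) = (real s / real z) powr (1/4)"
  proof -
    have "Y powr (-1/2) = (real z / real s) powr (-1/4)"
      using s z by (simp add: Y_def powr_half_sqrt[symmetric] powr_powr)
    also have "\<dots> = (real s / real z) powr (1/4)"
      using s z powr_minus[of "real z / real s" "1/4"] by (simp add: powr_divide)
    finally show ?thesis .
  qed
  define m where "m = nat \<lfloor>Y\<rfloor>"
  have m: "real m \<le> Y" "Y < real m + 1" using Y0 by (auto simp: m_def)
  have cmp: "j\<^sup>2 * s \<le> z \<longleftrightarrow> real j \<le> Y" "j\<^sup>2 * s = z \<longleftrightarrow> real j = Y" for j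
  proof -
    have "j\<^sup>2 * s \<le> z \<longleftrightarrow> (real j)\<^sup>2 \<le> Y\<^sup>2"
      unfolding Y2 using s by (simp add: pos_le_divide_eq flip: of_nat_power of_nat_mult)
    also have "\<dots> \<longleftrightarrow> real j \<le> Y" using Y0 by (simp add: abs_le_square_iff[symmetric])
    finally show "j\<^sup>2 * s \<le> z \<longleftrightarrow> real j \<le> Y" .
    have "j\<^sup>2 * s = z \<longleftrightarrow> (real j)\<^sup>2 = Y\<^sup>2"
      unfolding Y2 using s by (simp add: eq_divide_eq flip: of_nat_power of_nat_mult)
    also have "\<dots> \<longleftrightarrow> real j = Y" using Y0 by (simp add: power2_eq_iff_nonneg)
    finally show "j\<^sup>2 * s = z \<longleftrightarrow> real j = Y" .
  qed
  have jm: "real j \<le> Y \<longleftrightarrow> j \<le> m" for j using m by (auto simp: le_floor_iff m_def le_nat_iff)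
  have mz: "m \<le> z"
  proof (cases "m = 0")
    case False
    have "m\<^sup>2 * s \<le> z" using cmp m by simp
    moreover have "m * 1 * 1 \<le> m * m * s" using False s by (intro mult_mono) auto
    ultimately show ?thesis unfolding mult_1_right power2_eq_square by linarith
  qed simp
  have tm: "hw (j\<^sup>2 * s) z / real j = (if j \<le> m then inverse (real j) else 0) - (if j = m \<and> real m = Y then 1 / (2 * real m) else 0)" 
    if "j \<in> {1..z}" for j
  proof -
    have "real j = Y \<Longrightarrow> j = m" using m by linarith
    then have jY: "j = m \<and> real m = Y \<longleftrightarrow> real j = Y" by auto
    have "hw (j\<^sup>2 * s) z = (if real j = Y then 1/2 else if j \<le> m then 1 else 0)"
      unfolding hw_def less_le cmp jm by auto
    moreover have "j \<le> m" if "real j = Y" using that jm[of j] by linarith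
    ultimately have hw: "hw (j\<^sup>2 * s) z = (if j = m \<and> real m = Y then 1/2 else if j \<le> m then 1 else 0)"
      unfolding jY by simp
    have half: "1 / 2 / x = inverse x - 1 / (2 * x)" for x :: real by (cases "x = 0") (auto simp: field_simps)
    show ?thesis
    proof (cases "j = m \<and> real m = Y")
      case True
      then have "j \<le> m" by simp
      then show ?thesis unfolding hw if_P[OF True] if_P[OF \<open>j \<le> m\<close>] half using True by simp
    next
      case False
      then show ?thesis unfolding hw if_not_P[OF False] by (cases "j \<le> m") (simp_all only: if_True if_False divide_inverse mult_1 mult_zero_left diff_zero)
    qed
  qed
  have HS: "Hom s z = harm m - (if m > 0 \<and> real m = Y then 1 / (2 * real m) else 0)"
  proof -
    have "Hom s z = (\<Sum>j\<in>{1..z}. if j \<le> m then inverse (real j) else 0) - (\<Sum>j\<in>{1..z}. if j = m \<and> real m = Y then 1 / (2 * real m) else 0)"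
      unfolding Hom_def by (simp only: tm sum_subtractf cong: sum.cong)
    also have "(\<Sum>j\<in>{1..z}. if j \<le> m then inverse (real j) else 0) = harm m"
    proof -
      have "{1..z} \<inter> {j. j \<le> m} = {1..m}" using mz by auto
      then show ?thesis by (simp add: sum.If_cases harm_def)
    qed
    also have "(\<Sum>j\<in>{1..z}. if j = m \<and> real m = Y then 1 / (2 * real m) else 0) = (if m > 0 \<and> real m = Y then 1 / (2 * real m) else 0)"
      using mz by (cases "real m = Y") auto
    finally show ?thesis .
  qed
  have goal: "\<bar>Hom s z - (ln Y + euler_mascheroni)\<bar> \<le> 5 * Y powr (-1/2)"
  proof (cases "m = 0")
    case True
    then have "Y < 1" using m by simp
    have "Hom s z = 0" using True by (simp add: HS harm_def)
    moreover have "Y powr (-1/2) \<ge> 1"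
      using \<open>Y < 1\<close> Y0 by (simp add: powr_def)
    \<comment> \<open>From ln t <= t at t = Y powr (-1/2).\<close>
    moreover have "- ln Y \<le> 2 * Y powr (-1/2)"
    proof -
      have "ln (Y powr (-1/2)) \<le> Y powr (-1/2)" using Y0 by (intro ln_bound) auto
      then show ?thesis using Y0 by (simp add: ln_powr)
    qed
    moreover have "ln Y \<le> 0" using \<open>Y < 1\<close> Y0 by simp
    moreover have "(euler_mascheroni::real) > 0" "(euler_mascheroni::real) \<le> 2"
      using euler_mascheroni_pos harm_approx[of 1] by (auto simp: harm_def abs_le_iff)
    ultimately show ?thesis by (simp add: abs_le_iff)
  next
    case False
    then have m1: "real m \<ge> 1" by simp
    then have Y1: "Y \<ge> 1" using m by linarith
    have "\<bar>ln Y - ln (real m)\<bar> \<le> 1 / m"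
    proof -
      have "ln (real m) \<le> ln Y" using m m1 by simp
      moreover have "ln Y \<le> ln (real m) + 1 / m"
      proof -
        have "ln Y - ln (real m) = ln (Y / real m)" using m1 Y0 by (simp add: ln_div)
        also have "\<dots> \<le> Y / real m - 1" using m1 Y0 by (intro ln_le_minus_one) simp
        also have "\<dots> \<le> 1 / real m"
        proof -
          have "Y / real m \<le> (real m + 1) / real m" using m by (intro divide_right_mono) auto
          also have "\<dots> = 1 + 1 / real m" using m1 by (simp add: add_divide_distrib)
          finally show ?thesis by simp
        qed
        finally show ?thesis by simp
      qed
      ultimately show ?thesis by (simp add: abs_le_iff)
    qed
    moreover have "\<bar>harm m - ln (real m) - euler_mascheroni\<bar> \<le> 1 / m" using harm_approx False by simp
    moreover have "\<bar>Hom s z - harm m\<bar> \<le> (1/2) * (1 / m)" by (auto simp: HS)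
    ultimately have "\<bar>Hom s z - (ln Y + euler_mascheroni)\<bar> \<le> (5/2) * (1 / m)" by linarith
    also have "1 / real m \<le> 2 * (1 / Y)"
    proof -
      have "Y \<le> 2 * real m" using m m1 by linarith
      then have "1 / (2 * real m) \<le> 1 / Y" using Y0 by (intro divide_left_mono) auto
      then show ?thesis by simp
    qed
    also have "(5/2) * (2 * (1 / Y)) = 5 * Y powr (-1)" using Y0 by (simp add: powr_minus_divide)
    also have "\<dots> \<le> 5 * Y powr (-1/2)" using Y1 by (intro mult_left_mono powr_mono) auto
    finally show ?thesis by simp
  qed
  then show ?thesis unfolding Yp lnY by (simp add: algebra_simps)
qed

text \<open>The condition that e divides k d means that e' = e / gcd e k divides d, and the
  substitution d = e' j leaves a harmonic sum with s = e'^2 k. Terms with d > z vanish, so every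
  cutoff B >= z gives the same value.\<close>

lemma sum_dvd_hw:
  assumes k: "k > 0" and e: "e > 0" and zB: "z \<le> B"
  shows "(\<Sum>d\<in>{1..B}. if e dvd k * d then hw (d\<^sup>2 * k) z / (real k * real d) else 0)
    = Hom ((e div gcd e k)\<^sup>2 * k) z / real (k * (e div gcd e k))"
proof -
  define e' where "e' = e div gcd e k"
  have e'0: "e' > 0" using e by (auto simp: e'_def div_greater_zero_iff gcd_le1_nat)
  have dv: "e dvd k * d \<longleftrightarrow> e' dvd d" for d
  proof -
    have "e dvd k * d \<longleftrightarrow> e' * gcd e k dvd (k div gcd e k * d) * gcd e k" by (simp add: e'_def mult_ac)
    also have "\<dots> \<longleftrightarrow> e' dvd k div gcd e k * d" using e by (subst dvd_times_right_cancel_iff) auto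
    also have "\<dots> \<longleftrightarrow> e' dvd d"
      unfolding e'_def using e div_gcd_coprime[of e k] by (intro coprime_dvd_mult_right_iff) auto
    finally show ?thesis .
  qed
  let ?f = "\<lambda>d. hw (d\<^sup>2 * k) z / (real k * real d)"
  let ?S = "{j\<in>{1..B}. e' * j \<le> B}"
  have big: "z < n\<^sup>2 * m" if "n > z" "m > 0" for n m :: nat
  proof -
    have "n * 1 * 1 \<le> n * n * m" using that by (intro mult_mono) auto
    then have "n \<le> n\<^sup>2 * m" unfolding mult_1_right power2_eq_square .
    then show ?thesis using that(1) by linarith
  qed
  have "(\<Sum>d\<in>{1..B}. if e dvd k * d then ?f d else 0) = (\<Sum>d\<in>{d\<in>{1..B}. e' dvd d}. ?f d)"
    unfolding dv by (simp add: sum.If_cases Int_def)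
  also have "\<dots> = (\<Sum>j\<in>?S. ?f (e' * j))"
  proof (rule sum.reindex_bij_witness[of _ "\<lambda>j. e' * j" "\<lambda>d. d div e'"])
    fix d assume "d \<in> {d\<in>{1..B}. e' dvd d}"
    then show "d div e' \<in> ?S" using e'0 by (auto simp: dvd_imp_le Suc_le_eq div_greater_zero_iff intro: order.trans[OF div_le_dividend])
  qed (use e'0 in auto)
  also have "\<dots> = (\<Sum>j\<in>{1..B}. ?f (e' * j))"
  proof (rule sum.mono_neutral_left)
    show "\<forall>j\<in>{1..B} - ?S. ?f (e' * j) = 0"
    proof
      fix j assume "j \<in> {1..B} - ?S"
      then have "z < e' * j" using zB by auto
      then have "hw ((e' * j)\<^sup>2 * k) z = 0" using k by (intro hw_eq_0 big)
      then show "?f (e' * j) = 0" by simp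
    qed
  qed auto
  also have "\<dots> = (\<Sum>j\<in>{1..z}. ?f (e' * j))"
  proof (rule sum.mono_neutral_right)
    show "\<forall>j\<in>{1..B} - {1..z}. ?f (e' * j) = 0"
    proof
      fix j assume j: "j \<in> {1..B} - {1..z}"
      then have "1 * j \<le> e' * j" using e'0 by (intro mult_right_mono) auto
      moreover have "z < j" using j by auto
      ultimately have "z < e' * j" by linarith
      then have "hw ((e' * j)\<^sup>2 * k) z = 0" using k by (intro hw_eq_0 big)
      then show "?f (e' * j) = 0" by simp
    qed
  qed (use zB in auto)
  also have "\<dots> = Hom (e'\<^sup>2 * k) z / real (k * e')"
    unfolding Hom_def sum_divide_distrib by (intro sum.cong refl) (simp add: power_mult_distrib mult_ac)
  finally show ?thesis by (simp add: e'_def)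
qed

lemma sum_powr_bounded:
  assumes "a > 1"
  shows "\<exists>Z\<ge>0. \<forall>B. (\<Sum>b\<in>{1..B}. real b powr (-a)) \<le> Z"
proof -
  have s: "summable (\<lambda>n. real n powr (-a))" using assms by (simp add: summable_real_powr_iff)
  have "(\<Sum>b\<in>{1..B}. real b powr (-a)) \<le> suminf (\<lambda>n. real n powr (-a))" for B
    by (rule sum_le_suminf[OF s]) auto
  moreover have "suminf (\<lambda>n. real n powr (-a)) \<ge> 0" by (intro suminf_nonneg s) auto
  ultimately show ?thesis by blast
qed

text \<open>Fibre over g = gcd x t: within a fibre the quotients are distinct, and g runs through
  divisors of t.\<close>

lemma sum_div_gcd_powr_le:
  assumes t: "t > 0" and Z: "\<And>B. (\<Sum>b\<in>{1..B}. real b powr (-a)) \<le> Z"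
  shows "(\<Sum>x\<in>{1..B}. real (x div gcd x t) powr (-a)) \<le> real (ndiv t) * Z"
proof -
  let ?\<phi> = "\<lambda>x. (gcd x t, x div gcd x t)"
  let ?T = "{g. g dvd t} \<times> {1..B}"
  have inj: "inj_on ?\<phi> {1..B}"
    by (rule inj_onI) (metis dvd_mult_div_cancel gcd_dvd1 old.prod.inject)
  have sub: "?\<phi> ` {1..B} \<subseteq> ?T"
  proof (rule image_subsetI)
    fix x assume x: "x \<in> {1..B}"
    then have "x div gcd x t > 0" by (simp add: div_greater_zero_iff gcd_le1_nat)
    moreover have "x div gcd x t \<le> B" using x by (meson atLeastAtMost_iff div_le_dividend le_trans)
    ultimately show "?\<phi> x \<in> ?T" by auto
  qed
  have "(\<Sum>x\<in>{1..B}. real (x div gcd x t) powr (-a)) = (\<Sum>y\<in>?\<phi> ` {1..B}. real (snd y) powr (-a))"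
    by (subst sum.reindex[OF inj]) simp
  also have "\<dots> \<le> (\<Sum>y\<in>?T. real (snd y) powr (-a))"
    using sub t by (intro sum_mono2) (auto simp: finite_divs)
  also have "\<dots> = (\<Sum>g | g dvd t. \<Sum>b\<in>{1..B}. real b powr (-a))"
    by (subst sum.cartesian_product) (simp add: case_prod_unfold)
  also have "\<dots> \<le> (\<Sum>g | g dvd t. Z)" by (intro sum_mono Z)
  also have "\<dots> = real (ndiv t) * Z" by (simp add: ndiv_def)
  finally show ?thesis .
qed

lemma gcd_mult_dvd: "gcd (a * b) t dvd gcd a t * gcd b (t::nat)"
proof -
  have "gcd a t * gcd b t = gcd (gcd a t * b) (gcd a t * t)" by (rule gcd_mult_distrib_nat)
  also have "gcd a t * b = gcd (b * a) (b * t)" by (subst mult.commute) (rule gcd_mult_distrib_nat)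
  also have "gcd a t * t = gcd (t * a) (t * t)" by (subst mult.commute) (rule gcd_mult_distrib_nat)
  finally have eq: "gcd a t * gcd b t = gcd (gcd (b * a) (b * t)) (gcd (t * a) (t * t))" .
  have "gcd (a * b) t dvd b * a" by (metis gcd_dvd1 mult.commute)
  moreover have "gcd (a * b) t dvd x * t" for x by (intro dvd_mult gcd_dvd2)
  moreover have "gcd (a * b) t dvd t * x" for x by (intro dvd_mult2 gcd_dvd2)
  ultimately show ?thesis unfolding eq by (intro gcd_greatest)
qed

lemma gcd_prod_dvd: "finite A \<Longrightarrow> gcd (\<Prod>j\<in>A. f j) (t::nat) dvd (\<Prod>j\<in>A. gcd (f j) t)"
proof (induction A rule: finite_induct)
  case (insert x A)
  note gcd_mult_dvd[of "f x" "\<Prod>j\<in>A. f j" t]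
  also have "gcd (f x) t * gcd (\<Prod>j\<in>A. f j) t dvd gcd (f x) t * (\<Prod>j\<in>A. gcd (f j) t)"
    by (rule mult_dvd_mono[OF dvd_refl insert.IH])
  finally show ?case unfolding prod.insert[OF insert.hyps(1,2)] .
qed auto

section \<open>Convergence of the singular series\<close>

text \<open>All tuples, not only those with squarefree product: convergence is proved for arbitrary
  bounded weights.\<close>

definition KS :: "(nat \<Rightarrow> nat) set" where "KS = PiE {..<5} (\<lambda>_. {1..})"

definition KB :: "nat \<Rightarrow> (nat \<Rightarrow> nat) set" where "KB B = PiE {..<5} (\<lambda>_. {1..B})"

lemma KS_ge_1: "\<kappa> \<in> KS \<Longrightarrow> j < 5 \<Longrightarrow> \<kappa> j \<ge> 1"
  by (auto simp: KS_def PiE_def Pi_def)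

lemma KB_subset_KS: "KB B \<subseteq> KS"
  by (auto simp: KS_def KB_def PiE_def Pi_def)

lemma finite_KB: "finite (KB B)"
  unfolding KB_def by (intro finite_PiE) auto

lemma kk_pos:
  assumes "\<kappa> \<in> KS" "i < 3" shows "kk i \<kappa> > 0"
  unfolding kk_def
proof (rule prod_pos)
  fix j assume "j \<in> slots i"
  then have "j < 5" using slots_subset[OF assms(2)] by auto
  then show "\<kappa> j > 0" using KS_ge_1[OF assms(1), of j] by simp
qed

context three_forms
begin

text \<open>That \<open>den (\<theta> i)\<close> divides k_i d_i says that \<open>ee\<close> divides
  d_i. After the substitution of \<open>ee\<close> times j for d_i, the term has the denominator
  \<open>ll\<close>, a least common multiple, and the cutoff parameter \<open>ss\<close>.\<close>

definition ee :: "nat \<Rightarrow> (nat \<Rightarrow> nat) \<Rightarrow> (nat \<Rightarrow> real) \<Rightarrow> nat" where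
  "ee i \<kappa> \<theta> = den (\<theta> i) div gcd (den (\<theta> i)) (kk i \<kappa>)"

definition ll :: "nat \<Rightarrow> (nat \<Rightarrow> nat) \<Rightarrow> (nat \<Rightarrow> real) \<Rightarrow> nat" where
  "ll i \<kappa> \<theta> = kk i \<kappa> * ee i \<kappa> \<theta>"

definition ss :: "nat \<Rightarrow> (nat \<Rightarrow> nat) \<Rightarrow> (nat \<Rightarrow> real) \<Rightarrow> nat" where
  "ss i \<kappa> \<theta> = (ee i \<kappa> \<theta>)\<^sup>2 * kk i \<kappa>"

text \<open>A logarithm of \<open>ll\<close> is charged as its power 1/16, while the error of
  \<open>Hom_approx\<close> costs the power 1/2. The factor i0 carries that error and keeps the
  exponent 1/2, relaxed to 7/16; the other two keep 1 - 1/16.\<close>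

definition aa :: "nat \<Rightarrow> nat \<Rightarrow> real" where
  "aa i0 i = (if i = i0 then 7/16 else 15/16)"

lemma den_pos_K: "\<theta> \<in> K \<Longrightarrow> i < 3 \<Longrightarrow> den (\<theta> i) > 0"
  using den_pos K_rat by blast

lemma ee_pos: "\<theta> \<in> K \<Longrightarrow> i < 3 \<Longrightarrow> ee i \<kappa> \<theta> > 0"
  using den_pos_K[of \<theta> i] by (simp add: ee_def div_greater_zero_iff gcd_le1_nat)

lemma ll_pos: "\<kappa> \<in> KS \<Longrightarrow> \<theta> \<in> K \<Longrightarrow> i < 3 \<Longrightarrow> ll i \<kappa> \<theta> > 0"
  using ee_pos kk_pos by (simp add: ll_def)

lemma ll_eq_lcm: "ll i \<kappa> \<theta> = lcm (kk i \<kappa>) (den (\<theta> i))"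
  by (simp add: ll_def ee_def lcm_nat_def gcd.commute div_mult_swap)

lemma ss_bounds: assumes "\<kappa> \<in> KS" "\<theta> \<in> K" "i < 3" 
  shows "ss i \<kappa> \<theta> > 0" "ss i \<kappa> \<theta> \<le> (ll i \<kappa> \<theta>)\<^sup>2" "kk i \<kappa> \<le> ss i \<kappa> \<theta>" "ee i \<kappa> \<theta> \<le> ss i \<kappa> \<theta>"
proof -
  have k: "kk i \<kappa> \<ge> 1" and e: "ee i \<kappa> \<theta> \<ge> 1" using kk_pos[OF assms(1,3)] ee_pos[OF assms(2,3), of \<kappa>] by auto
  show "ss i \<kappa> \<theta> > 0" using k e by (simp add: ss_def)
  have "(ee i \<kappa> \<theta>)\<^sup>2 * (kk i \<kappa> * 1) \<le> (ee i \<kappa> \<theta>)\<^sup>2 * (kk i \<kappa> * kk i \<kappa>)" using k by (intro mult_left_mono) auto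
  then show "ss i \<kappa> \<theta> \<le> (ll i \<kappa> \<theta>)\<^sup>2" by (simp add: ss_def ll_def power2_eq_square mult_ac)
  have "1 * kk i \<kappa> \<le> (ee i \<kappa> \<theta>)\<^sup>2 * kk i \<kappa>" using e by (intro mult_right_mono) auto
  then show "kk i \<kappa> \<le> ss i \<kappa> \<theta>" by (simp only: ss_def mult_1)
  have "ee i \<kappa> \<theta> * 1 * 1 \<le> ee i \<kappa> \<theta> * ee i \<kappa> \<theta> * kk i \<kappa>" using k e by (intro mult_mono) auto
  then show "ee i \<kappa> \<theta> \<le> ss i \<kappa> \<theta>" by (simp only: ss_def mult_1_right power2_eq_square)
qed

text \<open>The order t of \<theta> 0 divides \<open>RR\<close> times that of \<theta> i, so it
  suffices to bound the lcm of k_i and t from below. It equals k_i t divided by the gcd, and this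
  gcd is at most the product of the gcds of the components with t.\<close>

lemma ll_ge:
  assumes \<kappa>: "\<kappa> \<in> KS" and \<theta>: "\<theta> \<in> K" and i: "i < 3"
  shows "den (\<theta> 0) * (\<Prod>j\<in>slots i. \<kappa> j div gcd (\<kappa> j) (den (\<theta> 0))) \<le> RR * ll i \<kappa> \<theta>"
proof -
  let ?t = "den (\<theta> 0)"
  have t: "?t > 0" using den_pos_K[OF \<theta>, of 0] by simp
  have k: "kk i \<kappa> > 0" by (rule kk_pos[OF \<kappa> i])
  have "lcm (kk i \<kappa>) ?t dvd RR * ll i \<kappa> \<theta>"
    unfolding ll_eq_lcm using den_0_dvd[OF \<theta> i]
    by (intro lcm_least) (auto intro: dvd_trans[OF _ mult_dvd_mono[OF dvd_refl dvd_lcm2]])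
  then have 1: "lcm (kk i \<kappa>) ?t \<le> RR * ll i \<kappa> \<theta>"
    using ll_pos[OF \<kappa> \<theta> i] RR_pos by (intro dvd_imp_le) auto
  define g where "g = (\<Prod>j\<in>slots i. gcd (\<kappa> j) ?t)"
  have g0: "g > 0" unfolding g_def using t by (intro prod_pos) auto
  have gle: "gcd (kk i \<kappa>) ?t \<le> g" unfolding g_def kk_def
    by (rule dvd_imp_le[OF gcd_prod_dvd]) (use g0 in \<open>auto simp: g_def\<close>)
  have "(\<Prod>j\<in>slots i. \<kappa> j div gcd (\<kappa> j) ?t) * g = kk i \<kappa>"
    unfolding g_def kk_def prod.distrib[symmetric] by (rule prod.cong[OF refl]) simp
  then have "?t * (\<Prod>j\<in>slots i. \<kappa> j div gcd (\<kappa> j) ?t) * g = ?t * kk i \<kappa>" by (metis mult.assoc)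
  also have "\<dots> = lcm (kk i \<kappa>) ?t * gcd (kk i \<kappa>) ?t" by (metis mult.commute prod_gcd_lcm_nat)
  also have "\<dots> \<le> lcm (kk i \<kappa>) ?t * g" using gle by (intro mult_left_mono) auto
  finally have "?t * (\<Prod>j\<in>slots i. \<kappa> j div gcd (\<kappa> j) ?t) \<le> lcm (kk i \<kappa>) ?t" using g0 by simp
  then show ?thesis using 1 by linarith
qed

text \<open>Every component occurs in at least two of the moduli, so the worst case is 7/16 + 15/16
  = 11/8. That this exceeds 1 makes the sum over each component converge.\<close>

lemma sum_aa_slots:
  assumes "i0 < 3" "j < 5" shows "(\<Sum>i<3. if j \<in> slots i then aa i0 i else 0) \<ge> 11/8"
proof -
  have j: "j = 0 \<or> j = 1 \<or> j = 2 \<or> j = 3 \<or> j = 4" and i: "i0 = 0 \<or> i0 = 1 \<or> i0 = 2" using assms by linarith+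
  have s: "(\<Sum>i<(3::nat). f i) = f 0 + f 1 + (f 2 :: real)" for f by (simp add: eval_nat_numeral)
  show ?thesis unfolding s using i j by (elim disjE) (simp_all add: slots_def aa_def)
qed

lemma sum_aa: "i0 < 3 \<Longrightarrow> (\<Sum>i<3. aa i0 i) = 37/16"
  by (auto simp: aa_def eval_nat_numeral less_Suc_eq)

definition rho :: "nat \<Rightarrow> nat \<Rightarrow> nat" where "rho t a = a div gcd a t"

text \<open>Splits the summand into a power of the order t and one function of each component,
  reduced by its gcd with t. The exponent of t is 37/16, the sum of \<open>aa i0\<close>.\<close>

lemma prod_ll_le:
  assumes \<kappa>: "\<kappa> \<in> KS" and \<theta>: "\<theta> \<in> K" and i0: "i0 < 3"
  shows "(\<Prod>i<3. real (ll i \<kappa> \<theta>) powr (- aa i0 i))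
     \<le> real RR powr (37/16) * real (den (\<theta> 0)) powr (-37/16) * (\<Prod>j<5. real (rho (den (\<theta> 0)) (\<kappa> j)) powr (-11/8))"
proof -
  let ?t = "den (\<theta> 0)"
  have t: "?t > 0" using den_pos_K[OF \<theta>, of 0] by simp
  define \<rho> where "\<rho> = (\<lambda>j. real (rho ?t (\<kappa> j)))"
  have \<rho>1: "\<rho> j \<ge> 1" if "j < 5" for j
  proof -
    have "rho ?t (\<kappa> j) > 0" using KS_ge_1[OF \<kappa> that] by (simp add: rho_def div_greater_zero_iff gcd_le1_nat)
    then show ?thesis by (simp add: \<rho>_def)
  qed
  have \<rho>0: "\<rho> j > 0" if "j < 5" for j using \<rho>1[OF that] by linarith
  have aa0: "aa i0 i > 0" for i by (simp add: aa_def)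
  have "(\<Prod>i<3. real (ll i \<kappa> \<theta>) powr (- aa i0 i)) \<le> (\<Prod>i<3. (real RR powr aa i0 i * real ?t powr (- aa i0 i)) * (\<Prod>j<5. if j \<in> slots i then \<rho> j powr (- aa i0 i) else 1))"
  proof (intro prod_mono conjI)
    fix i :: nat assume "i \<in> {..<3}"
    then have i: "i < 3" by simp
    have sub: "slots i \<subseteq> {..<5}" by (rule slots_subset[OF i])
    have R0: "real RR > 0" using RR_pos by simp
    have P0: "(\<Prod>j\<in>slots i. \<rho> j) > 0" using sub \<rho>0 by (intro prod_pos) auto
    have "real (?t * (\<Prod>j\<in>slots i. \<kappa> j div gcd (\<kappa> j) ?t)) \<le> real (RR * ll i \<kappa> \<theta>)"
      using ll_ge[OF \<kappa> \<theta> i] by (simp only: of_nat_le_iff)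
    then have "real ?t * (\<Prod>j\<in>slots i. \<rho> j) \<le> real RR * ll i \<kappa> \<theta>" by (simp add: \<rho>_def rho_def)
    then have ge: "real ?t * (\<Prod>j\<in>slots i. \<rho> j) / real RR \<le> ll i \<kappa> \<theta>" using R0 by (simp add: field_simps)
    have "real (ll i \<kappa> \<theta>) powr (- aa i0 i) \<le> (real ?t * (\<Prod>j\<in>slots i. \<rho> j) / real RR) powr (- aa i0 i)"
      using ge R0 P0 t aa0[of i] by (intro powr_mono2') auto
    also have "\<dots> = (real RR powr aa i0 i * real ?t powr (- aa i0 i)) * (\<Prod>j\<in>slots i. \<rho> j) powr (- aa i0 i)"
      using R0 P0 t by (simp add: powr_divide powr_mult powr_minus field_simps)
    also have "(\<Prod>j\<in>slots i. \<rho> j) powr (- aa i0 i) = (\<Prod>j\<in>slots i. \<rho> j powr (- aa i0 i))"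
      using sub \<rho>0 by (intro prod_powr_distrib)
    also have "\<dots> = (\<Prod>j<5. if j \<in> slots i then \<rho> j powr (- aa i0 i) else 1)"
      using sub by (simp add: prod.If_cases Int_absorb1)
    finally show "real (ll i \<kappa> \<theta>) powr (- aa i0 i) \<le> (real RR powr aa i0 i * real ?t powr (- aa i0 i)) * (\<Prod>j<5. if j \<in> slots i then \<rho> j powr (- aa i0 i) else 1)" .
  qed simp
  also have "\<dots> = (\<Prod>i<3. real RR powr aa i0 i) * (\<Prod>i<3. real ?t powr (- aa i0 i)) * (\<Prod>j<5. \<Prod>i<3. if j \<in> slots i then \<rho> j powr (- aa i0 i) else 1)"
    by (subst prod.swap) (simp add: prod.distrib)
  also have "(\<Prod>i<3. real RR powr aa i0 i) = real RR powr (37/16)"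
    using RR_pos by (simp add: powr_sum[symmetric] sum_aa[OF i0])
  also have "(\<Prod>i<3. real ?t powr (- aa i0 i)) = real ?t powr (-37/16)"
    using t by (simp add: powr_sum[symmetric] sum_negf sum_aa[OF i0])
  also have "(\<Prod>j<5. \<Prod>i<3. if j \<in> slots i then \<rho> j powr (- aa i0 i) else 1) \<le> (\<Prod>j<5. \<rho> j powr (-11/8))"
  proof (intro prod_mono conjI)
    fix j :: nat assume "j \<in> {..<5}"
    then have j: "j < 5" by simp
    have "(\<Prod>i<3. if j \<in> slots i then \<rho> j powr (- aa i0 i) else 1) = (\<Prod>i<3. \<rho> j powr (- (if j \<in> slots i then aa i0 i else 0)))"
      using \<rho>0[OF j] by (intro prod.cong) auto
    also have "\<dots> = \<rho> j powr (- (\<Sum>i<3. if j \<in> slots i then aa i0 i else 0))"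
      using \<rho>0[OF j] by (simp add: powr_sum[symmetric] sum_negf)
    also have "\<dots> \<le> \<rho> j powr (-11/8)" using \<rho>1[OF j] sum_aa_slots[OF i0 j] by (intro powr_mono) auto
    finally show "(\<Prod>i<3. if j \<in> slots i then \<rho> j powr (- aa i0 i) else 1) \<le> \<rho> j powr (-11/8)" .
  qed (auto intro!: prod_nonneg)
  finally show ?thesis by (simp add: \<rho>_def mult_left_mono)
qed

text \<open>The exponents of t = den (\<theta> 0) add up as follows: -37/16 from the summand, 1/16
  from the five divisor bounds (1/80 each) that the sums over the components produce, and 1 from the
  number of \<theta> with order t. The total -5/4 is summable.\<close>

lemma summable_ll:
  assumes i0: "i0 < 3"
  shows "(\<lambda>(\<kappa>, \<theta>). \<Prod>i<3. real (ll i \<kappa> \<theta>) powr (- aa i0 i)) summable_on (KS \<times> K)"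
proof -
  obtain Z where Z: "Z \<ge> 0" "\<And>B. (\<Sum>b\<in>{1..B}. real b powr (-(11/8))) \<le> Z"
    using sum_powr_bounded[of "11/8"] by auto
  obtain Y where Y: "\<And>B. (\<Sum>b\<in>{1..B}. real b powr (-(5/4))) \<le> Y"
    using sum_powr_bounded[of "5/4"] by auto
  obtain C where C: "C \<ge> 1" "\<And>n. n > 0 \<Longrightarrow> real (ndiv n) \<le> C * real n powr (1/80)"
    using ndiv_le_powr[of "1/80"] by auto
  define R where "R = real RR powr (37/16)"
  define W where "W = R * real RR * (C * Z) ^ 5"
  let ?f = "\<lambda>(\<kappa>, \<theta>). \<Prod>i<3. real (ll i \<kappa> \<theta>) powr (- aa i0 i)"
  let ?g = "\<lambda>\<kappa> \<theta>. R * real (den (\<theta> 0)) powr (-37/16) * (\<Prod>j<5. real (rho (den (\<theta> 0)) (\<kappa> j)) powr (-11/8))"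
  have W0: "W \<ge> 0" using Z C by (simp add: W_def R_def)
  have bound: "sum ?f F \<le> W * Y" if F: "F \<subseteq> KS \<times> K" "finite F" for F
  proof -
    \<comment> \<open>A finite set of pairs lies in a box for \<kappa> and for the order of \<theta>
      0, over which the bound factorises.\<close>
    define S where "S = (\<Union>(\<kappa>, \<theta>)\<in>F. insert (den (\<theta> 0)) (\<kappa> ` {..<5}))"
    have finS: "finite S" using F by (auto simp: S_def)
    define B where "B = Max (insert 0 S)"
    have SB: "s \<le> B" if "s \<in> S" for s using that finS by (simp add: B_def)
    let ?Th = "SIGMA t:{1..B}. {\<theta> \<in> K. den (\<theta> 0) = t}"
    let ?G = "KB B \<times> {\<theta> \<in> K. den (\<theta> 0) \<in> {1..B}}"
    have eqK: "{\<theta> \<in> K. den (\<theta> 0) \<in> {1..B}} = (\<Union>t\<in>{1..B}. {\<theta> \<in> K. den (\<theta> 0) = t})" by auto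
    have finK: "finite {\<theta> \<in> K. den (\<theta> 0) \<in> {1..B}}" unfolding eqK using card_K_den(1) by auto
    have sub: "F \<subseteq> ?G"
    proof
      fix x assume "x \<in> F"
      then obtain \<kappa> \<theta> where x: "x = (\<kappa>, \<theta>)" and m: "(\<kappa>, \<theta>) \<in> F" by (cases x) auto
      then have \<kappa>: "\<kappa> \<in> KS" and \<theta>: "\<theta> \<in> K" using F by auto
      have "den (\<theta> 0) \<in> S" "\<And>j. j < 5 \<Longrightarrow> \<kappa> j \<in> S" using m by (force simp: S_def)+
      then have "den (\<theta> 0) \<le> B" "\<And>j. j < 5 \<Longrightarrow> \<kappa> j \<le> B" using SB by auto
      then show "x \<in> ?G" unfolding x
        using \<kappa> \<theta> den_pos_K[OF \<theta>, of 0] by (auto simp: KS_def KB_def PiE_def Pi_def)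
    qed
    have "sum ?f F \<le> sum ?f ?G"
      using sub finK finite_KB by (intro sum_mono2) (auto intro!: prod_nonneg)
    also have "\<dots> \<le> (\<Sum>(\<kappa>, \<theta>)\<in>?G. ?g \<kappa> \<theta>)"
    proof (rule sum_mono)
      fix x assume "x \<in> ?G"
      then obtain \<kappa> \<theta> where x: "x = (\<kappa>, \<theta>)" "\<kappa> \<in> KS" "\<theta> \<in> K" using KB_subset_KS[of B] by auto
      show "?f x \<le> (case x of (\<kappa>, \<theta>) \<Rightarrow> ?g \<kappa> \<theta>)"
        using prod_ll_le[OF x(2,3) i0] unfolding x(1) R_def by (simp only: prod.case)
    qed
    also have "\<dots> = (\<Sum>\<theta> | \<theta> \<in> K \<and> den (\<theta> 0) \<in> {1..B}. \<Sum>\<kappa>\<in>KB B. ?g \<kappa> \<theta>)"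
      by (subst sum.cartesian_product[symmetric]) (rule sum.swap)
    also have "\<dots> \<le> (\<Sum>\<theta> | \<theta> \<in> K \<and> den (\<theta> 0) \<in> {1..B}. R * (C * Z) ^ 5 * real (den (\<theta> 0)) powr (-9/4))"
    proof (rule sum_mono)
      fix \<theta> assume "\<theta> \<in> {\<theta> \<in> K. den (\<theta> 0) \<in> {1..B}}"
      then have \<theta>: "\<theta> \<in> K" "den (\<theta> 0) \<in> {1..B}" by auto
      let ?t = "den (\<theta> 0)"
      have t: "?t > 0" using \<theta> by simp
      have "(\<Sum>\<kappa>\<in>KB B. \<Prod>j<5. real (rho ?t (\<kappa> j)) powr (-11/8)) = (\<Prod>j<(5::nat). \<Sum>a\<in>{1..B}. real (rho ?t a) powr (-11/8))"
        unfolding KB_def by (rule prod_sum_PiE[symmetric]) auto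
      also have "\<dots> \<le> (\<Prod>j<(5::nat). C * Z * real ?t powr (1/80))"
      proof (intro prod_mono conjI sum_nonneg)
        have "(\<Sum>a\<in>{1..B}. real (rho ?t a) powr (-11/8)) \<le> real (ndiv ?t) * Z"
          using sum_div_gcd_powr_le[OF t Z(2), of B] by (simp add: rho_def)
        also have "\<dots> \<le> (C * real ?t powr (1/80)) * Z" using C(2)[OF t] Z by (intro mult_right_mono) auto
        finally show "(\<Sum>a\<in>{1..B}. real (rho ?t a) powr (-11/8)) \<le> C * Z * real ?t powr (1/80)" by (simp add: mult_ac)
      qed auto
      also have "\<dots> = (C * Z) ^ 5 * real ?t powr (1/16)"
        using t by (simp add: power_mult_distrib powr_power)
      finally have *: "(\<Sum>\<kappa>\<in>KB B. \<Prod>j<5. real (rho ?t (\<kappa> j)) powr (-11/8)) \<le> (C * Z) ^ 5 * real ?t powr (1/16)" .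
      have "(\<Sum>\<kappa>\<in>KB B. ?g \<kappa> \<theta>) = R * real ?t powr (-37/16) * (\<Sum>\<kappa>\<in>KB B. \<Prod>j<5. real (rho ?t (\<kappa> j)) powr (-11/8))"
        by (simp add: sum_distrib_left)
      also have "\<dots> \<le> R * real ?t powr (-37/16) * ((C * Z) ^ 5 * real ?t powr (1/16))"
        using * by (intro mult_left_mono) (auto simp: R_def)
      also have "\<dots> = R * (C * Z) ^ 5 * (real ?t powr (-37/16) * real ?t powr (1/16))" by (simp add: mult_ac)
      also have "real ?t powr (-37/16) * real ?t powr (1/16) = real ?t powr (-9/4)" by (simp add: powr_add[symmetric])
      finally show "(\<Sum>\<kappa>\<in>KB B. ?g \<kappa> \<theta>) \<le> R * (C * Z) ^ 5 * real ?t powr (-9/4)" .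
    qed
    also have "\<dots> = (\<Sum>t\<in>{1..B}. \<Sum>\<theta> | \<theta> \<in> K \<and> den (\<theta> 0) = t. R * (C * Z) ^ 5 * real (den (\<theta> 0)) powr (-9/4))"
      unfolding eqK by (rule sum.UNION_disjoint) (auto simp: card_K_den(1))
    also have "\<dots> = (\<Sum>t\<in>{1..B}. real (card {\<theta> \<in> K. den (\<theta> 0) = t}) * (R * (C * Z) ^ 5 * real t powr (-9/4)))"
      by (intro sum.cong refl) simp
    also have "\<dots> \<le> (\<Sum>t\<in>{1..B}. real (t * RR) * (R * (C * Z) ^ 5 * real t powr (-9/4)))"
      using card_K_den(2) Z C by (intro sum_mono mult_right_mono) (auto simp: R_def simp del: of_nat_mult)
    also have "\<dots> = (\<Sum>t\<in>{1..B}. W * real t powr (-(5/4)))"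
    proof (intro sum.cong refl)
      fix t assume "t \<in> {1..B}"
      then have "real t * real t powr (-9/4) = real t powr (-(5/4))" by (simp add: powr_mult_base)
      then show "real (t * RR) * (R * (C * Z) ^ 5 * real t powr (-9/4)) = W * real t powr (-(5/4))"
        by (simp add: W_def mult_ac)
    qed
    also have "\<dots> = W * (\<Sum>t\<in>{1..B}. real t powr (-(5/4)))" by (simp add: sum_distrib_left)
    also have "\<dots> \<le> W * Y" using W0 Y by (intro mult_left_mono)
    finally show ?thesis .
  qed
  show ?thesis
    by (rule nonneg_bdd_above_summable_on) (use bound in \<open>auto intro!: prod_nonneg bdd_aboveI2\<close>)
qed

end

section \<open>Expansion of the main term\<close>

lemma summable_on_abs_bound:
  fixes f g :: "'a \<Rightarrow> real"
  assumes "g summable_on A" "\<And>x. x \<in> A \<Longrightarrow> \<bar>f x\<bar> \<le> g x"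
  shows "f summable_on A"
proof -
  have "(\<lambda>x. norm (g x)) summable_on A" using assms(1) unfolding summable_on_iff_abs_summable_on_real[of g] .
  then have "(\<lambda>x. norm (f x)) summable_on A"
    by (rule Infinite_Sum.abs_summable_on_comparison_test) (use assms(2) in \<open>fastforce intro: order.trans[OF _ abs_ge_self]\<close>)
  then show ?thesis by (rule Infinite_Sum.abs_summable_summable)
qed

lemma infsum_abs_diff_le:
  fixes f g h :: "'a \<Rightarrow> real"
  assumes "f summable_on A" "g summable_on A" "h summable_on A" "\<And>x. x \<in> A \<Longrightarrow> \<bar>f x - g x\<bar> \<le> h x"
  shows "\<bar>infsum f A - infsum g A\<bar> \<le> infsum h A"
proof -
  have "infsum f A \<le> infsum (\<lambda>x. g x + h x) A"
    using assms by (intro infsum_mono summable_on_add) (auto simp: abs_le_iff algebra_simps)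
  moreover have "infsum g A \<le> infsum (\<lambda>x. f x + h x) A"
  proof (intro infsum_mono summable_on_add assms(1-3))
    fix x assume "x \<in> A"
    then show "g x \<le> f x + h x" using assms(4)[of x] by (auto simp: abs_le_iff)
  qed
  ultimately show ?thesis using assms by (simp add: infsum_add abs_le_iff)
qed

lemma infsum_sum_real:
  fixes f :: "'b \<Rightarrow> 'a \<Rightarrow> real"
  assumes "finite I" "\<And>i. i \<in> I \<Longrightarrow> f i summable_on A"
  shows "infsum (\<lambda>x. \<Sum>i\<in>I. f i x) A = (\<Sum>i\<in>I. infsum (f i) A)" "(\<lambda>x. \<Sum>i\<in>I. f i x) summable_on A"
proof -
  have "infsum (\<lambda>x. \<Sum>i\<in>I. f i x) A = (\<Sum>i\<in>I. infsum (f i) A) \<and> (\<lambda>x. \<Sum>i\<in>I. f i x) summable_on A"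
    using assms by (induction I rule: finite_induct) (auto simp: infsum_add summable_on_add)
  then show "infsum (\<lambda>x. \<Sum>i\<in>I. f i x) A = (\<Sum>i\<in>I. infsum (f i) A)" "(\<lambda>x. \<Sum>i\<in>I. f i x) summable_on A" by auto
qed

text \<open>The factors are exchanged one at a time; i0 is the position where the exchange takes
  place.\<close>

lemma abs_prod_diff_le:
  fixes h a M :: "nat \<Rightarrow> real"
  assumes "\<And>i. i < 3 \<Longrightarrow> \<bar>h i\<bar> \<le> M i" "\<And>i. i < 3 \<Longrightarrow> \<bar>a i\<bar> \<le> M i"
  shows "\<bar>(\<Prod>i<3. h i) - (\<Prod>i<3. a i)\<bar> \<le> (\<Sum>i0<3. \<Prod>i<3. if i = i0 then \<bar>h i - a i\<bar> else M i)"
proof -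
  have p3: "(\<Prod>i<(3::nat). f i) = f 0 * f 1 * f 2" and s3: "(\<Sum>i<(3::nat). f i) = f 0 + f 1 + f 2" for f :: "nat \<Rightarrow> real"
    by (simp_all add: eval_nat_numeral)
  have M: "\<bar>h 0\<bar> \<le> M 0" "\<bar>h 1\<bar> \<le> M 1" "\<bar>h 2\<bar> \<le> M 2" "\<bar>a 0\<bar> \<le> M 0" "\<bar>a 1\<bar> \<le> M 1" "\<bar>a 2\<bar> \<le> M 2"
    using assms by auto
  have M0: "0 \<le> M 0" "0 \<le> M 1" "0 \<le> M 2" using M by linarith+
  have tri: "\<bar>x + y + z\<bar> \<le> \<bar>x\<bar> + \<bar>y\<bar> + \<bar>z\<bar>" for x y z :: real by linarith
  have "h 0 * h 1 * h 2 - a 0 * a 1 * a 2 = (h 0 - a 0) * h 1 * h 2 + a 0 * (h 1 - a 1) * h 2 + a 0 * a 1 * (h 2 - a 2)"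
    by (simp add: algebra_simps)
  from arg_cong[OF this, of abs]
  have "\<bar>h 0 * h 1 * h 2 - a 0 * a 1 * a 2\<bar> \<le> \<bar>(h 0 - a 0) * h 1 * h 2\<bar> + \<bar>a 0 * (h 1 - a 1) * h 2\<bar> + \<bar>a 0 * a 1 * (h 2 - a 2)\<bar>"
    by (rule ord_eq_le_trans[OF _ tri])
  also have "\<dots> = \<bar>h 0 - a 0\<bar> * \<bar>h 1\<bar> * \<bar>h 2\<bar> + \<bar>a 0\<bar> * \<bar>h 1 - a 1\<bar> * \<bar>h 2\<bar> + \<bar>a 0\<bar> * \<bar>a 1\<bar> * \<bar>h 2 - a 2\<bar>"
    by (simp only: abs_mult)
  also have "\<dots> \<le> \<bar>h 0 - a 0\<bar> * M 1 * M 2 + M 0 * \<bar>h 1 - a 1\<bar> * M 2 + M 0 * M 1 * \<bar>h 2 - a 2\<bar>"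
    by (intro add_mono mult_mono M M0 order.refl mult_nonneg_nonneg abs_ge_zero)
  also have "\<dots> = (\<Sum>i0<3. \<Prod>i<3. if i = i0 then \<bar>h i - a i\<bar> else M i)" unfolding p3 s3 by simp
  finally show ?thesis unfolding p3 .
qed

context three_forms
begin

text \<open>The density of \<open>Lam D\<close> among the integer points, by
  \<open>card_Lam_box\<close>.\<close>

definition dlt :: "(nat \<Rightarrow> nat) \<Rightarrow> real" where
  "dlt D = real (card (KD D)) / (\<Prod>i<3. real (D i))"

definition DB :: "nat \<Rightarrow> (nat \<Rightarrow> nat) set" where "DB B = PiE {..<3} (\<lambda>_. {1..B})"

text \<open>The contribution of one point x once the indicator of the lattice is replaced by its
  density, up to the factor 8 of the hyperbola method; z i stands for |L_i(x)|.\<close>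

definition Hsum :: "((nat \<Rightarrow> nat) \<Rightarrow> real) \<Rightarrow> nat \<Rightarrow> (nat \<Rightarrow> nat) \<Rightarrow> real" where
  "Hsum lam B z = (\<Sum>\<kappa>\<in>KB B. \<Sum>d\<in>DB B. lam \<kappa> * dlt (\<lambda>i. kk i \<kappa> * d i) * (\<Prod>i<3. hw ((d i)\<^sup>2 * kk i \<kappa>) (z i)))"

text \<open>The contribution of one pair (\<kappa>, \<theta>), in which the three variables have
  separated. In \<open>pterm\<close> the factors \<open>Hom\<close> are replaced by their asymptotic
  values, with constant term \<open>bb\<close>.\<close>

definition hterm :: "((nat \<Rightarrow> nat) \<Rightarrow> real) \<Rightarrow> (nat \<Rightarrow> nat) \<Rightarrow> (nat \<Rightarrow> nat) \<times> (nat \<Rightarrow> real) \<Rightarrow> real" where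
  "hterm lam z = (\<lambda>(\<kappa>, \<theta>). lam \<kappa> * (\<Prod>i<3. Hom (ss i \<kappa> \<theta>) (z i) / real (ll i \<kappa> \<theta>)))"

definition bb :: "nat \<Rightarrow> (nat \<Rightarrow> nat) \<Rightarrow> (nat \<Rightarrow> real) \<Rightarrow> real" where
  "bb i \<kappa> \<theta> = euler_mascheroni - ln (real (ss i \<kappa> \<theta>)) / 2"

definition pterm :: "((nat \<Rightarrow> nat) \<Rightarrow> real) \<Rightarrow> (nat \<Rightarrow> nat) \<Rightarrow> (nat \<Rightarrow> nat) \<times> (nat \<Rightarrow> real) \<Rightarrow> real" where
  "pterm lam z = (\<lambda>(\<kappa>, \<theta>). lam \<kappa> * (\<Prod>i<3. (ln (real (z i)) / 2 + bb i \<kappa> \<theta>) / real (ll i \<kappa> \<theta>)))"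

text \<open>The coefficient of the product of ln (z i) over i in S when the three linear factors of
  \<open>pterm\<close> are multiplied out and summed.\<close>

definition pc :: "((nat \<Rightarrow> nat) \<Rightarrow> real) \<Rightarrow> nat set \<Rightarrow> real" where
  "pc lam S = infsum (\<lambda>(\<kappa>, \<theta>). lam \<kappa> * ((\<Prod>i\<in>S. 1/2) * (\<Prod>i\<in>{..<3} - S. bb i \<kappa> \<theta>)) / (\<Prod>i<3. real (ll i \<kappa> \<theta>))) (KS \<times> K)"

lemma card_slots: "card (slots i) = 4"
  by (simp add: slots_def)

lemma kk_le_KB: assumes "\<kappa> \<in> KB B" "i < 3" shows "kk i \<kappa> \<le> B ^ 4"
proof -
  have "kk i \<kappa> \<le> (\<Prod>j\<in>slots i. B)" unfolding kk_def
    using assms slots_subset[OF assms(2)] by (intro prod_mono) (auto simp: KB_def PiE_def Pi_def)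
  then show ?thesis by (simp add: card_slots)
qed

lemma finite_DB: "finite (DB B)"
  unfolding DB_def by (intro finite_PiE) auto

text \<open>Opening the density as a sum over torus points separates the d_i. The sum extends to all
  \<kappa> and \<theta> without any error, because outside the finite range some \<open>ss\<close>
  exceeds its z i and that factor \<open>Hom\<close> vanishes.\<close>

lemma Hsum_eq_infsum:
  assumes z: "\<And>i. i < 3 \<Longrightarrow> z i \<le> B"
  shows "Hsum lam B z = infsum (hterm lam z) (KS \<times> K)"
proof -
  \<comment> \<open>The order of \<theta> 0 divides k_0 d_0, and k_0 has four components, so it is
    at most B^4 * B. Conversely an order above B^5 forces \<open>ee 0\<close> above B.\<close>
  let ?KK = "{\<theta> \<in> K. den (\<theta> 0) \<in> {1..B ^ 5}}"
  have eqK: "?KK = (\<Union>t\<in>{1..B ^ 5}. {\<theta> \<in> K. den (\<theta> 0) = t})" by auto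
  have finK: "finite ?KK" unfolding eqK using card_K_den(1) by auto
  have inner: "(\<Sum>d\<in>DB B. lam \<kappa> * dlt (\<lambda>i. kk i \<kappa> * d i) * (\<Prod>i<3. hw ((d i)\<^sup>2 * kk i \<kappa>) (z i)))
      = (\<Sum>\<theta>\<in>?KK. hterm lam z (\<kappa>, \<theta>))" if \<kappa>: "\<kappa> \<in> KB B" for \<kappa>
  proof -
    have \<kappa>S: "\<kappa> \<in> KS" using \<kappa> KB_subset_KS by auto
    have kd: "real (card (KD (\<lambda>i. kk i \<kappa> * d i))) = (\<Sum>\<theta>\<in>?KK. \<Prod>i<3. if den (\<theta> i) dvd kk i \<kappa> * d i then 1 else 0)"
      if d: "d \<in> DB B" for d
    proof -
      have "KD (\<lambda>i. kk i \<kappa> * d i) = {\<theta> \<in> ?KK. \<forall>i<3. den (\<theta> i) dvd kk i \<kappa> * d i}"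
      proof -
        have "den (\<theta> 0) \<in> {1..B ^ 5}" if \<theta>: "\<theta> \<in> K" "den (\<theta> 0) dvd kk 0 \<kappa> * d 0" for \<theta>
        proof -
          have d0: "1 \<le> d 0" "d 0 \<le> B" using d by (auto simp: DB_def PiE_def Pi_def)
          have "den (\<theta> 0) \<le> kk 0 \<kappa> * d 0" using \<theta>(2) kk_pos[OF \<kappa>S, of 0] d0 by (intro dvd_imp_le) auto
          also have "\<dots> \<le> B ^ 4 * B" using kk_le_KB[OF \<kappa>, of 0] d0 by (intro mult_mono) auto
          also have "\<dots> = B ^ 5" by (simp add: power_Suc2[symmetric])
          finally show ?thesis using den_pos_K[OF \<theta>(1), of 0] by simp
        qed
        then show ?thesis by (auto simp: KD_def)
      qed
      then have "real (card (KD (\<lambda>i. kk i \<kappa> * d i))) = (\<Sum>\<theta>\<in>?KK. if \<forall>i<3. den (\<theta> i) dvd kk i \<kappa> * d i then 1 else 0)"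
        using finK by (simp add: sum.If_cases Int_def)
      also have "\<dots> = (\<Sum>\<theta>\<in>?KK. \<Prod>i<3. if den (\<theta> i) dvd kk i \<kappa> * d i then 1 else 0)"
      proof (rule sum.cong[OF refl])
        fix \<theta>
        show "(if \<forall>i<3. den (\<theta> i) dvd kk i \<kappa> * d i then 1 else 0) = (\<Prod>i<3. if den (\<theta> i) dvd kk i \<kappa> * d i then 1 else (0::real))"
        proof (cases "\<forall>i<3. den (\<theta> i) dvd kk i \<kappa> * d i")
          case False
          then have "\<exists>i\<in>{..<3}. (if den (\<theta> i) dvd kk i \<kappa> * d i then 1 else (0::real)) = 0" by auto
          then have "(\<Prod>i<3. if den (\<theta> i) dvd kk i \<kappa> * d i then 1 else (0::real)) = 0" by (intro prod_zero) auto
          then show ?thesis using False by simp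
        qed (auto intro!: prod.neutral[symmetric])
      qed
      finally show ?thesis .
    qed
    have "(\<Sum>d\<in>DB B. lam \<kappa> * dlt (\<lambda>i. kk i \<kappa> * d i) * (\<Prod>i<3. hw ((d i)\<^sup>2 * kk i \<kappa>) (z i)))
      = (\<Sum>d\<in>DB B. \<Sum>\<theta>\<in>?KK. lam \<kappa> * (\<Prod>i<3. if den (\<theta> i) dvd kk i \<kappa> * d i then hw ((d i)\<^sup>2 * kk i \<kappa>) (z i) / (real (kk i \<kappa>) * real (d i)) else 0))"
    proof (rule sum.cong[OF refl])
      fix d assume d: "d \<in> DB B"
      have "lam \<kappa> * dlt (\<lambda>i. kk i \<kappa> * d i) * (\<Prod>i<3. hw ((d i)\<^sup>2 * kk i \<kappa>) (z i))
        = (\<Sum>\<theta>\<in>?KK. lam \<kappa> * ((\<Prod>i<3. if den (\<theta> i) dvd kk i \<kappa> * d i then 1 else 0) * (\<Prod>i<3. hw ((d i)\<^sup>2 * kk i \<kappa>) (z i)) / (\<Prod>i<3. real (kk i \<kappa> * d i))))"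
        unfolding dlt_def kd[OF d] by (simp add: sum_distrib_left sum_distrib_right sum_divide_distrib mult_ac)
      also have "\<dots> = (\<Sum>\<theta>\<in>?KK. lam \<kappa> * (\<Prod>i<3. if den (\<theta> i) dvd kk i \<kappa> * d i then hw ((d i)\<^sup>2 * kk i \<kappa>) (z i) / (real (kk i \<kappa>) * real (d i)) else 0))"
        unfolding prod.distrib[symmetric] prod_dividef[symmetric]
        by (intro sum.cong refl arg_cong2[of _ _ _ _ "(*)"] prod.cong) auto
      finally show "lam \<kappa> * dlt (\<lambda>i. kk i \<kappa> * d i) * (\<Prod>i<3. hw ((d i)\<^sup>2 * kk i \<kappa>) (z i))
        = (\<Sum>\<theta>\<in>?KK. lam \<kappa> * (\<Prod>i<3. if den (\<theta> i) dvd kk i \<kappa> * d i then hw ((d i)\<^sup>2 * kk i \<kappa>) (z i) / (real (kk i \<kappa>) * real (d i)) else 0))" .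
    qed
    also have "\<dots> = (\<Sum>\<theta>\<in>?KK. lam \<kappa> * (\<Sum>d\<in>DB B. \<Prod>i<3. if den (\<theta> i) dvd kk i \<kappa> * d i then hw ((d i)\<^sup>2 * kk i \<kappa>) (z i) / (real (kk i \<kappa>) * real (d i)) else 0))"
      by (subst sum.swap) (simp add: sum_distrib_left)
    also have "\<dots> = (\<Sum>\<theta>\<in>?KK. hterm lam z (\<kappa>, \<theta>))"
    proof (rule sum.cong[OF refl])
      fix \<theta> assume \<theta>: "\<theta> \<in> ?KK"
      have "(\<Sum>d\<in>DB B. \<Prod>i<3. if den (\<theta> i) dvd kk i \<kappa> * d i then hw ((d i)\<^sup>2 * kk i \<kappa>) (z i) / (real (kk i \<kappa>) * real (d i)) else 0)
        = (\<Prod>i<3. \<Sum>d\<in>{1..B}. if den (\<theta> i) dvd kk i \<kappa> * d then hw (d\<^sup>2 * kk i \<kappa>) (z i) / (real (kk i \<kappa>) * real d) else 0)"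
        unfolding DB_def by (rule prod_sum_PiE[symmetric]) auto
      also have "\<dots> = (\<Prod>i<3. Hom (ss i \<kappa> \<theta>) (z i) / real (ll i \<kappa> \<theta>))"
      proof (rule prod.cong[OF refl])
        fix i :: nat assume "i \<in> {..<3}"
        then have i: "i < 3" by simp
        show "(\<Sum>d\<in>{1..B}. if den (\<theta> i) dvd kk i \<kappa> * d then hw (d\<^sup>2 * kk i \<kappa>) (z i) / (real (kk i \<kappa>) * real d) else 0) = Hom (ss i \<kappa> \<theta>) (z i) / real (ll i \<kappa> \<theta>)"
          unfolding ss_def ll_def ee_def by (rule sum_dvd_hw[OF kk_pos[OF \<kappa>S i] den_pos_K[OF _ i] z[OF i]]) (use \<theta> in simp)
      qed
      finally show "lam \<kappa> * (\<Sum>d\<in>DB B. \<Prod>i<3. if den (\<theta> i) dvd kk i \<kappa> * d i then hw ((d i)\<^sup>2 * kk i \<kappa>) (z i) / (real (kk i \<kappa>) * real (d i)) else 0) = hterm lam z (\<kappa>, \<theta>)"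
        by (simp add: hterm_def)
    qed
    finally show ?thesis .
  qed
  have "Hsum lam B z = (\<Sum>x\<in>KB B \<times> ?KK. hterm lam z x)"
    unfolding Hsum_def by (subst sum.cartesian_product') (simp add: inner cong: sum.cong)
  also have "\<dots> = infsum (hterm lam z) (KB B \<times> ?KK)" using finK finite_KB by simp
  also have "\<dots> = infsum (hterm lam z) (KS \<times> K)"
  proof (rule infsum_cong_neutral)
    fix x assume x: "x \<in> KS \<times> K - KB B \<times> ?KK"
    then obtain \<kappa> \<theta> where k: "x = (\<kappa>, \<theta>)" "\<kappa> \<in> KS" "\<theta> \<in> K" by auto
    have "\<exists>i<3. z i < ss i \<kappa> \<theta>"
    proof (cases "\<kappa> \<in> KB B")
      case False
      then obtain j where j: "j < 5" "\<kappa> j > B" using k by (auto simp: KS_def KB_def PiE_def Pi_def)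
      obtain i where i: "i < 3" "j \<in> slots i" using slot_ex[OF j(1)] by blast
      have "\<kappa> j \<le> kk i \<kappa>" using kk_dvd_slot[OF i(2)] kk_pos[OF k(2) i(1)] by (rule dvd_imp_le)
      then have "z i < ss i \<kappa> \<theta>" using j z[OF i(1)] ss_bounds(3)[OF k(2,3) i(1)] by linarith
      then show ?thesis using i by auto
    next
      case True
      then have "den (\<theta> 0) > B ^ 5" using x k den_pos_K[OF k(3), of 0] by auto
      also have "den (\<theta> 0) = ee 0 \<kappa> \<theta> * gcd (den (\<theta> 0)) (kk 0 \<kappa>)" by (simp add: ee_def)
      also have "\<dots> \<le> ee 0 \<kappa> \<theta> * B ^ 4"
      proof (rule mult_left_mono)
        have "gcd (den (\<theta> 0)) (kk 0 \<kappa>) \<le> kk 0 \<kappa>" using kk_pos[OF k(2), of 0] by (intro dvd_imp_le) auto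
        then show "gcd (den (\<theta> 0)) (kk 0 \<kappa>) \<le> B ^ 4" using kk_le_KB[OF True, of 0] by simp
      qed simp
      finally have "B * B ^ 4 < ee 0 \<kappa> \<theta> * B ^ 4" by (simp add: power_Suc[symmetric])
      then have "B < ee 0 \<kappa> \<theta>" by simp
      then have "z 0 < ss 0 \<kappa> \<theta>" using z[of 0] ss_bounds(4)[OF k(2,3), of 0] by simp
      then show ?thesis by (intro exI[of _ 0]) simp
    qed
    then obtain i where "i < 3" "z i < ss i \<kappa> \<theta>" by blast
    then have "\<exists>i\<in>{..<3}. Hom (ss i \<kappa> \<theta>) (z i) / real (ll i \<kappa> \<theta>) = 0" by (intro bexI[of _ i]) (auto simp: Hom_eq_0)
    then have "(\<Prod>i<3. Hom (ss i \<kappa> \<theta>) (z i) / real (ll i \<kappa> \<theta>)) = 0" by (intro prod_zero) auto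
    then show "hterm lam z x = 0" by (simp add: hterm_def k)
  qed (use KB_subset_KS in auto)
  finally show ?thesis .
qed

lemma ln_ll_le: "real (ll i \<kappa> \<theta>) \<ge> 1 \<Longrightarrow> ln (real (ll i \<kappa> \<theta>)) \<le> 16 * real (ll i \<kappa> \<theta>) powr (1/16)"
  using ln_powr_bound[of "real (ll i \<kappa> \<theta>)" "1/16"] by simp

text \<open>From \<open>ss\<close> at most the square of \<open>ll\<close> and ln x <= 16 x powr
  (1/16); the rest of 18 = 16 + 2 covers Euler's constant.\<close>

lemma bb_bound:
  assumes "\<kappa> \<in> KS" "\<theta> \<in> K" "i < 3"
  shows "\<bar>bb i \<kappa> \<theta>\<bar> \<le> 18 * real (ll i \<kappa> \<theta>) powr (1/16)"
proof -
  have l: "real (ll i \<kappa> \<theta>) \<ge> 1" using ll_pos[OF assms] by simp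
  have s: "real (ss i \<kappa> \<theta>) \<ge> 1" "real (ss i \<kappa> \<theta>) \<le> (real (ll i \<kappa> \<theta>))\<^sup>2"
    using ss_bounds(1,2)[OF assms] by (auto simp flip: of_nat_power)
  have "ln (real (ss i \<kappa> \<theta>)) \<le> ln ((real (ll i \<kappa> \<theta>))\<^sup>2)" using s by (intro ln_mono) auto
  also have "\<dots> = 2 * ln (real (ll i \<kappa> \<theta>))" using l by (simp add: ln_realpow)
  finally have "ln (real (ss i \<kappa> \<theta>)) / 2 \<le> 16 * real (ll i \<kappa> \<theta>) powr (1/16)" using ln_ll_le[OF l] by linarith
  moreover have "0 \<le> ln (real (ss i \<kappa> \<theta>))" using s by simp
  moreover have "1 \<le> real (ll i \<kappa> \<theta>) powr (1/16)" using l by (simp add: ge_one_powr_ge_zero)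
  moreover have "(euler_mascheroni::real) > 0" "(euler_mascheroni::real) \<le> 2"
    using euler_mascheroni_pos harm_approx[of 1] by (auto simp: harm_def abs_le_iff)
  ultimately show ?thesis unfolding bb_def by (simp add: abs_le_iff)
qed

lemma summable_15_16: "(\<lambda>(\<kappa>, \<theta>). \<Prod>i<3. real (ll i \<kappa> \<theta>) powr (-15/16)) summable_on (KS \<times> K)"
proof (rule summable_on_abs_bound[OF summable_ll[of 0]])
  fix x assume "x \<in> KS \<times> K"
  then obtain \<kappa> \<theta> where x: "x = (\<kappa>, \<theta>)" "\<kappa> \<in> KS" "\<theta> \<in> K" by auto
  have "(\<Prod>i<3. real (ll i \<kappa> \<theta>) powr (-15/16)) \<le> (\<Prod>i<3. real (ll i \<kappa> \<theta>) powr (- aa 0 i))"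
    using ll_pos[OF x(2,3)] by (intro prod_mono conjI powr_mono) (auto simp: aa_def Suc_le_eq)
  then show "\<bar>case x of (\<kappa>, \<theta>) \<Rightarrow> \<Prod>i<3. real (ll i \<kappa> \<theta>) powr (-15/16)\<bar> \<le> (case x of (\<kappa>, \<theta>) \<Rightarrow> \<Prod>i<3. real (ll i \<kappa> \<theta>) powr (- aa 0 i))"
    by (simp add: x abs_prod)
qed simp

lemma powr_div_self: "x \<ge> 1 \<Longrightarrow> x powr a / x = (x::real) powr (a - 1)"
  by (simp add: powr_diff)

text \<open>The power 1/16 of \<open>ll\<close> granted to each f is the room for logarithms; it is
  what separates the exponent 15/16 from 1.\<close>

lemma summable_prod_bound:
  assumes lam: "\<And>\<kappa>. \<bar>lam \<kappa>\<bar> \<le> 1"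
    and f: "\<And>i \<kappa> \<theta>. i < 3 \<Longrightarrow> \<kappa> \<in> KS \<Longrightarrow> \<theta> \<in> K \<Longrightarrow> \<bar>f i \<kappa> \<theta>\<bar> \<le> c i * real (ll i \<kappa> \<theta>) powr (1/16)"
  shows "(\<lambda>(\<kappa>, \<theta>). lam \<kappa> * (\<Prod>i<3. f i \<kappa> \<theta> / real (ll i \<kappa> \<theta>))) summable_on (KS \<times> K)"
proof (rule summable_on_abs_bound)
  show "(\<lambda>x. (\<Prod>i<3. c i) * (case x of (\<kappa>, \<theta>) \<Rightarrow> \<Prod>i<3. real (ll i \<kappa> \<theta>) powr (-15/16))) summable_on (KS \<times> K)"
    by (intro summable_on_cmult_right summable_15_16)
  fix x assume "x \<in> KS \<times> K"
  then obtain \<kappa> \<theta> where x: "x = (\<kappa>, \<theta>)" "\<kappa> \<in> KS" "\<theta> \<in> K" by auto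
  have "\<bar>lam \<kappa> * (\<Prod>i<3. f i \<kappa> \<theta> / real (ll i \<kappa> \<theta>))\<bar> \<le> 1 * (\<Prod>i<3. c i * real (ll i \<kappa> \<theta>) powr (-15/16))"
    unfolding abs_mult abs_prod
  proof (intro mult_mono lam prod_mono conjI prod_nonneg)
    fix i :: nat assume "i \<in> {..<3}"
    then have i: "i < 3" by simp
    have l: "real (ll i \<kappa> \<theta>) \<ge> 1" using ll_pos[OF x(2,3) i] by simp
    have "\<bar>f i \<kappa> \<theta> / real (ll i \<kappa> \<theta>)\<bar> = \<bar>f i \<kappa> \<theta>\<bar> / real (ll i \<kappa> \<theta>)" using l by simp
    also have "\<dots> \<le> c i * real (ll i \<kappa> \<theta>) powr (1/16) / real (ll i \<kappa> \<theta>)" using f[OF i x(2,3)] l by (intro divide_right_mono) auto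
    also have "\<dots> = c i * real (ll i \<kappa> \<theta>) powr (-15/16)" using powr_div_self[OF l, of "1/16"] by (simp flip: times_divide_eq_right)
    finally show "\<bar>f i \<kappa> \<theta> / real (ll i \<kappa> \<theta>)\<bar> \<le> c i * real (ll i \<kappa> \<theta>) powr (-15/16)" .
  qed auto
  then show "\<bar>case x of (\<kappa>, \<theta>) \<Rightarrow> lam \<kappa> * (\<Prod>i<3. f i \<kappa> \<theta> / real (ll i \<kappa> \<theta>))\<bar>
    \<le> (\<Prod>i<3. c i) * (case x of (\<kappa>, \<theta>) \<Rightarrow> \<Prod>i<3. real (ll i \<kappa> \<theta>) powr (-15/16))"
    by (simp add: x prod.distrib)
qed

text \<open>Telescoping leaves three sums, each with the error of \<open>Hom_approx\<close> in one
  factor i0. There z^(-1/4) is gained and a power 1/2 of \<open>ll\<close> is lost, the other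
  factors being logarithmic; \<open>summable_ll\<close> bounds the rest independently of z.\<close>

lemma hterm_pterm:
  assumes lam: "\<And>\<kappa>. \<bar>lam \<kappa>\<bar> \<le> 1"
  shows "\<exists>C\<ge>0. \<forall>z. (\<forall>i<3. z i \<ge> 1) \<longrightarrow> \<bar>infsum (hterm lam z) (KS \<times> K) - infsum (pterm lam z) (KS \<times> K)\<bar>
     \<le> C * (\<Prod>i<3. 1 + ln (real (z i))) * (\<Sum>i<3. real (z i) powr (-1/4))"
proof -
  define T where "T = (\<Sum>i0<3. infsum (\<lambda>(\<kappa>, \<theta>). \<Prod>i<3. real (ll i \<kappa> \<theta>) powr (- aa i0 i)) (KS \<times> K))"
  have Tn: "infsum (\<lambda>(\<kappa>, \<theta>). \<Prod>i<3. real (ll i \<kappa> \<theta>) powr (- aa i0 i)) (KS \<times> K) \<ge> 0" for i0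
    by (intro infsum_nonneg) (auto intro!: prod_nonneg)
  have T0: "T \<ge> 0" unfolding T_def by (intro sum_nonneg Tn)
  have Tle: "infsum (\<lambda>(\<kappa>, \<theta>). \<Prod>i<3. real (ll i \<kappa> \<theta>) powr (- aa i0 i)) (KS \<times> K) \<le> T" if "i0 < 3" for i0
    unfolding T_def using that by (intro member_le_sum Tn) auto
  have "\<bar>infsum (hterm lam z) (KS \<times> K) - infsum (pterm lam z) (KS \<times> K)\<bar>
     \<le> 18 ^ 3 * T * (\<Prod>i<3. 1 + ln (real (z i))) * (\<Sum>i<3. real (z i) powr (-1/4))"
    if z: "\<forall>i<3. z i \<ge> 1" for z
  proof -
    define P where "P = (\<Prod>i<3. 1 + ln (real (z i)))"
    have lnz: "ln (real (z i)) \<ge> 0" if "i < 3" for i using z that by auto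
    have P0: "P \<ge> 0" unfolding P_def using lnz by (intro prod_nonneg) (auto intro: add_nonneg_nonneg)
    define M where "M = (\<lambda>i \<kappa> \<theta>. (18 * (1 + ln (real (z i)))) * real (ll i \<kappa> \<theta>) powr (1/16))"
    have l1: "real (ll i \<kappa> \<theta>) \<ge> 1" if "i < 3" "\<kappa> \<in> KS" "\<theta> \<in> K" for i \<kappa> \<theta> using ll_pos[OF that(2,3,1)] by simp
    have hM: "\<bar>Hom (ss i \<kappa> \<theta>) (z i)\<bar> \<le> M i \<kappa> \<theta>" if "i < 3" "\<kappa> \<in> KS" "\<theta> \<in> K" for i \<kappa> \<theta>
    proof -
      have zi: "z i > 0" using z that by (simp add: Suc_le_eq)
      have "\<bar>Hom (ss i \<kappa> \<theta>) (z i)\<bar> \<le> (1 + ln (real (z i))) * 1"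
        using Hom_nonneg[of "ss i \<kappa> \<theta>" "z i"] Hom_le[OF zi, of "ss i \<kappa> \<theta>"] by (simp only: mult_1_right abs_of_nonneg)
      also have "\<dots> \<le> (18 * (1 + ln (real (z i)))) * real (ll i \<kappa> \<theta>) powr (1/16)"
      proof (rule mult_mono)
        show "1 \<le> real (ll i \<kappa> \<theta>) powr (1/16)" using l1[OF that] by (simp add: ge_one_powr_ge_zero)
        have q: "0 \<le> ln (real (z i))" by (rule lnz[OF that(1)])
        have "x \<le> 18 * x" if "0 \<le> x" for x :: real using that by linarith
        then show "1 + ln (real (z i)) \<le> 18 * (1 + ln (real (z i)))" "0 \<le> 18 * (1 + ln (real (z i)))" using q by auto
      qed simp
      finally show ?thesis by (simp add: M_def)
    qed
    have aM: "\<bar>ln (real (z i)) / 2 + bb i \<kappa> \<theta>\<bar> \<le> M i \<kappa> \<theta>" if "i < 3" "\<kappa> \<in> KS" "\<theta> \<in> K" for i \<kappa> \<theta>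
    proof -
      have "1 \<le> real (ll i \<kappa> \<theta>) powr (1/16)" using l1[OF that] by (simp add: ge_one_powr_ge_zero)
      then have "ln (real (z i)) * 1 \<le> ln (real (z i)) * real (ll i \<kappa> \<theta>) powr (1/16)" using lnz[OF that(1)] by (intro mult_left_mono) auto
      moreover have "\<bar>bb i \<kappa> \<theta>\<bar> \<le> 18 * real (ll i \<kappa> \<theta>) powr (1/16)" using bb_bound that by blast
      ultimately have "\<bar>ln (real (z i)) / 2 + bb i \<kappa> \<theta>\<bar> \<le> 18 * (ln (real (z i)) * real (ll i \<kappa> \<theta>) powr (1/16)) + 18 * real (ll i \<kappa> \<theta>) powr (1/16)"
        using lnz[OF that(1)] by linarith
      then show ?thesis unfolding M_def by (simp only: distrib_left distrib_right mult_1_right mult_1 mult.assoc add.commute)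
    qed
    have dE: "\<bar>Hom (ss i \<kappa> \<theta>) (z i) - (ln (real (z i)) / 2 + bb i \<kappa> \<theta>)\<bar> \<le> 5 * real (z i) powr (-1/4) * real (ll i \<kappa> \<theta>) powr (1/2)"
      if "i < 3" "\<kappa> \<in> KS" "\<theta> \<in> K" for i \<kappa> \<theta>
    proof -
      have zi: "real (z i) > 0" using z that by (simp add: Suc_le_eq)
      have s: "real (ss i \<kappa> \<theta>) \<le> (real (ll i \<kappa> \<theta>))\<^sup>2" using ss_bounds(2)[OF that(2,3,1)] by (simp flip: of_nat_power)
      have "\<bar>Hom (ss i \<kappa> \<theta>) (z i) - (ln (real (z i)) / 2 + bb i \<kappa> \<theta>)\<bar> \<le> 5 * (real (ss i \<kappa> \<theta>) / real (z i)) powr (1/4)"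
        unfolding bb_def using Hom_approx[of "ss i \<kappa> \<theta>" "z i"] ss_bounds(1)[OF that(2,3,1)] zi by simp
      also have "\<dots> = 5 * (real (z i) powr (-1/4) * real (ss i \<kappa> \<theta>) powr (1/4))"
      proof -
        have m: "real (z i) powr (-1/4) = inverse (real (z i) powr (1/4))" using powr_minus[of "real (z i)" "1/4"] by simp
        have "(real (ss i \<kappa> \<theta>) / real (z i)) powr (1/4) = real (ss i \<kappa> \<theta>) powr (1/4) / real (z i) powr (1/4)"
          by (rule powr_divide)
        then show ?thesis unfolding m by (simp only: divide_inverse mult.commute)
      qed
      also have "\<dots> \<le> 5 * (real (z i) powr (-1/4) * real (ll i \<kappa> \<theta>) powr (1/2))"
      proof (intro mult_left_mono)
        have "real (ss i \<kappa> \<theta>) powr (1/4) \<le> ((real (ll i \<kappa> \<theta>))\<^sup>2) powr (1/4)" using s by (intro powr_mono2) auto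
        also have "(real (ll i \<kappa> \<theta>))\<^sup>2 = real (ll i \<kappa> \<theta>) powr 2" using l1[OF that] by (simp add: powr_numeral)
        finally show "real (ss i \<kappa> \<theta>) powr (1/4) \<le> real (ll i \<kappa> \<theta>) powr (1/2)" by (simp only: powr_powr) simp
      qed auto
      finally show ?thesis by (simp only: mult.assoc)
    qed
    define g where "g = (\<lambda>i0 x. (18 ^ 3 * P * real (z i0) powr (-1/4)) * (case x of (\<kappa>, \<theta>) \<Rightarrow> \<Prod>i<3. real (ll i \<kappa> \<theta>) powr (- aa i0 i)))"
    have gs: "g i0 summable_on (KS \<times> K)" if "i0 < 3" for i0
      unfolding g_def by (intro summable_on_cmult_right summable_ll that)
    have "\<bar>infsum (hterm lam z) (KS \<times> K) - infsum (pterm lam z) (KS \<times> K)\<bar> \<le> infsum (\<lambda>x. \<Sum>i0<3. g i0 x) (KS \<times> K)"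
    proof (rule infsum_abs_diff_le)
      show "hterm lam z summable_on KS \<times> K" unfolding hterm_def
        by (rule summable_prod_bound[OF lam, of _ "\<lambda>i. 18 * (1 + ln (real (z i)))"]) (use hM in \<open>simp add: M_def\<close>)
      show "pterm lam z summable_on KS \<times> K" unfolding pterm_def
        by (rule summable_prod_bound[OF lam, of _ "\<lambda>i. 18 * (1 + ln (real (z i)))"]) (use aM in \<open>simp add: M_def\<close>)
      show "(\<lambda>x. \<Sum>i0<3. g i0 x) summable_on KS \<times> K" by (rule infsum_sum_real(2)) (use gs in auto)
      fix x assume "x \<in> KS \<times> K"
      then obtain \<kappa> \<theta> where x: "x = (\<kappa>, \<theta>)" "\<kappa> \<in> KS" "\<theta> \<in> K" by auto
      let ?h = "\<lambda>i. Hom (ss i \<kappa> \<theta>) (z i)" and ?a = "\<lambda>i. ln (real (z i)) / 2 + bb i \<kappa> \<theta>"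
      have L: "(\<Prod>i<3. real (ll i \<kappa> \<theta>)) > 0" using l1 x by (intro prod_pos) (fastforce intro: less_le_trans[of 0 1])
      have "\<bar>hterm lam z x - pterm lam z x\<bar> = \<bar>lam \<kappa>\<bar> * (\<bar>(\<Prod>i<3. ?h i) - (\<Prod>i<3. ?a i)\<bar> / (\<Prod>i<3. real (ll i \<kappa> \<theta>)))"
        using L by (simp add: hterm_def pterm_def x prod_dividef right_diff_distrib[symmetric] diff_divide_distrib[symmetric] abs_mult)
      also have "\<dots> \<le> 1 * (\<bar>(\<Prod>i<3. ?h i) - (\<Prod>i<3. ?a i)\<bar> / (\<Prod>i<3. real (ll i \<kappa> \<theta>)))"
        using lam L by (intro mult_right_mono) auto
      also have "\<dots> \<le> (\<Sum>i0<3. \<Prod>i<3. if i = i0 then \<bar>?h i - ?a i\<bar> else M i \<kappa> \<theta>) / (\<Prod>i<3. real (ll i \<kappa> \<theta>))"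
        unfolding mult_1 using hM aM x L by (intro divide_right_mono abs_prod_diff_le) auto
      also have "\<dots> = (\<Sum>i0<3. \<Prod>i<3. (if i = i0 then \<bar>?h i - ?a i\<bar> else M i \<kappa> \<theta>) / real (ll i \<kappa> \<theta>))"
        by (simp add: sum_divide_distrib prod_dividef)
      also have "\<dots> \<le> (\<Sum>i0<3. g i0 x)"
      proof (rule sum_mono)
        fix i0 :: nat assume "i0 \<in> {..<3}"
        then have i0: "i0 < 3" by simp
        have "(\<Prod>i<3. (if i = i0 then \<bar>?h i - ?a i\<bar> else M i \<kappa> \<theta>) / real (ll i \<kappa> \<theta>))
          \<le> (\<Prod>i<3. (18 * (1 + ln (real (z i))) * (if i = i0 then real (z i0) powr (-1/4) else 1)) * real (ll i \<kappa> \<theta>) powr (- aa i0 i))"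
        proof (intro prod_mono conjI)
          fix i :: nat assume "i \<in> {..<3}"
          then have i: "i < 3" by simp
          note l = l1[OF i x(2,3)]
          show "0 \<le> (if i = i0 then \<bar>?h i - ?a i\<bar> else M i \<kappa> \<theta>) / real (ll i \<kappa> \<theta>)"
            using lnz[OF i] by (auto simp: M_def)
          show "(if i = i0 then \<bar>?h i - ?a i\<bar> else M i \<kappa> \<theta>) / real (ll i \<kappa> \<theta>) \<le> (18 * (1 + ln (real (z i))) * (if i = i0 then real (z i0) powr (-1/4) else 1)) * real (ll i \<kappa> \<theta>) powr (- aa i0 i)"
          proof (cases "i = i0")
            case True
            have "\<bar>?h i - ?a i\<bar> / real (ll i \<kappa> \<theta>) \<le> 5 * real (z i) powr (-1/4) * real (ll i \<kappa> \<theta>) powr (1/2) / real (ll i \<kappa> \<theta>)"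
              using dE[OF i x(2,3)] by (intro divide_right_mono) auto
            also have "\<dots> = 5 * real (z i) powr (-1/4) * real (ll i \<kappa> \<theta>) powr (-1/2)"
              using powr_div_self[OF l, of "1/2"] by (simp flip: times_divide_eq_right)
            also have "\<dots> \<le> (18 * (1 + ln (real (z i))) * real (z i) powr (-1/4)) * real (ll i \<kappa> \<theta>) powr (-7/16)"
              using l lnz[OF i] by (intro mult_mono powr_mono mult_right_mono) auto
            finally show ?thesis using True by (simp add: aa_def)
          next
            case False
            then show ?thesis using powr_div_self[OF l, of "1/16"] by (simp add: M_def aa_def flip: times_divide_eq_right)
          qed
        qed
        also have "\<dots> = g i0 x"
          unfolding prod.distrib using i0 by (simp add: g_def x P_def)
        finally show "(\<Prod>i<3. (if i = i0 then \<bar>?h i - ?a i\<bar> else M i \<kappa> \<theta>) / real (ll i \<kappa> \<theta>)) \<le> g i0 x" .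
      qed
      finally show "\<bar>hterm lam z x - pterm lam z x\<bar> \<le> (\<Sum>i0<3. g i0 x)" .
    qed
    also have "\<dots> = (\<Sum>i0<3. infsum (g i0) (KS \<times> K))" by (rule infsum_sum_real(1)) (use gs in auto)
    also have "\<dots> \<le> (\<Sum>i0<3. (18 ^ 3 * P * real (z i0) powr (-1/4)) * T)"
    proof (rule sum_mono)
      fix i0 :: nat assume i0: "i0 \<in> {..<3}"
      have "infsum (g i0) (KS \<times> K) = (18 ^ 3 * P * real (z i0) powr (-1/4)) * infsum (\<lambda>(\<kappa>, \<theta>). \<Prod>i<3. real (ll i \<kappa> \<theta>) powr (- aa i0 i)) (KS \<times> K)"
        unfolding g_def by (rule infsum_cmult_right')
      also have "\<dots> \<le> (18 ^ 3 * P * real (z i0) powr (-1/4)) * T" using Tle[of i0] i0 P0 by (intro mult_left_mono) auto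
      finally show "infsum (g i0) (KS \<times> K) \<le> (18 ^ 3 * P * real (z i0) powr (-1/4)) * T" .
    qed
    also have "\<dots> = 18 ^ 3 * T * P * (\<Sum>i<3. real (z i) powr (-1/4))" by (simp add: sum_distrib_left mult_ac)
    finally show ?thesis by (simp add: P_def)
  qed
  then show ?thesis using T0 by (intro exI[of _ "18 ^ 3 * T"]) auto
qed

lemma infsum_pterm:
  assumes lam: "\<And>\<kappa>. \<bar>lam \<kappa>\<bar> \<le> 1"
  shows "infsum (pterm lam z) (KS \<times> K) = (\<Sum>S\<in>Pow {..<3}. pc lam S * (\<Prod>i\<in>S. ln (real (z i))))"
proof -
  define u where "u = (\<lambda>S x. case x of (\<kappa>, \<theta>) \<Rightarrow> lam \<kappa> * ((\<Prod>i\<in>S. 1/2) * (\<Prod>i\<in>{..<3} - S. bb i \<kappa> \<theta>)) / (\<Prod>i<3. real (ll i \<kappa> \<theta>)))"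
  have us: "u S summable_on (KS \<times> K)" if "S \<subseteq> {..<3}" for S
  proof -
    have split: "(\<Prod>i<3. if i \<in> S then f i else g i) = (\<Prod>i\<in>S. f i) * (\<Prod>i\<in>{..<3} - S. g i)" for f g :: "nat \<Rightarrow> real"
      using that by (simp add: prod.If_cases Int_absorb1 Diff_eq)
    have "u S = (\<lambda>(\<kappa>, \<theta>). lam \<kappa> * (\<Prod>i<3. (if i \<in> S then 1/2 else bb i \<kappa> \<theta>) / real (ll i \<kappa> \<theta>)))"
      by (auto simp: u_def fun_eq_iff prod_dividef split)
    moreover have "(\<lambda>(\<kappa>, \<theta>). lam \<kappa> * (\<Prod>i<3. (if i \<in> S then 1/2 else bb i \<kappa> \<theta>) / real (ll i \<kappa> \<theta>))) summable_on (KS \<times> K)"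
    proof (rule summable_prod_bound[OF lam, of _ "\<lambda>i. 18"])
      fix i :: nat and \<kappa> \<theta> assume a: "i < 3" "\<kappa> \<in> KS" "\<theta> \<in> K"
      have "1 \<le> real (ll i \<kappa> \<theta>) powr (1/16)" using ll_pos[OF a(2,3,1)] by (simp add: ge_one_powr_ge_zero Suc_le_eq)
      then show "\<bar>if i \<in> S then 1/2 else bb i \<kappa> \<theta>\<bar> \<le> 18 * real (ll i \<kappa> \<theta>) powr (1/16)"
        using bb_bound[OF a(2,3,1)] by simp
    qed
    ultimately show ?thesis by simp
  qed
  have "pterm lam z x = (\<Sum>S\<in>Pow {..<3}. u S x * (\<Prod>i\<in>S. ln (real (z i))))" for x
  proof -
    obtain \<kappa> \<theta> where x: "x = (\<kappa>, \<theta>)" by (cases x)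
    have "(\<Prod>i<3. ln (real (z i)) / 2 + bb i \<kappa> \<theta>) = (\<Sum>S\<in>Pow {..<3}. (\<Prod>i\<in>S. ln (real (z i)) / 2) * (\<Prod>i\<in>{..<3} - S. bb i \<kappa> \<theta>))"
      by (rule prod_add) simp
    also have "\<dots> = (\<Sum>S\<in>Pow {..<3}. (\<Prod>i\<in>S. ln (real (z i))) * ((\<Prod>i\<in>S. 1/2) * (\<Prod>i\<in>{..<3} - S. bb i \<kappa> \<theta>)))"
      unfolding mult.assoc[symmetric] prod.distrib[symmetric] by simp
    finally show ?thesis
      by (simp add: pterm_def x u_def prod_dividef sum_distrib_left sum_divide_distrib mult_ac)
  qed
  then have "infsum (pterm lam z) (KS \<times> K) = infsum (\<lambda>x. \<Sum>S\<in>Pow {..<3}. u S x * (\<Prod>i\<in>S. ln (real (z i)))) (KS \<times> K)"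
    by (intro infsum_cong)
  also have "\<dots> = (\<Sum>S\<in>Pow {..<3}. infsum (\<lambda>x. u S x * (\<Prod>i\<in>S. ln (real (z i)))) (KS \<times> K))"
    by (rule infsum_sum_real(1)) (auto intro!: summable_on_cmult_left us)
  also have "\<dots> = (\<Sum>S\<in>Pow {..<3}. pc lam S * (\<Prod>i\<in>S. ln (real (z i))))"
    by (simp add: infsum_cmult_left' pc_def u_def)
  finally show ?thesis .
qed

definition lam1 :: "(nat \<Rightarrow> nat) \<Rightarrow> real" where
  "lam1 \<kappa> = (if \<forall>j<5. \<kappa> j = 1 then 1 else 0)"

text \<open>For the full set no factor \<open>bb\<close> occurs, so all terms are nonnegative, and
  the term at \<kappa> = 1, \<theta> = 0 is positive.\<close>

lemma pc_lam1_pos: "pc lam1 {..<3} > 0"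
proof -
  let ?f = "\<lambda>(\<kappa>, \<theta>). lam1 \<kappa> * ((\<Prod>i<(3::nat). 1/2) * (\<Prod>i\<in>{..<3} - {..<3}. bb i \<kappa> \<theta>)) / (\<Prod>i<3. real (ll i \<kappa> \<theta>))"
  let ?\<kappa> = "\<lambda>j\<in>{..<5::nat}. 1::nat" and ?\<theta> = "\<lambda>i\<in>{..<3::nat}. 0::real"
  have eq: "?f = (\<lambda>(\<kappa>, \<theta>). lam1 \<kappa> * (\<Prod>i<3. 1/2 / real (ll i \<kappa> \<theta>)))"
  proof (rule ext)
    fix x
    show "?f x = (case x of (\<kappa>, \<theta>) \<Rightarrow> lam1 \<kappa> * (\<Prod>i<3. 1/2 / real (ll i \<kappa> \<theta>)))"
      by (cases x) (simp only: prod.case prod_dividef Diff_cancel prod.empty mult_1_right times_divide_eq_right)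
  qed
  have s: "?f summable_on (KS \<times> K)" unfolding eq
  proof (rule summable_prod_bound[where c = "\<lambda>_. 1"])
    fix i :: nat and \<kappa> \<theta> assume a: "i < 3" "\<kappa> \<in> KS" "\<theta> \<in> K"
    have "1 \<le> real (ll i \<kappa> \<theta>) powr (1/16)" using ll_pos[OF a(2,3,1)] by (simp add: ge_one_powr_ge_zero Suc_le_eq)
    then show "\<bar>1/2\<bar> \<le> 1 * real (ll i \<kappa> \<theta>) powr (1/16)" by simp
  qed (simp add: lam1_def)
  have \<kappa>: "?\<kappa> \<in> KS" by (auto simp: KS_def)
  have \<theta>: "?\<theta> \<in> K" by (auto simp: K_def)
  have "(\<Sum>x\<in>{(?\<kappa>, ?\<theta>)}. ?f x) \<le> infsum ?f (KS \<times> K)"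
    by (rule finite_sum_le_infsum[OF s]) (use \<kappa> \<theta> in \<open>auto simp: lam1_def intro!: divide_nonneg_nonneg prod_nonneg\<close>)
  moreover have "(\<Sum>x\<in>{(?\<kappa>, ?\<theta>)}. ?f x) > 0"
    using ll_pos[OF \<kappa> \<theta>] by (auto simp: lam1_def intro!: divide_pos_pos prod_pos)
  ultimately show ?thesis by (simp add: pc_def)
qed

end

section \<open>Mean values of products of logarithms\<close>

text \<open>In the application the error contains logarithms of M, so M has to stay below a power of
  N. Repeated squaring of N reaches every M, and each squaring at least halves the bound since N
  powr (-1/2) <= 1/2 from 4 on; the errors add up to at most twice the first.\<close>

lemma convergence_of_square_steps:
  fixes A :: "nat \<Rightarrow> real"
  assumes C0: "C \<ge> 0" and step: "\<And>N M. 4 \<le> N \<Longrightarrow> N \<le> M \<Longrightarrow> M \<le> N\<^sup>2 \<Longrightarrow> \<bar>A N - A M\<bar> \<le> C * real N powr (-1/2)"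
  shows "\<exists>l D. D \<ge> 0 \<and> (\<forall>N\<ge>1. \<bar>A N - l\<bar> \<le> D * real N powr (-1/2))"
proof -
  have half: "real N powr (-1/2) \<le> 1/2" if "N \<ge> 4" for N
  proof -
    have "real N powr (-1/2) \<le> 4 powr (-1/2)" using that by (intro powr_mono2') auto
    also have "(4::real) powr (-1/2) = 1/2" by (simp add: powr_minus_divide powr_half_sqrt)
    finally show ?thesis .
  qed
  have main: "\<bar>A N - A M\<bar> \<le> 2 * C * real N powr (-1/2)" if "4 \<le> N" "N \<le> M" for N M
    using that
  proof (induction "M - N" arbitrary: N rule: less_induct)
    case less
    let ?p = "real N powr (-1/2)"
    have Np: "?p \<ge> 0" by simp
    show ?case
    proof (cases "M \<le> N\<^sup>2")
      case True
      have "C * ?p \<le> 2 * C * ?p" using C0 by simp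
      then show ?thesis using step[OF less.prems True] by linarith
    next
      case False
      have NN: "N < N\<^sup>2" using less.prems by (simp add: power2_eq_square)
      then have "M - N\<^sup>2 < M - N" using False by linarith
      then have "\<bar>A (N\<^sup>2) - A M\<bar> \<le> 2 * C * real (N\<^sup>2) powr (-1/2)"
        using less.hyps[of "N\<^sup>2"] False NN less.prems by linarith
      also have "real (N\<^sup>2) powr (-1/2) = ?p * ?p" using less.prems by (simp add: power2_eq_square powr_mult)
      also have "2 * C * (?p * ?p) \<le> 2 * C * (1/2 * ?p)"
        using half[OF less.prems(1)] C0 by (intro mult_left_mono mult_right_mono) auto
      finally have "\<bar>A (N\<^sup>2) - A M\<bar> \<le> C * ?p" by simp
      moreover have "\<bar>A N - A (N\<^sup>2)\<bar> \<le> C * ?p" using step[OF less.prems(1), of "N\<^sup>2"] NN by simp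
      ultimately show ?thesis by linarith
    qed
  qed
  have tend: "(\<lambda>N. 2 * C * real N powr (-1/2)) \<longlonglongrightarrow> 0" by real_asymp
  have "Cauchy A"
  proof (rule metric_CauchyI)
    fix e :: real assume "e > 0"
    then have "\<forall>\<^sub>F N in sequentially. 2 * C * real N powr (-1/2) < e / 2"
      using order_tendstoD(2)[OF tend, of "e / 2"] by simp
    then obtain N0 where N0: "\<And>N. N \<ge> N0 \<Longrightarrow> 2 * C * real N powr (-1/2) < e / 2"
      by (auto simp: eventually_sequentially)
    define N where "N = max 4 N0"
    have near: "\<bar>A N - A m\<bar> < e / 2" if "m \<ge> N" for m
      using main[of N m] N0[of N] that by (simp add: N_def)
    show "\<exists>M. \<forall>m\<ge>M. \<forall>n\<ge>M. dist (A m) (A n) < e"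
    proof (intro exI allI impI)
      fix m n assume "m \<ge> N" "n \<ge> N"
      then show "dist (A m) (A n) < e" using near[of m] near[of n] unfolding dist_real_def by linarith
    qed
  qed
  then obtain l where l: "A \<longlonglongrightarrow> l" using Cauchy_convergent convergent_def by blast
  have lim: "\<bar>A N - l\<bar> \<le> 2 * C * real N powr (-1/2)" if "N \<ge> 4" for N
  proof (rule tendsto_upperbound)
    show "(\<lambda>M. \<bar>A N - A M\<bar>) \<longlonglongrightarrow> \<bar>A N - l\<bar>" by (intro tendsto_intros l)
    show "\<forall>\<^sub>F M in sequentially. \<bar>A N - A M\<bar> \<le> 2 * C * real N powr (-1/2)"
      using main[OF that] by (auto simp: eventually_sequentially)
  qed simp
  \<comment> \<open>The finitely many N below 4 go into the constant; for them N powr (-1/2) is at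
    least 1/2.\<close>
  define D where "D = 2 * C + (\<Sum>N<4. 2 * \<bar>A N - l\<bar>)"
  have s0: "(\<Sum>N<4. 2 * \<bar>A N - l\<bar>) \<ge> 0" by (intro sum_nonneg) auto
  have "\<bar>A N - l\<bar> \<le> D * real N powr (-1/2)" if "N \<ge> 1" for N
  proof (cases "N \<ge> 4")
    case True
    have "2 * C * real N powr (-1/2) \<le> D * real N powr (-1/2)" using s0 by (intro mult_right_mono) (auto simp: D_def)
    then show ?thesis using lim[OF True] by linarith
  next
    case False
    have "2 * \<bar>A N - l\<bar> \<le> (\<Sum>N<4. 2 * \<bar>A N - l\<bar>)" using False by (intro member_le_sum) auto
    also have "\<dots> \<le> D" using C0 by (simp add: D_def)
    finally have "2 * \<bar>A N - l\<bar> * (1/2) \<le> D * (1/2)" by simp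
    also have "\<dots> \<le> D * real N powr (-1/2)"
    proof (rule mult_left_mono)
      have "(4::real) powr (-1/2) \<le> real N powr (-1/2)" using False that by (intro powr_mono2') auto
      moreover have "(4::real) powr (-1/2) = 1/2" by (simp add: powr_minus_divide powr_half_sqrt)
      ultimately show "1/2 \<le> real N powr (-1/2)" by simp
      show "D \<ge> 0" using C0 s0 by (simp add: D_def)
    qed
    finally show ?thesis by simp
  qed
  moreover have "D \<ge> 0" using C0 s0 by (simp add: D_def)
  ultimately show ?thesis by blast
qed

text \<open>Division by W makes all factors at most 1 in absolute value, where a difference of
  products is bounded by the sum of the differences.\<close>

lemma abs_prod_diff_le_powr:
  fixes a b :: "'a \<Rightarrow> real"
  assumes "finite S" "card S \<le> 3" "W \<ge> 1" "\<And>i. i \<in> S \<Longrightarrow> \<bar>a i\<bar> \<le> W" "\<And>i. i \<in> S \<Longrightarrow> \<bar>b i\<bar> \<le> W"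
  shows "\<bar>(\<Prod>i\<in>S. a i) - (\<Prod>i\<in>S. b i)\<bar> \<le> W ^ 3 * (\<Sum>i\<in>S. \<bar>a i - b i\<bar>)"
proof -
  have W: "W > 0" using assms(3) by linarith
  have eq: "(\<Prod>i\<in>S. f i) = W ^ card S * (\<Prod>i\<in>S. f i / W)" for f
    using W by (simp add: prod_dividef)
  have "\<bar>(\<Prod>i\<in>S. a i / W) - (\<Prod>i\<in>S. b i / W)\<bar> \<le> (\<Sum>i\<in>S. \<bar>a i / W - b i / W\<bar>)"
    using norm_prod_diff[of S "\<lambda>i. a i / W" "\<lambda>i. b i / W"] assms(4,5) W by simp
  also have "\<dots> \<le> (\<Sum>i\<in>S. \<bar>a i - b i\<bar>)"
  proof (rule sum_mono)
    fix i
    have "\<bar>a i / W - b i / W\<bar> = \<bar>a i - b i\<bar> / W" using W by (simp flip: diff_divide_distrib)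
    also have "\<dots> \<le> \<bar>a i - b i\<bar> / 1" using assms(3) by (intro divide_left_mono) auto
    finally show "\<bar>a i / W - b i / W\<bar> \<le> \<bar>a i - b i\<bar>" by simp
  qed
  finally have *: "\<bar>(\<Prod>i\<in>S. a i / W) - (\<Prod>i\<in>S. b i / W)\<bar> \<le> (\<Sum>i\<in>S. \<bar>a i - b i\<bar>)" .
  have "\<bar>(\<Prod>i\<in>S. a i) - (\<Prod>i\<in>S. b i)\<bar> = W ^ card S * \<bar>(\<Prod>i\<in>S. a i / W) - (\<Prod>i\<in>S. b i / W)\<bar>"
    using W by (subst (1 2) eq) (simp add: abs_mult flip: right_diff_distrib)
  also have "\<dots> \<le> W ^ 3 * (\<Sum>i\<in>S. \<bar>a i - b i\<bar>)"
    using * assms(2,3) W by (intro mult_mono power_increasing) auto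
  finally show ?thesis .
qed

lemma abs_prod_le_power:
  fixes a :: "'a \<Rightarrow> real"
  assumes "finite S" "card S \<le> 3" "W \<ge> 1" "\<And>i. i \<in> S \<Longrightarrow> \<bar>a i\<bar> \<le> W"
  shows "\<bar>\<Prod>i\<in>S. a i\<bar> \<le> W ^ 3"
proof -
  have "\<bar>\<Prod>i\<in>S. a i\<bar> \<le> (\<Prod>i\<in>S. W)" unfolding abs_prod using assms by (intro prod_mono) auto
  also have "\<dots> = W ^ card S" by simp
  also have "\<dots> \<le> W ^ 3" using assms by (intro power_increasing) auto
  finally show ?thesis .
qed

lemma abs_ln_one_minus_le: assumes "\<bar>u\<bar> \<le> 1/2" shows "\<bar>ln (1 - u)\<bar> \<le> 2 * \<bar>u :: real\<bar>"
proof -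
  have p: "1 - u > 0" using assms by linarith
  have 1: "ln (1 - u) \<le> - u" using ln_le_minus_one[OF p] by simp
  have "ln (inverse (1 - u)) \<le> inverse (1 - u) - 1" using p by (intro ln_le_minus_one) simp
  also have "\<dots> = u / (1 - u)" using p by (simp add: field_simps)
  also have "\<dots> \<le> \<bar>u\<bar> / (1/2)" using assms p by (intro frac_le) auto
  finally have "- ln (1 - u) \<le> 2 * \<bar>u\<bar>" using p by (simp add: ln_inverse)
  then show ?thesis using 1 by (simp add: abs_le_iff)
qed

context three_forms
begin

text \<open>On the box of side N all |L_i| are at most \<open>CL * N\<close>, which serves as the
  common cutoff for these values, for \<kappa> and for d.\<close>

definition CL :: nat where "CL = 1 + (\<Sum>i<3. nat \<bar>fst (L i)\<bar> + nat \<bar>snd (L i)\<bar>)"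

definition na :: "nat \<Rightarrow> int \<times> int \<Rightarrow> nat" where "na i x = nat \<bar>lf i x\<bar>"

definition bx :: "nat \<Rightarrow> (int \<times> int) set" where "bx N = {1..int N} \<times> {1..int N}"

lemma finite_bx [simp]: "finite (bx N)" and card_bx [simp]: "card (bx N) = N\<^sup>2"
  by (auto simp: bx_def card_cartesian_product power2_eq_square)

lemma CL_ge_1: "CL \<ge> 1" by (simp add: CL_def)

lemma lf_bound:
  assumes "i < 3" "\<bar>fst x\<bar> \<le> int N" "\<bar>snd x\<bar> \<le> int N" shows "na i x \<le> CL * N"
proof -
  have "nat \<bar>fst (L i)\<bar> + nat \<bar>snd (L i)\<bar> \<le> (\<Sum>i<3. nat \<bar>fst (L i)\<bar> + nat \<bar>snd (L i)\<bar>)"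
    using assms(1) member_le_sum[of i "{..<3}" "\<lambda>i. nat \<bar>fst (L i)\<bar> + nat \<bar>snd (L i)\<bar>"] by simp
  then have c: "\<bar>fst (L i)\<bar> + \<bar>snd (L i)\<bar> \<le> int CL" unfolding CL_def by linarith
  have "\<bar>lf i x\<bar> \<le> \<bar>fst (L i)\<bar> * \<bar>fst x\<bar> + \<bar>snd (L i)\<bar> * \<bar>snd x\<bar>"
    unfolding lf_def linform_def abs_mult[symmetric] by (rule abs_triangle_ineq)
  also have "\<dots> \<le> \<bar>fst (L i)\<bar> * int N + \<bar>snd (L i)\<bar> * int N" using assms by (intro add_mono mult_left_mono) auto
  also have "\<dots> = (\<bar>fst (L i)\<bar> + \<bar>snd (L i)\<bar>) * int N" by (simp add: algebra_simps)
  also have "\<dots> \<le> int CL * int N" using c by (intro mult_right_mono) auto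
  finally show ?thesis by (simp add: na_def nat_le_iff)
qed

lemma na_bx: "i < 3 \<Longrightarrow> x \<in> bx N \<Longrightarrow> na i x \<le> CL * N"
  by (rule lf_bound) (auto simp: bx_def)

lemma L_nonzero: assumes "i < 3" shows "fst (L i) \<noteq> 0 \<or> snd (L i) \<noteq> 0"
proof -
  obtain j :: nat where "j < 3" "j \<noteq> i" by (metis assms less_numeral_extra(1) one_less_numeral_iff semiring_norm(77) zero_less_numeral zero_neq_one)
  then show ?thesis using res[of i j] assms by (auto simp: lin_res_def)
qed

lemma card_fiber: assumes i: "i < 3" shows "card {x \<in> bx N. lf i x = m} \<le> N"
proof (cases "snd (L i) = 0")
  case False
  have "inj_on fst {x \<in> bx N. lf i x = m}"
    using False by (auto simp: inj_on_def lf_def linform_def prod_eq_iff)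
  then have "card {x \<in> bx N. lf i x = m} \<le> card {1..int N}"
    by (rule card_inj_on_le) (auto simp: bx_def)
  then show ?thesis by simp
next
  case True
  then have "fst (L i) \<noteq> 0" using L_nonzero[OF i] by simp
  then have "inj_on snd {x \<in> bx N. lf i x = m}"
    using True by (auto simp: inj_on_def lf_def linform_def prod_eq_iff)
  then have "card {x \<in> bx N. lf i x = m} \<le> card {1..int N}"
    by (rule card_inj_on_le) (auto simp: bx_def)
  then show ?thesis by simp
qed

text \<open>A nonzero form takes each value at most N times on the box, and the values n and -n both
  count.\<close>

lemma sum_fiber_le:
  assumes i: "i < 3" and g: "\<And>n. g n \<ge> (0::real)"
  shows "(\<Sum>x | x \<in> bx N \<and> lf i x \<noteq> 0. g (na i x)) \<le> 2 * real N * (\<Sum>n\<in>{1..CL * N}. g n)"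
proof -
  let ?S = "{x. x \<in> bx N \<and> lf i x \<noteq> 0}"
  have fin: "finite ?S" by (rule finite_subset[OF _ finite_bx[of N]]) auto
  have "(\<Sum>x\<in>?S. g (na i x)) = (\<Sum>n\<in>na i ` ?S. \<Sum>x | x \<in> ?S \<and> na i x = n. g (na i x))"
    by (rule sum.image_gen[OF fin])
  also have "\<dots> = (\<Sum>n\<in>na i ` ?S. real (card {x. x \<in> ?S \<and> na i x = n}) * g n)"
    by (intro sum.cong refl) simp
  also have "\<dots> \<le> (\<Sum>n\<in>na i ` ?S. 2 * real N * g n)"
  proof (intro sum_mono mult_right_mono g)
    fix n
    have "{x. x \<in> ?S \<and> na i x = n} \<subseteq> {x \<in> bx N. lf i x = int n} \<union> {x \<in> bx N. lf i x = - int n}"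
      by (auto simp: na_def)
    then have "card {x. x \<in> ?S \<and> na i x = n} \<le> card ({x \<in> bx N. lf i x = int n} \<union> {x \<in> bx N. lf i x = - int n})"
      by (rule card_mono[rotated]) auto
    also have "\<dots> \<le> card {x \<in> bx N. lf i x = int n} + card {x \<in> bx N. lf i x = - int n}" by (rule card_Un_le)
    also have "\<dots> \<le> N + N" by (intro add_mono card_fiber i)
    finally show "real (card {x. x \<in> ?S \<and> na i x = n}) \<le> 2 * real N" by simp
  qed
  also have "\<dots> \<le> (\<Sum>n\<in>{1..CL * N}. 2 * real N * g n)"
  proof (rule sum_mono2)
    show "na i ` ?S \<subseteq> {1..CL * N}" using na_bx[OF i] by (auto simp: na_def)
  qed (use g in auto)
  finally show ?thesis by (simp add: sum_distrib_left)
qed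

text \<open>Division by Q makes the logarithms invariant under a common scaling of y and Q, which is
  the homogeneity behind \<open>AS_mult\<close>.\<close>

definition GG :: "nat set \<Rightarrow> nat \<Rightarrow> int \<times> int \<Rightarrow> real" where
  "GG S Q y = (if \<forall>i<3. lf i y \<noteq> 0 then \<Prod>i\<in>S. ln (real (na i y) / real Q) else 0)"

definition AS :: "nat set \<Rightarrow> nat \<Rightarrow> real" where
  "AS S N = (\<Sum>x\<in>bx N. GG S N x) / (real N)\<^sup>2"

text \<open>Bounds the variation of ln |L_i| over the cell belonging to x. Where
  \<open>na i x < 2 * CL\<close> the logarithm is not controlled; there \<open>phi\<close> is at
  least 2, enough for the trivial bound of a difference.\<close>

definition phi :: "nat \<Rightarrow> int \<times> int \<Rightarrow> real" where
  "phi i x = (if lf i x = 0 then 2 else 4 * real CL / real (na i x))"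

lemma sum_phi_le:
  assumes i: "i < 3" and N: "N \<ge> 1"
  shows "(\<Sum>x\<in>bx N. phi i x) \<le> 10 * real CL * real N * (1 + ln (real (CL * N)))"
proof -
  have B: "CL * N > 0" using CL_ge_1 N by simp
  have ln0: "ln (real (CL * N)) \<ge> 0" using B by (simp add: Suc_le_eq del: of_nat_mult)
  have "(\<Sum>x\<in>bx N. phi i x) = (\<Sum>x\<in>bx N. if lf i x = 0 then 2 else 0) + (\<Sum>x\<in>bx N. if lf i x \<noteq> 0 then 4 * real CL / real (na i x) else 0)"
    unfolding sum.distrib[symmetric] by (intro sum.cong) (auto simp: phi_def)
  also have "(\<Sum>x\<in>bx N. if lf i x = 0 then 2 else 0) = 2 * real (card {x \<in> bx N. lf i x = 0})"
    by (simp add: sum.If_cases Int_def)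
  also have "\<dots> \<le> 2 * real N" using card_fiber[OF i, of N 0] by simp
  also have "(\<Sum>x\<in>bx N. if lf i x \<noteq> 0 then 4 * real CL / real (na i x) else 0) = (\<Sum>x | x \<in> bx N \<and> lf i x \<noteq> 0. 4 * real CL / real (na i x))"
    by (subst sum.inter_filter[symmetric]) auto
  also have "\<dots> \<le> 2 * real N * (\<Sum>n\<in>{1..CL * N}. 4 * real CL / real n)" by (rule sum_fiber_le[OF i]) simp
  also have "(\<Sum>n\<in>{1..CL * N}. 4 * real CL / real n) = 4 * real CL * harm (CL * N)"
    by (simp add: harm_def sum_distrib_left divide_inverse)
  also have "\<dots> \<le> 4 * real CL * (1 + ln (real (CL * N)))" using harm_le_ln[OF B] by (intro mult_left_mono) auto
  finally have "(\<Sum>x\<in>bx N. phi i x) \<le> 2 * real N + 2 * real N * (4 * real CL * (1 + ln (real (CL * N))))"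
    by (simp add: mult_left_mono)
  moreover have "2 * real N \<le> 2 * real N * (real CL * (1 + ln (real (CL * N))))"
  proof -
    have "1 * 1 \<le> real CL * (1 + ln (real (CL * N)))" using CL_ge_1 ln0 by (intro mult_mono) auto
    then have "2 * real N * 1 \<le> 2 * real N * (real CL * (1 + ln (real (CL * N))))" by (intro mult_left_mono) auto
    then show ?thesis by simp
  qed
  moreover have "2 * real N * (4 * real CL * (1 + ln (real (CL * N)))) + 2 * real N * (real CL * (1 + ln (real (CL * N)))) = 10 * real CL * real N * (1 + ln (real (CL * N)))"
    by (simp add: algebra_simps)
  ultimately show ?thesis by linarith
qed

lemma abs_ln_ratio_le:
  assumes "1 \<le> n" "n \<le> c * Q" "1 \<le> Q" "Q \<le> Q'" "1 \<le> c"
  shows "\<bar>ln (real n / real Q)\<bar> \<le> 1 + ln (real (c * Q'))"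
proof -
  have "ln (real n / real Q) = ln (real n) - ln (real Q)" using assms by (simp add: ln_div)
  moreover have "0 \<le> ln (real n)" "0 \<le> ln (real Q)" using assms by auto
  moreover have "ln (real n) \<le> ln (real (c * Q'))"
  proof -
    have "n \<le> c * Q'" using assms(2,4) by (meson le_trans mult_le_mono2)
    then show ?thesis using assms by (subst ln_le_cancel_iff) (auto simp del: of_nat_mult)
  qed
  moreover have "ln (real Q) \<le> ln (real (c * Q'))"
  proof -
    have "1 * Q \<le> c * Q'" using assms by (intro mult_mono) auto
    then show ?thesis using assms by (subst ln_le_cancel_iff) (auto simp del: of_nat_mult)
  qed
  ultimately show ?thesis by linarith
qed

text \<open>The box of side N M is tiled by squares of side M, one for each x in the box of side N,
  through y = M x - r. Away from the zero lines L_i(y) = M L_i(x) (1 - u) with |u| <= CL / |L_i(x)|,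
  so the normalised logarithms differ by at most \<open>phi\<close>, whose mean over x is of order
  (1 + ln N) / N.\<close>

lemma AS_mult:
  assumes S: "S \<subseteq> {..<3}" and N: "N \<ge> 1" and M: "M \<ge> 1"
  shows "\<bar>AS S (N * M) - AS S N\<bar> \<le> 30 * real CL * (1 + ln (real (CL * (N * M)))) ^ 4 / real N"
proof -
  define W where "W = 1 + ln (real (CL * (N * M)))"
  define R where "R = {0..<int M} \<times> {0..<int M}"
  have finS: "finite S" "card S \<le> 3" using S finite_subset[OF S] card_mono[OF _ S] by auto
  have NM: "1 \<le> N * M" "N \<le> N * M" using N M by auto
  have "CL * (N * M) \<ge> 1" using CL_ge_1 NM by (metis mult_le_mono nat_mult_1_right)
  then have W1: "W \<ge> 1" unfolding W_def by (simp del: of_nat_mult)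
  have Glog: "\<bar>ln (real (na i y) / real Q)\<bar> \<le> W" if "i < 3" "y \<in> bx Q" "lf i y \<noteq> 0" "1 \<le> Q" "Q \<le> N * M" for i y Q
    unfolding W_def by (rule abs_ln_ratio_le) (use that na_bx CL_ge_1 in \<open>auto simp: na_def\<close>)
  have Gb: "\<bar>GG S Q y\<bar> \<le> W ^ 3" if "y \<in> bx Q" "1 \<le> Q" "Q \<le> N * M" for y Q
  proof (cases "\<forall>i<3. lf i y \<noteq> 0")
    case True
    have "\<bar>\<Prod>i\<in>S. ln (real (na i y) / real Q)\<bar> \<le> W ^ 3"
    proof (rule abs_prod_le_power[OF finS W1])
      fix i assume "i \<in> S"
      then have "i < 3" using S by auto
      then show "\<bar>ln (real (na i y) / real Q)\<bar> \<le> W" using True by (intro Glog that) auto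
    qed
    then show ?thesis using True by (simp add: GG_def)
  next
    case False
    then show ?thesis using W1 by (auto simp: GG_def)
  qed
  have yin: "(int M * fst x - fst r, int M * snd x - snd r) \<in> bx (N * M)" if "x \<in> bx N" "r \<in> R" for x r
  proof -
    have "1 \<le> int M * a - b \<and> int M * a - b \<le> int (N * M)" if "1 \<le> a" "a \<le> int N" "0 \<le> b" "b < int M" for a b
    proof -
      have "int M * 1 \<le> int M * a" "int M * a \<le> int M * int N" using that by (auto intro: mult_left_mono)
      moreover have "int (N * M) = int M * int N" by simp
      ultimately show ?thesis using that by linarith
    qed
    then show ?thesis using that by (cases x; cases r) (auto simp: bx_def R_def)
  qed
  have bij: "bij_betw (\<lambda>(x, r). (int M * fst x - fst r, int M * snd x - snd r)) (bx N \<times> R) (bx (N * M))"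
    unfolding bij_betw_def
  proof
    show inj: "inj_on (\<lambda>(x, r). (int M * fst x - fst r, int M * snd x - snd r)) (bx N \<times> R)"
    proof (rule inj_onI)
      fix p q assume p: "p \<in> bx N \<times> R" and q: "q \<in> bx N \<times> R"
        and e: "(case p of (x, r) \<Rightarrow> (int M * fst x - fst r, int M * snd x - snd r)) = (case q of (x, r) \<Rightarrow> (int M * fst x - fst r, int M * snd x - snd r))"
      have one: "a = a' \<and> b = b'" if "int M * a - b = int M * a' - b'" "0 \<le> b" "b < int M" "0 \<le> b'" "b' < int M" for a a' b b'
      proof -
        have eq: "int M * (a - a') = b - b'" using that(1) by (simp add: algebra_simps)
        have "a = a'"
        proof (rule ccontr)
          assume "a \<noteq> a'"
          then have "int M * 1 \<le> int M * \<bar>a - a'\<bar>" by (intro mult_left_mono) auto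
          also have "\<dots> = \<bar>b - b'\<bar>" unfolding eq[symmetric] by (simp add: abs_mult)
          finally show False using that by linarith
        qed
        then show ?thesis using that(1) by simp
      qed
      obtain x r where p': "p = (x, r)" by (cases p)
      obtain x' r' where q': "q = (x', r')" by (cases q)
      have e': "int M * fst x - fst r = int M * fst x' - fst r'" "int M * snd x - snd r = int M * snd x' - snd r'"
        using e unfolding p' q' by simp_all
      have rr: "0 \<le> fst r" "fst r < int M" "0 \<le> fst r'" "fst r' < int M" "0 \<le> snd r" "snd r < int M" "0 \<le> snd r'" "snd r' < int M"
        using p q by (simp_all add: p' q' R_def mem_Times_iff)
      have "fst x = fst x' \<and> fst r = fst r'" by (rule one[OF e'(1) rr(1-4)])
      moreover have "snd x = snd x' \<and> snd r = snd r'" by (rule one[OF e'(2) rr(5-8)])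
      ultimately show "p = q" by (simp add: p' q' prod_eq_iff)
    qed
    have sub: "(\<lambda>(x, r). (int M * fst x - fst r, int M * snd x - snd r)) ` (bx N \<times> R) \<subseteq> bx (N * M)"
      using yin by auto
    show "(\<lambda>(x, r). (int M * fst x - fst r, int M * snd x - snd r)) ` (bx N \<times> R) = bx (N * M)"
    proof (rule card_subset_eq[OF finite_bx sub])
      show "card ((\<lambda>(x, r). (int M * fst x - fst r, int M * snd x - snd r)) ` (bx N \<times> R)) = card (bx (N * M))"
        by (subst card_image[OF inj]) (simp add: card_cartesian_product R_def power2_eq_square)
    qed
  qed
  have finR: "finite R" and cardR: "card R = M\<^sup>2" by (auto simp: R_def card_cartesian_product power2_eq_square)
  have pt: "\<bar>GG S (N * M) (int M * fst x - fst r, int M * snd x - snd r) - GG S N x\<bar> \<le> W ^ 3 * (\<Sum>i<3. phi i x)"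
    if x: "x \<in> bx N" and r: "r \<in> R" for x r
  proof -
    let ?y = "(int M * fst x - fst r, int M * snd x - snd r)"
    have y: "?y \<in> bx (N * M)" by (rule yin[OF x r])
    have phi0: "phi i x \<ge> 0" for i by (simp add: phi_def)
    show ?thesis
    proof (cases "\<forall>i<3. na i x \<ge> 2 * CL")
      case False
      then obtain i where i: "i < 3" "na i x < 2 * CL" by (auto simp: not_le)
      \<comment> \<open>Close to a zero line both values of \<open>GG\<close> are merely bounded by
        W^3.\<close>
      have "2 \<le> phi i x"
      proof (cases "lf i x = 0")
        case False
        then have "real (na i x) > 0" by (simp add: na_def)
        then show ?thesis using i False by (simp add: phi_def le_divide_eq)
      qed (simp add: phi_def)
      also have "\<dots> \<le> (\<Sum>i<3. phi i x)" using i phi0 by (intro member_le_sum) auto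
      finally have "W ^ 3 * 2 \<le> W ^ 3 * (\<Sum>i<3. phi i x)" using W1 by (intro mult_left_mono) auto
      moreover have "\<bar>GG S (N * M) ?y\<bar> \<le> W ^ 3" "\<bar>GG S N x\<bar> \<le> W ^ 3" using Gb[OF y] Gb[OF x] N NM by auto
      ultimately show ?thesis by linarith
    next
      case True
      have nz: "lf i x \<noteq> 0" if "i < 3" for i using True that CL_ge_1 by (fastforce simp: na_def)
      have ydiff: "lf i ?y = int M * lf i x - lf i r" for i by (simp add: lf_def linform_def algebra_simps)
      define u where "u = (\<lambda>i. real_of_int (lf i r) / (real M * real_of_int (lf i x)))"
      have ub: "\<bar>u i\<bar> \<le> real CL / real (na i x)" "\<bar>u i\<bar> \<le> 1/2" if i: "i < 3" for i
      proof -
        have "na i r \<le> CL * M" using r by (intro lf_bound i) (auto simp: R_def)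
        then have rb: "real (na i r) \<le> real CL * real M" by (simp flip: of_nat_mult)
        have nx: "real (na i x) > 0" using nz[OF i] by (simp add: na_def)
        have "\<bar>u i\<bar> = real (na i r) / (real M * real (na i x))" by (simp add: u_def na_def abs_mult)
        also have "\<dots> \<le> (real CL * real M) / (real M * real (na i x))" using rb nx M by (intro divide_right_mono) auto
        also have "\<dots> = real CL / real (na i x)" using M by simp
        finally show 1: "\<bar>u i\<bar> \<le> real CL / real (na i x)" .
        have "real (2 * CL) \<le> real (na i x)" using True i by (simp only: of_nat_le_iff)
        then have "real CL / real (na i x) \<le> 1/2" using nx by (simp add: divide_le_eq)
        then show "\<bar>u i\<bar> \<le> 1/2" using 1 by linarith
      qed
      have yeq: "real_of_int (lf i ?y) = real M * real_of_int (lf i x) * (1 - u i)" if "i < 3" for i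
        using nz[OF that] M by (simp add: ydiff u_def field_simps)
      have ynz: "lf i ?y \<noteq> 0" if "i < 3" for i
      proof -
        have "1 - u i \<noteq> 0" using ub(2)[OF that] by auto
        then have "real_of_int (lf i ?y) \<noteq> 0" unfolding yeq[OF that] using nz[OF that] M by simp
        then show ?thesis by simp
      qed
      have lnd: "\<bar>ln (real (na i ?y) / real (N * M)) - ln (real (na i x) / real N)\<bar> \<le> phi i x" if i: "i < 3" for i
      proof -
        have nx: "real (na i x) > 0" using nz[OF i] by (simp add: na_def)
        have up: "1 - u i > 0" using ub(2)[OF i] by linarith
        have "real (na i ?y) = \<bar>real_of_int (lf i ?y)\<bar>" by (simp add: na_def)
        also have "\<dots> = real M * real (na i x) * (1 - u i)" unfolding yeq[OF i] using up by (simp add: abs_mult na_def)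
        finally have "real (na i ?y) / real (N * M) = real (na i x) / real N * (1 - u i)" using M N by (simp add: field_simps)
        moreover have "ln (real (na i x) / real N * (1 - u i)) = ln (real (na i x) / real N) + ln (1 - u i)"
          using nx up N by (intro ln_mult_pos) auto
        ultimately have "ln (real (na i ?y) / real (N * M)) - ln (real (na i x) / real N) = ln (1 - u i)"
          by (simp only: add_diff_cancel_left')
        then have "\<bar>ln (real (na i ?y) / real (N * M)) - ln (real (na i x) / real N)\<bar> \<le> 2 * \<bar>u i\<bar>"
          using abs_ln_one_minus_le[OF ub(2)[OF i]] by simp
        also have "\<dots> \<le> 2 * (real CL / real (na i x))" using ub(1)[OF i] by simp
        also have "\<dots> \<le> phi i x" using nz[OF i] by (simp add: phi_def divide_right_mono)
        finally show ?thesis .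
      qed
      have "\<bar>GG S (N * M) ?y - GG S N x\<bar> = \<bar>(\<Prod>i\<in>S. ln (real (na i ?y) / real (N * M))) - (\<Prod>i\<in>S. ln (real (na i x) / real N))\<bar>"
      proof -
        have a: "\<forall>i<3. lf i x \<noteq> 0" and b: "\<forall>i<3. lf i ?y \<noteq> 0" using nz ynz by blast+
        show ?thesis unfolding GG_def if_P[OF a] if_P[OF b] by (rule refl)
      qed
      also have "\<dots> \<le> W ^ 3 * (\<Sum>i\<in>S. \<bar>ln (real (na i ?y) / real (N * M)) - ln (real (na i x) / real N)\<bar>)"
      proof (rule abs_prod_diff_le_powr[OF finS W1])
        fix i assume "i \<in> S"
        then have i: "i < 3" using S by auto
        show "\<bar>ln (real (na i ?y) / real (N * M))\<bar> \<le> W" by (rule Glog[OF i y ynz[OF i] NM(1)]) simp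
        show "\<bar>ln (real (na i x) / real N)\<bar> \<le> W" by (rule Glog[OF i x nz[OF i] N NM(2)])
      qed
      also have "\<dots> \<le> W ^ 3 * (\<Sum>i\<in>S. phi i x)"
        using lnd S W1 by (intro mult_left_mono sum_mono) auto
      also have "\<dots> \<le> W ^ 3 * (\<Sum>i<3. phi i x)"
        using S W1 phi0 by (intro mult_left_mono sum_mono2) auto
      finally show ?thesis .
    qed
  qed
  have e1: "(\<Sum>y\<in>bx (N * M). GG S (N * M) y) = (\<Sum>x\<in>bx N. \<Sum>r\<in>R. GG S (N * M) (int M * fst x - fst r, int M * snd x - snd r))"
    by (subst sum.reindex_bij_betw[OF bij, symmetric]) (simp add: sum.cartesian_product case_prod_unfold)
  have e2: "(real M)\<^sup>2 * (\<Sum>x\<in>bx N. GG S N x) = (\<Sum>x\<in>bx N. \<Sum>r\<in>R. GG S N x)"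
    by (simp add: sum_distrib_left cardR)
  have "\<bar>(\<Sum>y\<in>bx (N * M). GG S (N * M) y) - (real M)\<^sup>2 * (\<Sum>x\<in>bx N. GG S N x)\<bar>
      = \<bar>\<Sum>x\<in>bx N. \<Sum>r\<in>R. GG S (N * M) (int M * fst x - fst r, int M * snd x - snd r) - GG S N x\<bar>"
    unfolding e1 e2 by (simp only: sum_subtractf)
  also have "\<dots> \<le> (\<Sum>x\<in>bx N. \<Sum>r\<in>R. W ^ 3 * (\<Sum>i<3. phi i x))"
    by (intro order.trans[OF sum_abs] sum_mono order.trans[OF sum_abs] pt)
  also have "\<dots> = (real M)\<^sup>2 * W ^ 3 * (\<Sum>i<3. \<Sum>x\<in>bx N. phi i x)"
    by (subst sum.swap[of _ "bx N" "{..<3}"]) (simp add: sum_distrib_left cardR mult_ac)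
  also have "\<dots> \<le> (real M)\<^sup>2 * W ^ 3 * (\<Sum>i<(3::nat). 10 * real CL * real N * W)"
  proof (intro mult_left_mono sum_mono)
    fix i :: nat assume "i \<in> {..<3}"
    then have "(\<Sum>x\<in>bx N. phi i x) \<le> 10 * real CL * real N * (1 + ln (real (CL * N)))" by (intro sum_phi_le N) auto
    also have "\<dots> \<le> 10 * real CL * real N * W"
    proof -
      have "CL * N \<le> CL * (N * M)" "CL * N > 0" using NM CL_ge_1 N by auto
      then have "ln (real (CL * N)) \<le> ln (real (CL * (N * M)))" by (subst ln_le_cancel_iff) (auto simp del: of_nat_mult)
      then show ?thesis unfolding W_def by (intro mult_left_mono) auto
    qed
    finally show "(\<Sum>x\<in>bx N. phi i x) \<le> 10 * real CL * real N * W" .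
  qed (use W1 in auto)
  also have "\<dots> = (real M)\<^sup>2 * (real N * (30 * real CL * W ^ 4))" by (simp add: eval_nat_numeral mult_ac)
  finally have bound: "\<bar>(\<Sum>y\<in>bx (N * M). GG S (N * M) y) - (real M)\<^sup>2 * (\<Sum>x\<in>bx N. GG S N x)\<bar> \<le> (real M)\<^sup>2 * (real N * (30 * real CL * W ^ 4))" .
  have pos: "real M > 0" "real N > 0" using M N by auto
  have "AS S (N * M) - AS S N = ((\<Sum>y\<in>bx (N * M). GG S (N * M) y) - (real M)\<^sup>2 * (\<Sum>x\<in>bx N. GG S N x)) / (real (N * M))\<^sup>2"
    unfolding AS_def using pos by (simp add: field_simps power2_eq_square)
  then have "\<bar>AS S (N * M) - AS S N\<bar> \<le> ((real M)\<^sup>2 * (real N * (30 * real CL * W ^ 4))) / (real (N * M))\<^sup>2"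
    using bound by (simp add: abs_divide divide_right_mono)
  also have "\<dots> = 30 * real CL * W ^ 4 / real N" using pos by (simp add: power2_eq_square)
  finally show ?thesis unfolding W_def .
qed

lemma AS_convergent:
  assumes S: "S \<subseteq> {..<3}"
  shows "\<exists>l D. D \<ge> 0 \<and> (\<forall>N\<ge>1. \<bar>AS S N - l\<bar> \<le> D * real N powr (-1/2))"
proof -
  \<comment> \<open>For M <= N^2 the logarithm of N M is at most 3 ln N <= 24 N powr (1/8), and the
    fourth power costs N powr (1/2).\<close>
  define c where "c = 1 + ln (real CL) + 24"
  have c0: "c \<ge> 1" using CL_ge_1 by (simp add: c_def)
  have lnb: "(1 + ln (real (CL * (N * M)))) ^ 4 / real Q \<le> c ^ 4 * real N powr (-1/2)"
    if "1 \<le> N" "N \<le> Q" "1 \<le> M" "M \<le> N\<^sup>2" for N M Q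
  proof -
    have pos: "real CL > 0" "real N > 0" "real M > 0" using CL_ge_1 that by auto
    have "ln (real M) \<le> ln ((real N)\<^sup>2)" using that pos by (subst ln_le_cancel_iff) (auto simp flip: of_nat_power)
    then have lM: "ln (real M) \<le> 2 * ln (real N)" using pos by (simp add: ln_realpow)
    have N8: "real N powr (1/8) \<ge> 1" using that by (simp add: ge_one_powr_ge_zero)
    have lN: "ln (real N) \<le> 8 * real N powr (1/8)" using ln_powr_bound[of "real N" "1/8"] that by simp
    have lC: "0 \<le> ln (real CL)" using CL_ge_1 by simp
    have l0: "0 \<le> ln (real (CL * (N * M)))" using that CL_ge_1 by (simp add: ln_mult pos)
    have "1 + ln (real (CL * (N * M))) = 1 + ln (real CL) + ln (real N) + ln (real M)" using pos by (simp add: ln_mult)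
    also have "\<dots> \<le> (1 + ln (real CL)) * 1 + 24 * real N powr (1/8)" unfolding mult_1_right using lM lN by linarith
    also have "\<dots> \<le> (1 + ln (real CL)) * real N powr (1/8) + 24 * real N powr (1/8)"
      using N8 lC by (intro add_right_mono mult_left_mono) auto
    also have "\<dots> = c * real N powr (1/8)" by (simp add: c_def algebra_simps)
    finally have "(1 + ln (real (CL * (N * M)))) ^ 4 \<le> (c * real N powr (1/8)) ^ 4" using l0 by (intro power_mono) auto
    also have "\<dots> = c ^ 4 * real N powr (1/2)" using pos by (simp add: power_mult_distrib powr_power)
    finally have "(1 + ln (real (CL * (N * M)))) ^ 4 / real Q \<le> (c ^ 4 * real N powr (1/2)) / real N"
      using that pos c0 by (intro frac_le) auto
    also have "\<dots> = c ^ 4 * (real N powr (1/2) / real N)" by simp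
    also have "real N powr (1/2) / real N = real N powr (-1/2)" using powr_div_self[of "real N" "1/2"] that by simp
    finally show ?thesis .
  qed
  show ?thesis
  proof (rule convergence_of_square_steps[of "2 * (30 * real CL * c ^ 4)"])
    fix N M :: nat assume a: "4 \<le> N" "N \<le> M" "M \<le> N\<^sup>2"
    have "\<bar>AS S (N * M) - AS S N\<bar> \<le> 30 * real CL * ((1 + ln (real (CL * (N * M)))) ^ 4 / real N)"
      using AS_mult[OF S, of N M] a by simp
    also have "\<dots> \<le> 30 * real CL * (c ^ 4 * real N powr (-1/2))" using lnb[of N N M] a by (intro mult_left_mono) auto
    finally have 1: "\<bar>AS S (N * M) - AS S N\<bar> \<le> 30 * real CL * c ^ 4 * real N powr (-1/2)" by simp
    have "\<bar>AS S (M * N) - AS S M\<bar> \<le> 30 * real CL * ((1 + ln (real (CL * (N * M)))) ^ 4 / real M)"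
      using AS_mult[OF S, of M N] a by (simp add: mult.commute[of M N])
    also have "\<dots> \<le> 30 * real CL * (c ^ 4 * real N powr (-1/2))" using lnb[of N M M] a by (intro mult_left_mono) auto
    finally have 2: "\<bar>AS S (N * M) - AS S M\<bar> \<le> 30 * real CL * c ^ 4 * real N powr (-1/2)" by (simp add: mult.commute[of M N])
    show "\<bar>AS S N - AS S M\<bar> \<le> 2 * (30 * real CL * c ^ 4) * real N powr (-1/2)" using 1 2 by linarith
  qed (use c0 in simp)
qed

definition Ainf :: "nat set \<Rightarrow> real" where
  "Ainf S = (SOME l. \<exists>D\<ge>0. \<forall>N\<ge>1. \<bar>AS S N - l\<bar> \<le> D * real N powr (-1/2))"

lemma Ainf: "S \<subseteq> {..<3} \<Longrightarrow> \<exists>D\<ge>0. \<forall>N\<ge>1. \<bar>AS S N - Ainf S\<bar> \<le> D * real N powr (-1/2)"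
  unfolding Ainf_def by (rule someI_ex) (use AS_convergent in blast)

lemma card_zero_le: "card {x \<in> bx N. \<not> (\<forall>i<3. lf i x \<noteq> 0)} \<le> 3 * N"
proof -
  have "{x \<in> bx N. \<not> (\<forall>i<3. lf i x \<noteq> 0)} = (\<Union>i<3. {x \<in> bx N. lf i x = 0})" by auto
  also have "card \<dots> \<le> (\<Sum>i<3. card {x \<in> bx N. lf i x = 0})" by (rule card_UN_le) simp
  also have "\<dots> \<le> (\<Sum>i<(3::nat). N)" by (intro sum_mono card_fiber) auto
  finally show ?thesis by simp
qed

text \<open>For the empty product the mean is the proportion of points off the three zero lines, and
  these lines hold at most 3 N points.\<close>

lemma Ainf_empty: "Ainf {} = 1"
proof -
  obtain D where D: "\<And>N. N \<ge> 1 \<Longrightarrow> \<bar>AS {} N - Ainf {}\<bar> \<le> D * real N powr (-1/2)" using Ainf[of "{}"] by auto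
  have near: "\<bar>1 - Ainf {}\<bar> \<le> D * real N powr (-1/2) + 3 / real N" if N: "N \<ge> 1" for N
  proof -
    have "(\<Sum>x\<in>bx N. GG {} N x) = real (card {x \<in> bx N. \<forall>i<3. lf i x \<noteq> 0})"
      unfolding GG_def by (simp add: sum.If_cases Int_def)
    moreover have "card {x \<in> bx N. \<forall>i<3. lf i x \<noteq> 0} + card {x \<in> bx N. \<not> (\<forall>i<3. lf i x \<noteq> 0)} = N\<^sup>2"
    proof -
      have "card {x \<in> bx N. \<forall>i<3. lf i x \<noteq> 0} + card {x \<in> bx N. \<not> (\<forall>i<3. lf i x \<noteq> 0)}
        = card ({x \<in> bx N. \<forall>i<3. lf i x \<noteq> 0} \<union> {x \<in> bx N. \<not> (\<forall>i<3. lf i x \<noteq> 0)})"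
        by (rule card_Un_disjoint[symmetric]) auto
      also have "{x \<in> bx N. \<forall>i<3. lf i x \<noteq> 0} \<union> {x \<in> bx N. \<not> (\<forall>i<3. lf i x \<noteq> 0)} = bx N" by blast
      finally show ?thesis by simp
    qed
    ultimately have e: "(\<Sum>x\<in>bx N. GG {} N x) = (real N)\<^sup>2 - real (card {x \<in> bx N. \<not> (\<forall>i<3. lf i x \<noteq> 0)})"
      unfolding eq_diff_eq of_nat_power[symmetric] by (simp only: of_nat_add[symmetric])
    have "\<bar>AS {} N - 1\<bar> = real (card {x \<in> bx N. \<not> (\<forall>i<3. lf i x \<noteq> 0)}) / (real N)\<^sup>2"
      unfolding AS_def e using N by (simp add: diff_divide_distrib)
    also have "\<dots> \<le> real (3 * N) / (real N)\<^sup>2" using card_zero_le by (intro divide_right_mono) (simp_all only: of_nat_le_iff zero_le_power2)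
    also have "\<dots> = 3 / real N" using N by (simp add: power2_eq_square)
    finally show ?thesis using D[OF N] by linarith
  qed
  have "(\<lambda>N. D * real N powr (-1/2) + 3 / real N) \<longlonglongrightarrow> 0" by real_asymp
  then have "\<bar>1 - Ainf {}\<bar> \<le> 0"
    by (rule tendsto_lowerbound) (use near in \<open>auto simp: eventually_sequentially\<close>)
  then show ?thesis by simp
qed

text \<open>Write ln |L_i(x)| = ln (|L_i(x)| / N) + ln N and expand: T collects the normalised
  logarithms, the rest of S the powers of ln N.\<close>

lemma sum_prod_ln:
  assumes S: "S \<subseteq> {..<3}" and N: "N \<ge> 1"
  shows "(\<Sum>x | x \<in> bx N \<and> (\<forall>i<3. lf i x \<noteq> 0). \<Prod>i\<in>S. ln (real (na i x))) = (real N)\<^sup>2 * (\<Sum>T\<in>Pow S. ln (real N) ^ card (S - T) * AS T N)"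
proof -
  have finS: "finite S" using S finite_subset by blast
  have pt: "(\<Prod>i\<in>S. ln (real (na i x))) = (\<Sum>T\<in>Pow S. ln (real N) ^ card (S - T) * GG T N x)" if nz: "\<forall>i<3. lf i x \<noteq> 0" for x
  proof -
    have "(\<Prod>i\<in>S. ln (real (na i x))) = (\<Prod>i\<in>S. ln (real (na i x) / real N) + ln (real N))"
    proof (rule prod.cong[OF refl])
      fix i assume "i \<in> S"
      then have "lf i x \<noteq> 0" using nz S by auto
      then have "real (na i x) > 0" by (simp add: na_def)
      then show "ln (real (na i x)) = ln (real (na i x) / real N) + ln (real N)" using N by (simp add: ln_div)
    qed
    also have "\<dots> = (\<Sum>T\<in>Pow S. (\<Prod>i\<in>T. ln (real (na i x) / real N)) * (\<Prod>i\<in>S - T. ln (real N)))" by (rule prod_add[OF finS])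
    also have "\<dots> = (\<Sum>T\<in>Pow S. ln (real N) ^ card (S - T) * GG T N x)"
      using nz by (intro sum.cong refl) (simp add: GG_def)
    finally show ?thesis .
  qed
  have "(\<Sum>x | x \<in> bx N \<and> (\<forall>i<3. lf i x \<noteq> 0). \<Prod>i\<in>S. ln (real (na i x))) = (\<Sum>x | x \<in> bx N \<and> (\<forall>i<3. lf i x \<noteq> 0). \<Sum>T\<in>Pow S. ln (real N) ^ card (S - T) * GG T N x)"
    by (intro sum.cong refl) (simp add: pt)
  also have "\<dots> = (\<Sum>x\<in>bx N. \<Sum>T\<in>Pow S. ln (real N) ^ card (S - T) * GG T N x)"
  proof (rule sum.mono_neutral_left)
    show "\<forall>x\<in>bx N - {x. x \<in> bx N \<and> (\<forall>i<3. lf i x \<noteq> 0)}. (\<Sum>T\<in>Pow S. ln (real N) ^ card (S - T) * GG T N x) = 0"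
    proof
      fix x assume "x \<in> bx N - {x. x \<in> bx N \<and> (\<forall>i<3. lf i x \<noteq> 0)}"
      then have "GG T N x = 0" for T by (auto simp: GG_def)
      then show "(\<Sum>T\<in>Pow S. ln (real N) ^ card (S - T) * GG T N x) = 0" by simp
    qed
  qed auto
  also have "\<dots> = (\<Sum>T\<in>Pow S. ln (real N) ^ card (S - T) * (\<Sum>x\<in>bx N. GG T N x))"
    by (subst sum.swap) (simp only: sum_distrib_left)
  also have "\<dots> = (\<Sum>T\<in>Pow S. (real N)\<^sup>2 * (ln (real N) ^ card (S - T) * AS T N))"
    using N by (intro sum.cong refl) (simp add: AS_def)
  also have "\<dots> = (real N)\<^sup>2 * (\<Sum>T\<in>Pow S. ln (real N) ^ card (S - T) * AS T N)" by (rule sum_distrib_left[symmetric])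
  finally show ?thesis .
qed

end

section \<open>The level of distribution\<close>

lemma one_plus_ln_le:
  fixes a :: real and k :: nat
  assumes "a > 0"
  shows "\<exists>C\<ge>1. \<forall>x\<ge>1. (1 + ln x) ^ k \<le> C * x powr a"
proof (cases "k = 0")
  case True
  then show ?thesis using assms by (intro exI[of _ 1]) (auto simp: ge_one_powr_ge_zero)
next
  case False
  define b where "b = a / real k"
  have b: "b > 0" using assms False by (simp add: b_def)
  have bk: "real k * b = a" using False unfolding b_def by simp
  have "(1 + ln x) ^ k \<le> (1 + 1 / b) ^ k * x powr a" if x: "x \<ge> 1" for x :: real
  proof -
    have x1: "x powr b \<ge> 1" using x b by (simp add: ge_one_powr_ge_zero)
    have "1 + ln x \<le> x powr b + x powr b / b" using ln_powr_bound[OF x b] x1 by linarith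
    also have "\<dots> = (1 + 1 / b) * x powr b" by (simp add: algebra_simps)
    finally have "(1 + ln x) ^ k \<le> ((1 + 1 / b) * x powr b) ^ k"
      by (rule power_mono) (use x in simp)
    also have "\<dots> = (1 + 1 / b) ^ k * x powr (real k * b)"
      unfolding power_mult_distrib by (rule arg_cong[OF powr_power]) (use x in simp)
    also have "\<dots> = (1 + 1 / b) ^ k * x powr a" unfolding bk by (rule refl)
    finally show ?thesis .
  qed
  moreover have "(1 + 1 / b) ^ k \<ge> 1" by (rule one_le_power) (use b in simp)
  ultimately show ?thesis by (intro exI[of _ "(1 + 1 / b) ^ k"] conjI allI impI)
qed

lemma sn_eqD:
  assumes "sn v = int j"
  shows "fst v = int j \<or> fst v = - int j \<or> snd v = int j \<or> snd v = - int j"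
    "- int j \<le> fst v" "fst v \<le> int j" "- int j \<le> snd v" "snd v \<le> int j"
  using assms unfolding sn_def by linarith+

lemma card_sn_eq_le:
  assumes "j \<ge> 1"
  shows "finite {v. sn v = int j}" "card {v. sn v = int j} \<le> 12 * j"
proof -
  let ?I = "{- int j..int j}"
  let ?A = "{int j, - int j} \<times> ?I" and ?B = "?I \<times> {int j, - int j}"
  have sub: "{v. sn v = int j} \<subseteq> ?A \<union> ?B" 
  proof
    fix v assume "v \<in> {v. sn v = int j}"
    then have "sn v = int j" by simp
    note sn_eqD[OF this]
    then show "v \<in> ?A \<union> ?B" by (cases v) auto
  qed
  have fin: "finite (?A \<union> ?B)" by simp
  show "finite {v. sn v = int j}" by (rule finite_subset[OF sub fin])
  have "card {v. sn v = int j} \<le> card (?A \<union> ?B)" by (rule card_mono[OF fin sub])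
  also have "\<dots> \<le> card ?A + card ?B" by (rule card_Un_le)
  also have "\<dots> = 4 * (2 * j + 1)" using assms by (simp add: card_cartesian_product)
  also have "\<dots> \<le> 12 * j" using assms by simp
  finally show "card {v. sn v = int j} \<le> 12 * j" .
qed

text \<open>Summation over the spheres sn v = j; only the number of vectors on each sphere
  enters.\<close>

lemma sum_inverse_sn_le:
  assumes "\<And>v. v \<in> A \<Longrightarrow> 1 \<le> sn v \<and> sn v \<le> int m"
    and "\<And>j. j \<ge> 1 \<Longrightarrow> real (card {v \<in> A. sn v = int j}) \<le> w j" and "\<And>j. w j \<ge> 0"
  shows "finite A" "(\<Sum>v\<in>A. 1 / real_of_int (sn v)) \<le> (\<Sum>j\<in>{1..m}. w j / real j)"
proof -
  have "A \<subseteq> (\<Union>j\<in>{1..m}. {v. sn v = int j})"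
  proof
    fix v assume "v \<in> A"
    from assms(1)[OF this] show "v \<in> (\<Union>j\<in>{1..m}. {v. sn v = int j})"
      by (intro UN_I[of "nat (sn v)"]) auto
  qed
  then show fin: "finite A" by (rule finite_subset) (auto intro!: card_sn_eq_le(1))
  have "(\<Sum>v\<in>A. 1 / real_of_int (sn v)) = (\<Sum>j\<in>(\<lambda>v. nat (sn v)) ` A. \<Sum>v | v \<in> A \<and> nat (sn v) = j. 1 / real_of_int (sn v))"
    by (rule sum.image_gen[OF fin])
  also have "\<dots> \<le> (\<Sum>j\<in>(\<lambda>v. nat (sn v)) ` A. w j / real j)"
  proof (rule sum_mono)
    fix j assume "j \<in> (\<lambda>v. nat (sn v)) ` A"
    then have j: "j \<ge> 1" using assms(1) by force
    have e: "{v. v \<in> A \<and> nat (sn v) = j} = {v \<in> A. sn v = int j}" using j by auto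
    have "(\<Sum>v | v \<in> A \<and> nat (sn v) = j. 1 / real_of_int (sn v)) = real (card {v \<in> A. sn v = int j}) / real j"
      unfolding e by simp
    also have "\<dots> \<le> w j / real j" using assms(2)[OF j] by (intro divide_right_mono) auto
    finally show "(\<Sum>v | v \<in> A \<and> nat (sn v) = j. 1 / real_of_int (sn v)) \<le> w j / real j" .
  qed
  also have "\<dots> \<le> (\<Sum>j\<in>{1..m}. w j / real j)"
  proof (rule sum_mono2)
    show "(\<lambda>v. nat (sn v)) ` A \<subseteq> {1..m}" using assms(1) by force
  qed (use assms(3) in auto)
  finally show "(\<Sum>v\<in>A. 1 / real_of_int (sn v)) \<le> (\<Sum>j\<in>{1..m}. w j / real j)" .
qed

context three_forms
begin

text \<open>For every other pair some cutoff (d i)^2 k_i exceeds all values of its form, so that the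
  weight \<open>hw\<close> vanishes on the whole box.\<close>

definition VV :: "nat \<Rightarrow> ((nat \<Rightarrow> nat) \<times> (nat \<Rightarrow> nat)) set" where
  "VV N = {(\<kappa>, d) \<in> KB (CL * N) \<times> DB (CL * N). \<forall>i<3. (d i)\<^sup>2 * kk i \<kappa> \<le> CL * N}"

lemma finite_VV: "finite (VV N)"
  by (rule finite_subset[of _ "KB (CL * N) \<times> DB (CL * N)"]) (auto simp: VV_def finite_KB finite_DB)

text \<open>For fixed \<kappa> the choices of d are at most the product of the sqrt (B / k_i). The
  product of the k_i is at least the square of the product of all components, so that the sum over
  \<kappa> costs only logarithms.\<close>

lemma card_VV_le:
  assumes N: "N \<ge> 1"
  shows "real (card (VV N)) \<le> real (CL * N) powr (3/2) * (1 + ln (real (CL * N))) ^ 5"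
proof -
  define B where "B = CL * N"
  have B: "B > 0" using CL_ge_1 N by (simp add: B_def)
  define q where "q = (\<lambda>\<kappa> i. nat \<lfloor>sqrt (real B / real (kk i \<kappa>))\<rfloor>)"
  have sub: "VV N \<subseteq> (SIGMA \<kappa>:KB B. PiE {..<3} (\<lambda>i. {1..q \<kappa> i}))"
  proof
    fix x assume x: "x \<in> VV N"
    then obtain \<kappa> d where xd: "x = (\<kappa>, d)" "\<kappa> \<in> KB B" "d \<in> DB B" "\<And>i. i < 3 \<Longrightarrow> (d i)\<^sup>2 * kk i \<kappa> \<le> B"
      by (auto simp: VV_def B_def)
    have \<kappa>: "\<kappa> \<in> KS" using xd(2) KB_subset_KS by auto
    have "d i \<in> {1..q \<kappa> i}" if i: "i < 3" for i
    proof -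
      have k: "real (kk i \<kappa>) > 0" using kk_pos[OF \<kappa> i] by simp
      have "real ((d i)\<^sup>2 * kk i \<kappa>) \<le> real B" using xd(4)[OF i] by (simp only: of_nat_le_iff)
      then have "(real (d i))\<^sup>2 \<le> real B / real (kk i \<kappa>)" using k by (simp add: pos_le_divide_eq)
      then have "real (d i) \<le> sqrt (real B / real (kk i \<kappa>))" by (rule real_le_rsqrt)
      then have "d i \<le> q \<kappa> i" unfolding q_def by (simp add: le_nat_iff le_floor_iff)
      then show ?thesis using xd(3) i by (auto simp: DB_def PiE_def Pi_def)
    qed
    then show "x \<in> (SIGMA \<kappa>:KB B. PiE {..<3} (\<lambda>i. {1..q \<kappa> i}))"
      using xd by (auto simp: DB_def PiE_def Pi_def)
  qed
  have "card (VV N) \<le> card (SIGMA \<kappa>:KB B. PiE {..<3} (\<lambda>i. {1..q \<kappa> i}))"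
    by (rule card_mono[OF _ sub]) (auto intro!: finite_SigmaI finite_KB finite_PiE)
  also have "\<dots> = (\<Sum>\<kappa>\<in>KB B. \<Prod>i<3. q \<kappa> i)"
    by (subst card_SigmaI) (auto intro!: finite_KB finite_PiE simp: card_PiE)
  finally have "real (card (VV N)) \<le> (\<Sum>\<kappa>\<in>KB B. \<Prod>i<3. real (q \<kappa> i))"
    by (simp flip: of_nat_prod of_nat_sum)
  also have "\<dots> \<le> (\<Sum>\<kappa>\<in>KB B. real B powr (3/2) * (\<Prod>j<5. 1 / real (\<kappa> j)))"
  proof (rule sum_mono)
    fix \<kappa> assume "\<kappa> \<in> KB B"
    then have \<kappa>: "\<kappa> \<in> KS" using KB_subset_KS by auto
    have k0: "real (kk i \<kappa>) > 0" if "i < 3" for i using kk_pos[OF \<kappa> that] by simp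
    have \<kappa>1: "\<kappa> j \<ge> 1" if "j < 5" for j using KS_ge_1[OF \<kappa> that] .
    have P0: "(\<Prod>j<5. real (\<kappa> j)) > 0" using \<kappa>1 by (intro prod_pos) (auto simp: Suc_le_eq)
    have "(\<Prod>i<3. real (q \<kappa> i)) \<le> (\<Prod>i<3. sqrt (real B / real (kk i \<kappa>)))"
      unfolding q_def by (intro prod_mono) auto
    also have "\<dots> = sqrt (\<Prod>i<3. real B / real (kk i \<kappa>))" unfolding prod_lessThan_3 real_sqrt_mult by (rule refl)
    also have "(\<Prod>i<3. real B / real (kk i \<kappa>)) \<le> real B ^ 3 / (\<Prod>j<5. real (\<kappa> j))\<^sup>2"
    proof -
      \<comment> \<open>The slots 0, 1, 2 occur in two of the k_i, the slots 3 and 4 in all three;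
        the surplus factor is dropped.\<close>
      have "(\<Prod>j<5. \<kappa> j)\<^sup>2 * 1 \<le> (\<Prod>j<5. \<kappa> j)\<^sup>2 * (\<kappa> 3 * \<kappa> 4)" using \<kappa>1[of 3] \<kappa>1[of 4] by (intro mult_left_mono) auto
      also have "\<dots> = (\<Prod>i<3. kk i \<kappa>)"
        unfolding prod_lessThan_3 prod_lessThan_5 kk_explicit[unfolded One_nat_def[symmetric]] by (simp add: power2_eq_square mult_ac)
      finally have "real ((\<Prod>j<5. \<kappa> j)\<^sup>2) \<le> real (\<Prod>i<3. kk i \<kappa>)" by (simp only: of_nat_le_iff mult_1_right)
      then have "(\<Prod>j<5. real (\<kappa> j))\<^sup>2 \<le> (\<Prod>i<3. real (kk i \<kappa>))" by simp
      then have "real B ^ 3 / (\<Prod>i<3. real (kk i \<kappa>)) \<le> real B ^ 3 / (\<Prod>j<5. real (\<kappa> j))\<^sup>2"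
      proof (rule divide_left_mono)
        have "(\<Prod>i<3. real (kk i \<kappa>)) > 0" by (intro prod_pos k0) auto
        then show "0 < (\<Prod>i<3. real (kk i \<kappa>)) * (\<Prod>j<5. real (\<kappa> j))\<^sup>2" using P0 by (intro mult_pos_pos zero_less_power)
      qed simp
      then show ?thesis by (simp add: prod_dividef)
    qed
    also have "sqrt (real B ^ 3 / (\<Prod>j<5. real (\<kappa> j))\<^sup>2) = sqrt (real B ^ 3) / (\<Prod>j<5. real (\<kappa> j))"
      using P0 by (simp add: real_sqrt_divide)
    also have "sqrt (real B ^ 3) = real B powr (3/2)"
    proof -
      have "real B ^ 3 = real B powr 3" using B by (simp add: powr_numeral)
      then have "sqrt (real B ^ 3) = (real B powr 3) powr (1/2)" by (simp only: powr_half_sqrt[symmetric] powr_ge_zero)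
      then show ?thesis by (simp only: powr_powr) simp
    qed
    also have "real B powr (3/2) / (\<Prod>j<5. real (\<kappa> j)) = real B powr (3/2) * (\<Prod>j<5. 1 / real (\<kappa> j))"
      by (simp add: prod_dividef)
    finally show "(\<Prod>i<3. real (q \<kappa> i)) \<le> real B powr (3/2) * (\<Prod>j<5. 1 / real (\<kappa> j))" by simp
  qed
  also have "\<dots> = real B powr (3/2) * (\<Sum>\<kappa>\<in>KB B. \<Prod>j<5. 1 / real (\<kappa> j))" by (simp add: sum_distrib_left)
  also have "(\<Sum>\<kappa>\<in>KB B. \<Prod>j<5. 1 / real (\<kappa> j)) = (\<Prod>j<(5::nat). \<Sum>a\<in>{1..B}. 1 / real a)"
    unfolding KB_def by (rule prod_sum_PiE[symmetric]) auto
  also have "\<dots> = harm B ^ 5" by (simp add: harm_def divide_inverse)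
  also have "real B powr (3/2) * harm B ^ 5 \<le> real B powr (3/2) * (1 + ln (real B)) ^ 5"
    using harm_le_ln[OF B] by (intro mult_left_mono power_mono harm_nonneg) auto
  finally show ?thesis by (simp add: B_def)
qed

text \<open>Bounds the number of pairs for which v can be the chosen lattice vector.\<close>

definition cv :: "nat \<Rightarrow> int \<times> int \<Rightarrow> nat" where
  "cv N v = card {(\<kappa>, d) \<in> VV N. \<forall>i<3. int (kk i \<kappa> * d i) dvd lf i v}"

text \<open>Where L_i(v) is nonzero it is a multiple of k_i d_i, so d_i and the components in k_i
  are divisors of n. For the other forms only the cutoff (d i)^2 <= CL * N remains, hence the square
  root.\<close>

lemma cv_le_general:
  assumes T: "\<And>n. n \<in> {1..(CL * N) ^ 3} \<Longrightarrow> real (ndiv n) \<le> T"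
    and n: "1 \<le> n" "n \<le> (CL * N) ^ 3"
    and I: "I \<subseteq> {..<3}" "\<And>i. i \<in> I \<Longrightarrow> lf i v \<noteq> 0 \<and> na i v dvd n" "\<And>j. j < 5 \<Longrightarrow> \<exists>i\<in>I. j \<in> slots i"
  shows "real (cv N v) \<le> T ^ 5 * (\<Prod>i<3. if i \<in> I then T else sqrt (real (CL * N)))"
proof -
  let ?B = "CL * N" let ?Dv = "{a. a dvd n}"
  let ?q = "nat \<lfloor>sqrt (real ?B)\<rfloor>"
  have finD: "finite ?Dv" using n by (intro finite_divs) auto
  let ?X = "PiE {..<5::nat} (\<lambda>_. ?Dv) \<times> PiE {..<3::nat} (\<lambda>i. if i \<in> I then ?Dv else {1..?q})"
  have "{(\<kappa>, d) \<in> VV N. \<forall>i<3. int (kk i \<kappa> * d i) dvd lf i v} \<subseteq> ?X"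
  proof
    fix x assume "x \<in> {(\<kappa>, d) \<in> VV N. \<forall>i<3. int (kk i \<kappa> * d i) dvd lf i v}"
    then obtain \<kappa> d where x: "x = (\<kappa>, d)" "(\<kappa>, d) \<in> VV N" and dv: "\<And>i. i < 3 \<Longrightarrow> int (kk i \<kappa> * d i) dvd lf i v" by auto
    have \<kappa>: "\<kappa> \<in> KB ?B" and d: "d \<in> DB ?B" and sz: "\<And>i. i < 3 \<Longrightarrow> (d i)\<^sup>2 * kk i \<kappa> \<le> ?B"
      using x(2) by (auto simp: VV_def)
    have \<kappa>S: "\<kappa> \<in> KS" using \<kappa> KB_subset_KS by auto
    have kd: "kk i \<kappa> * d i dvd n" if "i \<in> I" for i
    proof -
      have i: "i < 3" using that I(1) by auto
      have "kk i \<kappa> * d i dvd na i v" using dv[OF i] by (simp add: na_def nat_abs_dvd_iff dvd_abs_iff del: of_nat_mult flip: int_dvd_int_iff)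
      then show ?thesis using I(2)[OF that] dvd_trans by blast
    qed
    have "\<kappa> j dvd n" if j: "j < 5" for j
    proof -
      obtain i where i: "i \<in> I" "j \<in> slots i" using I(3)[OF j] by blast
      show ?thesis using kk_dvd_slot[OF i(2), of \<kappa>] kd[OF i(1)] by (meson dvd_mult_left dvd_trans)
    qed
    moreover have "d i \<in> (if i \<in> I then ?Dv else {1..?q})" if i: "i < 3" for i
    proof (cases "i \<in> I")
      case True then show ?thesis using kd[OF True] by (auto dest: dvd_mult_right)
    next
      case False
      have "(d i)\<^sup>2 * 1 \<le> (d i)\<^sup>2 * kk i \<kappa>" using kk_pos[OF \<kappa>S i] by (intro mult_left_mono) auto
      then have "(d i)\<^sup>2 \<le> ?B" using sz[OF i] by linarith
      then have "real ((d i)\<^sup>2) \<le> real ?B" by (simp only: of_nat_le_iff)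
      then have "(real (d i))\<^sup>2 \<le> real ?B" by simp
      then have "real (d i) \<le> sqrt (real ?B)" by (rule real_le_rsqrt)
      then have "d i \<le> ?q" by (simp add: le_nat_iff le_floor_iff)
      then show ?thesis using False d i by (auto simp: DB_def PiE_def Pi_def)
    qed
    ultimately show "x \<in> ?X" using \<kappa> d x by (auto simp: KB_def DB_def PiE_def Pi_def)
  qed
  then have "cv N v \<le> card ?X"
    unfolding cv_def by (rule card_mono[rotated]) (use finD in \<open>auto intro!: finite_cartesian_product finite_PiE\<close>)
  also have "\<dots> = ndiv n ^ 5 * (\<Prod>i<3. if i \<in> I then ndiv n else ?q)"
    by (simp add: card_cartesian_product card_PiE ndiv_def if_distrib[of card] cong: if_cong)
  finally have "real (cv N v) \<le> real (ndiv n ^ 5 * (\<Prod>i<3. if i \<in> I then ndiv n else ?q))" by (simp only: of_nat_le_iff)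
  also have "\<dots> = real (ndiv n) ^ 5 * (\<Prod>i<3. if i \<in> I then real (ndiv n) else real ?q)"
    by (simp add: if_distrib[of real] cong: if_cong)
  also have "\<dots> \<le> T ^ 5 * (\<Prod>i<3. if i \<in> I then T else sqrt (real ?B))"
    using T[of n] n by (intro mult_mono power_mono prod_mono) (auto intro!: prod_nonneg)
  finally show ?thesis .
qed

lemma lf_two_zero:
  assumes "i < 3" "j < 3" "i \<noteq> j" "lf i v = 0" "lf j v = 0" shows "v = 0"
proof -
  have "lin_res (L i) (L j) * fst v = lf i v * snd (L j) - lf j v * snd (L i)"
    "lin_res (L i) (L j) * snd v = lf j v * fst (L i) - lf i v * fst (L j)"
    by (auto simp: lin_res_def lf_def linform_def algebra_simps)
  then show ?thesis using assms res[OF assms(1-3)] by (simp add: prod_eq_iff)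
qed

text \<open>A nonzero v annihilates at most one form, and the other two still involve all five
  components, so that only one d_i escapes the divisor bound. The power T^8 counts five components
  and three d_i.\<close>

lemma cv_le:
  assumes T: "\<And>n. n \<in> {1..(CL * N) ^ 3} \<Longrightarrow> real (ndiv n) \<le> T" "T \<ge> 1"
    and v: "v \<noteq> 0" "sn v \<le> int N" and N: "N \<ge> 1"
  shows "real (cv N v) \<le> T ^ 8 * (if \<forall>i<3. lf i v \<noteq> 0 then 1 else sqrt (real (CL * N)))"
proof -
  have B1: "CL * N \<ge> 1" using CL_ge_1 N by simp
  have vb: "na i v \<le> CL * N" if "i < 3" for i using v(2) by (intro lf_bound that) (auto simp: sn_def)
  show ?thesis
  proof (cases "\<forall>i<3. lf i v \<noteq> 0")
    case True
    let ?n = "\<Prod>i<3. na i v"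
    have n1: "?n \<ge> 1" using True by (auto simp: Suc_le_eq na_def intro!: prod_pos)
    have n2: "?n \<le> (CL * N) ^ 3" using prod_mono[of "{..<3}" "\<lambda>i. na i v" "\<lambda>_. CL * N"] vb by simp
    have "real (cv N v) \<le> T ^ 5 * (\<Prod>i<3. if i \<in> {..<3::nat} then T else sqrt (real (CL * N)))"
    proof (rule cv_le_general[OF T(1) n1 n2])
      show "\<exists>i\<in>{..<3}. j \<in> slots i" if "j < 5" for j using slot_ex[OF that] by auto
    qed (use True in \<open>auto intro!: dvd_prodI\<close>)
    also have "(\<Prod>i<3. if i \<in> {..<3::nat} then T else sqrt (real (CL * N))) = T ^ 3" by simp
    also have "T ^ 5 * T ^ 3 = T ^ 8" by (simp add: power_add[symmetric])
    finally show ?thesis using True by simp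
  next
    case False
    then obtain i0 where i0: "i0 < 3" "lf i0 v = 0" by auto
    let ?I = "{..<3} - {i0}" let ?n = "\<Prod>i\<in>?I. na i v"
    have nz: "lf i v \<noteq> 0" if "i \<in> ?I" for i using lf_two_zero[of i i0 v] i0 that v by auto
    have n1: "?n \<ge> 1" using nz by (auto simp: Suc_le_eq na_def intro!: prod_pos)
    have "?n \<le> (CL * N) ^ card ?I" using prod_mono[of ?I "\<lambda>i. na i v" "\<lambda>_. CL * N"] vb by simp
    also have "\<dots> \<le> (CL * N) ^ 3" using i0 B1 by (intro power_increasing) auto
    finally have n2: "?n \<le> (CL * N) ^ 3" .
    have "real (cv N v) \<le> T ^ 5 * (\<Prod>i<3. if i \<in> ?I then T else sqrt (real (CL * N)))"
    proof (rule cv_le_general[OF T(1) n1 n2])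
      \<comment> \<open>Each slot belongs to at least two of the three forms, so it survives the
        removal of i0.\<close>
      show "\<exists>i\<in>?I. j \<in> slots i" if j: "j < 5" for j
      proof -
        have "j = 0 \<or> j = 1 \<or> j = 2 \<or> j = 3 \<or> j = 4" "i0 = 0 \<or> i0 = 1 \<or> i0 = 2" using j i0 by linarith+
        then have "(i0 \<noteq> 0 \<and> j \<in> slots 0) \<or> (i0 \<noteq> 1 \<and> j \<in> slots 1) \<or> (i0 \<noteq> 2 \<and> j \<in> slots 2)"
          by (elim disjE) (simp_all add: slots_def)
        then show ?thesis by force
      qed
      show "lf i v \<noteq> 0 \<and> na i v dvd ?n" if "i \<in> ?I" for i using nz[OF that] that by (auto intro!: dvd_prodI)
    qed auto
    also have "(\<Prod>i<3. if i \<in> ?I then T else sqrt (real (CL * N))) = T ^ 2 * sqrt (real (CL * N))"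
    proof -
      have "(\<Prod>i<3. if i \<in> ?I then T else sqrt (real (CL * N))) = (\<Prod>i\<in>insert i0 ?I. if i \<in> ?I then T else sqrt (real (CL * N)))"
        using i0 by (intro prod.cong) auto
      also have "\<dots> = sqrt (real (CL * N)) * (\<Prod>i\<in>?I. T)" by (subst prod.insert) auto
      also have "\<dots> = T ^ 2 * sqrt (real (CL * N))" using i0 by simp
      finally show ?thesis .
    qed
    also have "T ^ 5 * (T ^ 2 * sqrt (real (CL * N))) \<le> T ^ 8 * sqrt (real (CL * N))"
      using T(2) by (simp add: mult.assoc[symmetric] power_add[symmetric] mult_right_mono power_increasing)
    finally show ?thesis using False by auto
  qed
qed

text \<open>A vector on the line is determined by any nonzero coordinate, and on the sphere of
  radius j one of the two coordinates is j or -j.\<close>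

lemma card_line_sn:
  assumes i: "i < 3" and j: "j \<ge> 1"
  shows "card {v \<in> A. sn v = int j \<and> lf i v = 0} \<le> 4"
proof -
  let ?S = "\<lambda>P. {v. sn v = int j \<and> lf i v = 0 \<and> P v}"
  have fin: "finite (?S P)" for P by (rule finite_subset[OF _ card_sn_eq_le(1)[OF j]]) auto
  have one: "card (?S P) \<le> 1" if P: "\<And>v w. P v \<Longrightarrow> P w \<Longrightarrow> fst v = fst w \<and> fst v \<noteq> 0 \<or> snd v = snd w \<and> snd v \<noteq> 0" for P
  proof -
    have "v = w" if "v \<in> ?S P" "w \<in> ?S P" for v w
    proof -
      have e: "fst (L i) * fst v + snd (L i) * snd v = 0" "fst (L i) * fst w + snd (L i) * snd w = 0"
        using that by (auto simp: lf_def linform_def)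
      have "fst v = fst w \<and> fst v \<noteq> 0 \<or> snd v = snd w \<and> snd v \<noteq> 0" using P that by auto
      then consider "fst v = fst w" "fst v \<noteq> 0" | "snd v = snd w" "snd v \<noteq> 0" by blast
      then show ?thesis
      proof cases
        case 1
        have "snd (L i) \<noteq> 0" using e(1) 1(2) L_nonzero[OF i] by auto
        moreover have "snd (L i) * snd v = snd (L i) * snd w" using e unfolding 1(1) by linarith
        ultimately show ?thesis using 1(1) by (simp add: prod_eq_iff)
      next
        case 2
        have "fst (L i) \<noteq> 0" using e(1) 2(2) L_nonzero[OF i] by auto
        moreover have "fst (L i) * fst v = fst (L i) * fst w" using e unfolding 2(1) by linarith
        ultimately show ?thesis using 2(1) by (simp add: prod_eq_iff)
      qed
    qed
    then show ?thesis using card_le_Suc0_iff_eq[OF fin[of P]] by auto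
  qed
  have "{v \<in> A. sn v = int j \<and> lf i v = 0} \<subseteq> (?S (\<lambda>v. fst v = int j) \<union> ?S (\<lambda>v. fst v = - int j)) \<union> (?S (\<lambda>v. snd v = int j) \<union> ?S (\<lambda>v. snd v = - int j))"
    using sn_eqD(1) by blast
  then have "card {v \<in> A. sn v = int j \<and> lf i v = 0} \<le> card ((?S (\<lambda>v. fst v = int j) \<union> ?S (\<lambda>v. fst v = - int j)) \<union> (?S (\<lambda>v. snd v = int j) \<union> ?S (\<lambda>v. snd v = - int j)))"
    by (rule card_mono[rotated]) (intro finite_UnI fin)
  also have "\<dots> \<le> (card (?S (\<lambda>v. fst v = int j)) + card (?S (\<lambda>v. fst v = - int j))) + (card (?S (\<lambda>v. snd v = int j)) + card (?S (\<lambda>v. snd v = - int j)))"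
    by (intro order.trans[OF card_Un_le] add_mono card_Un_le)
  also have "\<dots> \<le> (1 + 1) + (1 + 1)" using j by (intro add_mono one) auto
  finally show ?thesis by simp
qed

text \<open>The pairs are split at |v| = N^(3/4), with \<open>vf\<close> any choice of nonzero
  lattice vectors. Longer vectors cost at most 14 N^(1/4) per pair. Pairs with a shorter one are
  sorted by v, each v occurring at most \<open>cv\<close> times. Off the zero lines this leaves the
  sum of 1/|v|, about N^(3/4). Vectors on such a line occur up to sqrt (CL * N) times more often,
  but their sum of 1/|v| is only logarithmic.\<close>

lemma level_error_explicit:
  assumes N: "N \<ge> 1" and T: "\<And>n. n \<in> {1..(CL * N) ^ 3} \<Longrightarrow> real (ndiv n) \<le> T" "T \<ge> 1"
    and vf: "\<And>\<kappa> d. (\<kappa>, d) \<in> VV N \<Longrightarrow> vf \<kappa> d \<noteq> 0 \<and> vf \<kappa> d \<in> Lam (\<lambda>i. kk i \<kappa> * d i)"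
  shows "(\<Sum>(\<kappa>, d)\<in>VV N. 12 * real N / real_of_int (sn (vf \<kappa> d)) + 2)
    \<le> 14 * real N powr (1/4) * real (card (VV N)) + 12 * real N * (T ^ 8 * (12 * real N powr (3/4) + 12 * sqrt (real (CL * N)) * (1 + ln (real N))))"
proof -
  define m where "m = nat \<lfloor>real N powr (3/4)\<rfloor>"
  have N0: "real N \<ge> 1" using N by simp
  have pos: "real N powr (1/4) \<ge> 1" using N0 by (simp add: ge_one_powr_ge_zero)
  define A where "A = {v. 1 \<le> sn v \<and> sn v \<le> int m}"
  have mN: "real m \<le> real N powr (3/4)" by (simp add: m_def)
  have "real N powr (3/4) \<le> real N powr 1" using N0 by (intro powr_mono) auto
  then have mN': "m \<le> N" using mN N0 by simp
  have fA: "finite A" and sA: "(\<Sum>v\<in>A. 1 / real_of_int (sn v)) \<le> 12 * real m"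
  proof -
    have a: "real (card {v \<in> A. sn v = int j}) \<le> 12 * real j" if "j \<ge> 1" for j
    proof -
      have "card {v \<in> A. sn v = int j} \<le> card {v. sn v = int j}" by (rule card_mono[OF card_sn_eq_le(1)[OF that]]) auto
      also have "\<dots> \<le> 12 * j" by (rule card_sn_eq_le(2)[OF that])
      finally show ?thesis by simp
    qed
    show "finite A" by (rule sum_inverse_sn_le(1)[of A m "\<lambda>j. 12 * real j"]) (use a in \<open>auto simp: A_def\<close>)
    have "(\<Sum>v\<in>A. 1 / real_of_int (sn v)) \<le> (\<Sum>j\<in>{1..m}. 12 * real j / real j)"
      by (rule sum_inverse_sn_le(2)) (use a in \<open>auto simp: A_def\<close>)
    also have "\<dots> = (\<Sum>j\<in>{1..m}. 12)" by (intro sum.cong) auto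
    finally show "(\<Sum>v\<in>A. 1 / real_of_int (sn v)) \<le> 12 * real m" by simp
  qed
  have sZ: "(\<Sum>v\<in>{v \<in> A. lf i v = 0}. 1 / real_of_int (sn v)) \<le> 4 * (1 + ln (real N))" if i: "i < 3" for i
  proof -
    have "(\<Sum>v\<in>{v \<in> A. lf i v = 0}. 1 / real_of_int (sn v)) \<le> (\<Sum>j\<in>{1..N}. 4 / real j)"
    proof (rule sum_inverse_sn_le(2))
      fix j :: nat assume j: "j \<ge> 1"
      have "{v \<in> {v \<in> A. lf i v = 0}. sn v = int j} = {v \<in> A. sn v = int j \<and> lf i v = 0}" by auto
      then show "real (card {v \<in> {v \<in> A. lf i v = 0}. sn v = int j}) \<le> 4" using card_line_sn[OF i j, of A] by simp
    qed (use mN' in \<open>auto simp: A_def\<close>)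
    also have "\<dots> = 4 * harm N" by (simp add: harm_def sum_distrib_left divide_inverse)
    also have "\<dots> \<le> 4 * (1 + ln (real N))" using harm_le_ln[of N] N by simp
    finally show ?thesis .
  qed
  let ?s = "\<lambda>x. vf (fst x) (snd x)"
  let ?small = "{x \<in> VV N. ?s x \<in> A}"
  have pt: "12 * real N / real_of_int (sn (?s x)) + 2 \<le> 14 * real N powr (1/4) + (if ?s x \<in> A then 12 * real N * (1 / real_of_int (sn (?s x))) else 0)"
    if x: "x \<in> VV N" for x
  proof (cases "?s x \<in> A")
    case True
    then show ?thesis using pos by simp
  next
    case False
    have "sn (?s x) > 0" using sn_pos vf[of "fst x" "snd x"] x by simp
    then have "sn (?s x) > int m" using False by (auto simp: A_def)
    then have "real_of_int (sn (?s x)) \<ge> real m + 1" by linarith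
    moreover have "real m + 1 \<ge> real N powr (3/4)" unfolding m_def by linarith
    ultimately have "12 * real N / real_of_int (sn (?s x)) \<le> 12 * real N / real N powr (3/4)"
      using N0 by (intro divide_left_mono mult_pos_pos) (auto intro!: less_le_trans[of 0 "real N powr (3/4)"])
    also have "\<dots> = 12 * real N powr (1/4)" using N0 powr_diff[of "real N" 1 "3/4"] by simp
    finally show ?thesis using False pos by simp
  qed
  have "(\<Sum>(\<kappa>, d)\<in>VV N. 12 * real N / real_of_int (sn (vf \<kappa> d)) + 2) = (\<Sum>x\<in>VV N. 12 * real N / real_of_int (sn (?s x)) + 2)"
    by (simp add: case_prod_unfold)
  also have "\<dots> \<le> (\<Sum>x\<in>VV N. 14 * real N powr (1/4) + (if ?s x \<in> A then 12 * real N * (1 / real_of_int (sn (?s x))) else 0))"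
    by (intro sum_mono pt)
  also have "\<dots> = 14 * real N powr (1/4) * real (card (VV N)) + 12 * real N * (\<Sum>x\<in>?small. 1 / real_of_int (sn (?s x)))"
    using finite_VV by (simp add: sum.distrib sum.If_cases Int_def sum_distrib_left)
  also have "(\<Sum>x\<in>?small. 1 / real_of_int (sn (?s x))) \<le> T ^ 8 * (12 * real N powr (3/4) + 12 * sqrt (real (CL * N)) * (1 + ln (real N)))"
  proof -
    have fs: "finite ?small" using finite_VV by auto
    have "(\<Sum>x\<in>?small. 1 / real_of_int (sn (?s x))) = (\<Sum>v\<in>?s ` ?small. \<Sum>x | x \<in> ?small \<and> ?s x = v. 1 / real_of_int (sn (?s x)))"
      by (rule sum.image_gen[OF fs])
    also have "\<dots> = (\<Sum>v\<in>?s ` ?small. real (card {x. x \<in> ?small \<and> ?s x = v}) * (1 / real_of_int (sn v)))"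
      by (intro sum.cong refl) simp
    also have "\<dots> \<le> (\<Sum>v\<in>?s ` ?small. real (cv N v) * (1 / real_of_int (sn v)))"
    proof (intro sum_mono mult_right_mono)
      fix v assume "v \<in> ?s ` ?small"
      then show "0 \<le> 1 / real_of_int (sn v)" by (auto simp: A_def)
      have "card {x. x \<in> ?small \<and> ?s x = v} \<le> cv N v" unfolding cv_def
      proof (rule card_mono)
        show "finite {(\<kappa>, d) \<in> VV N. \<forall>i<3. int (kk i \<kappa> * d i) dvd lf i v}" by (rule finite_subset[OF _ finite_VV[of N]]) auto
        show "{x. x \<in> ?small \<and> ?s x = v} \<subseteq> {(\<kappa>, d) \<in> VV N. \<forall>i<3. int (kk i \<kappa> * d i) dvd lf i v}"
          using vf by (auto simp: Lam_def)
      qed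
      then show "real (card {x. x \<in> ?small \<and> ?s x = v}) \<le> real (cv N v)" by simp
    qed
    also have "\<dots> \<le> (\<Sum>v\<in>A. real (cv N v) * (1 / real_of_int (sn v)))"
      using fA by (intro sum_mono2) (auto simp: A_def)
    also have "\<dots> \<le> (\<Sum>v\<in>A. T ^ 8 * (1 / real_of_int (sn v) + (\<Sum>i<3. if lf i v = 0 then sqrt (real (CL * N)) * (1 / real_of_int (sn v)) else 0)))"
    proof (rule sum_mono)
      fix v assume v: "v \<in> A"
      then have v0: "v \<noteq> 0" "sn v \<le> int N" using mN' by (auto simp: A_def sn_def)
      have i0: "0 \<le> 1 / real_of_int (sn v)" using v by (auto simp: A_def)
      have "real (cv N v) \<le> T ^ 8 * (if \<forall>i<3. lf i v \<noteq> 0 then 1 else sqrt (real (CL * N)))" by (rule cv_le[OF T v0 N])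
      also have "\<dots> \<le> T ^ 8 * (1 + (\<Sum>i<3. if lf i v = 0 then sqrt (real (CL * N)) else 0))"
      proof (rule mult_left_mono)
        show "(if \<forall>i<3. lf i v \<noteq> 0 then 1 else sqrt (real (CL * N))) \<le> 1 + (\<Sum>i<3. if lf i v = 0 then sqrt (real (CL * N)) else 0)"
        proof (cases "\<forall>i<3. lf i v \<noteq> 0")
          case False
          then obtain i where i: "i < 3" "lf i v = 0" by auto
          have "(if lf i v = 0 then sqrt (real (CL * N)) else 0) \<le> (\<Sum>i<3. if lf i v = 0 then sqrt (real (CL * N)) else 0)"
            using i by (intro member_le_sum) auto
          then show ?thesis using False i by auto
        qed (auto intro!: sum_nonneg)
      qed (use T in auto)
      finally have "real (cv N v) * (1 / real_of_int (sn v)) \<le> T ^ 8 * (1 + (\<Sum>i<3. if lf i v = 0 then sqrt (real (CL * N)) else 0)) * (1 / real_of_int (sn v))"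
        using i0 by (rule mult_right_mono)
      also have "\<dots> = T ^ 8 * (1 / real_of_int (sn v) + (\<Sum>i<3. if lf i v = 0 then sqrt (real (CL * N)) * (1 / real_of_int (sn v)) else 0))"
      proof -
        have "(\<Sum>i<3. if lf i v = 0 then sqrt (real (CL * N)) * (1 / real_of_int (sn v)) else 0) = (\<Sum>i<3. if lf i v = 0 then sqrt (real (CL * N)) else 0) * (1 / real_of_int (sn v))"
          unfolding sum_distrib_right by (intro sum.cong) auto
        then show ?thesis by (simp only: distrib_right mult_1 mult.assoc)
      qed
      finally show "real (cv N v) * (1 / real_of_int (sn v)) \<le> T ^ 8 * (1 / real_of_int (sn v) + (\<Sum>i<3. if lf i v = 0 then sqrt (real (CL * N)) * (1 / real_of_int (sn v)) else 0))" .
    qed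
    also have "\<dots> = T ^ 8 * ((\<Sum>v\<in>A. 1 / real_of_int (sn v)) + (\<Sum>i<3. \<Sum>v\<in>A. if lf i v = 0 then sqrt (real (CL * N)) * (1 / real_of_int (sn v)) else 0))"
      by (simp only: sum_distrib_left[symmetric] sum.distrib sum.swap[of _ A])
    also have "\<dots> \<le> T ^ 8 * (12 * real N powr (3/4) + 12 * sqrt (real (CL * N)) * (1 + ln (real N)))"
    proof (intro mult_left_mono add_mono)
      show "(\<Sum>v\<in>A. 1 / real_of_int (sn v)) \<le> 12 * real N powr (3/4)" using sA mN by linarith
      have "(\<Sum>v\<in>A. if lf i v = 0 then sqrt (real (CL * N)) * (1 / real_of_int (sn v)) else 0) \<le> sqrt (real (CL * N)) * (4 * (1 + ln (real N)))" if i: "i < 3" for i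
      proof -
        have "(\<Sum>v\<in>A. if lf i v = 0 then sqrt (real (CL * N)) * (1 / real_of_int (sn v)) else 0) = sqrt (real (CL * N)) * (\<Sum>v\<in>{v \<in> A. lf i v = 0}. 1 / real_of_int (sn v))"
          using fA by (simp add: sum.If_cases Int_def sum_distrib_left)
        also have "\<dots> \<le> sqrt (real (CL * N)) * (4 * (1 + ln (real N)))" using sZ[OF i] by (intro mult_left_mono) auto
        finally show ?thesis .
      qed
      moreover have const: "(\<Sum>i<(3::nat). a * (4 * b)) = 12 * a * b" for a b :: real by simp
      ultimately have "(\<Sum>i<3. \<Sum>v\<in>A. if lf i v = 0 then sqrt (real (CL * N)) * (1 / real_of_int (sn v)) else 0) \<le> (\<Sum>i<(3::nat). sqrt (real (CL * N)) * (4 * (1 + ln (real N))))"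
        by (intro sum_mono) auto
      then show "(\<Sum>i<3. \<Sum>v\<in>A. if lf i v = 0 then sqrt (real (CL * N)) * (1 / real_of_int (sn v)) else 0) \<le> 12 * sqrt (real (CL * N)) * (1 + ln (real N))"
        using const[of "sqrt (real (CL * N))" "1 + ln (real N)"] by linarith
    qed (use T in auto)
    finally show ?thesis .
  qed
  finally show ?thesis using N0 by (simp add: mult_left_mono)
qed

lemma level_error:
  fixes \<epsilon> :: real
  assumes e: "\<epsilon> > 0"
  shows "\<exists>C\<ge>0. \<forall>N\<ge>1. \<forall>vf. (\<forall>(\<kappa>, d)\<in>VV N. vf \<kappa> d \<noteq> 0 \<and> vf \<kappa> d \<in> Lam (\<lambda>i. kk i \<kappa> * d i)) \<longrightarrow>
     (\<Sum>(\<kappa>, d)\<in>VV N. 12 * real N / real_of_int (sn (vf \<kappa> d)) + 2) \<le> C * real N powr (7/4 + \<epsilon>)"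
proof -
  \<comment> \<open>The numbers whose divisors are counted go up to (CL * N)^3, so \<epsilon>/24
    makes T about N^(\<epsilon>/8) and T^8 about N^\<epsilon>.\<close>
  obtain C0 where C0: "C0 \<ge> 1" "\<And>n. n > 0 \<Longrightarrow> real (ndiv n) \<le> C0 * real n powr (\<epsilon> / 24)"
    using ndiv_le_powr[of "\<epsilon> / 24"] e by auto
  obtain C1 where C1: "C1 \<ge> 1" "\<And>x. x \<ge> 1 \<Longrightarrow> (1 + ln x) ^ 5 \<le> C1 * x powr \<epsilon>"
    using one_plus_ln_le[OF e, of 5] by auto
  obtain C2 where C2: "C2 \<ge> 1" "\<And>x::real. x \<ge> 1 \<Longrightarrow> (1 + ln x) ^ 1 \<le> C2 * x powr (1/4)"
    using one_plus_ln_le[of "1/4" 1] by auto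
  define c where "c = real CL"
  have c1: "c \<ge> 1" using CL_ge_1 by (simp add: c_def)
  define C where "C = 14 * (c powr (3/2 + \<epsilon>) * C1) + 12 * (C0 ^ 8 * c powr \<epsilon> * (12 + 12 * (sqrt c * C2)))"
  have "(\<Sum>(\<kappa>, d)\<in>VV N. 12 * real N / real_of_int (sn (vf \<kappa> d)) + 2) \<le> C * real N powr (7/4 + \<epsilon>)"
    if N: "N \<ge> 1" and vf: "\<forall>(\<kappa>, d)\<in>VV N. vf \<kappa> d \<noteq> 0 \<and> vf \<kappa> d \<in> Lam (\<lambda>i. kk i \<kappa> * d i)" for N vf
  proof -
    define n where "n = real N"
    have n1: "n \<ge> 1" using N by (simp add: n_def)
    have B: "real (CL * N) = c * n" by (simp add: c_def n_def)
    have cn: "c * n \<ge> 1" using c1 n1 mult_mono[of 1 c 1 n] by simp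
    define T where "T = C0 * (c * n) powr (\<epsilon> / 8)"
    have T1: "T \<ge> 1"
      unfolding T_def using C0(1) cn e mult_mono[of 1 C0 1 "(c * n) powr (\<epsilon> / 8)"] by (simp add: ge_one_powr_ge_zero)
    have T: "real (ndiv k) \<le> T" if "k \<in> {1..(CL * N) ^ 3}" for k
    proof -
      have "real k \<le> real ((CL * N) ^ 3)" using that by (simp only: of_nat_le_iff atLeastAtMost_iff)
      also have "\<dots> = (c * n) ^ 3" by (simp only: of_nat_power B)
      finally have "real k powr (\<epsilon> / 24) \<le> ((c * n) ^ 3) powr (\<epsilon> / 24)" using e by (intro powr_mono2) auto
      also have "(c * n) ^ 3 = (c * n) powr 3" using cn by (simp add: powr_numeral)
      also have "((c * n) powr 3) powr (\<epsilon> / 24) = (c * n) powr (\<epsilon> / 8)" by (simp only: powr_powr) simp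
      finally have "C0 * real k powr (\<epsilon> / 24) \<le> T" unfolding T_def using C0(1) by (intro mult_left_mono) auto
      moreover have "real (ndiv k) \<le> C0 * real k powr (\<epsilon> / 24)" using that by (intro C0(2)) auto
      ultimately show ?thesis by linarith
    qed
    have T8: "T ^ 8 = C0 ^ 8 * c powr \<epsilon> * n powr \<epsilon>"
      using c1 n1 by (simp add: T_def power_mult_distrib powr_power powr_mult)
    have lnn: "1 + ln n \<le> C2 * n powr (1/4)" using C2(2)[OF n1] by simp
    have "(\<Sum>(\<kappa>, d)\<in>VV N. 12 * real N / real_of_int (sn (vf \<kappa> d)) + 2)
      \<le> 14 * n powr (1/4) * real (card (VV N)) + 12 * n * (T ^ 8 * (12 * n powr (3/4) + 12 * sqrt (c * n) * (1 + ln n)))"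
      using level_error_explicit[OF N T T1, of vf] vf unfolding B n_def by fastforce
    also have "\<dots> \<le> 14 * n powr (1/4) * ((c powr (3/2 + \<epsilon>) * C1) * n powr (3/2 + \<epsilon>)) + 12 * n * (T ^ 8 * (12 * n powr (3/4) + 12 * (sqrt c * C2) * n powr (3/4)))"
    proof (intro add_mono mult_left_mono)
      have "real (card (VV N)) \<le> (c * n) powr (3/2) * (1 + ln (c * n)) ^ 5" using card_VV_le[OF N] unfolding B .
      also have "\<dots> \<le> (c * n) powr (3/2) * (C1 * (c * n) powr \<epsilon>)" using C1(2)[OF cn] by (intro mult_left_mono) auto
      also have "\<dots> = C1 * (c * n) powr (3/2 + \<epsilon>)" by (simp add: powr_add)
      also have "\<dots> = (c powr (3/2 + \<epsilon>) * C1) * n powr (3/2 + \<epsilon>)" using c1 n1 by (simp add: powr_mult)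
      finally show "real (card (VV N)) \<le> (c powr (3/2 + \<epsilon>) * C1) * n powr (3/2 + \<epsilon>)" .
      have "12 * sqrt (c * n) * (1 + ln n) \<le> 12 * sqrt (c * n) * (C2 * n powr (1/4))" using lnn c1 n1 by (intro mult_left_mono) auto
      also have "\<dots> = 12 * (sqrt c * C2) * (n powr (1/2) * n powr (1/4))" using n1 by (simp add: real_sqrt_mult powr_half_sqrt)
      also have "n powr (1/2) * n powr (1/4) = n powr (3/4)" by (simp add: powr_add[symmetric])
      finally show "12 * sqrt (c * n) * (1 + ln n) \<le> 12 * (sqrt c * C2) * n powr (3/4)" .
    qed (use n1 T1 in auto)
    also have "\<dots> = C * n powr (7/4 + \<epsilon>)"
    proof -
      have e1: "n powr (1/4) * n powr (3/2 + \<epsilon>) = n powr (7/4 + \<epsilon>)" by (simp add: powr_add[symmetric])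
      have e2: "n * n powr \<epsilon> * n powr (3/4) = n powr (7/4 + \<epsilon>)"
      proof -
        have "n * n powr \<epsilon> * n powr (3/4) = n powr 1 * n powr \<epsilon> * n powr (3/4)" using n1 by simp
        also have "\<dots> = n powr (7/4 + \<epsilon>)" by (simp only: powr_add[symmetric]) (simp add: add_ac)
        finally show ?thesis .
      qed
      have "14 * n powr (1/4) * ((c powr (3/2 + \<epsilon>) * C1) * n powr (3/2 + \<epsilon>)) + 12 * n * (T ^ 8 * (12 * n powr (3/4) + 12 * (sqrt c * C2) * n powr (3/4)))
        = 14 * (c powr (3/2 + \<epsilon>) * C1) * (n powr (1/4) * n powr (3/2 + \<epsilon>)) + 12 * (C0 ^ 8 * c powr \<epsilon> * (12 + 12 * (sqrt c * C2))) * (n * n powr \<epsilon> * n powr (3/4))"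
        unfolding T8 by (simp only: distrib_left distrib_right mult.assoc mult.left_commute mult.commute)
      then show ?thesis unfolding e1 e2 C_def by (simp only: distrib_right)
    qed
    finally show ?thesis by (simp add: n_def)
  qed
  moreover have "C \<ge> 0" unfolding C_def using C0(1) C1(1) C2(1) c1 by (intro add_nonneg_nonneg mult_nonneg_nonneg) auto
  ultimately show ?thesis by (intro exI[of _ C] conjI allI impI)
qed

end

section \<open>Asymptotics at integers\<close>

text \<open>With n = k m both arguments of the weight carry the factor k, and \<open>hw\<close>
  depends only on their comparison; this is the hyperbola method for m.\<close>

lemma qdiv_eq_sum_hw:
  assumes n: "1 \<le> n" "n \<le> B" and k: "k \<ge> 1"
  shows "real (qdiv n k) = 2 * (\<Sum>d\<in>{1..B}. if k * d dvd n then hw (d\<^sup>2 * k) n else 0)"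
proof (cases "k dvd n")
  case False
  then have "\<not> k * d dvd n" for d by (meson dvd_mult_left)
  then show ?thesis using False by (simp add: qdiv_def)
next
  case True
  then obtain m where m: "n = k * m" by auto
  have m0: "m > 0" using n m by (auto intro!: Nat.gr0I)
  have mB: "m \<le> B"
  proof -
    have "m \<le> k * m" using k by (cases k) auto
    then show ?thesis using n m by linarith
  qed
  have hwk: "hw (d\<^sup>2 * k) n = hw (d\<^sup>2) m" for d
  proof -
    have "d\<^sup>2 * k < k * m \<longleftrightarrow> d\<^sup>2 < m" "d\<^sup>2 * k = k * m \<longleftrightarrow> d\<^sup>2 = m" using k by (auto simp: mult.commute)
    then show ?thesis by (simp add: hw_def m)
  qed
  have "(\<Sum>d\<in>{1..B}. if k * d dvd n then hw (d\<^sup>2 * k) n else 0) = (\<Sum>d\<in>{1..B}. if d dvd m then hw (d\<^sup>2) m else 0)"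
    using k by (intro sum.cong refl) (simp add: m hwk[unfolded m])
  also have "\<dots> = (\<Sum>d | d \<in> {1..B} \<and> d dvd m. hw (d\<^sup>2) m)" by (simp add: sum.If_cases Int_def)
  also have "{d. d \<in> {1..B} \<and> d dvd m} = {d. d dvd m}"
  proof (intro equalityI subsetI)
    fix d assume "d \<in> {d. d dvd m}"
    then have d: "d dvd m" by simp
    then have "d \<le> m" "d > 0" using m0 by (auto intro: dvd_imp_le intro!: Nat.gr0I)
    then show "d \<in> {d. d \<in> {1..B} \<and> d dvd m}" using d mB by auto
  qed auto
  finally show ?thesis using ndiv_eq_sum_hw[OF m0] k by (simp add: qdiv_def m)
qed

context three_forms
begin

section \<open>Half-planes and the passage from lattices to densities\<close>

definition lin :: "nat \<Rightarrow> real \<times> real \<Rightarrow> real" where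
  "lin i p = (real_of_int (fst (L i)), real_of_int (snd (L i))) \<bullet> p"

text \<open>Lattice points are counted in convex sets, but \<open>hw\<close> is 1/2 on a boundary
  line and depends on |L_i|. Closed and open half-planes on both sides of the zero line, each with
  weight 1/2, reproduce it.\<close>

definition Hs :: "nat \<Rightarrow> nat \<Rightarrow> nat \<Rightarrow> (real \<times> real) set" where
  "Hs q i t = (if q = 0 then {p. lin i p \<ge> real t} else if q = 1 then {p. lin i p > real t}
     else if q = 2 then {p. lin i p \<le> - real t} else {p. lin i p < - real t})"

lemma convex_Hs: "convex (Hs q i t)"
  unfolding Hs_def lin_def
  by (simp add: convex_halfspace_ge convex_halfspace_gt convex_halfspace_le convex_halfspace_lt)

lemma lin_rp: "lin i (rp x) = real_of_int (lf i x)"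
  by (simp add: lin_def rp_def lf_def linform_def inner_prod_def)

text \<open>As t >= 1 the two sides are disjoint. Beyond the boundary both half-planes of one side
  count, on it the closed one alone.\<close>

lemma hw_eq_sum_Hs:
  assumes "t \<ge> 1"
  shows "hw t (na i x) = 1/2 * (\<Sum>q<4. if rp x \<in> Hs q i t then 1 else 0)"
proof -
  have s4: "(\<Sum>q<(4::nat). f q) = f 0 + f 1 + f 2 + (f 3 :: real)" for f by (simp add: eval_nat_numeral)
  define l where "l = lf i x"
  have m: "rp x \<in> Hs 0 i t \<longleftrightarrow> int t \<le> l" "rp x \<in> Hs 1 i t \<longleftrightarrow> int t < l"
    "rp x \<in> Hs 2 i t \<longleftrightarrow> int t \<le> - l" "rp x \<in> Hs 3 i t \<longleftrightarrow> int t < - l"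
    unfolding Hs_def l_def by (simp_all add: lin_rp) linarith+
  have n: "t < na i x \<longleftrightarrow> int t < \<bar>l\<bar>" "t = na i x \<longleftrightarrow> int t = \<bar>l\<bar>" by (auto simp: na_def l_def)
  consider "l \<ge> 0" | "l < 0" by linarith
  then show ?thesis
    unfolding s4 m hw_def n using assms by cases auto
qed

definition Qs :: "(nat \<Rightarrow> nat) set" where "Qs = PiE {..<3} (\<lambda>_. {..<4})"

lemma prod_hw_eq_sum:
  assumes t: "\<And>i. i < 3 \<Longrightarrow> t i \<ge> 1"
  shows "(\<Prod>i<3. hw (t i) (na i x)) = 1/8 * (\<Sum>q\<in>Qs. if \<forall>i<3. rp x \<in> Hs (q i) i (t i) then 1 else 0)"
proof -
  have "(\<Prod>i<3. hw (t i) (na i x)) = (\<Prod>i<(3::nat). 1/2) * (\<Prod>i<3. \<Sum>q<4. if rp x \<in> Hs q i (t i) then 1 else 0)"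
    unfolding prod.distrib[symmetric] by (intro prod.cong refl hw_eq_sum_Hs t) auto
  also have "(\<Prod>i<3. \<Sum>q<4. if rp x \<in> Hs q i (t i) then 1 else (0::real)) = (\<Sum>q\<in>Qs. \<Prod>i<3. if rp x \<in> Hs (q i) i (t i) then 1 else 0)"
    unfolding Qs_def by (rule prod_sum_PiE) auto
  also have "\<dots> = (\<Sum>q\<in>Qs. if \<forall>i<3. rp x \<in> Hs (q i) i (t i) then 1 else 0)"
  proof (rule sum.cong[OF refl])
    fix q
    show "(\<Prod>i<3. if rp x \<in> Hs (q i) i (t i) then 1 else (0::real)) = (if \<forall>i<3. rp x \<in> Hs (q i) i (t i) then 1 else 0)"
    proof (cases "\<forall>i<3. rp x \<in> Hs (q i) i (t i)")
      case False
      then have "(\<Prod>i<3. if rp x \<in> Hs (q i) i (t i) then 1 else (0::real)) = 0" by (intro prod_zero) auto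
      then show ?thesis using False by simp
    qed (auto intro!: prod.neutral)
  qed
  finally show ?thesis by (simp add: power3_eq_cube)
qed

lemma sum_prod_hw:
  assumes t: "\<And>i. i < 3 \<Longrightarrow> t i \<ge> 1"
  shows "(\<Sum>x\<in>bx N \<inter> A. \<Prod>i<3. hw (t i) (na i x))
     = 1/8 * (\<Sum>q\<in>Qs. real (card {x \<in> A. rp x \<in> ({1..real N} \<times> {1..real N}) \<inter> (\<Inter>i<3. Hs (q i) i (t i))}))"
proof -
  have fin: "finite (bx N \<inter> A)" by simp
  have e: "{x \<in> A. rp x \<in> ({1..real N} \<times> {1..real N}) \<inter> (\<Inter>i<3. Hs (q i) i (t i))} = {x \<in> bx N \<inter> A. \<forall>i<3. rp x \<in> Hs (q i) i (t i)}" for q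
  proof -
    have mem: "rp x \<in> {1..real N} \<times> {1..real N} \<longleftrightarrow> x \<in> bx N" for x
      by (cases x) (auto simp: rp_def bx_def)
    show ?thesis unfolding Int_iff INT_iff lessThan_iff mem Ball_def by (rule Collect_cong) (simp only: conj_ac)
  qed
  have "(\<Sum>x\<in>bx N \<inter> A. \<Prod>i<3. hw (t i) (na i x)) = 1/8 * (\<Sum>x\<in>bx N \<inter> A. \<Sum>q\<in>Qs. if \<forall>i<3. rp x \<in> Hs (q i) i (t i) then 1 else 0)"
    by (subst sum_distrib_left, rule sum.cong[OF refl], rule prod_hw_eq_sum[OF t])
  also have "(\<Sum>x\<in>bx N \<inter> A. \<Sum>q\<in>Qs. if \<forall>i<3. rp x \<in> Hs (q i) i (t i) then 1 else (0::real)) = (\<Sum>q\<in>Qs. \<Sum>x\<in>bx N \<inter> A. if \<forall>i<3. rp x \<in> Hs (q i) i (t i) then 1 else 0)"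
    by (rule sum.swap)
  also have "\<dots> = (\<Sum>q\<in>Qs. real (card {x \<in> bx N \<inter> A. \<forall>i<3. rp x \<in> Hs (q i) i (t i)}))"
    using fin by (intro sum.cong refl) (simp add: sum.If_cases Collect_conj_eq Int_assoc)
  finally show ?thesis unfolding e .
qed

text \<open>Four half-planes for each form make 64 convex regions of weight 1/8, hence the factor 8.
  The vector v depends on D alone.\<close>

lemma lattice_hw:
  assumes D: "\<And>i. i < 3 \<Longrightarrow> D i > 0"
  shows "\<exists>v. v \<noteq> 0 \<and> v \<in> Lam D \<and> (\<forall>N t. (\<forall>i<3. t i \<ge> 1) \<longrightarrow>
     \<bar>(\<Sum>x\<in>bx N \<inter> Lam D. \<Prod>i<3. hw (t i) (na i x)) - dlt D * (\<Sum>x\<in>bx N. \<Prod>i<3. hw (t i) (na i x))\<bar> \<le> 8 * (12 * real N / real_of_int (sn v) + 2))"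
proof -
  let ?M = "\<Prod>i<3. D i"
  interpret plane_lattice "Lam D" "int ?M" by (rule plane_lattice_Lam[OF D])
  have "?M > 0" using D by (intro prod_pos) auto
  then have M0: "real ?M > 0" by (simp only: of_nat_0_less_iff)
  have "real (card (Lam D \<inter> {0..<int ?M} \<times> {0..<int ?M})) * real ?M = real ?M ^ 2 * real (card (KD D))"
    by (rule card_Lam_box(2)[OF D])
  moreover have "a / m\<^sup>2 = k / m" if "a * m = m ^ 2 * k" "m > 0" for a m k :: real
    using that by (simp add: power2_eq_square)
  ultimately have "real (card (Lam D \<inter> {0..<int ?M} \<times> {0..<int ?M})) / (real ?M)\<^sup>2 = real (card (KD D)) / real ?M"
    using M0 by blast
  also have "real (card (KD D)) / real ?M = dlt D" by (simp add: dlt_def)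
  finally have dl: "real (card (Lam D \<inter> {0..<int ?M} \<times> {0..<int ?M})) / (real_of_int (int ?M))\<^sup>2 = dlt D"
    unfolding of_int_of_nat_eq .
  obtain v where v: "v \<in> Lam D" "v \<noteq> 0"
    and cnt: "\<And>R N. convex R \<Longrightarrow> R \<subseteq> {0..N} \<times> {0..N} \<Longrightarrow> N \<ge> 0 \<Longrightarrow>
       \<bar>real (card {x \<in> Lam D. rp x \<in> R}) - dlt D * real (card {x. rp x \<in> R})\<bar> \<le> 12 * N / sn v + 2"
    by (rule lattice_count[unfolded dl]) (rule that)
  have "\<bar>(\<Sum>x\<in>bx N \<inter> Lam D. \<Prod>i<3. hw (t i) (na i x)) - dlt D * (\<Sum>x\<in>bx N. \<Prod>i<3. hw (t i) (na i x))\<bar> \<le> 8 * (12 * real N / real_of_int (sn v) + 2)"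
    if t: "\<forall>i<3. t i \<ge> 1" for N t
  proof -
    define R where "R = (\<lambda>q. ({1..real N} \<times> {1..real N}) \<inter> (\<Inter>i<3. Hs (q i) i (t i)))"
    have t': "\<And>i. i < 3 \<Longrightarrow> t i \<ge> 1" using t by auto
    have 1: "(\<Sum>x\<in>bx N \<inter> Lam D. \<Prod>i<3. hw (t i) (na i x)) = 1/8 * (\<Sum>q\<in>Qs. real (card {x \<in> Lam D. rp x \<in> R q}))"
      unfolding R_def by (rule sum_prod_hw[OF t'])
    have 2: "(\<Sum>x\<in>bx N. \<Prod>i<3. hw (t i) (na i x)) = 1/8 * (\<Sum>q\<in>Qs. real (card {x. rp x \<in> R q}))"
      using sum_prod_hw[where N = N and A = UNIV and t = t, OF t'] unfolding R_def by simp
    have cR: "convex (R q)" for q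
      unfolding R_def by (intro convex_Int convex_Times convex_INT convex_Hs) (auto intro: convex_real_interval)
    have sR: "R q \<subseteq> {0..real N} \<times> {0..real N}" for q unfolding R_def by auto
    have "(\<Sum>x\<in>bx N \<inter> Lam D. \<Prod>i<3. hw (t i) (na i x)) - dlt D * (\<Sum>x\<in>bx N. \<Prod>i<3. hw (t i) (na i x))
      = 1/8 * (\<Sum>q\<in>Qs. real (card {x \<in> Lam D. rp x \<in> R q}) - dlt D * real (card {x. rp x \<in> R q}))"
      unfolding 1 2 sum_subtractf sum_distrib_left[symmetric] by (simp add: algebra_simps)
    also have "\<bar>\<dots>\<bar> = 1/8 * \<bar>\<Sum>q\<in>Qs. real (card {x \<in> Lam D. rp x \<in> R q}) - dlt D * real (card {x. rp x \<in> R q})\<bar>"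
      by (simp add: abs_mult)
    also have "\<dots> \<le> 1/8 * (\<Sum>q\<in>Qs. 12 * real N / real_of_int (sn v) + 2)"
      by (intro mult_left_mono order.trans[OF sum_abs] sum_mono cnt cR sR) auto
    also have "(\<Sum>q\<in>Qs. 12 * real N / real_of_int (sn v) + 2) = 64 * (12 * real N / real_of_int (sn v) + 2)"
      by (simp add: Qs_def card_PiE)
    finally show ?thesis by simp
  qed
  then show ?thesis using v by (intro exI[of _ v] conjI allI impI)
qed

definition nz :: "nat \<Rightarrow> (int \<times> int) set" where "nz N = {x \<in> bx N. \<forall>i<3. lf i x \<noteq> 0}"

text \<open>The common object: \<open>lamT\<close> yields the sum of the theorem,
  \<open>lam1\<close> the sum of the products of three divisor functions.\<close>

definition Tlam :: "((nat \<Rightarrow> nat) \<Rightarrow> real) \<Rightarrow> nat \<Rightarrow> real" where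
  "Tlam lam N = (\<Sum>x\<in>nz N. \<Sum>\<kappa>\<in>KB (CL * N). lam \<kappa> * (\<Prod>i<3. real (qdiv (na i x) (kk i \<kappa>))))"

lemma finite_nz: "finite (nz N)"
  by (rule finite_subset[OF _ finite_bx[of N]]) (auto simp: nz_def)

lemma na_pos: "x \<in> nz N \<Longrightarrow> i < 3 \<Longrightarrow> na i x \<ge> 1" and na_le: "x \<in> nz N \<Longrightarrow> i < 3 \<Longrightarrow> na i x \<le> CL * N"
proof -
  show "x \<in> nz N \<Longrightarrow> i < 3 \<Longrightarrow> na i x \<ge> 1" by (force simp: nz_def na_def)
  show "x \<in> nz N \<Longrightarrow> i < 3 \<Longrightarrow> na i x \<le> CL * N" by (auto simp: nz_def intro: na_bx)
qed

lemma prod_hw_zero: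
  assumes "x \<in> bx N - nz N" "\<And>i. i < 3 \<Longrightarrow> t i \<ge> 1"
  shows "(\<Prod>i<3. hw (t i) (na i x)) = 0"
proof -
  obtain i where i: "i < 3" "lf i x = 0" using assms(1) by (auto simp: nz_def)
  have "hw (t i) (na i x) = 0" using assms(2)[OF i(1)] i(2) by (intro hw_eq_0) (simp add: na_def)
  then show ?thesis using i(1) by (intro prod_zero) auto
qed

definition tt :: "(nat \<Rightarrow> nat) \<Rightarrow> (nat \<Rightarrow> nat) \<Rightarrow> nat \<Rightarrow> nat" where "tt \<kappa> d i = (d i)\<^sup>2 * kk i \<kappa>"

lemma tt_ge_1: "\<kappa> \<in> KB B \<Longrightarrow> d \<in> DB B \<Longrightarrow> i < 3 \<Longrightarrow> tt \<kappa> d i \<ge> 1"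
  using kk_pos[of \<kappa> i] KB_subset_KS[of B] by (fastforce simp: tt_def DB_def PiE_def Pi_def Suc_le_eq)

text \<open>The hyperbola method opens each \<open>qdiv\<close>, and its three factors 2 give 8.
  Points outside \<open>nz\<close> may be added back, since a positive cutoff makes
  \<open>hw\<close> vanish at 0.\<close>

lemma Tlam_eq:
  "Tlam lam N = 8 * (\<Sum>\<kappa>\<in>KB (CL * N). \<Sum>d\<in>DB (CL * N). lam \<kappa> * (\<Sum>x\<in>bx N \<inter> Lam (\<lambda>i. kk i \<kappa> * d i). \<Prod>i<3. hw (tt \<kappa> d i) (na i x)))"
proof -
  let ?B = "CL * N"
  have q: "(\<Prod>i<3. real (qdiv (na i x) (kk i \<kappa>))) = 8 * (\<Sum>d\<in>DB ?B. if x \<in> Lam (\<lambda>i. kk i \<kappa> * d i) then \<Prod>i<3. hw (tt \<kappa> d i) (na i x) else 0)"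
    if x: "x \<in> nz N" and \<kappa>: "\<kappa> \<in> KB ?B" for x \<kappa>
  proof -
    have \<kappa>S: "\<kappa> \<in> KS" using \<kappa> KB_subset_KS by auto
    have "(\<Prod>i<3. real (qdiv (na i x) (kk i \<kappa>))) = (\<Prod>i<3. 2 * (\<Sum>d\<in>{1..?B}. if kk i \<kappa> * d dvd na i x then hw (d\<^sup>2 * kk i \<kappa>) (na i x) else 0))"
      using na_pos[OF x] na_le[OF x] kk_pos[OF \<kappa>S] by (intro prod.cong refl qdiv_eq_sum_hw) (auto simp: Suc_le_eq)
    also have "\<dots> = 8 * (\<Prod>i<3. \<Sum>d\<in>{1..?B}. if kk i \<kappa> * d dvd na i x then hw (d\<^sup>2 * kk i \<kappa>) (na i x) else 0)"
      by (simp only: prod.distrib) simp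
    also have "(\<Prod>i<3. \<Sum>d\<in>{1..?B}. if kk i \<kappa> * d dvd na i x then hw (d\<^sup>2 * kk i \<kappa>) (na i x) else 0)
      = (\<Sum>d\<in>DB ?B. \<Prod>i<3. if kk i \<kappa> * d i dvd na i x then hw ((d i)\<^sup>2 * kk i \<kappa>) (na i x) else 0)"
      unfolding DB_def by (rule prod_sum_PiE) auto
    also have "\<dots> = (\<Sum>d\<in>DB ?B. if x \<in> Lam (\<lambda>i. kk i \<kappa> * d i) then \<Prod>i<3. hw (tt \<kappa> d i) (na i x) else 0)"
    proof (rule sum.cong[OF refl])
      fix d
      have dv: "kk i \<kappa> * d i dvd na i x \<longleftrightarrow> int (kk i \<kappa> * d i) dvd lf i x" for i
        unfolding na_def by (simp add: nat_abs_dvd_iff dvd_abs_iff del: of_nat_mult flip: int_dvd_int_iff)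
      show "(\<Prod>i<3. if kk i \<kappa> * d i dvd na i x then hw ((d i)\<^sup>2 * kk i \<kappa>) (na i x) else 0) = (if x \<in> Lam (\<lambda>i. kk i \<kappa> * d i) then \<Prod>i<3. hw (tt \<kappa> d i) (na i x) else 0)"
      proof (cases "x \<in> Lam (\<lambda>i. kk i \<kappa> * d i)")
        case True
        then have "(\<Prod>i<3. if kk i \<kappa> * d i dvd na i x then hw ((d i)\<^sup>2 * kk i \<kappa>) (na i x) else 0) = (\<Prod>i<3. hw (tt \<kappa> d i) (na i x))"
          unfolding dv Lam_def tt_def by (intro prod.cong) auto
        then show ?thesis using True by simp
      next
        case False
        then obtain i where "i < 3" "\<not> kk i \<kappa> * d i dvd na i x" unfolding dv Lam_def by auto
        then have "(\<Prod>i<3. if kk i \<kappa> * d i dvd na i x then hw ((d i)\<^sup>2 * kk i \<kappa>) (na i x) else 0) = 0"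
          by (intro prod_zero) auto
        then show ?thesis using False by simp
      qed
    qed
    finally show ?thesis .
  qed
  have "Tlam lam N = (\<Sum>x\<in>nz N. \<Sum>\<kappa>\<in>KB ?B. \<Sum>d\<in>DB ?B. 8 * (lam \<kappa> * (if x \<in> Lam (\<lambda>i. kk i \<kappa> * d i) then \<Prod>i<3. hw (tt \<kappa> d i) (na i x) else 0)))"
    unfolding Tlam_def by (intro sum.cong refl) (simp add: q sum_distrib_left mult_ac)
  also have "\<dots> = (\<Sum>\<kappa>\<in>KB ?B. \<Sum>x\<in>nz N. \<Sum>d\<in>DB ?B. 8 * (lam \<kappa> * (if x \<in> Lam (\<lambda>i. kk i \<kappa> * d i) then \<Prod>i<3. hw (tt \<kappa> d i) (na i x) else 0)))"
    by (rule sum.swap)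
  also have "\<dots> = (\<Sum>\<kappa>\<in>KB ?B. \<Sum>d\<in>DB ?B. \<Sum>x\<in>nz N. 8 * (lam \<kappa> * (if x \<in> Lam (\<lambda>i. kk i \<kappa> * d i) then \<Prod>i<3. hw (tt \<kappa> d i) (na i x) else 0)))"
    by (intro sum.cong[OF refl] sum.swap)
  also have "\<dots> = (\<Sum>\<kappa>\<in>KB ?B. \<Sum>d\<in>DB ?B. 8 * (lam \<kappa> * (\<Sum>x\<in>bx N \<inter> Lam (\<lambda>i. kk i \<kappa> * d i). \<Prod>i<3. hw (tt \<kappa> d i) (na i x))))"
  proof (intro sum.cong refl)
    fix \<kappa> d assume kd: "\<kappa> \<in> KB ?B" "d \<in> DB ?B"
    have "(\<Sum>x\<in>nz N. if x \<in> Lam (\<lambda>i. kk i \<kappa> * d i) then \<Prod>i<3. hw (tt \<kappa> d i) (na i x) else 0) = (\<Sum>x\<in>bx N. if x \<in> Lam (\<lambda>i. kk i \<kappa> * d i) then \<Prod>i<3. hw (tt \<kappa> d i) (na i x) else 0)"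
    proof (rule sum.mono_neutral_left)
      show "\<forall>x\<in>bx N - nz N. (if x \<in> Lam (\<lambda>i. kk i \<kappa> * d i) then \<Prod>i<3. hw (tt \<kappa> d i) (na i x) else 0) = 0"
        using prod_hw_zero[OF _ tt_ge_1[OF kd]] by simp
    qed (auto simp: nz_def)
    also have "\<dots> = (\<Sum>x\<in>bx N \<inter> Lam (\<lambda>i. kk i \<kappa> * d i). \<Prod>i<3. hw (tt \<kappa> d i) (na i x))"
      by (rule sum.inter_restrict[symmetric]) simp
    finally show "(\<Sum>x\<in>nz N. 8 * (lam \<kappa> * (if x \<in> Lam (\<lambda>i. kk i \<kappa> * d i) then \<Prod>i<3. hw (tt \<kappa> d i) (na i x) else 0))) = 8 * (lam \<kappa> * (\<Sum>x\<in>bx N \<inter> Lam (\<lambda>i. kk i \<kappa> * d i). \<Prod>i<3. hw (tt \<kappa> d i) (na i x)))"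
      by (simp only: sum_distrib_left[symmetric])
  qed
  finally show ?thesis by (simp only: sum_distrib_left)
qed

text \<open>Lattice sums become densities with the error of \<open>lattice_hw\<close>, and
  \<open>level_error\<close> adds these errors up over \<open>VV\<close>; for all other pairs both
  sums vanish. The constant 64 combines the 8 of \<open>Tlam_eq\<close> with the 8 of
  \<open>lattice_hw\<close>.\<close>

lemma Tlam_Hsum:
  assumes lam: "\<And>\<kappa>. \<bar>lam \<kappa>\<bar> \<le> 1" and e: "\<epsilon> > 0"
  shows "\<exists>C\<ge>0. \<forall>N\<ge>1. \<bar>Tlam lam N - 8 * (\<Sum>x\<in>nz N. Hsum lam (CL * N) (\<lambda>i. na i x))\<bar> \<le> C * real N powr (7/4 + \<epsilon>)"
proof -
  from level_error[OF e]
  obtain C where C: "C \<ge> 0" and lev: "\<forall>N\<ge>1. \<forall>vf. (\<forall>(\<kappa>, d)\<in>VV N. vf \<kappa> d \<noteq> 0 \<and> vf \<kappa> d \<in> Lam (\<lambda>i. kk i \<kappa> * d i)) \<longrightarrow>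
     (\<Sum>(\<kappa>, d)\<in>VV N. 12 * real N / real_of_int (sn (vf \<kappa> d)) + 2) \<le> C * real N powr (7/4 + \<epsilon>)"
    by (elim exE conjE)
  have "\<bar>Tlam lam N - 8 * (\<Sum>x\<in>nz N. Hsum lam (CL * N) (\<lambda>i. na i x))\<bar> \<le> (64 * C) * real N powr (7/4 + \<epsilon>)" if N: "N \<ge> 1" for N
  proof -
    let ?B = "CL * N"
    let ?D = "\<lambda>\<kappa> d i. kk i \<kappa> * d i"
    define P where "P = (\<lambda>\<kappa> d v. v \<noteq> 0 \<and> v \<in> Lam (?D \<kappa> d) \<and> (\<forall>N t. (\<forall>i<3. t i \<ge> 1) \<longrightarrow>
     \<bar>(\<Sum>x\<in>bx N \<inter> Lam (?D \<kappa> d). \<Prod>i<3. hw (t i) (na i x)) - dlt (?D \<kappa> d) * (\<Sum>x\<in>bx N. \<Prod>i<3. hw (t i) (na i x))\<bar> \<le> 8 * (12 * real N / real_of_int (sn v) + 2)))"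
    define vf where "vf = (\<lambda>\<kappa> d. SOME v. P \<kappa> d v)"
    have vf: "P \<kappa> d (vf \<kappa> d)" if "\<kappa> \<in> KB ?B" "d \<in> DB ?B" for \<kappa> d
      unfolding vf_def
    proof (rule someI_ex)
      show "\<exists>v. P \<kappa> d v" unfolding P_def
      proof (rule lattice_hw)
        fix i :: nat assume i: "i < 3"
        have "\<kappa> \<in> KS" using that(1) KB_subset_KS by auto
        then show "kk i \<kappa> * d i > 0" using kk_pos[of \<kappa> i] i that(2) by (auto simp: DB_def PiE_def Pi_def Suc_le_eq)
      qed
    qed
    have HS: "(\<Sum>x\<in>nz N. Hsum lam ?B (\<lambda>i. na i x)) = (\<Sum>\<kappa>\<in>KB ?B. \<Sum>d\<in>DB ?B. lam \<kappa> * (dlt (?D \<kappa> d) * (\<Sum>x\<in>bx N. \<Prod>i<3. hw (tt \<kappa> d i) (na i x))))"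
    proof -
      have "(\<Sum>x\<in>nz N. Hsum lam ?B (\<lambda>i. na i x)) = (\<Sum>\<kappa>\<in>KB ?B. \<Sum>x\<in>nz N. \<Sum>d\<in>DB ?B. lam \<kappa> * dlt (?D \<kappa> d) * (\<Prod>i<3. hw (tt \<kappa> d i) (na i x)))"
        unfolding Hsum_def tt_def by (rule sum.swap)
      also have "\<dots> = (\<Sum>\<kappa>\<in>KB ?B. \<Sum>d\<in>DB ?B. \<Sum>x\<in>nz N. lam \<kappa> * dlt (?D \<kappa> d) * (\<Prod>i<3. hw (tt \<kappa> d i) (na i x)))"
        by (intro sum.cong[OF refl] sum.swap)
      also have "\<dots> = (\<Sum>\<kappa>\<in>KB ?B. \<Sum>d\<in>DB ?B. lam \<kappa> * (dlt (?D \<kappa> d) * (\<Sum>x\<in>bx N. \<Prod>i<3. hw (tt \<kappa> d i) (na i x))))"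
      proof (intro sum.cong refl)
        fix \<kappa> d assume kd: "\<kappa> \<in> KB ?B" "d \<in> DB ?B"
        have "(\<Sum>x\<in>nz N. \<Prod>i<3. hw (tt \<kappa> d i) (na i x)) = (\<Sum>x\<in>bx N. \<Prod>i<3. hw (tt \<kappa> d i) (na i x))"
        proof (rule sum.mono_neutral_left)
          show "\<forall>x\<in>bx N - nz N. (\<Prod>i<3. hw (tt \<kappa> d i) (na i x)) = 0"
            using prod_hw_zero[OF _ tt_ge_1[OF kd]] by simp
        qed (auto simp: nz_def)
        then show "(\<Sum>x\<in>nz N. lam \<kappa> * dlt (?D \<kappa> d) * (\<Prod>i<3. hw (tt \<kappa> d i) (na i x))) = lam \<kappa> * (dlt (?D \<kappa> d) * (\<Sum>x\<in>bx N. \<Prod>i<3. hw (tt \<kappa> d i) (na i x)))"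
          by (simp only: sum_distrib_left[symmetric] mult.assoc)
      qed
      finally show ?thesis .
    qed
    have pt: "\<bar>lam \<kappa> * ((\<Sum>x\<in>bx N \<inter> Lam (?D \<kappa> d). \<Prod>i<3. hw (tt \<kappa> d i) (na i x)) - dlt (?D \<kappa> d) * (\<Sum>x\<in>bx N. \<Prod>i<3. hw (tt \<kappa> d i) (na i x)))\<bar>
        \<le> (if (\<kappa>, d) \<in> VV N then 8 * (12 * real N / real_of_int (sn (vf \<kappa> d)) + 2) else 0)" (is "\<bar>lam \<kappa> * ?E\<bar> \<le> _")
      if kd: "\<kappa> \<in> KB ?B" "d \<in> DB ?B" for \<kappa> d
    proof (cases "(\<kappa>, d) \<in> VV N")
      case True
      have "\<bar>lam \<kappa> * ?E\<bar> \<le> 1 * \<bar>?E\<bar>" unfolding abs_mult by (intro mult_right_mono lam) auto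
      also have "\<bar>?E\<bar> \<le> 8 * (12 * real N / real_of_int (sn (vf \<kappa> d)) + 2)"
        using vf[OF kd] tt_ge_1[OF kd] unfolding P_def by blast
      finally show ?thesis using True by simp
    next
      case False
      then obtain i where i: "i < 3" "tt \<kappa> d i > ?B" using kd by (auto simp: VV_def tt_def not_le)
      have zz: "(\<Prod>i<3. hw (tt \<kappa> d i) (na i x)) = 0" if "x \<in> bx N" for x
      proof -
        have "hw (tt \<kappa> d i) (na i x) = 0" using na_bx[OF i(1) that] i(2) by (intro hw_eq_0) linarith
        then show ?thesis using i(1) by (intro prod_zero) auto
      qed
      have z1: "(\<Sum>x\<in>bx N \<inter> Lam (?D \<kappa> d). \<Prod>i<3. hw (tt \<kappa> d i) (na i x)) = 0"
      proof (rule sum.neutral, rule ballI)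
        fix x assume "x \<in> bx N \<inter> Lam (?D \<kappa> d)"
        then show "(\<Prod>i<3. hw (tt \<kappa> d i) (na i x)) = 0" by (intro zz) simp
      qed
      have "(\<Sum>x\<in>bx N. \<Prod>i<3. hw (tt \<kappa> d i) (na i x)) = 0"
      proof (rule sum.neutral, rule ballI)
        fix x assume "x \<in> bx N"
        then show "(\<Prod>i<3. hw (tt \<kappa> d i) (na i x)) = 0" by (rule zz)
      qed
      note z1 this
      then have "?E = 0" by (simp only: mult_zero_right diff_zero)
      then show ?thesis using False by simp
    qed
    have "\<bar>Tlam lam N - 8 * (\<Sum>x\<in>nz N. Hsum lam ?B (\<lambda>i. na i x))\<bar>
      = 8 * \<bar>\<Sum>\<kappa>\<in>KB ?B. \<Sum>d\<in>DB ?B. lam \<kappa> * ((\<Sum>x\<in>bx N \<inter> Lam (?D \<kappa> d). \<Prod>i<3. hw (tt \<kappa> d i) (na i x)) - dlt (?D \<kappa> d) * (\<Sum>x\<in>bx N. \<Prod>i<3. hw (tt \<kappa> d i) (na i x)))\<bar>"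
      unfolding Tlam_eq HS by (simp only: right_diff_distrib[of "lam _"] sum_subtractf right_diff_distrib[of 8, symmetric] abs_mult abs_numeral)
    also have "\<dots> \<le> 8 * (\<Sum>\<kappa>\<in>KB ?B. \<Sum>d\<in>DB ?B. if (\<kappa>, d) \<in> VV N then 8 * (12 * real N / real_of_int (sn (vf \<kappa> d)) + 2) else 0)"
      by (intro mult_left_mono order.trans[OF sum_abs] sum_mono pt) auto
    also have "(\<Sum>\<kappa>\<in>KB ?B. \<Sum>d\<in>DB ?B. if (\<kappa>, d) \<in> VV N then 8 * (12 * real N / real_of_int (sn (vf \<kappa> d)) + 2) else 0)
      = (\<Sum>x\<in>KB ?B \<times> DB ?B. if x \<in> VV N then case x of (\<kappa>, d) \<Rightarrow> 8 * (12 * real N / real_of_int (sn (vf \<kappa> d)) + 2) else 0)"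
      by (subst sum.cartesian_product) (rule sum.cong[OF refl], auto split: prod.splits)
    also have "\<dots> = (\<Sum>x\<in>VV N. case x of (\<kappa>, d) \<Rightarrow> 8 * (12 * real N / real_of_int (sn (vf \<kappa> d)) + 2))"
    proof -
      have "KB ?B \<times> DB ?B \<inter> VV N = VV N" by (auto simp: VV_def)
      have f: "finite (KB ?B \<times> DB ?B)" by (intro finite_cartesian_product finite_KB finite_DB)
      show ?thesis unfolding sum.inter_restrict[OF f, symmetric] \<open>KB ?B \<times> DB ?B \<inter> VV N = VV N\<close> by (rule refl)
    qed
    also have "\<dots> = 8 * (\<Sum>(\<kappa>, d)\<in>VV N. 12 * real N / real_of_int (sn (vf \<kappa> d)) + 2)"
      unfolding sum_distrib_left by (intro sum.cong) auto
    also have "8 * (8 * (\<Sum>(\<kappa>, d)\<in>VV N. 12 * real N / real_of_int (sn (vf \<kappa> d)) + 2)) \<le> 8 * (8 * (C * real N powr (7/4 + \<epsilon>)))"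
    proof (intro mult_left_mono lev[THEN spec, THEN mp, OF N, THEN spec, THEN mp])
      show "\<forall>(\<kappa>, d)\<in>VV N. vf \<kappa> d \<noteq> 0 \<and> vf \<kappa> d \<in> Lam (\<lambda>i. kk i \<kappa> * d i)"
        using vf by (auto simp: VV_def P_def)
    qed auto
    finally show ?thesis by simp
  qed
  then show ?thesis using C by (intro exI[of _ "64 * C"]) auto
qed

text \<open>A factor n powr (3/4 + \<epsilon>) is bounded by its value at B, which leaves a
  convergent series; the loss of \<epsilon> is harmless.\<close>

lemma sum_powr_le:
  fixes \<epsilon> :: real
  assumes "\<epsilon> > 0"
  shows "\<exists>Z\<ge>0. \<forall>B. (\<Sum>n\<in>{1..B}. real n powr (-1/4)) \<le> Z * real B powr (3/4 + \<epsilon>)"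
proof -
  obtain Z where Z: "Z \<ge> 0" "\<And>B. (\<Sum>b\<in>{1..B}. real b powr (-(1 + \<epsilon>))) \<le> Z"
    using sum_powr_bounded[of "1 + \<epsilon>"] assms by auto
  have "(\<Sum>n\<in>{1..B}. real n powr (-1/4)) \<le> Z * real B powr (3/4 + \<epsilon>)" for B
  proof -
    have "(\<Sum>n\<in>{1..B}. real n powr (-1/4)) \<le> (\<Sum>n\<in>{1..B}. real B powr (3/4 + \<epsilon>) * real n powr (-(1 + \<epsilon>)))"
    proof (rule sum_mono)
      fix n assume n: "n \<in> {1..B}"
      have "real n powr (-1/4) = real n powr (3/4 + \<epsilon>) * real n powr (-(1 + \<epsilon>))" by (simp add: powr_add[symmetric])
      also have "\<dots> \<le> real B powr (3/4 + \<epsilon>) * real n powr (-(1 + \<epsilon>))"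
        using n assms by (intro mult_right_mono powr_mono2) auto
      finally show "real n powr (-1/4) \<le> real B powr (3/4 + \<epsilon>) * real n powr (-(1 + \<epsilon>))" .
    qed
    also have "\<dots> = real B powr (3/4 + \<epsilon>) * (\<Sum>n\<in>{1..B}. real n powr (-(1 + \<epsilon>)))" by (rule sum_distrib_left[symmetric])
    also have "\<dots> \<le> real B powr (3/4 + \<epsilon>) * Z" by (intro mult_left_mono Z) auto
    finally show ?thesis by (simp add: mult.commute)
  qed
  then show ?thesis using Z(1) by blast
qed

text \<open>The error z^(-1/4) is poor at points near a zero line, but each absolute value of a form
  occurs at most 2 N times, so its mean over the box is still about N^(-1/4).\<close>

lemma Hsum_pterm_sum:
  assumes lam: "\<And>\<kappa>. \<bar>lam \<kappa>\<bar> \<le> 1" and e: "\<epsilon> > 0"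
  shows "\<exists>C\<ge>0. \<forall>N\<ge>1. \<bar>(\<Sum>x\<in>nz N. Hsum lam (CL * N) (\<lambda>i. na i x)) - (\<Sum>x\<in>nz N. infsum (pterm lam (\<lambda>i. na i x)) (KS \<times> K))\<bar>
     \<le> C * real N powr (7/4 + \<epsilon>)"
proof -
  from hterm_pterm[where lam = lam, OF lam]
  obtain C0 where C0: "C0 \<ge> 0" and hp: "\<forall>z. (\<forall>i<3. z i \<ge> 1) \<longrightarrow> \<bar>infsum (hterm lam z) (KS \<times> K) - infsum (pterm lam z) (KS \<times> K)\<bar>
     \<le> C0 * (\<Prod>i<3. 1 + ln (real (z i))) * (\<Sum>i<3. real (z i) powr (-1/4))"
    by (elim exE conjE)
  obtain C1 where C1: "C1 \<ge> 1" "\<And>x::real. x \<ge> 1 \<Longrightarrow> (1 + ln x) ^ 3 \<le> C1 * x powr (\<epsilon> / 2)"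
    using one_plus_ln_le[of "\<epsilon> / 2" 3] e by auto
  obtain Z where Z: "Z \<ge> 0" "\<And>B. (\<Sum>n\<in>{1..B}. real n powr (-1/4)) \<le> Z * real B powr (3/4 + \<epsilon> / 2)"
    using sum_powr_le[of "\<epsilon> / 2"] e by auto
  define c where "c = real CL"
  have c1: "c \<ge> 1" using CL_ge_1 by (simp add: c_def)
  define C where "C = C0 * C1 * 6 * Z * c powr (3/4 + \<epsilon>)"
  have "\<bar>(\<Sum>x\<in>nz N. Hsum lam (CL * N) (\<lambda>i. na i x)) - (\<Sum>x\<in>nz N. infsum (pterm lam (\<lambda>i. na i x)) (KS \<times> K))\<bar>
     \<le> C * real N powr (7/4 + \<epsilon>)" if N: "N \<ge> 1" for N
  proof -
    have N0: "real N \<ge> 1" using N by simp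
    have B1: "real (CL * N) \<ge> 1" using mult_mono[of 1 c 1 "real N"] c1 N0 by (simp add: c_def)
    define W where "W = C0 * (C1 * real (CL * N) powr (\<epsilon> / 2))"
    have W0: "W \<ge> 0" unfolding W_def using C0 C1(1) by (intro mult_nonneg_nonneg) auto
    have pt: "\<bar>Hsum lam (CL * N) (\<lambda>i. na i x) - infsum (pterm lam (\<lambda>i. na i x)) (KS \<times> K)\<bar> \<le> W * (\<Sum>i<3. real (na i x) powr (-1/4))"
      if x: "x \<in> nz N" for x
    proof -
      have "Hsum lam (CL * N) (\<lambda>i. na i x) = infsum (hterm lam (\<lambda>i. na i x)) (KS \<times> K)"
        by (rule Hsum_eq_infsum) (rule na_le[OF x])
      then have "\<bar>Hsum lam (CL * N) (\<lambda>i. na i x) - infsum (pterm lam (\<lambda>i. na i x)) (KS \<times> K)\<bar>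
        \<le> C0 * (\<Prod>i<3. 1 + ln (real (na i x))) * (\<Sum>i<3. real (na i x) powr (-1/4))"
        using hp[rule_format, of "\<lambda>i. na i x"] na_pos[OF x] by simp
      also have "\<dots> \<le> W * (\<Sum>i<3. real (na i x) powr (-1/4))"
      proof (rule mult_right_mono)
        have "(\<Prod>i<3. 1 + ln (real (na i x))) \<le> (\<Prod>i<(3::nat). 1 + ln (real (CL * N)))"
        proof (intro prod_mono conjI)
          fix i :: nat assume "i \<in> {..<3}"
          then have i: "i < 3" by simp
          have a: "real (na i x) \<ge> 1" using na_pos[OF x i] by simp
          have b: "real (na i x) \<le> real (CL * N)" using na_le[OF x i] by (simp only: of_nat_le_iff)
          show "0 \<le> 1 + ln (real (na i x))" using a by (simp add: add_nonneg_nonneg)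
          show "1 + ln (real (na i x)) \<le> 1 + ln (real (CL * N))" using a b by (intro add_left_mono) (subst ln_le_cancel_iff, auto)
        qed
        also have "\<dots> = (1 + ln (real (CL * N))) ^ 3" by simp
        also have "\<dots> \<le> C1 * real (CL * N) powr (\<epsilon> / 2)" by (rule C1(2)[OF B1])
        finally show "C0 * (\<Prod>i<3. 1 + ln (real (na i x))) \<le> W" unfolding W_def using C0 by (intro mult_left_mono)
      qed (auto intro!: sum_nonneg)
      finally show ?thesis .
    qed
    have "\<bar>(\<Sum>x\<in>nz N. Hsum lam (CL * N) (\<lambda>i. na i x)) - (\<Sum>x\<in>nz N. infsum (pterm lam (\<lambda>i. na i x)) (KS \<times> K))\<bar>
      \<le> (\<Sum>x\<in>nz N. W * (\<Sum>i<3. real (na i x) powr (-1/4)))"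
      unfolding sum_subtractf[symmetric] by (intro order.trans[OF sum_abs] sum_mono pt)
    also have "\<dots> = W * (\<Sum>i<3. \<Sum>x\<in>nz N. real (na i x) powr (-1/4))"
      by (simp only: sum_distrib_left[symmetric] sum.swap[of _ "nz N"])
    also have "\<dots> \<le> W * (\<Sum>i<(3::nat). 2 * real N * (Z * real (CL * N) powr (3/4 + \<epsilon> / 2)))"
    proof (intro mult_left_mono sum_mono W0)
      fix i :: nat assume "i \<in> {..<3}"
      then have i: "i < 3" by simp
      have "(\<Sum>x\<in>nz N. real (na i x) powr (-1/4)) \<le> (\<Sum>x | x \<in> bx N \<and> lf i x \<noteq> 0. real (na i x) powr (-1/4))"
        using i by (intro sum_mono2) (auto simp: nz_def intro: finite_subset[OF _ finite_bx[of N]])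
      also have "\<dots> \<le> 2 * real N * (\<Sum>n\<in>{1..CL * N}. real n powr (-1/4))" by (rule sum_fiber_le[OF i]) simp
      also have "\<dots> \<le> 2 * real N * (Z * real (CL * N) powr (3/4 + \<epsilon> / 2))" by (intro mult_left_mono Z) auto
      finally show "(\<Sum>x\<in>nz N. real (na i x) powr (-1/4)) \<le> 2 * real N * (Z * real (CL * N) powr (3/4 + \<epsilon> / 2))" .
    qed
    also have "\<dots> = C0 * C1 * 6 * Z * (real N * (real (CL * N) powr (\<epsilon> / 2) * real (CL * N) powr (3/4 + \<epsilon> / 2)))"
      by (simp add: W_def)
    also have "real N * (real (CL * N) powr (\<epsilon> / 2) * real (CL * N) powr (3/4 + \<epsilon> / 2)) = c powr (3/4 + \<epsilon>) * real N powr (7/4 + \<epsilon>)"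
    proof -
      have "real (CL * N) powr (\<epsilon> / 2) * real (CL * N) powr (3/4 + \<epsilon> / 2) = (c * real N) powr (3/4 + \<epsilon>)"
        by (simp add: powr_add[symmetric] c_def add_ac)
      also have "\<dots> = c powr (3/4 + \<epsilon>) * real N powr (3/4 + \<epsilon>)" using c1 by (simp add: powr_mult)
      finally have "real N * (real (CL * N) powr (\<epsilon> / 2) * real (CL * N) powr (3/4 + \<epsilon> / 2)) = c powr (3/4 + \<epsilon>) * (real N * real N powr (3/4 + \<epsilon>))"
        by (simp only: mult.left_commute)
      also have "real N * real N powr (3/4 + \<epsilon>) = real N powr (7/4 + \<epsilon>)" using N0 by (simp add: powr_mult_base)
      finally show ?thesis .
    qed
    finally show ?thesis by (simp add: C_def mult_ac)
  qed
  moreover have "C \<ge> 0" unfolding C_def using C0 C1(1) Z(1) by (intro mult_nonneg_nonneg) auto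
  ultimately show ?thesis by (intro exI[of _ C] conjI allI impI)
qed

text \<open>The coefficient of (ln N)^j after \<open>infsum_pterm\<close> and
  \<open>sum_prod_ln\<close> are combined and the means replaced by their limits; the 8 is that of
  \<open>Tlam_eq\<close>.\<close>

definition Cc :: "((nat \<Rightarrow> nat) \<Rightarrow> real) \<Rightarrow> nat \<Rightarrow> real" where
  "Cc lam j = 8 * (\<Sum>S\<in>Pow {..<3}. \<Sum>T\<in>Pow S. if card (S - T) = j then pc lam S * Ainf T else 0)"

text \<open>A third power of ln N needs S full and T empty, and \<open>Ainf {}\<close> is 1.\<close>

lemma Cc_3: "Cc lam 3 = 8 * pc lam {..<3}"
proof -
  have key: "S = {..<3} \<and> T = {}" if "S \<subseteq> {..<3::nat}" "T \<subseteq> S" "card (S - T) = 3" for S T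
  proof -
    have fS: "finite S" using that(1) finite_subset by blast
    have "card (S - T) \<le> card S" using fS by (intro card_mono) auto
    moreover have "card S \<le> 3" using card_mono[OF _ that(1)] by simp
    ultimately have cS: "card S = 3" using that(3) by linarith
    then have S: "S = {..<3}" using card_subset_eq[OF _ that(1)] by simp
    have "S - T = S" using that(3) cS fS by (intro card_subset_eq) auto
    then show ?thesis using S that(2) by auto
  qed
  have "(\<Sum>S\<in>Pow {..<3::nat}. \<Sum>T\<in>Pow S. if card (S - T) = 3 then pc lam S * Ainf T else 0)
    = (\<Sum>S\<in>{{..<3::nat}}. \<Sum>T\<in>Pow S. if card (S - T) = 3 then pc lam S * Ainf T else 0)"
  proof (rule sum.mono_neutral_right)
    show "\<forall>S\<in>Pow {..<3::nat} - {{..<3}}. (\<Sum>T\<in>Pow S. if card (S - T) = 3 then pc lam S * Ainf T else 0) = 0"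
    proof
      fix S assume S: "S \<in> Pow {..<3::nat} - {{..<3}}"
      have "(if card (S - T) = 3 then pc lam S * Ainf T else 0) = 0" if "T \<in> Pow S" for T
        using key[of S T] S that by auto
      then show "(\<Sum>T\<in>Pow S. if card (S - T) = 3 then pc lam S * Ainf T else 0) = 0" by (intro sum.neutral) blast
    qed
  qed auto
  also have "\<dots> = (\<Sum>T\<in>Pow {..<3::nat}. if card ({..<3::nat} - T) = 3 then pc lam {..<3} * Ainf T else 0)" by simp
  also have "\<dots> = (\<Sum>T\<in>{{}}. if card ({..<3::nat} - T) = 3 then pc lam {..<3} * Ainf T else 0)"
  proof (rule sum.mono_neutral_right)
    show "\<forall>T\<in>Pow {..<3::nat} - {{}}. (if card ({..<3} - T) = 3 then pc lam {..<3} * Ainf T else 0) = 0"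
      using key[of "{..<3}"] by auto
  qed auto
  also have "\<dots> = pc lam {..<3}" by (simp add: Ainf_empty)
  finally show ?thesis by (simp add: Cc_def)
qed

lemma Ainf_uniform: "\<exists>D\<ge>0. \<forall>T\<in>Pow {..<3}. \<forall>N\<ge>1. \<bar>AS T N - Ainf T\<bar> \<le> D * real N powr (-1/2)"
proof -
  have "\<forall>T\<in>Pow {..<3}. \<exists>D\<ge>0. \<forall>N\<ge>1. \<bar>AS T N - Ainf T\<bar> \<le> D * real N powr (-1/2)" using Ainf by auto
  then obtain D where D: "\<And>T. T \<in> Pow {..<3} \<Longrightarrow> D T \<ge> 0 \<and> (\<forall>N\<ge>1. \<bar>AS T N - Ainf T\<bar> \<le> D T * real N powr (-1/2))" by metis
  have "\<bar>AS T N - Ainf T\<bar> \<le> (\<Sum>T\<in>Pow {..<3}. D T) * real N powr (-1/2)" if "T \<in> Pow {..<3}" "N \<ge> 1" for T N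
  proof -
    have "\<bar>AS T N - Ainf T\<bar> \<le> D T * real N powr (-1/2)" using D[OF that(1)] that(2) by blast
    also have "\<dots> \<le> (\<Sum>T\<in>Pow {..<3}. D T) * real N powr (-1/2)"
      using that(1) D by (intro mult_right_mono member_le_sum) auto
    finally show ?thesis .
  qed
  moreover have "(\<Sum>T\<in>Pow {..<3}. D T) \<ge> 0" using D by (intro sum_nonneg) auto
  ultimately show ?thesis by (intro exI[of _ "\<Sum>T\<in>Pow {..<3}. D T"] conjI ballI allI impI)
qed

lemma pterm_sum_asymp:
  assumes lam: "\<And>\<kappa>. \<bar>lam \<kappa>\<bar> \<le> 1"
  shows "\<exists>C\<ge>0. \<forall>N\<ge>1. \<bar>8 * (\<Sum>x\<in>nz N. infsum (pterm lam (\<lambda>i. na i x)) (KS \<times> K)) - (real N)\<^sup>2 * (\<Sum>j\<le>3. Cc lam j * ln (real N) ^ j)\<bar>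
     \<le> C * real N powr (7/4)"
proof -
  obtain D where D: "D \<ge> 0" "\<And>T N. T \<in> Pow {..<3} \<Longrightarrow> N \<ge> 1 \<Longrightarrow> \<bar>AS T N - Ainf T\<bar> \<le> D * real N powr (-1/2)"
    using Ainf_uniform by auto
  \<comment> \<open>The means converge at the rate N^(-1/2), so a factor N^(1/4) is to spare for the
    logarithms.\<close>
  obtain C1 where C1: "C1 \<ge> 1" "\<And>x::real. x \<ge> 1 \<Longrightarrow> (1 + ln x) ^ 3 \<le> C1 * x powr (1/4)"
    using one_plus_ln_le[of "1/4" 3] by auto
  define Q where "Q = (\<Sum>S\<in>Pow {..<3::nat}. \<Sum>T\<in>Pow S. \<bar>pc lam S\<bar>)"
  have Q0: "Q \<ge> 0" unfolding Q_def by (intro sum_nonneg) auto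
  have cardST: "card (S - T) \<le> 3" if "S \<subseteq> {..<3::nat}" for S T
  proof -
    have "card (S - T) \<le> card {..<3::nat}" using that by (intro card_mono) auto
    then show ?thesis by simp
  qed
  have "\<bar>8 * (\<Sum>x\<in>nz N. infsum (pterm lam (\<lambda>i. na i x)) (KS \<times> K)) - (real N)\<^sup>2 * (\<Sum>j\<le>3. Cc lam j * ln (real N) ^ j)\<bar>
     \<le> (8 * Q * D * C1) * real N powr (7/4)" if N: "N \<ge> 1" for N
  proof -
    have N0: "real N \<ge> 1" using N by simp
    define l where "l = ln (real N)"
    have l0: "l \<ge> 0" using N0 by (simp add: l_def)
    have "(\<Sum>x\<in>nz N. infsum (pterm lam (\<lambda>i. na i x)) (KS \<times> K)) = (\<Sum>x\<in>nz N. \<Sum>S\<in>Pow {..<3}. pc lam S * (\<Prod>i\<in>S. ln (real (na i x))))"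
      by (simp add: infsum_pterm[where lam = lam, OF lam])
    also have "\<dots> = (\<Sum>S\<in>Pow {..<3}. \<Sum>x\<in>nz N. pc lam S * (\<Prod>i\<in>S. ln (real (na i x))))"
      by (rule sum.swap)
    also have "\<dots> = (\<Sum>S\<in>Pow {..<3}. (real N)\<^sup>2 * (\<Sum>T\<in>Pow S. pc lam S * (l ^ card (S - T) * AS T N)))"
    proof (rule sum.cong[OF refl])
      fix S assume "S \<in> Pow {..<3::nat}"
      then have "(\<Sum>x\<in>nz N. \<Prod>i\<in>S. ln (real (na i x))) = (real N)\<^sup>2 * (\<Sum>T\<in>Pow S. l ^ card (S - T) * AS T N)"
        unfolding nz_def l_def using sum_prod_ln[OF _ N, of S] by simp
      then show "(\<Sum>x\<in>nz N. pc lam S * (\<Prod>i\<in>S. ln (real (na i x)))) = (real N)\<^sup>2 * (\<Sum>T\<in>Pow S. pc lam S * (l ^ card (S - T) * AS T N))"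
        by (simp only: sum_distrib_left[symmetric] mult.left_commute)
    qed
    also have "\<dots> = (real N)\<^sup>2 * (\<Sum>S\<in>Pow {..<3}. \<Sum>T\<in>Pow S. pc lam S * (l ^ card (S - T) * AS T N))"
      by (rule sum_distrib_left[symmetric])
    finally have e1: "8 * (\<Sum>x\<in>nz N. infsum (pterm lam (\<lambda>i. na i x)) (KS \<times> K)) = (real N)\<^sup>2 * (8 * (\<Sum>S\<in>Pow {..<3}. \<Sum>T\<in>Pow S. pc lam S * (l ^ card (S - T) * AS T N)))"
      by simp
    have e2: "(\<Sum>j\<le>3. Cc lam j * l ^ j) = 8 * (\<Sum>S\<in>Pow {..<3}. \<Sum>T\<in>Pow S. pc lam S * (l ^ card (S - T) * Ainf T))"
    proof -
      have "(\<Sum>j\<le>3. Cc lam j * l ^ j) = 8 * (\<Sum>j\<le>3. \<Sum>S\<in>Pow {..<3::nat}. \<Sum>T\<in>Pow S. if card (S - T) = j then pc lam S * (l ^ card (S - T) * Ainf T) else 0)"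
        unfolding Cc_def sum_distrib_left sum_distrib_right by (intro sum.cong refl) auto
      also have "(\<Sum>j\<le>3. \<Sum>S\<in>Pow {..<3::nat}. \<Sum>T\<in>Pow S. if card (S - T) = j then pc lam S * (l ^ card (S - T) * Ainf T) else 0)
        = (\<Sum>S\<in>Pow {..<3::nat}. \<Sum>T\<in>Pow S. \<Sum>j\<le>3. if card (S - T) = j then pc lam S * (l ^ card (S - T) * Ainf T) else 0)"
        by (subst sum.swap, intro sum.cong[OF refl] sum.swap)
      also have "\<dots> = (\<Sum>S\<in>Pow {..<3::nat}. \<Sum>T\<in>Pow S. pc lam S * (l ^ card (S - T) * Ainf T))"
        using cardST by (intro sum.cong refl) auto
      finally show ?thesis .
    qed
    have "8 * (\<Sum>x\<in>nz N. infsum (pterm lam (\<lambda>i. na i x)) (KS \<times> K)) - (real N)\<^sup>2 * (\<Sum>j\<le>3. Cc lam j * l ^ j)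
      = (real N)\<^sup>2 * (8 * (\<Sum>S\<in>Pow {..<3}. \<Sum>T\<in>Pow S. pc lam S * (l ^ card (S - T) * (AS T N - Ainf T))))"
      unfolding e1 e2 by (simp only: right_diff_distrib sum_subtractf)
    also have "\<bar>\<dots>\<bar> \<le> (real N)\<^sup>2 * (8 * (\<Sum>S\<in>Pow {..<3::nat}. \<Sum>T\<in>Pow S. \<bar>pc lam S\<bar> * ((1 + l) ^ 3 * (D * real N powr (-1/2)))))"
    proof -
      have "\<bar>\<Sum>S\<in>Pow {..<3}. \<Sum>T\<in>Pow S. pc lam S * (l ^ card (S - T) * (AS T N - Ainf T))\<bar>
        \<le> (\<Sum>S\<in>Pow {..<3::nat}. \<Sum>T\<in>Pow S. \<bar>pc lam S\<bar> * ((1 + l) ^ 3 * (D * real N powr (-1/2))))"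
      proof (intro order.trans[OF sum_abs] sum_mono)
        fix S T assume S: "S \<in> Pow {..<3::nat}" and T: "T \<in> Pow S"
        have "l ^ card (S - T) \<le> (1 + l) ^ card (S - T)" using l0 by (intro power_mono) auto
        also have "\<dots> \<le> (1 + l) ^ 3" using l0 cardST[of S T] S by (intro power_increasing) auto
        finally have "l ^ card (S - T) * \<bar>AS T N - Ainf T\<bar> \<le> (1 + l) ^ 3 * (D * real N powr (-1/2))"
          using D(2)[of T N] S T N l0 by (intro mult_mono) auto
        then show "\<bar>pc lam S * (l ^ card (S - T) * (AS T N - Ainf T))\<bar> \<le> \<bar>pc lam S\<bar> * ((1 + l) ^ 3 * (D * real N powr (-1/2)))"
          using l0 by (simp add: abs_mult mult_left_mono)
      qed
      then show ?thesis by (simp add: abs_mult mult_left_mono)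
    qed
    also have "\<dots> = 8 * Q * D * ((real N)\<^sup>2 * real N powr (-1/2) * (1 + l) ^ 3)"
      unfolding Q_def sum_distrib_right[symmetric] by (simp only: mult_ac)
    also have "\<dots> \<le> 8 * Q * D * ((real N)\<^sup>2 * real N powr (-1/2) * (C1 * real N powr (1/4)))"
      using C1(2)[OF N0] Q0 D(1) unfolding l_def by (intro mult_left_mono) auto
    also have "(real N)\<^sup>2 * real N powr (-1/2) * (C1 * real N powr (1/4)) = C1 * real N powr (7/4)"
    proof -
      have "(real N)\<^sup>2 = real N powr 2" using N0 by (simp add: powr_numeral)
      then have "(real N)\<^sup>2 * real N powr (-1/2) * (C1 * real N powr (1/4)) = C1 * (real N powr 2 * real N powr (-1/2) * real N powr (1/4))"
        by (simp only: mult_ac)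
      also have "real N powr 2 * real N powr (-1/2) * real N powr (1/4) = real N powr (7/4)" by (simp only: powr_add[symmetric]) simp
      finally show ?thesis .
    qed
    finally show ?thesis by (simp add: l_def mult.assoc)
  qed
  moreover have "8 * Q * D * C1 \<ge> 0" using Q0 D(1) C1(1) by (intro mult_nonneg_nonneg) auto
  ultimately show ?thesis by (intro exI[of _ "8 * Q * D * C1"] conjI allI impI)
qed

theorem Tlam_asymptotics:
  assumes lam: "\<And>\<kappa>. \<bar>lam \<kappa>\<bar> \<le> 1" and e: "\<epsilon> > 0"
  shows "\<exists>C\<ge>0. \<forall>N\<ge>1. \<bar>Tlam lam N - (real N)\<^sup>2 * (\<Sum>j\<le>3. Cc lam j * ln (real N) ^ j)\<bar> \<le> C * real N powr (7/4 + \<epsilon>)"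
proof -
  obtain C1 where C1: "C1 \<ge> 0" "\<And>N. N \<ge> 1 \<Longrightarrow> \<bar>Tlam lam N - 8 * (\<Sum>x\<in>nz N. Hsum lam (CL * N) (\<lambda>i. na i x))\<bar> \<le> C1 * real N powr (7/4 + \<epsilon>)"
    using Tlam_Hsum[where lam = lam, OF lam e] by (elim exE conjE) auto
  obtain C2 where C2: "C2 \<ge> 0" "\<And>N. N \<ge> 1 \<Longrightarrow> \<bar>(\<Sum>x\<in>nz N. Hsum lam (CL * N) (\<lambda>i. na i x)) - (\<Sum>x\<in>nz N. infsum (pterm lam (\<lambda>i. na i x)) (KS \<times> K))\<bar>
     \<le> C2 * real N powr (7/4 + \<epsilon>)"
    using Hsum_pterm_sum[where lam = lam, OF lam e] by (elim exE conjE) auto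
  obtain C3 where C3: "C3 \<ge> 0" "\<And>N. N \<ge> 1 \<Longrightarrow> \<bar>8 * (\<Sum>x\<in>nz N. infsum (pterm lam (\<lambda>i. na i x)) (KS \<times> K)) - (real N)\<^sup>2 * (\<Sum>j\<le>3. Cc lam j * ln (real N) ^ j)\<bar>
     \<le> C3 * real N powr (7/4)"
    using pterm_sum_asymp[where lam = lam, OF lam] by (elim exE conjE) auto
  have "\<bar>Tlam lam N - (real N)\<^sup>2 * (\<Sum>j\<le>3. Cc lam j * ln (real N) ^ j)\<bar> \<le> (C1 + 8 * C2 + C3) * real N powr (7/4 + \<epsilon>)" if N: "N \<ge> 1" for N
  proof -
    have "real N powr (7/4) \<le> real N powr (7/4 + \<epsilon>)" using N e by (intro powr_mono) auto
    then have "C3 * real N powr (7/4) \<le> C3 * real N powr (7/4 + \<epsilon>)" using C3(1) by (rule mult_left_mono)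
    then have "\<bar>Tlam lam N - (real N)\<^sup>2 * (\<Sum>j\<le>3. Cc lam j * ln (real N) ^ j)\<bar> \<le> C1 * real N powr (7/4 + \<epsilon>) + 8 * (C2 * real N powr (7/4 + \<epsilon>)) + C3 * real N powr (7/4 + \<epsilon>)"
      using C1(2)[OF N] C2(2)[OF N] C3(2)[OF N] by linarith
    then show ?thesis by (simp add: algebra_simps)
  qed
  moreover have "C1 + 8 * C2 + C3 \<ge> 0" using C1(1) C2(1) C3(1) by simp
  ultimately show ?thesis by (intro exI[of _ "C1 + 8 * C2 + C3"] conjI allI impI)
qed

end

section \<open>Positivity of the leading coefficient\<close>

context three_forms begin

lemma Tlam_lamT: "Tlam lamT N = (\<Sum>x\<in>nz N. real (ndiv (\<Prod>i<3. na i x)))"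
  unfolding Tlam_def KB_def
proof (rule sum.cong[OF refl])
  fix x assume x: "x \<in> nz N"
  show "(\<Sum>\<kappa>\<in>PiE {..<5} (\<lambda>_. {1..CL * N}). lamT \<kappa> * (\<Prod>i<3. real (qdiv (na i x) (kk i \<kappa>)))) = real (ndiv (\<Prod>i<3. na i x))"
    by (rule ndiv_prod_eq_sum[symmetric]) (use na_pos[OF x] na_le[OF x] in \<open>auto simp: Suc_le_eq\<close>)
qed

definition PP :: "int \<times> int \<Rightarrow> real" where "PP x = (\<Prod>i<3. real (ndiv (na i x)))"

lemma PP_nonneg: "PP x \<ge> 0"
  unfolding PP_def by (intro prod_nonneg) auto

lemma Tlam_lam1: assumes N: "N \<ge> 1" shows "Tlam lam1 N = (\<Sum>x\<in>nz N. PP x)"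
  unfolding Tlam_def
proof (rule sum.cong[OF refl])
  fix x assume x: "x \<in> nz N"
  define one :: "nat \<Rightarrow> nat" where "one = (\<lambda>j\<in>{..<5}. 1)"
  have "CL * N \<ge> 1" using N CL_ge_1 by (simp add: Suc_le_eq)
  then have o: "one \<in> KB (CL * N)" by (auto simp: one_def KB_def)
  have o1: "kk i one = 1" for i by (auto simp: kk_def one_def slots_def intro!: prod.neutral)
  have l1: "lam1 one = 1" by (simp add: lam1_def one_def)
  have l0: "lam1 \<kappa> = 0" if "\<kappa> \<in> KB (CL * N) - {one}" for \<kappa>
  proof (rule ccontr)
    assume "lam1 \<kappa> \<noteq> 0"
    then have "\<forall>j<5. \<kappa> j = 1" by (auto simp: lam1_def split: if_splits)
    then have "\<kappa> = one" using that by (intro extensionalityI[of \<kappa> "{..<5}" one]) (auto simp: one_def KB_def PiE_def)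
    then show False using that by simp
  qed
  have "(\<Sum>\<kappa>\<in>KB (CL * N). lam1 \<kappa> * (\<Prod>i<3. real (qdiv (na i x) (kk i \<kappa>))))
    = (\<Sum>\<kappa>\<in>{one}. lam1 \<kappa> * (\<Prod>i<3. real (qdiv (na i x) (kk i \<kappa>))))"
    by (rule sum.mono_neutral_right) (use o l0 finite_KB in auto)
  also have "\<dots> = PP x" by (simp add: l1 o1 qdiv_def PP_def)
  finally show "(\<Sum>\<kappa>\<in>KB (CL * N). lam1 \<kappa> * (\<Prod>i<3. real (qdiv (na i x) (kk i \<kappa>)))) = PP x" .
qed

lemma Tlam_tendsto:
  assumes lam: "\<And>\<kappa>. \<bar>lam \<kappa>\<bar> \<le> 1"
  shows "(\<lambda>N. Tlam lam N / ((real N)\<^sup>2 * ln (real N) ^ 3)) \<longlonglongrightarrow> Cc lam 3"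
proof -
  \<comment> \<open>Any \<epsilon> below 1/4 keeps the error below N^2.\<close>
  obtain C where C: "C \<ge> 0" "\<And>N. N \<ge> 1 \<Longrightarrow> \<bar>Tlam lam N - (real N)\<^sup>2 * (\<Sum>j\<le>3. Cc lam j * ln (real N) ^ j)\<bar> \<le> C * real N powr (7/4 + 1/8)"
    using Tlam_asymptotics[where lam = lam and \<epsilon> = "1/8", OF lam] by auto
  define c0 c1 c2 c3 where "c0 = Cc lam 0" and "c1 = Cc lam 1" and "c2 = Cc lam 2" and "c3 = Cc lam 3"
  have s: "(\<Sum>j\<le>3. Cc lam j * l ^ j) = c0 + c1 * l + c2 * l ^ 2 + c3 * l ^ 3" for l :: real
    by (simp add: c0_def c1_def c2_def c3_def numeral_3_eq_3 numeral_2_eq_2 atMost_Suc)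
  define E where "E = (\<lambda>N. Tlam lam N - (real N)\<^sup>2 * (c0 + c1 * ln (real N) + c2 * ln (real N) ^ 2 + c3 * ln (real N) ^ 3))"
  define D where "D = (\<lambda>N. (real N)\<^sup>2 * ln (real N) ^ 3)"
  have D0: "eventually (\<lambda>N. D N > 0) sequentially" unfolding D_def by real_asymp
  have l1: "(\<lambda>N. (real N)\<^sup>2 * (c0 + c1 * ln (real N) + c2 * ln (real N) ^ 2 + c3 * ln (real N) ^ 3) / D N) \<longlonglongrightarrow> c3"
  proof -
    have l: "filterlim (\<lambda>N. ln (real N)) at_top sequentially" by real_asymp
    have z: "(\<lambda>N. c / ln (real N) ^ k) \<longlonglongrightarrow> 0" if "k > 0" for k :: nat and c
      by (rule real_tendsto_divide_at_top[OF tendsto_const filterlim_pow_at_top[OF that l]])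
    have "(\<lambda>N. c0 / ln (real N) ^ 3 + c1 / ln (real N) ^ 2 + c2 / ln (real N) + c3) \<longlonglongrightarrow> 0 + 0 + 0 + c3"
      using z[of 3 c0, OF zero_less_numeral] z[of 2 c1, OF zero_less_numeral] z[of 1 c2, OF zero_less_one] by (intro tendsto_add tendsto_const) (simp_all only: power_one_right)
    moreover have "eventually (\<lambda>N. (real N)\<^sup>2 * (c0 + c1 * ln (real N) + c2 * ln (real N) ^ 2 + c3 * ln (real N) ^ 3) / D N
      = c0 / ln (real N) ^ 3 + c1 / ln (real N) ^ 2 + c2 / ln (real N) + c3) sequentially"
      using eventually_gt_at_top[of 1]
    proof eventually_elim
      case (elim N)
      then have "ln (real N) > 0" "real N > 0" by auto
      then show ?case unfolding D_def by (simp add: field_simps power2_eq_square power3_eq_cube)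
    qed
    ultimately show ?thesis by (simp add: tendsto_cong)
  qed
  have l2: "(\<lambda>N. E N / D N) \<longlonglongrightarrow> 0"
  proof (rule Lim_null_comparison)
    show "(\<lambda>N. C * (real N powr (15/8) / D N)) \<longlonglongrightarrow> 0"
      unfolding D_def by (rule tendsto_mult_right_zero) real_asymp
    show "eventually (\<lambda>N. norm (E N / D N) \<le> C * (real N powr (15/8) / D N)) sequentially"
      using D0 eventually_ge_at_top[of 1]
    proof eventually_elim
      case (elim N)
      have "\<bar>E N\<bar> \<le> C * real N powr (15/8)" using C(2)[OF elim(2)] unfolding E_def s by simp
      then show ?case using elim(1) by (simp add: divide_right_mono)
    qed
  qed
  have "(\<lambda>N. (real N)\<^sup>2 * (c0 + c1 * ln (real N) + c2 * ln (real N) ^ 2 + c3 * ln (real N) ^ 3) / D N + E N / D N) \<longlonglongrightarrow> c3 + 0"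
    by (intro tendsto_add l1 l2)
  then show ?thesis unfolding E_def add_divide_distrib[symmetric] by (simp add: D_def c3_def)
qed

text \<open>The choice \<epsilon> = 1/4 turns the error into N^2. The bound has 1 + ln N because it
  is applied at \<open>N div g\<close>, which can be 1.\<close>

lemma Tlam_upper:
  assumes lam: "\<And>\<kappa>. \<bar>lam \<kappa>\<bar> \<le> 1"
  shows "\<exists>C\<ge>0. \<forall>N\<ge>1. Tlam lam N \<le> C * ((real N)\<^sup>2 * (1 + ln (real N)) ^ 3)"
proof -
  obtain C where C: "C \<ge> 0" "\<And>N. N \<ge> 1 \<Longrightarrow> \<bar>Tlam lam N - (real N)\<^sup>2 * (\<Sum>j\<le>3. Cc lam j * ln (real N) ^ j)\<bar> \<le> C * real N powr (7/4 + 1/4)"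
    using Tlam_asymptotics[where lam = lam and \<epsilon> = "1/4", OF lam] by auto
  have "Tlam lam N \<le> (C + (\<Sum>j\<le>3. \<bar>Cc lam j\<bar>)) * ((real N)\<^sup>2 * (1 + ln (real N)) ^ 3)" if N: "N \<ge> 1" for N
  proof -
    define l where "l = ln (real N)"
    have l0: "l \<ge> 0" using N by (simp add: l_def)
    have p: "(1 + l) ^ 3 \<ge> 1" using l0 by (intro one_le_power) simp
    have "(\<Sum>j\<le>3. Cc lam j * l ^ j) \<le> (\<Sum>j\<le>3. \<bar>Cc lam j\<bar> * (1 + l) ^ 3)"
    proof (intro sum_mono mult_mono)
      fix j :: nat assume "j \<in> {..3}"
      then have "l ^ j \<le> (1 + l) ^ j" "(1 + l) ^ j \<le> (1 + l) ^ 3" using l0 by (auto intro: power_mono power_increasing)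
      then show "l ^ j \<le> (1 + l) ^ 3" by linarith
    qed (use l0 in auto)
    then have a: "(real N)\<^sup>2 * (\<Sum>j\<le>3. Cc lam j * l ^ j) \<le> (real N)\<^sup>2 * ((\<Sum>j\<le>3. \<bar>Cc lam j\<bar>) * (1 + l) ^ 3)"
      unfolding sum_distrib_right by (intro mult_left_mono) auto
    have "C * real N powr (7/4 + 1/4) = C * (real N)\<^sup>2 * 1" using N by (simp add: powr_numeral)
    also have "\<dots> \<le> C * (real N)\<^sup>2 * (1 + l) ^ 3" using C(1) p by (intro mult_left_mono) auto
    finally show ?thesis using a C(2)[OF N] unfolding l_def[symmetric] by (simp add: algebra_simps)
  qed
  then show ?thesis using C(1) by (intro exI[of _ "C + (\<Sum>j\<le>3. \<bar>Cc lam j\<bar>)"]) (auto intro!: add_nonneg_nonneg sum_nonneg)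
qed

section \<open>Comparison with the product of three divisor functions\<close>

definition gx :: "int \<times> int \<Rightarrow> nat" where "gx x = nat (gcd (fst x) (snd x))"

text \<open>Eliminating either variable shows that a common divisor of L_i(x) and L_j(x) divides the
  resultant times each coordinate of x.\<close>

lemma gcd_na_dvd:
  assumes "i < 3" "j < 3"
  shows "gcd (na i x) (na j x) dvd nat \<bar>lin_res (L i) (L j)\<bar> * gx x"
proof -
  define e where "e = int (gcd (na i x) (na j x))"
  have "e dvd int (na i x)" "e dvd int (na j x)" unfolding e_def int_dvd_int_iff by (rule gcd_dvd1, rule gcd_dvd2)
  then have e: "e dvd lf i x" "e dvd lf j x" by (simp_all add: na_def)
  have "e dvd snd (L j) * lf i x - snd (L i) * lf j x" "e dvd fst (L i) * lf j x - fst (L j) * lf i x"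
    using e by auto
  moreover have "snd (L j) * lf i x - snd (L i) * lf j x = lin_res (L i) (L j) * fst x"
    "fst (L i) * lf j x - fst (L j) * lf i x = lin_res (L i) (L j) * snd x"
    by (simp_all add: lf_def linform_def lin_res_def algebra_simps)
  ultimately have "e dvd gcd (lin_res (L i) (L j) * fst x) (lin_res (L i) (L j) * snd x)" by simp
  also have "\<dots> = \<bar>lin_res (L i) (L j)\<bar> * gcd (fst x) (snd x)" by (simp add: gcd_mult_distrib_int)
  also have "\<dots> = int (nat \<bar>lin_res (L i) (L j)\<bar> * gx x)" by (simp add: gx_def)
  finally show ?thesis unfolding e_def int_dvd_int_iff .
qed

text \<open>Two applications of \<open>ndiv_mult_ndiv_le\<close> merge the three factors. With g the
  gcd of the coordinates, the two gcds that arise are at most constants times g and g^2, so the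
  divisor bound with exponent 1/12 gives g^(1/4).\<close>

lemma PP_le:
  "\<exists>C\<ge>1. \<forall>N. \<forall>x\<in>nz N. \<exists>w\<ge>1. w \<le> C * real (gx x) powr (1/4) \<and> PP x \<le> w * real (ndiv (\<Prod>i<3. na i x))"
proof -
  obtain C0 where C0: "C0 \<ge> 1" "\<And>n. n > 0 \<Longrightarrow> real (ndiv n) \<le> C0 * real n powr (1/12)"
    using ndiv_le_powr[of "1/12"] by auto
  define r where "r = (\<lambda>i j. nat \<bar>lin_res (L i) (L j)\<bar>)"
  have r: "r 0 1 > 0" "r 0 2 > 0" "r 1 2 > 0" using res[of 0 1] res[of 0 2] res[of 1 2] by (auto simp: r_def)
  define C where "C = C0 * C0 * real (r 0 1 * (r 0 2 * r 1 2)) powr (1/12)"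
  have C1: "C \<ge> 1"
  proof -
    have "r 0 1 * (r 0 2 * r 1 2) \<ge> 1" using r by (simp add: Suc_le_eq)
    then have "real (r 0 1 * (r 0 2 * r 1 2)) \<ge> 1" by linarith
    then have "real (r 0 1 * (r 0 2 * r 1 2)) powr (1/12) \<ge> 1" by (rule ge_one_powr_ge_zero) simp
    then show ?thesis unfolding C_def using C0(1) mult_mono[of 1 C0 1 C0] mult_mono[of 1 "C0 * C0" 1 "real (r 0 1 * (r 0 2 * r 1 2)) powr (1/12)"] by simp
  qed
  have "\<exists>w\<ge>1. w \<le> C * real (gx x) powr (1/4) \<and> PP x \<le> w * real (ndiv (\<Prod>i<3. na i x))" if x: "x \<in> nz N" for N x
  proof -
    define a b c g where "a = na 0 x" and "b = na 1 x" and "c = na 2 x" and "g = gx x"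
    have pos: "a > 0" "b > 0" "c > 0" using na_pos[OF x, of 0] na_pos[OF x, of 1] na_pos[OF x, of 2] by (auto simp: a_def b_def c_def)
    have g: "g > 0" using x by (auto simp: g_def gx_def nz_def bx_def)
    have "gcd a b dvd r 0 1 * g" unfolding a_def b_def r_def g_def by (rule gcd_na_dvd) auto
    then have l1: "gcd a b \<le> r 0 1 * g" by (rule dvd_imp_le) (use r g in auto)
    have "gcd (a * b) c dvd gcd a c * gcd b c" by (rule gcd_mult_dvd)
    also have "\<dots> dvd (r 0 2 * g) * (r 1 2 * g)"
      unfolding a_def b_def c_def r_def g_def by (intro mult_dvd_mono gcd_na_dvd) auto
    finally have l2: "gcd (a * b) c \<le> (r 0 2 * g) * (r 1 2 * g)" by (rule dvd_imp_le) (use r g in auto)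
    define w where "w = real (ndiv (gcd a b)) * real (ndiv (gcd (a * b) c))"
    have "ndiv (gcd a b) > 0" "ndiv (gcd (a * b) c) > 0" using pos by (auto intro!: ndiv_pos)
    then have w1: "w \<ge> 1" unfolding w_def using mult_mono[of 1 "real (ndiv (gcd a b))" 1 "real (ndiv (gcd (a * b) c))"] by simp
    have "w \<le> (C0 * real (gcd a b) powr (1/12)) * (C0 * real (gcd (a * b) c) powr (1/12))"
      unfolding w_def using pos C0(1) by (intro mult_mono C0(2)) auto
    also have "\<dots> \<le> (C0 * real (r 0 1 * g) powr (1/12)) * (C0 * real ((r 0 2 * g) * (r 1 2 * g)) powr (1/12))"
      using C0(1) l1 l2 by (intro mult_mono mult_left_mono powr_mono2 mult_nonneg_nonneg of_nat_mono) auto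
    also have "\<dots> = C * real g powr (1/4)"
    proof -
      have "real g powr (1/4) = (real g powr (1/12)) * (real g powr (1/12)) * (real g powr (1/12))"
        using g by (simp add: powr_add[symmetric])
      then show ?thesis unfolding C_def by (simp add: powr_mult mult_ac)
    qed
    finally have w2: "w \<le> C * real g powr (1/4)" .
    have "ndiv a * ndiv b * ndiv c \<le> (ndiv (gcd a b) * ndiv (a * b)) * ndiv c"
      by (intro mult_right_mono ndiv_mult_ndiv_le) auto
    also have "\<dots> = ndiv (gcd a b) * (ndiv (a * b) * ndiv c)" by (simp only: mult.assoc)
    also have "\<dots> \<le> ndiv (gcd a b) * (ndiv (gcd (a * b) c) * ndiv (a * b * c))"
      by (intro mult_left_mono ndiv_mult_ndiv_le) auto
    finally have "real (ndiv a * ndiv b * ndiv c) \<le> real (ndiv (gcd a b) * (ndiv (gcd (a * b) c) * ndiv (a * b * c)))" by (simp only: of_nat_le_iff)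
    then have "PP x \<le> w * real (ndiv (\<Prod>i<3. na i x))"
      unfolding PP_def w_def prod_lessThan_3 a_def b_def c_def by (simp only: of_nat_mult mult.assoc)
    then show ?thesis using w1 w2 by (auto simp: g_def)
  qed
  then show ?thesis using C1 by blast
qed

text \<open>Sort by the gcd g and write x = g y with y in the box of side \<open>N div g\<close>.
  The weight gives g^(1/4), submultiplicativity another g^(1/4) and the smaller box g^(-2); the
  total exponent -3/2 is summable.\<close>

lemma weighted_PP_sum:
  "\<exists>C\<ge>0. \<forall>N\<ge>1. (\<Sum>x\<in>nz N. real (gx x) powr (1/4) * PP x) \<le> C * ((real N)\<^sup>2 * (1 + ln (real N)) ^ 3)"
proof -
  have "\<bar>lam1 \<kappa>\<bar> \<le> 1" for \<kappa> by (simp add: lam1_def)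
  from Tlam_upper[where lam = lam1, OF this]
  obtain C where C: "C \<ge> 0" "\<And>N. N \<ge> 1 \<Longrightarrow> Tlam lam1 N \<le> C * ((real N)\<^sup>2 * (1 + ln (real N)) ^ 3)" by auto
  obtain C0 where C0: "C0 \<ge> 1" "\<And>n. n > 0 \<Longrightarrow> real (ndiv n) \<le> C0 * real n powr (1/12)"
    using ndiv_le_powr[of "1/12"] by auto
  obtain Z where Z: "Z \<ge> 0" "\<And>B. (\<Sum>b\<in>{1..B}. real b powr (-(3/2))) \<le> Z"
    using sum_powr_bounded[of "3/2"] by auto
  have "(\<Sum>x\<in>nz N. real (gx x) powr (1/4) * PP x) \<le> (C0 ^ 3 * C * Z) * ((real N)\<^sup>2 * (1 + ln (real N)) ^ 3)" if N: "N \<ge> 1" for N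
  proof -
    define Y where "Y = (real N)\<^sup>2 * (1 + ln (real N)) ^ 3"
    have Y0: "Y \<ge> 0" using N by (simp add: Y_def)
    have gI: "gx x \<in> {1..N}" if "x \<in> nz N" for x
    proof -
      have x: "1 \<le> fst x" "fst x \<le> int N" using that by (auto simp: nz_def bx_def)
      then have "gcd (fst x) (snd x) \<le> fst x" by (intro gcd_le1_int) auto
      then have "gcd (fst x) (snd x) \<le> int N" using x by linarith
      moreover have "gcd (fst x) (snd x) > 0" using x by auto
      ultimately show ?thesis unfolding gx_def atLeastAtMost_iff by linarith
    qed
    have fib: "(\<Sum>x | x \<in> nz N \<and> gx x = g. real (gx x) powr (1/4) * PP x) \<le> C0 ^ 3 * C * Y * real g powr (-(3/2))"
      if g: "g \<in> {1..N}" for g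
    proof -
      define M where "M = N div g"
      have g0: "g > 0" using g by simp
      have M1: "M \<ge> 1" using g by (simp add: M_def Suc_le_eq div_greater_zero_iff)
      define sc where "sc = (\<lambda>y::int \<times> int. (int g * fst y, int g * snd y))"
      have inj: "inj_on sc (nz M)" using g0 by (auto simp: sc_def inj_on_def prod_eq_iff)
      have lfs: "lf i (sc y) = int g * lf i y" for i y by (simp add: lf_def linform_def sc_def algebra_simps)
      have nas: "na i (sc y) = g * na i y" for i y unfolding na_def lfs abs_mult by (simp add: nat_mult_distrib)
      have sub: "{x. x \<in> nz N \<and> gx x = g} \<subseteq> sc ` nz M"
      proof
        fix x assume "x \<in> {x. x \<in> nz N \<and> gx x = g}"
        then have x: "x \<in> nz N" "gx x = g" by auto
        have gg: "gcd (fst x) (snd x) = int g" using x(2) by (auto simp: gx_def)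
        have "int g dvd fst x" "int g dvd snd x" unfolding gg[symmetric] by auto
        then obtain u v where uv: "fst x = int g * u" "snd x = int g * v" by (elim dvdE)
        have xs: "x = sc (u, v)" using uv by (simp add: sc_def prod_eq_iff)
        have b: "1 \<le> int g * u" "int g * u \<le> int N" "1 \<le> int g * v" "int g * v \<le> int N"
          using x(1) uv by (auto simp: nz_def bx_def)
        have up: "1 \<le> t \<and> t \<le> int M" if t: "1 \<le> int g * t" "int g * t \<le> int N" for t
        proof
          have "0 < int g * t" using t by linarith
          then show "1 \<le> t" using g0 by (simp add: zero_less_mult_iff)
          have "t * int g \<le> int N" using t by (simp add: mult.commute)
          then have "t \<le> int N div int g" using g0 zdiv_mono1[of "t * int g" "int N" "int g"] by simp
          then show "t \<le> int M" by (simp add: M_def zdiv_int)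
        qed
        have "(u, v) \<in> nz M" using up[OF b(1,2)] up[OF b(3,4)] x(1) unfolding xs nz_def bx_def by (auto simp: lfs)
        then show "x \<in> sc ` nz M" using xs by blast
      qed
      have PPs: "PP (sc y) \<le> (C0 ^ 3 * real g powr (1/4)) * PP y" for y
      proof -
        have "PP (sc y) \<le> (\<Prod>i<(3::nat). C0 * real g powr (1/12) * real (ndiv (na i y)))"
          unfolding PP_def
        proof (intro prod_mono conjI)
          fix i :: nat
          have "real (ndiv (na i (sc y))) \<le> real (ndiv g * ndiv (na i y))" unfolding nas by (intro of_nat_mono ndiv_mult_le)
          also have "\<dots> \<le> C0 * real g powr (1/12) * real (ndiv (na i y))" unfolding of_nat_mult by (intro mult_right_mono C0(2) g0) auto
          finally show "real (ndiv (na i (sc y))) \<le> C0 * real g powr (1/12) * real (ndiv (na i y))" .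
        qed auto
        also have "\<dots> = (C0 * real g powr (1/12)) ^ 3 * PP y" unfolding prod.distrib PP_def by (simp only: prod_constant card_lessThan power_mult_distrib)
        also have "(C0 * real g powr (1/12)) ^ 3 = C0 ^ 3 * real g powr (1/4)"
          unfolding power_mult_distrib using g0 by (simp add: powr_power)
        finally show ?thesis .
      qed
      have "(\<Sum>x | x \<in> nz N \<and> gx x = g. real (gx x) powr (1/4) * PP x) = (\<Sum>x | x \<in> nz N \<and> gx x = g. real g powr (1/4) * PP x)"
        by (rule sum.cong) auto
      also have "\<dots> \<le> (\<Sum>x\<in>sc ` nz M. real g powr (1/4) * PP x)"
        by (rule sum_mono2) (use sub PP_nonneg finite_nz in auto)
      also have "\<dots> = (\<Sum>y\<in>nz M. real g powr (1/4) * PP (sc y))" by (subst sum.reindex[OF inj]) simp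
      also have "\<dots> \<le> (\<Sum>y\<in>nz M. real g powr (1/4) * ((C0 ^ 3 * real g powr (1/4)) * PP y))"
        by (intro sum_mono mult_left_mono PPs) auto
      also have "\<dots> = (C0 ^ 3 * (real g powr (1/4) * real g powr (1/4))) * Tlam lam1 M"
        unfolding Tlam_lam1[OF M1] sum_distrib_left by (simp add: mult_ac)
      also have "real g powr (1/4) * real g powr (1/4) = real g powr (1/2)" by (simp add: powr_add[symmetric])
      also have "(C0 ^ 3 * real g powr (1/2)) * Tlam lam1 M \<le> (C0 ^ 3 * real g powr (1/2)) * (C * (real g powr (-2) * Y))"
      proof (intro mult_left_mono)
        have "real (M * g) \<le> real N" unfolding M_def by (intro of_nat_mono div_times_less_eq_dividend)
        then have m: "real M \<le> real N / real g" using g0 by (simp add: pos_le_divide_eq)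

        have "(real M)\<^sup>2 \<le> (real N / real g)\<^sup>2" using m by (intro power_mono) auto
        also have "\<dots> = real g powr (-2) * (real N)\<^sup>2" using g0 by (simp add: powr_minus power_divide divide_inverse power_mult_distrib power_inverse mult.commute)
        finally have a: "(real M)\<^sup>2 \<le> real g powr (-2) * (real N)\<^sup>2" .
        have "real M \<le> real N" unfolding M_def by simp
        then have "ln (real M) \<le> ln (real N)" using M1 by simp
        then have "(1 + ln (real M)) ^ 3 \<le> (1 + ln (real N)) ^ 3" using M1 by (intro power_mono) auto
        then have "(real M)\<^sup>2 * (1 + ln (real M)) ^ 3 \<le> (real g powr (-2) * (real N)\<^sup>2) * (1 + ln (real N)) ^ 3"
          using a M1 by (intro mult_mono) auto
        then have "C * ((real M)\<^sup>2 * (1 + ln (real M)) ^ 3) \<le> C * (real g powr (-2) * Y)"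
          unfolding Y_def mult.assoc using C(1) by (intro mult_left_mono)
        then show "Tlam lam1 M \<le> C * (real g powr (-2) * Y)" using C(2)[OF M1] by linarith
      qed (use C0 in auto)
      also have "\<dots> = C0 ^ 3 * C * Y * (real g powr (1/2) * real g powr (-2))" by (simp only: mult_ac)
      also have "real g powr (1/2) * real g powr (-2) = real g powr (-(3/2))" by (simp add: powr_add[symmetric])
      finally show ?thesis .
    qed
    have "(\<Sum>x\<in>nz N. real (gx x) powr (1/4) * PP x) = (\<Sum>g\<in>{1..N}. \<Sum>x | x \<in> nz N \<and> gx x = g. real (gx x) powr (1/4) * PP x)"
      by (rule sum.group[symmetric]) (use gI finite_nz in auto)
    also have "\<dots> \<le> (\<Sum>g\<in>{1..N}. C0 ^ 3 * C * Y * real g powr (-(3/2)))" by (intro sum_mono fib)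
    also have "\<dots> = C0 ^ 3 * C * Y * (\<Sum>g\<in>{1..N}. real g powr (-(3/2)))" by (rule sum_distrib_left[symmetric])
    also have "\<dots> \<le> C0 ^ 3 * C * Y * Z" using C0(1) C(1) Y0 by (intro mult_left_mono Z(2) mult_nonneg_nonneg) auto
    finally show ?thesis by (simp only: Y_def mult_ac)
  qed
  moreover have "C0 ^ 3 * C * Z \<ge> 0" using C0 C Z by simp
  ultimately show ?thesis by (intro exI[of _ "C0 ^ 3 * C * Z"] conjI allI impI)
qed

text \<open>The factor w between the two divisor functions is unbounded and cannot simply be divided
  out. Instead 1/w >= 2 \<theta> - \<theta>^2 w, which is (1 - \<theta> w)^2 >= 0, is linear in w
  and asks only for the mean of w with weight \<open>PP\<close>, supplied by
  \<open>weighted_PP_sum\<close>. In the limit this gives the lower bound 2 \<theta> c - \<theta>^2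
  D.\<close>

theorem Cc_lamT_pos: "Cc lamT 3 > 0"
proof -
  obtain A where A: "A \<ge> 1" "\<And>N x. x \<in> nz N \<Longrightarrow> \<exists>w\<ge>1. w \<le> A * real (gx x) powr (1/4) \<and> PP x \<le> w * real (ndiv (\<Prod>i<3. na i x))"
    using PP_le by auto
  obtain B where B: "B \<ge> 0" "\<And>N. N \<ge> 1 \<Longrightarrow> (\<Sum>x\<in>nz N. real (gx x) powr (1/4) * PP x) \<le> B * ((real N)\<^sup>2 * (1 + ln (real N)) ^ 3)"
    using weighted_PP_sum by auto
  define D where "D = 1 + A * B"
  have D: "D > 0" using A(1) B(1) by (simp add: D_def add_pos_nonneg)
  have l1: "\<bar>lam1 \<kappa>\<bar> \<le> 1" for \<kappa> by (simp add: lam1_def)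
  define c where "c = Cc lam1 3"
  have c: "c > 0" using pc_lam1_pos by (simp add: c_def Cc_3)
  \<comment> \<open>This maximises 2 \<theta> c - \<theta>^2 D, with the value c^2 / D.\<close>
  define \<theta> where "\<theta> = c / D"
  have lower: "Tlam lamT N \<ge> 2 * \<theta> * Tlam lam1 N - \<theta>\<^sup>2 * (D * ((real N)\<^sup>2 * (1 + ln (real N)) ^ 3))" if N: "N \<ge> 1" for N
  proof -
    have pt: "2 * \<theta> * PP x - \<theta>\<^sup>2 * (A * (real (gx x) powr (1/4) * PP x)) \<le> real (ndiv (\<Prod>i<3. na i x))" if x: "x \<in> nz N" for x
    proof -
      obtain w where w: "w \<ge> 1" "w \<le> A * real (gx x) powr (1/4)" "PP x \<le> w * real (ndiv (\<Prod>i<3. na i x))"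
        using A(2)[OF x] by blast
      have "0 \<le> (1 - \<theta> * w)\<^sup>2" by simp
      then have "w * (2 * \<theta> - \<theta>\<^sup>2 * w) \<le> 1" by (simp add: power2_eq_square algebra_simps)
      then have "2 * \<theta> - \<theta>\<^sup>2 * w \<le> 1 / w" using w(1) by (simp add: field_simps)
      then have "PP x * (2 * \<theta> - \<theta>\<^sup>2 * w) \<le> PP x * (1 / w)" by (rule mult_left_mono) (rule PP_nonneg)
      also have "\<dots> \<le> real (ndiv (\<Prod>i<3. na i x))" using w(1,3) by (simp add: pos_divide_le_eq mult.commute)
      finally have 1: "PP x * (2 * \<theta> - \<theta>\<^sup>2 * w) \<le> real (ndiv (\<Prod>i<3. na i x))" .
      have "\<theta>\<^sup>2 * (w * PP x) \<le> \<theta>\<^sup>2 * ((A * real (gx x) powr (1/4)) * PP x)"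
        by (intro mult_left_mono mult_right_mono w(2) PP_nonneg) auto
      then show ?thesis using 1 by (simp add: algebra_simps)
    qed
    have "2 * \<theta> * Tlam lam1 N - \<theta>\<^sup>2 * (A * (\<Sum>x\<in>nz N. real (gx x) powr (1/4) * PP x)) \<le> Tlam lamT N"
      unfolding Tlam_lam1[OF N] Tlam_lamT sum_distrib_left sum_subtractf[symmetric] by (rule sum_mono) (rule pt)
    moreover have "A * (\<Sum>x\<in>nz N. real (gx x) powr (1/4) * PP x) \<le> D * ((real N)\<^sup>2 * (1 + ln (real N)) ^ 3)"
    proof -
      have "A * (\<Sum>x\<in>nz N. real (gx x) powr (1/4) * PP x) \<le> A * (B * ((real N)\<^sup>2 * (1 + ln (real N)) ^ 3))"
        using A(1) by (intro mult_left_mono B(2) N) auto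
      moreover have "0 \<le> (real N)\<^sup>2 * (1 + ln (real N)) ^ 3" using N by simp
      ultimately show ?thesis unfolding D_def by (simp add: algebra_simps)
    qed
    then have "\<theta>\<^sup>2 * (A * (\<Sum>x\<in>nz N. real (gx x) powr (1/4) * PP x)) \<le> \<theta>\<^sup>2 * (D * ((real N)\<^sup>2 * (1 + ln (real N)) ^ 3))"
      by (intro mult_left_mono) auto
    ultimately show ?thesis by linarith
  qed
  define Q where "Q = (\<lambda>N. (real N)\<^sup>2 * ln (real N) ^ 3)"
  have Q0: "eventually (\<lambda>N. Q N > 0) sequentially" unfolding Q_def by real_asymp
  have t1: "(\<lambda>N. Tlam lam1 N / Q N) \<longlonglongrightarrow> c" unfolding Q_def c_def by (rule Tlam_tendsto) (rule l1)
  have t2: "(\<lambda>N. Tlam lamT N / Q N) \<longlonglongrightarrow> Cc lamT 3" unfolding Q_def by (rule Tlam_tendsto) (rule abs_lamT_le_1)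
  have t3: "(\<lambda>N. ((real N)\<^sup>2 * (1 + ln (real N)) ^ 3) / Q N) \<longlonglongrightarrow> 1" unfolding Q_def by real_asymp
  have "(\<lambda>N. 2 * \<theta> * (Tlam lam1 N / Q N) - \<theta>\<^sup>2 * (D * (((real N)\<^sup>2 * (1 + ln (real N)) ^ 3) / Q N))) \<longlonglongrightarrow> 2 * \<theta> * c - \<theta>\<^sup>2 * (D * 1)"
    by (intro tendsto_diff tendsto_mult tendsto_const t1 t3)
  moreover have "eventually (\<lambda>N. 2 * \<theta> * (Tlam lam1 N / Q N) - \<theta>\<^sup>2 * (D * (((real N)\<^sup>2 * (1 + ln (real N)) ^ 3) / Q N)) \<le> Tlam lamT N / Q N) sequentially"
    using Q0 eventually_ge_at_top[of 1]
  proof eventually_elim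
    case (elim N)
    have "(2 * \<theta> * Tlam lam1 N - \<theta>\<^sup>2 * (D * ((real N)\<^sup>2 * (1 + ln (real N)) ^ 3))) / Q N \<le> Tlam lamT N / Q N"
      using lower[OF elim(2)] elim(1) by (intro divide_right_mono) auto
    then show ?case by (simp only: diff_divide_distrib times_divide_eq_right)
  qed
  ultimately have "2 * \<theta> * c - \<theta>\<^sup>2 * (D * 1) \<le> Cc lamT 3" using t2 by (intro tendsto_le[OF sequentially_bot]) 
  moreover have "2 * \<theta> * c - \<theta>\<^sup>2 * (D * 1) = c * c / D" using D by (simp add: \<theta>_def power2_eq_square)
  moreover have "c * c / D > 0" using c D by simp
  ultimately show ?thesis by linarith
qed

section \<open>From integers to real X\<close>

lemma power_diff_le:
  fixes a b :: real
  assumes "0 \<le> b" "b \<le> a"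
  shows "a ^ j - b ^ j \<le> real j * (1 + a) ^ j * (a - b)"
proof (induction j)
  case (Suc j)
  have a0: "a \<ge> 0" using assms by simp
  have "a ^ Suc j - b ^ Suc j = a * (a ^ j - b ^ j) + b ^ j * (a - b)" by (simp add: algebra_simps)
  also have "\<dots> \<le> (1 + a) * (real j * (1 + a) ^ j * (a - b)) + (1 + a) ^ Suc j * (a - b)"
  proof (intro add_mono)
    have "a * (a ^ j - b ^ j) \<le> a * (real j * (1 + a) ^ j * (a - b))" by (rule mult_left_mono[OF Suc a0])
    also have "\<dots> \<le> (1 + a) * (real j * (1 + a) ^ j * (a - b))" using assms by (intro mult_right_mono mult_nonneg_nonneg) auto
    finally show "a * (a ^ j - b ^ j) \<le> (1 + a) * (real j * (1 + a) ^ j * (a - b))" .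
    have "b ^ j \<le> (1 + a) ^ j" using assms by (intro power_mono) auto
    also have "\<dots> \<le> (1 + a) ^ Suc j" using a0 by (intro power_increasing) auto
    finally show "b ^ j * (a - b) \<le> (1 + a) ^ Suc j * (a - b)" using assms by (intro mult_right_mono) auto
  qed
  also have "\<dots> = real (Suc j) * (1 + a) ^ Suc j * (a - b)" by (simp add: algebra_simps)
  finally show ?case .
qed simp

text \<open>Passing to the integer part changes X^2 by O(X) and ln X by O(1/X), so the main terms
  move far less than the error term allows.\<close>

lemma square_ln_power_diff:
  assumes X: "X \<ge> 1" and j: "j \<le> 3"
  defines "N \<equiv> nat \<lfloor>X\<rfloor>"
  shows "\<bar>(real N)\<^sup>2 * ln (real N) ^ j - X\<^sup>2 * ln X ^ j\<bar> \<le> 5 * X * (1 + ln X) ^ 3"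
proof -
  have N1: "real N \<ge> 1" "real N \<le> X" "X < real N + 1" using X by (auto simp: N_def le_floor_iff)
  define a b where "a = ln X" and "b = ln (real N)"
  have b0: "0 \<le> b" "b \<le> a" using N1 X by (auto simp: a_def b_def)
  have "a - b = ln (X / real N)" using N1 X by (simp add: a_def b_def ln_div)
  also have "\<dots> \<le> X / real N - 1" using N1 X by (intro ln_le_minus_one) auto
  also have "\<dots> = (X - real N) / real N" using N1 by (simp add: diff_divide_distrib)
  also have "\<dots> \<le> 1 / real N" using N1 by (intro divide_right_mono) auto
  finally have ab: "a - b \<le> 1 / real N" .
  have pj: "(1 + a) ^ j \<le> (1 + a) ^ 3" using b0 j by (intro power_increasing) auto
  have 1: "a ^ j - b ^ j \<le> 3 * (1 + a) ^ 3 * (1 / real N)"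
  proof -
    have "a ^ j - b ^ j \<le> real j * (1 + a) ^ j * (a - b)" by (rule power_diff_le) (use b0 in auto)
    also have "\<dots> \<le> 3 * (1 + a) ^ 3 * (1 / real N)" using pj ab b0 j by (intro mult_mono) auto
    finally show ?thesis .
  qed
  have 2: "b ^ j \<le> a ^ j" using b0 by (intro power_mono) auto
  have 3: "a ^ j \<le> (1 + a) ^ 3" using power_mono[of a "1 + a" j] b0 pj by simp
  have eq: "X\<^sup>2 * a ^ j - (real N)\<^sup>2 * b ^ j = (X - real N) * (X + real N) * a ^ j + (real N)\<^sup>2 * (a ^ j - b ^ j)"
    by (simp add: algebra_simps power2_eq_square)
  have "(X - real N) * (X + real N) * a ^ j \<le> (1 * (2 * X)) * (1 + a) ^ 3"
    using N1 X b0 3 by (intro mult_mono) auto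
  moreover have "(real N)\<^sup>2 * (a ^ j - b ^ j) \<le> 3 * X * (1 + a) ^ 3"
  proof -
    have "(real N)\<^sup>2 * (a ^ j - b ^ j) \<le> (real N)\<^sup>2 * (3 * (1 + a) ^ 3 * (1 / real N))" by (rule mult_left_mono[OF 1]) simp
    also have "\<dots> = real N * (3 * (1 + a) ^ 3)" using N1 by (simp add: power2_eq_square)
    also have "\<dots> \<le> X * (3 * (1 + a) ^ 3)" using N1 b0 by (intro mult_right_mono) auto
    finally show ?thesis by (simp add: mult_ac)
  qed
  moreover have "0 \<le> (X - real N) * (X + real N) * a ^ j" using N1 X b0 by (intro mult_nonneg_nonneg) auto
  moreover have "0 \<le> (real N)\<^sup>2 * (a ^ j - b ^ j)" using 2 by simp
  ultimately show ?thesis unfolding a_def[symmetric] b_def[symmetric] using eq by (simp add: abs_le_iff)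
qed

lemma tau_eq_ndiv: "tau z = ndiv (nat \<bar>z\<bar>)"
proof (cases "z = 0")
  case False
  have "{d. 0 < d \<and> int d dvd z} = {d. d dvd nat \<bar>z\<bar>}" using False by (auto simp: nat_dvd_iff intro!: Nat.gr0I)
  then show ?thesis using False by (simp add: tau_def ndiv_def)
qed (simp add: tau_def)

text \<open>Points at which some form vanishes drop out through the convention
  \<open>tau 0 = 0\<close>; on the others \<open>Tlam_lamT\<close> applies.\<close>

lemma Tsum_eq: "Tsum (L 0) (L 1) (L 2) X = Tlam lamT (nat \<lfloor>X\<rfloor>)"
proof -
  define N where "N = nat \<lfloor>X\<rfloor>"
  define F where "F = (\<lambda>x. real (tau (linform (L 0) (fst x) (snd x) * linform (L 1) (fst x) (snd x) * linform (L 2) (fst x) (snd x))))"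
  have Fe: "F x = real (ndiv (\<Prod>i<3. na i x))" for x
    unfolding F_def tau_eq_ndiv prod_lessThan_3 na_def lf_def by (simp add: abs_mult nat_mult_distrib)
  have "Tsum (L 0) (L 1) (L 2) X = (\<Sum>x1\<in>{1..N}. \<Sum>x2\<in>{1..N}. F (int x1, int x2))"
    unfolding Tsum_def F_def N_def by simp
  also have "\<dots> = (\<Sum>p\<in>{1..N} \<times> {1..N}. F (int (fst p), int (snd p)))"
    unfolding sum.cartesian_product by (simp add: case_prod_beta)
  also have "\<dots> = (\<Sum>x\<in>bx N. F x)"
  proof (rule sum.reindex_bij_witness[of _ "\<lambda>x. (nat (fst x), nat (snd x))" "\<lambda>p. (int (fst p), int (snd p))"])
    fix x assume "x \<in> bx N" then show "(nat (fst x), nat (snd x)) \<in> {1..N} \<times> {1..N}" by (auto simp: bx_def)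
  qed (auto simp: bx_def)
  also have "\<dots> = (\<Sum>x\<in>nz N. F x)"
  proof (rule sum.mono_neutral_right)
    show "\<forall>x\<in>bx N - nz N. F x = 0"
    proof
      fix x assume "x \<in> bx N - nz N"
      then obtain i where i: "i < 3" "na i x = 0" by (auto simp: nz_def na_def)
      then have z: "(\<Prod>i<3. na i x) = 0" by (intro prod_zero) auto
      show "F x = 0" unfolding Fe z ndiv_0 by simp
    qed
  qed (auto simp: nz_def)
  finally show ?thesis unfolding Tlam_lamT Fe N_def .
qed

theorem Tsum_asymptotics:
  assumes e: "\<epsilon> > 0"
  shows "\<exists>C. \<forall>X\<ge>1. \<bar>Tsum (L 0) (L 1) (L 2) X - X\<^sup>2 * (\<Sum>j\<le>3. Cc lamT j * ln X ^ j)\<bar> \<le> C * X powr (7/4 + \<epsilon>)"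
proof -
  obtain C where C: "C \<ge> 0" "\<And>N. N \<ge> 1 \<Longrightarrow> \<bar>Tlam lamT N - (real N)\<^sup>2 * (\<Sum>j\<le>3. Cc lamT j * ln (real N) ^ j)\<bar> \<le> C * real N powr (7/4 + \<epsilon>)"
    using Tlam_asymptotics[where lam = lamT and \<epsilon> = \<epsilon>, OF abs_lamT_le_1 e] by auto
  obtain C1 where C1: "C1 \<ge> 1" "\<And>x::real. x \<ge> 1 \<Longrightarrow> (1 + ln x) ^ 3 \<le> C1 * x powr (3/4)"
    using one_plus_ln_le[of "3/4" 3] by auto
  define S where "S = (\<Sum>j\<le>3. \<bar>Cc lamT j\<bar>)"
  have S0: "S \<ge> 0" unfolding S_def by (intro sum_nonneg) auto
  have "\<bar>Tsum (L 0) (L 1) (L 2) X - X\<^sup>2 * (\<Sum>j\<le>3. Cc lamT j * ln X ^ j)\<bar> \<le> (C + S * (5 * C1)) * X powr (7/4 + \<epsilon>)" if X: "X \<ge> 1" for X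
  proof -
    define N where "N = nat \<lfloor>X\<rfloor>"
    have N1: "N \<ge> 1" and NX: "real N \<le> X" using X by (auto simp: N_def le_floor_iff le_nat_iff)
    have Y: "5 * X * (1 + ln X) ^ 3 \<le> 5 * C1 * X powr (7/4 + \<epsilon>)"
    proof -
      have "5 * X * (1 + ln X) ^ 3 \<le> 5 * X * (C1 * X powr (3/4))" using X by (intro mult_left_mono C1(2)) auto
      also have "\<dots> = 5 * C1 * (X powr 1 * X powr (3/4))" using X by simp
      also have "X powr 1 * X powr (3/4) = X powr (7/4)" by (simp only: powr_add[symmetric]) simp
      also have "5 * C1 * X powr (7/4) \<le> 5 * C1 * X powr (7/4 + \<epsilon>)" using X e C1(1) by (intro mult_left_mono powr_mono) auto
      finally show ?thesis .
    qed
    have "(real N)\<^sup>2 * (\<Sum>j\<le>3. Cc lamT j * ln (real N) ^ j) - X\<^sup>2 * (\<Sum>j\<le>3. Cc lamT j * ln X ^ j)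
      = (\<Sum>j\<le>3. Cc lamT j * ((real N)\<^sup>2 * ln (real N) ^ j - X\<^sup>2 * ln X ^ j))"
      unfolding sum_distrib_left sum_subtractf[symmetric] by (intro sum.cong) (auto simp: algebra_simps)
    also have "\<bar>\<dots>\<bar> \<le> (\<Sum>j\<le>3. \<bar>Cc lamT j\<bar> * (5 * X * (1 + ln X) ^ 3))"
    proof (rule order.trans[OF sum_abs], rule sum_mono)
      fix j :: nat assume "j \<in> {..3}"
      then have "\<bar>(real N)\<^sup>2 * ln (real N) ^ j - X\<^sup>2 * ln X ^ j\<bar> \<le> 5 * X * (1 + ln X) ^ 3"
        unfolding N_def by (intro square_ln_power_diff X) simp
      then show "\<bar>Cc lamT j * ((real N)\<^sup>2 * ln (real N) ^ j - X\<^sup>2 * ln X ^ j)\<bar> \<le> \<bar>Cc lamT j\<bar> * (5 * X * (1 + ln X) ^ 3)"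
        unfolding abs_mult by (intro mult_left_mono) auto
    qed
    also have "\<dots> = S * (5 * X * (1 + ln X) ^ 3)" unfolding S_def by (rule sum_distrib_right[symmetric])
    also have "\<dots> \<le> S * (5 * C1 * X powr (7/4 + \<epsilon>))" by (rule mult_left_mono[OF Y S0])
    finally have d: "\<bar>(real N)\<^sup>2 * (\<Sum>j\<le>3. Cc lamT j * ln (real N) ^ j) - X\<^sup>2 * (\<Sum>j\<le>3. Cc lamT j * ln X ^ j)\<bar> \<le> S * (5 * C1 * X powr (7/4 + \<epsilon>))" .
    have "C * real N powr (7/4 + \<epsilon>) \<le> C * X powr (7/4 + \<epsilon>)" using NX C(1) e by (intro mult_left_mono powr_mono2) auto
    then show ?thesis using d C(2)[OF N1] unfolding Tsum_eq N_def[symmetric] by (simp add: algebra_simps)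
  qed
  then show ?thesis by blast
qed

end

theorem theorem1:
  fixes L1 L2 L3 :: "int \<times> int"
  assumes "lin_res L1 L2 \<noteq> 0" and "lin_res L1 L3 \<noteq> 0" and "lin_res L2 L3 \<noteq> 0"
  shows "\<forall>\<epsilon>::real. \<epsilon> > 0 \<longrightarrow>
           (\<exists>c0 c1 c2 c3 :: real. c0 > 0 \<and>
              (\<exists>C::real. \<forall>X::real. X \<ge> 1 \<longrightarrow>
                 \<bar>Tsum L1 L2 L3 X
                   - (c0 * X^2 * (ln X)^3 + c1 * X^2 * (ln X)^2 + c2 * X^2 * ln X + c3 * X^2)\<bar>
                 \<le> C * X powr (2 - 1/4 + \<epsilon>)))"
proof (intro allI impI)
  fix \<epsilon> :: real assume e: "\<epsilon> > 0"
  define L where "L = (\<lambda>i::nat. if i = 0 then L1 else if i = 1 then L2 else L3)"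
  have anti: "lin_res M N = - lin_res N M" for M N by (simp add: lin_res_def)
  have L: "L 0 = L1" "L 1 = L2" "L 2 = L3" by (simp_all add: L_def)
  interpret three_forms L
  proof
    fix i j :: nat assume "i < 3" "j < 3" "i \<noteq> j"
    then show "lin_res (L i) (L j) \<noteq> 0"
      using assms anti[of L2 L1] anti[of L3 L1] anti[of L3 L2] by (auto simp: L_def)
  qed
  obtain C where C: "\<And>X. X \<ge> 1 \<Longrightarrow> \<bar>Tsum (L 0) (L 1) (L 2) X - X\<^sup>2 * (\<Sum>j\<le>3. Cc lamT j * ln X ^ j)\<bar> \<le> C * X powr (7/4 + \<epsilon>)"
    using Tsum_asymptotics[OF e] by auto
  have s: "X\<^sup>2 * (\<Sum>j\<le>3. Cc lamT j * ln X ^ j) = Cc lamT 3 * X^2 * (ln X)^3 + Cc lamT 2 * X^2 * (ln X)^2 + Cc lamT 1 * X^2 * ln X + Cc lamT 0 * X^2" for X :: real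
  proof -
    have "{..3} = {0, 1, 2, 3::nat}" by auto
    then show ?thesis by (simp add: algebra_simps)
  qed
  show "\<exists>c0 c1 c2 c3 :: real. c0 > 0 \<and>
              (\<exists>C::real. \<forall>X::real. X \<ge> 1 \<longrightarrow>
                 \<bar>Tsum L1 L2 L3 X
                   - (c0 * X^2 * (ln X)^3 + c1 * X^2 * (ln X)^2 + c2 * X^2 * ln X + c3 * X^2)\<bar>
                 \<le> C * X powr (2 - 1/4 + \<epsilon>))"
  proof (intro exI conjI allI impI)
    show "Cc lamT 3 > 0" by (rule Cc_lamT_pos)
    fix X :: real assume "X \<ge> 1"
    then show "\<bar>Tsum L1 L2 L3 X
                   - (Cc lamT 3 * X^2 * (ln X)^3 + Cc lamT 2 * X^2 * (ln X)^2 + Cc lamT 1 * X^2 * ln X + Cc lamT 0 * X^2)\<bar>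
                 \<le> C * X powr (2 - 1/4 + \<epsilon>)"
      using C[of X] unfolding s L by simp
  qed
qed

end
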